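(* Let $n\ge 3$ and let $(\alpha,\beta)$ satisfy $\beta\ge 0$, $0<\alpha+\beta<n-\beta$ and $\frac{n-\alpha-2\beta}{2n}+\frac{n-\alpha}{2(n-1)}<1$. Then: (1) If $\alpha\le 1$ (equivalently $p\ge 2$), there exists a constant $c_0>0$ such that for all $u\in L^p(\mathbb S^{n-1})$ with $u\not\equiv 0$, $$c^p_{\alpha,\beta}-\frac{\|Q_{\alpha,\beta}u\|^p_{L^q(\mathbb B^n)}}{\|u\|^p_{L^p(\mathbb S^{n-1})}}\ \ge\ c_0\inf_{\Psi,\lambda}\Big(\big\|\lambda|\mathbb S^{n-1}|^{\frac1p}u_\Psi-1\big\|^p_{L^p(\mathbb S^{n-1})}+\big\|\lambda|\mathbb S^{n-1}|^{\frac1p}u_\Psi-1\big\|^2_{L^2(\mathbb S^{n-1})}\Big).$$ (2) If $1<\alpha<n$ (equivalently $1<p<2$), there exists a constant $c_0>0$ such that for all $u\in L^p(\mathbb S^{n-1})$ with $u\not\equiv 0$, $$c^p_{\alpha,\beta}-\frac{\|Q_{\alpha,\beta}u\|^p_{L^q(\mathbb B^n)}}{\|u\|^p_{L^p(\mathbb S^{n-1})}}\ \ge\ c_0\inf_{\Psi,\lambda}\big\|\lambda|\mathbb S^{n-1}|^{\frac1p}u_\Psi-1\big\|^2_{L^p(\mathbb S^{n-1})}.$$ In both cases the infimum is over all conformal transformations $\Psi$ of $\mathbb B^n$ and all $\lambda\in\mathbb R$.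
   Context: $\mathbb B^n$ is the open unit ball in $\mathbb R^n$, $\mathbb S^{n-1}$ the unit sphere with its standard surface measure $\mathrm dV$, $|\mathbb S^{n-1}|$ its area. Set $p=\frac{2(n-1)}{n+\alpha-2}$, $q=\frac{2n}{n-\alpha-2\beta}$. For $u$ on $\mathbb S^{n-1}$ and $\xi\in\mathbb B^n$, $Q_{\alpha,\beta}(u)(\xi)=\left(\frac{1-|\xi|^2}{2}\right)^{\beta}\int_{\mathbb S^{n-1}}|\xi-\eta|^{\alpha-n}u(\eta)\,\mathrm dV(\eta)$. The constant $c_{\alpha,\beta}$ is the sharp constant $c_{\alpha,\beta}=\sup\{\|Q_{\alpha,\beta}u\|_{L^q(\mathbb B^n)}/\|u\|_{L^p(\mathbb S^{n-1})}: 0\not\equiv u\in L^p(\mathbb S^{n-1})\}$, which is finite and equals $|\mathbb S^{n-1}|^{-1/p}\|Q_{\alpha,\beta}(1)\|_{L^q(\mathbb B^n)}$. A conformal transformation $\Psi$ of $\mathbb B^n$ is a conformal (Möbius) diffeomorphism of $\overline{\mathbb B^n}$ onto itself (e.g. compositions of orthogonal maps with $\Psi_\zeta(\eta)=\frac{(1-|\zeta|^2)(\eta-\zeta)-|\eta-\zeta|^2\zeta}{1-2\zeta\cdot\eta+|\zeta|^2|\eta|^2}$, $\zeta\in\mathbb B^n$); for such $\Psi$, $u_\Psi:=(\det \mathrm d\Psi|_{\partial\mathbb B^n})^{1/p}\,u\circ\Psi$, where $\det\mathrm d\Psi|_{\partial\mathbb B^n}$ is the Jacobian of the restriction of $\Psi$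 to $\mathbb S^{n-1}$ (for $\Psi_\zeta$ it equals $\big(\frac{1-|\zeta|^2}{1-2\zeta\cdot\eta+|\zeta|^2}\big)^{n-1}$). *)

theory Defs
  imports "HOL-Analysis.Analysis"
begin

text \<open>Dimension n = DIM('a). Surface measure on the unit sphere S^{n-1}, defined as
  n times the push-forward of Lebesgue measure on the punctured unit ball under the radial
  projection x \<mapsto> x/|x| (the cone-measure construction; for A \<subseteq> S^{n-1} this is
  n * vol({t x. 0<t<1, x\<in>A}), i.e. the standard surface measure).\<close>
definition sphere_measure :: "'a::euclidean_space measure" where
  "sphere_measure = scale_measure (of_nat DIM('a))
     (distr (restrict_space lborel (ball 0 1 - {0})) (restrict_space borel (sphere 0 1))
        (\<lambda>x. x /\<^sub>R norm x))"

definition ball_measure :: "'a::euclidean_space measure" where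
  "ball_measure = restrict_space lborel (ball 0 1)"

definition sphere_area :: "'a::euclidean_space itself \<Rightarrow> real" where
  "sphere_area _ = measure (sphere_measure :: 'a measure) (sphere 0 1)"

definition in_Lp :: "'a measure \<Rightarrow> real \<Rightarrow> ('a \<Rightarrow> real) \<Rightarrow> bool" where
  "in_Lp M r f \<longleftrightarrow> f \<in> borel_measurable M \<and> integrable M (\<lambda>x. \<bar>f x\<bar> powr r)"

definition Lp_norm :: "'a measure \<Rightarrow> real \<Rightarrow> ('a \<Rightarrow> real) \<Rightarrow> real" where
  "Lp_norm M r f = (\<integral>x. \<bar>f x\<bar> powr r \<partial>M) powr (1 / r)"

definition p_exp :: "'a::euclidean_space itself \<Rightarrow> real \<Rightarrow> real" where
  "p_exp _ \<alpha> = 2 * (real DIM('a) - 1) / (real DIM('a) + \<alpha> - 2)"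

definition q_exp :: "'a::euclidean_space itself \<Rightarrow> real \<Rightarrow> real \<Rightarrow> real" where
  "q_exp _ \<alpha> \<beta> = 2 * real DIM('a) / (real DIM('a) - \<alpha> - 2 * \<beta>)"

definition Qop :: "real \<Rightarrow> real \<Rightarrow> ('a::euclidean_space \<Rightarrow> real) \<Rightarrow> 'a \<Rightarrow> real" where
  "Qop \<alpha> \<beta> u \<xi> = ((1 - (norm \<xi>)\<^sup>2) / 2) powr \<beta> *
     (\<integral>\<eta>. norm (\<xi> - \<eta>) powr (\<alpha> - real DIM('a)) * u \<eta> \<partial>(sphere_measure :: 'a measure))"

definition sharp_const :: "'a::euclidean_space itself \<Rightarrow> real \<Rightarrow> real \<Rightarrow> real" where
  "sharp_const T \<alpha> \<beta> = Sup {Lp_norm (ball_measure :: 'a measure) (q_exp T \<alpha> \<beta>) (Qop \<alpha> \<beta> u)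
       / Lp_norm (sphere_measure :: 'a measure) (p_exp T \<alpha>) u | u.
       in_Lp (sphere_measure :: 'a measure) (p_exp T \<alpha>) u
       \<and> Lp_norm (sphere_measure :: 'a measure) (p_exp T \<alpha>) u \<noteq> 0}"

definition conformal_ball_auto :: "('a::euclidean_space \<Rightarrow> 'a) \<Rightarrow> bool" where
  "conformal_ball_auto \<Psi> \<longleftrightarrow>
     bij_betw \<Psi> (cball 0 1) (cball 0 1)
   \<and> (\<forall>x\<in>cball 0 1. \<Psi> differentiable (at x within cball 0 1))
   \<and> (\<forall>v. continuous_on (cball 0 1) (\<lambda>x. frechet_derivative \<Psi> (at x within cball 0 1) v))
   \<and> (\<forall>y\<in>cball 0 1. inv_into (cball 0 1) \<Psi> differentiable (at y within cball 0 1))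
   \<and> (\<forall>x\<in>cball 0 1. \<exists>c>0. \<forall>v. norm (frechet_derivative \<Psi> (at x within cball 0 1) v) = c * norm v)"

text \<open>Jacobian of the restriction of a conformal map to the sphere: for a conformal
  map with conformal factor c(\<eta>) (= operator norm of the derivative) it is c(\<eta>)^{n-1}.\<close>
definition sphere_jac :: "('a::euclidean_space \<Rightarrow> 'a) \<Rightarrow> 'a \<Rightarrow> real" where
  "sphere_jac \<Psi> \<eta> = onorm (frechet_derivative \<Psi> (at \<eta> within cball 0 1)) ^ (DIM('a) - 1)"

definition pullback :: "real \<Rightarrow> ('a::euclidean_space \<Rightarrow> 'a) \<Rightarrow> ('a \<Rightarrow> real) \<Rightarrow> 'a \<Rightarrow> real" where
  "pullback p \<Psi> u \<eta> = sphere_jac \<Psi> \<eta> powr (1 / p) * u (\<Psi> \<eta>)"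

end

theory Submission
  imports Defs
begin

text \<open>
  With \<open>s = (n - \<alpha>) / 2\<close> and \<open>T u (\<xi>) = \<integral> ((1 - |\<xi>|\<^sup>2) / (2 |\<xi> - \<eta>|\<^sup>2))\<^sup>s u(\<eta>) d\<eta>\<close>, the \<open>q\<close>-th power of the norm of
  \<open>Q u\<close> is the integral of \<open>|T u|\<^sup>q\<close> against hyperbolic measure, and everything is invariant under the
  conformal group. Let \<open>u\<close> be normalised with deficit \<open>\<tau>\<close>. A conformal map moves an almost maximum point
  of \<open>T |u|\<close> to the origin, which makes the first moments of \<open>|u|\<close> of order \<open>\<surd>\<tau>\<close>. Polarization with
  respect to a hyperplane through the origin can raise the norm of \<open>Q u\<close> only up to the sharp
  constant; quantified, this bounds the difference of \<open>u\<close> and its reflections, and averaging over reflections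
  gives \<open>\<parallel>u - l\<parallel>\<^sub>1 = O(\<surd>\<tau>)\<close> for the mean \<open>l\<close> of \<open>u\<close>.
  For \<open>w = u / l - 1\<close> strict convexity of \<open>x \<mapsto> x powr (q / p)\<close> excludes that a part of the mass concentrates,
  so \<open>w\<close> is small in \<open>L\<^sup>p\<close>. In the expansion around the constant the coercive term \<open>\<integral> min(w\<^sup>2, |w|\<^sup>p)\<close> of the
  \<open>L\<^sup>p\<close> norm dominates, because the quadratic term of \<open>\<integral> |T u|\<^sup>q\<close> is at most \<open>A \<parallel>w\<parallel>\<^sub>1\<^sup>2 + \<epsilon> \<parallel>w\<parallel>\<^sup>2\<close>: the kernel is
  bounded away from the sphere and the contribution near the sphere is small. As \<open>\<parallel>w\<parallel>\<^sub>1\<^sup>2 = O(\<tau>)\<close>, no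
  spectral information on the second variation is needed.
\<close>

section \<open>Change of variables\<close>

typedef (overloaded) 'a basis_index = "{..<DIM('a::euclidean_space)}"
  using DIM_positive by blast

instance basis_index :: (euclidean_space) finite
proof
  have "(UNIV :: 'a basis_index set) = Abs_basis_index ` {..<DIM('a)}"
    using type_definition.Abs_image[OF type_definition_basis_index] by blast
  then show "finite (UNIV :: 'a basis_index set)"
    by (metis finite_imageI finite_lessThan)
qed

instantiation basis_index :: (euclidean_space) wellorder
begin

definition less_eq_basis_index :: "'a basis_index \<Rightarrow> 'a basis_index \<Rightarrow> bool" where
  "i \<le> j \<longleftrightarrow> Rep_basis_index i \<le> Rep_basis_index j"

definition less_basis_index :: "'a basis_index \<Rightarrow> 'a basis_index \<Rightarrow> bool" where
  "i < j \<longleftrightarrow> Rep_basis_index i < Rep_basis_index j"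

instance
proof
  fix P :: "'a basis_index \<Rightarrow> bool" and a :: "'a basis_index"
  assume step: "\<And>x. (\<And>y. y < x \<Longrightarrow> P y) \<Longrightarrow> P x"
  show "P a"
    by (induction a rule: measure_induct_rule[where f = Rep_basis_index]) (rule step, simp add: less_basis_index_def)
qed (auto simp: less_eq_basis_index_def less_basis_index_def Rep_basis_index_inject)

end

definition nth_basis :: "'a::euclidean_space basis_index \<Rightarrow> 'a" where
  "nth_basis i = (SOME f. bij_betw f {..<DIM('a)} (Basis :: 'a set)) (Rep_basis_index i)"

lemma bij_nth_basis: "bij_betw (nth_basis :: 'a::euclidean_space basis_index \<Rightarrow> 'a) UNIV Basis"
proof -
  define f where "f = (SOME f. bij_betw f {..<DIM('a)} (Basis :: 'a set))"
  have "\<exists>f. bij_betw f {..<DIM('a)} (Basis :: 'a set)"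
    by (metis atLeast0LessThan ex_bij_betw_nat_finite finite_Basis)
  then have "bij_betw f {..<DIM('a)} (Basis :: 'a set)"
    unfolding f_def by (rule someI_ex)
  moreover have "bij_betw (Rep_basis_index :: 'a basis_index \<Rightarrow> nat) UNIV {..<DIM('a)}"
    by (simp add: bij_betw_def inj_on_def Rep_basis_index_inject type_definition.Rep_range[OF type_definition_basis_index])
  ultimately have "bij_betw (f \<circ> Rep_basis_index) (UNIV :: 'a basis_index set) Basis"
    by (rule bij_betw_trans[rotated])
  then show ?thesis
    by (simp add: nth_basis_def[abs_def] f_def comp_def)
qed

lemma nth_basis_Basis [simp]: "nth_basis i \<in> Basis"
  using bij_nth_basis by (auto simp: bij_betw_def)

lemma inj_nth_basis: "inj nth_basis"
  using bij_nth_basis by (auto simp: bij_betw_def)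

lemma card_basis_index: "CARD('a::euclidean_space basis_index) = DIM('a)"
  using bij_betw_same_card[OF bij_nth_basis] by auto

definition to_vec :: "'a::euclidean_space \<Rightarrow> real ^ 'a basis_index" where
  "to_vec x = (\<chi> i. x \<bullet> nth_basis i)"

definition of_vec :: "real ^ 'a basis_index \<Rightarrow> 'a::euclidean_space" where
  "of_vec y = (\<Sum>i\<in>UNIV. (y $ i) *\<^sub>R nth_basis i)"

lemma inner_nth_basis: "nth_basis i \<bullet> nth_basis j = (if i = j then 1 else 0)"
  using inj_nth_basis by (auto simp: inner_Basis dest: injD)

lemma to_vec_of_vec [simp]: "to_vec (of_vec y) = y"
  by (simp add: to_vec_def of_vec_def vec_eq_iff inner_sum_left inner_nth_basis if_distrib cong: if_cong)

lemma sum_nth_basis: "(\<Sum>b\<in>Basis. g b) = (\<Sum>i\<in>UNIV. g (nth_basis i :: 'a::euclidean_space))"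
  by (rule sum.reindex_bij_betw[symmetric, OF bij_nth_basis])

lemma prod_nth_basis: "(\<Prod>b\<in>Basis. g b) = (\<Prod>i\<in>UNIV. g (nth_basis i :: 'a::euclidean_space))"
  by (rule prod.reindex_bij_betw[symmetric, OF bij_nth_basis])

lemma of_vec_to_vec [simp]: "of_vec (to_vec x) = x"
  using euclidean_representation[of x] by (simp add: to_vec_def of_vec_def sum_nth_basis)

lemma to_vec_eq_iff [simp]: "to_vec x = to_vec y \<longleftrightarrow> x = y"
  by (metis of_vec_to_vec)

lemma of_vec_eq_iff [simp]: "of_vec x = of_vec y \<longleftrightarrow> x = y"
  by (metis to_vec_of_vec)

lemma linear_to_vec: "linear to_vec"
  by (intro linearI) (simp_all add: to_vec_def vec_eq_iff inner_add_left)

lemma linear_of_vec: "linear of_vec"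
  by (intro linearI) (simp_all add: of_vec_def sum.distrib scaleR_add_left scaleR_sum_right)

lemma inner_to_vec [simp]: "to_vec x \<bullet> to_vec y = x \<bullet> y"
  by (simp add: inner_vec_def to_vec_def euclidean_inner[of x y] sum_nth_basis)

lemma norm_to_vec [simp]: "norm (to_vec x) = norm x"
  by (simp add: norm_eq_sqrt_inner)

lemma inner_of_vec [simp]: "of_vec x \<bullet> of_vec y = x \<bullet> y"
  using inner_to_vec[of "of_vec x" "of_vec y"] by simp

lemma norm_of_vec [simp]: "norm (of_vec x) = norm x"
  by (simp add: norm_eq_sqrt_inner)

lemma bounded_linear_to_vec: "bounded_linear to_vec"
  using linear_to_vec linear_conv_bounded_linear by blast

lemma bounded_linear_of_vec: "bounded_linear of_vec"
  using linear_of_vec linear_conv_bounded_linear by blast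

lemma of_vec_borel [measurable]: "of_vec \<in> borel \<rightarrow>\<^sub>M borel"
  by (intro borel_measurable_continuous_onI linear_continuous_on bounded_linear_of_vec)

lemma distr_of_vec: "distr lborel borel of_vec = (lborel :: 'a::euclidean_space measure)"
proof (rule lborel_eqI[symmetric])
  fix l u :: 'a
  assume ordered: "\<And>b. b \<in> Basis \<Longrightarrow> l \<bullet> b \<le> u \<bullet> b"
  have box_vimage: "of_vec -` box l u = box (to_vec l) (to_vec u)"
  proof (intro set_eqI)
    fix y :: "real ^ 'a basis_index"
    have component: "of_vec y \<bullet> nth_basis i = y $ i" for i
      by (metis to_vec_def to_vec_of_vec vec_lambda_beta)
    have "y \<in> of_vec -` box l u \<longleftrightarrow> (\<forall>b\<in>range nth_basis. l \<bullet> b < of_vec y \<bullet> b \<and> of_vec y \<bullet> b < u \<bullet> b)"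
      using bij_nth_basis[where 'a='a] by (simp add: box_def bij_betw_def)
    then show "y \<in> of_vec -` box l u \<longleftrightarrow> y \<in> box (to_vec l) (to_vec u)"
      by (simp add: mem_box_cart to_vec_def component)
  qed
  have "emeasure (distr lborel borel of_vec) (box l u) = emeasure lborel (of_vec -` box l u)"
    by (subst emeasure_distr) auto
  also have "\<dots> = (\<Prod>b\<in>Basis. (to_vec u - to_vec l) \<bullet> b)"
    unfolding box_vimage
  proof (rule emeasure_lborel_box)
    fix b :: "real ^ 'a basis_index"
    assume "b \<in> Basis"
    then show "to_vec l \<bullet> b \<le> to_vec u \<bullet> b"
      by (auto simp: Basis_vec_def inner_axis to_vec_def ordered)
  qed
  also have "(\<Prod>b\<in>Basis. (to_vec u - to_vec l) \<bullet> b) = (\<Prod>b\<in>Basis. (u - l) \<bullet> b)"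
  proof -
    have "(\<Prod>b\<in>(Basis :: (real ^ 'a basis_index) set). (to_vec u - to_vec l) \<bullet> b)
        = (\<Prod>i\<in>UNIV. (to_vec u - to_vec l) \<bullet> axis i 1)"
      by (rule prod.reindex_cong[where l = "\<lambda>i. axis i 1"])
         (auto simp: Basis_vec_def inj_on_def axis_eq_axis)
    also have "\<dots> = (\<Prod>i\<in>UNIV. (u - l) \<bullet> nth_basis i)"
      by (simp add: inner_axis to_vec_def inner_diff_left)
    finally show ?thesis
      by (simp add: prod_nth_basis)
  qed
  finally show "emeasure (distr lborel borel of_vec) (box l u) = (\<Prod>b\<in>Basis. (u - l) \<bullet> b)"
    by simp
qed simp

lemma emeasure_of_vec_vimage:
  "A \<in> sets borel \<Longrightarrow> emeasure lborel (of_vec -` A) = emeasure lborel (A :: 'a::euclidean_space set)"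
  by (subst (2) distr_of_vec[symmetric]) (simp add: emeasure_distr)

lemma nn_integral_of_vec:
  assumes [measurable]: "g \<in> borel_measurable (borel :: 'a::euclidean_space measure)"
  shows "(\<integral>\<^sup>+y. g (of_vec y) \<partial>lborel) = (\<integral>\<^sup>+x. g x \<partial>lborel)"
  by (subst (2) distr_of_vec[symmetric]) (simp add: nn_integral_distr)

definition jac :: "('a::euclidean_space \<Rightarrow> 'a) \<Rightarrow> real" where
  "jac L = \<bar>det (matrix (to_vec \<circ> L \<circ> of_vec))\<bar>"



lemma to_vec_image: "to_vec ` A = of_vec -` A"
  by (auto simp: image_iff) (metis to_vec_of_vec)

lemma has_derivative_coordinates:
  fixes f :: "'a::euclidean_space \<Rightarrow> 'a"
  assumes "(f has_derivative f') (at (of_vec y) within V)"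
  shows "(to_vec \<circ> f \<circ> of_vec has_derivative to_vec \<circ> f' \<circ> of_vec) (at y within of_vec -` V)"
proof -
  have "of_vec ` of_vec -` V \<subseteq> V"
    by blast
  then have "(f has_derivative f') (at (of_vec y) within of_vec ` of_vec -` V)"
    by (rule has_derivative_subset[OF assms])
  then have "(f \<circ> of_vec has_derivative f' \<circ> of_vec) (at y within of_vec -` V)"
    by (intro diff_chain_within bounded_linear_imp_has_derivative bounded_linear_of_vec)
  then show ?thesis
    unfolding comp_assoc
    by (rule diff_chain_within) (rule bounded_linear_imp_has_derivative[OF bounded_linear_to_vec])
qed

lemma lmeasurable_vec_image_eq_det:
  fixes F :: "real ^ 'n::{finite, wellorder} \<Rightarrow> real ^ 'n::_"
  assumes W_borel [measurable]: "W \<in> sets borel" and finite: "emeasure lborel W < \<infinity>"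
    and has_derivative: "\<And>y. y \<in> W \<Longrightarrow> (F has_derivative F' y) (at y within W)" and injective: "inj_on F W"
    and J_borel [measurable]: "J \<in> borel_measurable borel" and J_eq: "\<And>y. y \<in> W \<Longrightarrow> J y = \<bar>det (matrix (F' y))\<bar>"
    and bound: "\<And>y. y \<in> W \<Longrightarrow> J y \<le> B"
  shows "F ` W \<in> lmeasurable" "emeasure lebesgue (F ` W) = (\<integral>\<^sup>+y\<in>W. ennreal (J y) \<partial>lborel)"
proof -
  have J_nonneg: "0 \<le> J y" if "y \<in> W" for y
    using J_eq that by simp
  have integrable: "integrable lborel (\<lambda>y. indicator W y *\<^sub>R J y)"
    using finite bound J_nonneg by (intro integrableI_bounded_set_indicator[where B = B]) auto
  define I where "I = (\<integral>y. indicator W y *\<^sub>R J y \<partial>lborel)"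
  have "((\<lambda>y. if y \<in> W then J y else 0) has_integral I) UNIV"
    using has_integral_integral_lborel[OF integrable] unfolding I_def
    by (rule has_integral_eq[rotated]) simp
  then have "((\<lambda>y. \<bar>det (matrix (F' y))\<bar>) has_integral I) W"
    unfolding has_integral_restrict_UNIV by (rule has_integral_eq[rotated]) (simp add: J_eq)
  then have image: "F ` W \<in> lmeasurable" "measure lebesgue (F ` W) = I"
    using has_measure_differentiable_image[of W F F' I] has_derivative injective by (auto simp: sets_completionI_sets)
  then show "F ` W \<in> lmeasurable"
    by simp
  have "emeasure lebesgue (F ` W) = ennreal I"
    using image emeasure_eq_measure2 by blast
  also have "\<dots> = (\<integral>\<^sup>+y. ennreal (indicator W y *\<^sub>R J y) \<partial>lborel)"
    unfolding I_def
    by (rule nn_integral_eq_integral[symmetric, OF integrable]) (auto simp: indicator_def J_nonneg)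
  also have "\<dots> = (\<integral>\<^sup>+y\<in>W. ennreal (J y) \<partial>lborel)"
    by (rule nn_integral_cong) (auto simp: indicator_def)
  finally show "emeasure lebesgue (F ` W) = (\<integral>\<^sup>+y\<in>W. ennreal (J y) \<partial>lborel)" .
qed

lemma emeasure_image_eq_jac:
  fixes f :: "'a::euclidean_space \<Rightarrow> 'a"
  assumes V_borel [measurable]: "V \<in> sets borel" and finite: "emeasure lborel V < \<infinity>" and image: "f ` V \<in> sets borel"
    and has_derivative: "\<And>x. x \<in> V \<Longrightarrow> (f has_derivative f' x) (at x within V)" and injective: "inj_on f V"
    and J_borel [measurable]: "J \<in> borel_measurable borel" and J_eq: "\<And>x. x \<in> V \<Longrightarrow> J x = jac (f' x)"
    and bound: "\<And>x. x \<in> V \<Longrightarrow> J x \<le> B"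
  shows "emeasure lborel (f ` V) = (\<integral>\<^sup>+x\<in>V. ennreal (J x) \<partial>lborel)"
proof -
  define W where "W = of_vec -` V"
  define F where "F = to_vec \<circ> f \<circ> of_vec"
  have W_borel: "W \<in> sets borel"
    unfolding W_def by (rule measurable_sets_borel[OF of_vec_borel V_borel])
  have F_image: "F ` W = of_vec -` (f ` V)"
    unfolding F_def W_def to_vec_image[symmetric] by (simp add: image_comp comp_assoc[symmetric])
  have "emeasure lborel (f ` V) = emeasure lborel (F ` W)"
    using image by (simp add: F_image emeasure_of_vec_vimage)
  also have "\<dots> = emeasure lebesgue (F ` W)"
    unfolding F_image using measurable_sets_borel[OF of_vec_borel image] by (simp add: emeasure_completion)
  also have "\<dots> = (\<integral>\<^sup>+y\<in>W. ennreal (J (of_vec y)) \<partial>lborel)"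
  proof (rule lmeasurable_vec_image_eq_det(2)[OF W_borel])
    show "emeasure lborel W < \<infinity>"
      using finite V_borel by (simp add: W_def emeasure_of_vec_vimage)
    show "(F has_derivative to_vec \<circ> f' (of_vec y) \<circ> of_vec) (at y within W)" if "y \<in> W" for y
      unfolding F_def W_def using that by (intro has_derivative_coordinates has_derivative) (simp add: W_def)
    show "inj_on F W"
      using injective by (intro inj_onI) (simp add: F_def W_def inj_on_eq_iff)
    show "J (of_vec y) = \<bar>det (matrix (to_vec \<circ> f' (of_vec y) \<circ> of_vec))\<bar>" "J (of_vec y) \<le> B" if "y \<in> W" for y
      using that J_eq bound by (simp_all add: W_def jac_def)
  qed simp
  also have "\<dots> = (\<integral>\<^sup>+y. ennreal (J (of_vec y)) * indicator V (of_vec y) \<partial>lborel)"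
    by (simp add: W_def indicator_def)
  also have "\<dots> = (\<integral>\<^sup>+x\<in>V. ennreal (J x) \<partial>lborel)"
    by (rule nn_integral_of_vec) measurable
  finally show ?thesis .
qed

lemma nn_integral_change_of_variables:
  fixes f :: "'a::euclidean_space \<Rightarrow> 'a"
  assumes U_borel [measurable]: "U \<in> sets borel" and finite: "emeasure lborel U < \<infinity>" and image [measurable]: "f ` U \<in> sets borel"
    and f_borel [measurable]: "f \<in> borel \<rightarrow>\<^sub>M borel"
    and has_derivative: "\<And>x. x \<in> U \<Longrightarrow> (f has_derivative f' x) (at x within U)" and injective: "inj_on f U"
    and J_borel [measurable]: "J \<in> borel_measurable borel" and J_eq: "\<And>x. x \<in> U \<Longrightarrow> J x = jac (f' x)"
    and bound: "\<And>x. x \<in> U \<Longrightarrow> J x \<le> B"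
    and g_borel [measurable]: "g \<in> borel_measurable borel"
  shows "(\<integral>\<^sup>+x\<in>U. ennreal (J x) * g (f x) \<partial>lborel) = (\<integral>\<^sup>+y\<in>f ` U. g y \<partial>lborel)"
proof -
  define M where "M = distr (density lborel (\<lambda>x. ennreal (J x) * indicator U x)) borel f"
  define N where "N = density lborel (indicator (f ` U) :: 'a \<Rightarrow> ennreal)"
  have "M = N"
  proof (rule measure_eqI)
    fix A assume "A \<in> sets M"
    then have A_borel [measurable]: "A \<in> sets borel"
      by (simp add: M_def)
    define V where "V = U \<inter> f -` A"
    have vimage [measurable]: "f -` A \<in> sets borel"
      using measurable_sets_borel[OF f_borel A_borel] .
    have V_image: "f ` V = f ` U \<inter> A"
      by (auto simp: V_def)
    have "emeasure M A = (\<integral>\<^sup>+x\<in>V. ennreal (J x) \<partial>lborel)"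
      unfolding M_def by (auto simp: emeasure_distr emeasure_density V_def indicator_def intro!: nn_integral_cong)
    also have "\<dots> = emeasure lborel (f ` V)"
    proof (rule emeasure_image_eq_jac[symmetric, where f' = f' and B = B])
      show "emeasure lborel V < \<infinity>"
        by (rule le_less_trans[OF emeasure_mono finite]) (auto simp: V_def)
      show "f ` V \<in> sets borel"
        unfolding V_image by simp
    qed (use J_eq bound has_derivative injective in \<open>auto simp: V_def inj_on_def intro: has_derivative_subset\<close>)
    also have "\<dots> = emeasure N A"
      unfolding N_def V_image by (simp add: emeasure_density indicator_inter_arith[symmetric])
    finally show "emeasure M A = emeasure N A" .
  qed (simp add: M_def N_def)
  then have "(\<integral>\<^sup>+y. g y \<partial>M) = (\<integral>\<^sup>+y. g y \<partial>N)"
    by simp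
  then show ?thesis
    unfolding M_def N_def by (simp add: nn_integral_distr nn_integral_density mult_ac)
qed

lemma jac_compose:
  assumes "linear L1" "linear L2"
  shows "jac (L1 \<circ> L2) = jac L1 * jac L2"
proof -
  have "to_vec \<circ> (L1 \<circ> L2) \<circ> of_vec = (to_vec \<circ> L1 \<circ> of_vec) \<circ> (to_vec \<circ> L2 \<circ> of_vec)"
    by (auto simp: fun_eq_iff)
  then show ?thesis
    unfolding jac_def using assms
    by (simp add: matrix_compose linear_compose linear_to_vec linear_of_vec det_mul abs_mult)
qed

lemma jac_orthogonal:
  assumes "orthogonal_transformation R"
  shows "jac R = 1"
proof -
  have "orthogonal_transformation (to_vec \<circ> R \<circ> of_vec)"
    using assms unfolding orthogonal_transformation
    by (simp add: linear_compose linear_to_vec linear_of_vec)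
  then show ?thesis
    by (simp add: jac_def)
qed

lemma jac_scaleR:
  assumes "linear L"
  shows "jac (\<lambda>x. c *\<^sub>R L x) = \<bar>c\<bar> ^ DIM('a) * jac (L :: 'a::euclidean_space \<Rightarrow> 'a)"
proof -
  have "jac ((\<lambda>x. c *\<^sub>R x) :: 'a \<Rightarrow> 'a) = \<bar>c\<bar> ^ DIM('a)"
  proof -
    have "to_vec \<circ> ((\<lambda>x. c *\<^sub>R x) :: 'a \<Rightarrow> 'a) \<circ> of_vec = (\<lambda>y. c *\<^sub>R y)"
      by (auto simp: fun_eq_iff linear_scale[OF linear_to_vec])
    then show ?thesis
      unfolding jac_def by (simp add: det_matrix_scaleR card_basis_index power_abs)
  qed
  then show ?thesis
    using jac_compose[of "\<lambda>x. c *\<^sub>R x" L] assms by (simp add: comp_def)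
qed

lemma det_stretch_complement:
  fixes k :: "'n::finite"
  shows "det (matrix (\<lambda>y::real ^ 'n. c *\<^sub>R y + ((1 - c) * y $ k) *\<^sub>R axis k 1)) = c ^ (CARD('n) - 1)"
proof -
  define D :: "real ^ 'n ^ 'n" where "D = matrix (\<lambda>y. c *\<^sub>R y + ((1 - c) * y $ k) *\<^sub>R axis k 1)"
  have "det D = (\<Prod>i\<in>UNIV. D $ i $ i)"
    by (rule det_diagonal) (auto simp: matrix_def D_def axis_def)
  also have "\<dots> = (\<Prod>i\<in>UNIV. if i = k then 1 else c)"
    by (intro prod.cong refl) (auto simp: matrix_def D_def axis_def)
  also have "\<dots> = c ^ (CARD('n) - 1)"
    by (subst prod.remove[of _ k]) (auto simp: card_Diff_singleton)
  finally show ?thesis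
    by (simp add: D_def)
qed

text \<open>A rotation taking \<open>\<eta>\<close> to a coordinate axis diagonalises the map.\<close>

lemma jac_stretch_complement:
  fixes \<eta> :: "'a::euclidean_space"
  assumes norm_\<eta>: "norm \<eta> = 1" and c_pos: "0 < c"
  shows "jac (\<lambda>h. (h \<bullet> \<eta>) *\<^sub>R \<eta> + c *\<^sub>R (h - (h \<bullet> \<eta>) *\<^sub>R \<eta>)) = c ^ (DIM('a) - 1)"
proof -
  define L where "L = (\<lambda>h::'a. (h \<bullet> \<eta>) *\<^sub>R \<eta> + c *\<^sub>R (h - (h \<bullet> \<eta>) *\<^sub>R \<eta>))"
  define k where "k = (undefined :: 'a basis_index)"
  define D where "D = (\<lambda>y::real ^ 'a basis_index. c *\<^sub>R y + ((1 - c) * y $ k) *\<^sub>R axis k 1)"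
  obtain U :: "real ^ 'a basis_index \<Rightarrow> real ^ 'a basis_index"
    where U_rotation: "orthogonal_transformation U" "U (axis k 1) = to_vec \<eta>"
    using orthogonal_transformation_exists[of "axis k 1" "to_vec \<eta>"] norm_\<eta> by auto
  have inv_U_orthogonal: "orthogonal_transformation (inv U)" and U_inv: "U (inv U y) = y" for y
    using orthogonal_transformation_inv[OF U_rotation(1)] orthogonal_transformation_surj[OF U_rotation(1)] by (simp_all add: surj_f_inv_f)
  note linear = orthogonal_transformation_linear[OF U_rotation(1)] orthogonal_transformation_linear[OF inv_U_orthogonal] linear_to_vec
  have D_linear: "linear D"
    unfolding D_def by (intro linearI) (simp_all add: algebra_simps)
  have "to_vec (L (of_vec y)) = U (D (inv U y))" for y
  proof -
    have "inv U y $ k = U (inv U y) \<bullet> U (axis k 1)"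
      using U_rotation(1) by (simp add: orthogonal_transformation_def inner_axis)
    also have "\<dots> = of_vec y \<bullet> \<eta>"
      using inner_to_vec[of "of_vec y" \<eta>] U_rotation(2) U_inv by simp
    finally have "inv U y $ k = of_vec y \<bullet> \<eta>" .
    then show ?thesis
      using U_rotation(2) U_inv
      by (simp add: D_def L_def linear[THEN linear_add] linear[THEN linear_diff] linear[THEN linear_scale] algebra_simps)
  qed
  then have "to_vec \<circ> L \<circ> of_vec = U \<circ> D \<circ> inv U"
    by auto
  then have "jac L = \<bar>det (matrix D)\<bar>"
    unfolding jac_def using D_linear U_rotation(1) inv_U_orthogonal linear by (simp add: matrix_compose linear_compose det_mul abs_mult)
  then show ?thesis
    using c_pos by (simp add: L_def D_def det_stretch_complement card_basis_index)
qed

lemma jac_le: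
  fixes L :: "'a::euclidean_space \<Rightarrow> 'a"
  assumes bound: "\<And>h. norm (L h) \<le> B * norm h"
  shows "jac L \<le> fact DIM('a) * B ^ DIM('a)"
proof -
  define A where "A = matrix (to_vec \<circ> L \<circ> of_vec)"
  have entry_bound: "\<bar>A $ i $ j\<bar> \<le> B" for i j
  proof -
    have "\<bar>A $ i $ j\<bar> \<le> norm (to_vec (L (of_vec (axis j 1))))"
      using component_le_norm_cart[of "to_vec (L (of_vec (axis j 1)))" i] by (simp add: A_def matrix_def)
    also have "\<dots> \<le> B"
      using bound[of "of_vec (axis j 1)"] by simp
    finally show ?thesis .
  qed
  have "\<bar>det A\<bar> \<le> (\<Sum>p\<in>{p. p permutes (UNIV :: 'a basis_index set)}. \<bar>of_int (sign p) * (\<Prod>i\<in>UNIV. A $ i $ p i)\<bar>)"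
    unfolding det_def by (rule sum_abs)
  also have "\<dots> \<le> (\<Sum>p\<in>{p. p permutes (UNIV :: 'a basis_index set)}. B ^ DIM('a))"
  proof (rule sum_mono)
    fix p
    have "\<bar>of_int (sign p) * (\<Prod>i\<in>UNIV. A $ i $ p i)\<bar> = (\<Prod>i\<in>UNIV. \<bar>A $ i $ p i\<bar>)"
      by (simp add: abs_mult abs_prod sign_def)
    also have "\<dots> \<le> (\<Prod>i\<in>(UNIV :: 'a basis_index set). B)"
      by (rule prod_mono) (simp add: entry_bound)
    finally show "\<bar>of_int (sign p) * (\<Prod>i\<in>UNIV. A $ i $ p i)\<bar> \<le> B ^ DIM('a)"
      by (simp add: card_basis_index)
  qed
  also have "\<dots> = fact DIM('a) * B ^ DIM('a)"
    by (simp add: card_permutations card_basis_index)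
  finally show ?thesis
    by (simp add: jac_def A_def)
qed

section \<open>Orthogonal maps and inversions\<close>

lemma sgn_borel [measurable]: "sgn \<in> borel \<rightarrow>\<^sub>M (borel :: 'a::euclidean_space measure)"
  unfolding sgn_div_norm[abs_def] by measurable

lemma space_sphere_measure [simp]: "space (sphere_measure :: 'a::euclidean_space measure) = sphere 0 1"
  by (simp add: sphere_measure_def space_scale_measure space_restrict_space)

lemma sets_sphere_measure: "sets (sphere_measure :: 'a::euclidean_space measure) = sets (restrict_space borel (sphere 0 1))"
  by (simp add: sphere_measure_def)

lemma borel_measurable_sphere_measureI:
  "f \<in> borel \<rightarrow>\<^sub>M N \<Longrightarrow> f \<in> (sphere_measure :: 'a::euclidean_space measure) \<rightarrow>\<^sub>M N"
  using measurable_restrict_space1 measurable_cong_sets[OF sets_sphere_measure refl] by blast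

lemma nn_integral_sphere_measure:
  fixes g :: "'a::euclidean_space \<Rightarrow> ennreal"
  assumes [measurable]: "g \<in> borel_measurable borel"
  shows "(\<integral>\<^sup>+\<eta>. g \<eta> \<partial>sphere_measure) = of_nat DIM('a) * (\<integral>\<^sup>+x\<in>ball 0 1 - {0}. g (sgn x) \<partial>lborel)"
proof -
  let ?R = "restrict_space lborel (ball 0 1 - {0}) :: 'a measure"
  let ?D = "distr ?R (restrict_space borel (sphere 0 1)) sgn"
  have sgn_measurable: "sgn \<in> ?R \<rightarrow>\<^sub>M restrict_space borel (sphere 0 1)"
  proof (rule measurable_restrict_space2)
    show "sgn \<in> space ?R \<rightarrow> sphere 0 1"
      by (auto simp: space_restrict_space norm_sgn)
    show "sgn \<in> ?R \<rightarrow>\<^sub>M borel"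
      by (rule measurable_restrict_space1) measurable
  qed
  have g_measurable: "g \<in> borel_measurable ?D"
    by (simp add: measurable_restrict_space1)
  have measure_eq: "sphere_measure = scale_measure (of_nat DIM('a)) ?D"
    by (simp add: sphere_measure_def sgn_div_norm[abs_def])
  have "(\<integral>\<^sup>+\<eta>. g \<eta> \<partial>sphere_measure) = of_nat DIM('a) * (\<integral>\<^sup>+x. g (sgn x) \<partial>?R)"
    unfolding measure_eq nn_integral_scale_measure[OF g_measurable] by (simp add: nn_integral_distr[OF sgn_measurable] measurable_restrict_space1)
  also have "(\<integral>\<^sup>+x. g (sgn x) \<partial>?R) = (\<integral>\<^sup>+x\<in>ball 0 1 - {0}. g (sgn x) \<partial>lborel)"
    by (subst nn_integral_restrict_space) auto
  finally show ?thesis .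
qed

lemma emeasure_punctured_ball: "emeasure lborel (ball 0 1 - {0} :: 'a::euclidean_space set) = emeasure lborel (ball 0 1 :: 'a set)"
  by (rule emeasure_Diff_null_set) auto

lemma emeasure_sphere_measure_space: "emeasure (sphere_measure :: 'a::euclidean_space measure) (sphere 0 1)
    = of_nat DIM('a) * emeasure lborel (ball 0 1 :: 'a set)"
proof -
  have "emeasure (sphere_measure :: 'a measure) (sphere 0 1) = (\<integral>\<^sup>+\<eta>. 1 \<partial>(sphere_measure :: 'a measure))"
    by simp
  also have "\<dots> = of_nat DIM('a) * emeasure lborel (ball 0 1 - {0} :: 'a set)"
    by (subst nn_integral_sphere_measure) simp_all
  finally show ?thesis
    by (simp only: emeasure_punctured_ball)
qed

interpretation sphere: finite_measure "sphere_measure :: 'a::euclidean_space measure"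
proof
  have "emeasure lborel (ball 0 1 :: 'a set) < \<infinity>"
    using emeasure_lborel_ball_finite by blast
  then show "emeasure (sphere_measure :: 'a measure) (space sphere_measure) \<noteq> \<infinity>"
    by (simp add: emeasure_sphere_measure_space ennreal_mult_eq_top_iff)
qed

lemma sphere_area_pos: "0 < sphere_area TYPE('a::euclidean_space)"
proof -
  have "emeasure lborel (ball 0 1 :: 'a set) \<noteq> 0"
    using content_ball_pos[of 1 "0::'a"] by (auto simp: measure_def)
  then show ?thesis
    unfolding sphere_area_def
    using emeasure_lborel_ball_finite[of "0::'a" 1] DIM_positive[where 'a='a]
    by (simp add: measure_def emeasure_sphere_measure_space enn2real_positive_iff ennreal_zero_less_mult_iff
        ennreal_mult_less_top of_nat_less_top zero_less_iff_neq_zero)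
qed

definition radial_extension :: "('a::euclidean_space \<Rightarrow> 'a) \<Rightarrow> 'a \<Rightarrow> 'a" where
  "radial_extension f x = norm x *\<^sub>R f (sgn x)"

lemma has_derivative_sgn:
  fixes x :: "'a::euclidean_space"
  assumes "x \<noteq> 0"
  shows "(sgn has_derivative (\<lambda>h. (h - (h \<bullet> sgn x) *\<^sub>R sgn x) /\<^sub>R norm x)) (at x within A)"
proof -
  have norm: "(norm has_derivative (\<lambda>h. h \<bullet> sgn x)) (at x within A)"
    by (rule has_derivative_at_withinI[OF has_derivative_norm[OF assms]])
  have "((\<lambda>x. inverse (norm x) *\<^sub>R x) has_derivative
      (\<lambda>h. inverse (norm x) *\<^sub>R h + (- (inverse (norm x) * (h \<bullet> sgn x) * inverse (norm x))) *\<^sub>R x)) (at x within A)"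
    by (rule has_derivative_scaleR[OF has_derivative_compose[OF norm has_derivative_inverse'] has_derivative_ident])
      (use assms in simp)
  then show ?thesis
    by (simp add: sgn_div_norm[abs_def] scaleR_diff_right mult_ac)
qed

lemma has_derivative_radial_extension:
  fixes x :: "'a::euclidean_space"
  assumes x_nonzero: "x \<noteq> 0" and f_derivative: "(f has_derivative f') (at (sgn x))"
  shows "(radial_extension f has_derivative (\<lambda>h. (h \<bullet> sgn x) *\<^sub>R f (sgn x) + f' (h - (h \<bullet> sgn x) *\<^sub>R sgn x))) (at x within A)"
proof -
  have "(radial_extension f has_derivative
      (\<lambda>h. norm x *\<^sub>R f' ((h - (h \<bullet> sgn x) *\<^sub>R sgn x) /\<^sub>R norm x) + (h \<bullet> sgn x) *\<^sub>R f (sgn x))) (at x within A)"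
    unfolding radial_extension_def[abs_def]
    by (rule has_derivative_scaleR[OF has_derivative_at_withinI[OF has_derivative_norm[OF x_nonzero]]
          has_derivative_compose[OF has_derivative_sgn[OF x_nonzero] f_derivative]])
  moreover have "norm x *\<^sub>R f' (h /\<^sub>R norm x) = f' h" for h
    using x_nonzero linear_scale[OF has_derivative_linear[OF f_derivative]] by simp
  ultimately show ?thesis
    by (simp add: add.commute)
qed

context
  fixes f :: "'a::euclidean_space \<Rightarrow> 'a"
  assumes image: "f ` sphere 0 1 = sphere 0 1"
begin

lemma norm_radial_extension: "norm (radial_extension f x) = norm x"
proof (cases "x = 0")
  case False
  then have "f (sgn x) \<in> sphere 0 1"
    using image by (auto simp: norm_sgn)
  then show ?thesis
    by (simp add: radial_extension_def)
qed (simp add: radial_extension_def)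

lemma sgn_radial_extension:
  "x \<noteq> 0 \<Longrightarrow> sgn (radial_extension f x) = f (sgn x)"
  by (simp add: sgn_div_norm[of "radial_extension f x"] norm_radial_extension)
    (simp add: radial_extension_def)

lemma radial_extension_punctured_ball: "radial_extension f ` (ball 0 1 - {0}) = ball 0 1 - {0}"
proof (intro equalityI subsetI)
  fix y :: 'a
  assume y_in: "y \<in> ball 0 1 - {0}"
  then have "sgn y \<in> f ` sphere 0 1"
    unfolding image by (simp add: norm_sgn)
  then obtain \<eta> where norm_\<eta>: "norm \<eta> = 1" "f \<eta> = sgn y"
    by auto
  show "y \<in> radial_extension f ` (ball 0 1 - {0})"
    using y_in norm_\<eta> by (intro image_eqI[of _ _ "norm y *\<^sub>R \<eta>"]) (auto simp: radial_extension_def sgn_scaleR sgn_div_norm)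
next
  fix y :: 'a
  assume "y \<in> radial_extension f ` (ball 0 1 - {0})"
  then obtain x where "x \<in> ball 0 1 - {0}" "y = radial_extension f x"
    by blast
  then show "y \<in> ball 0 1 - {0}"
    using norm_radial_extension[of x] by auto
qed

lemma inj_on_radial_extension:
  assumes injective: "inj_on f (sphere 0 1)"
  shows "inj_on (radial_extension f) (ball 0 1 - {0})"
proof (rule inj_onI)
  fix x y :: 'a
  assume same_image: "x \<in> ball 0 1 - {0}" "y \<in> ball 0 1 - {0}" "radial_extension f x = radial_extension f y"
  then have "f (sgn x) = f (sgn y)"
    using sgn_radial_extension[of x] sgn_radial_extension[of y] by simp
  then have "sgn x = sgn y"
    using injective same_image by (simp add: inj_on_eq_iff norm_sgn)
  moreover have "norm x = norm y"
    using same_image norm_radial_extension[of x] norm_radial_extension[of y] by simp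
  ultimately show "x = y"
    using same_image by (simp add: sgn_div_norm)
qed

end

text \<open>The Jacobian of the radial extension of \<open>f\<close> at \<open>\<eta>\<close> is that of the restriction of \<open>f\<close> to the sphere.\<close>

lemma nn_integral_sphere_substitution:
  fixes f :: "'a::euclidean_space \<Rightarrow> 'a"
  assumes f_borel [measurable]: "f \<in> borel \<rightarrow>\<^sub>M borel"
    and image: "f ` sphere 0 1 = sphere 0 1" and injective: "inj_on f (sphere 0 1)"
    and has_derivative: "\<And>\<eta>. norm \<eta> = 1 \<Longrightarrow> (f has_derivative f' \<eta>) (at \<eta>)"
    and J_borel [measurable]: "J \<in> borel_measurable borel"
    and J_eq: "\<And>\<eta>. norm \<eta> = 1 \<Longrightarrow> J \<eta> = jac (\<lambda>h. (h \<bullet> \<eta>) *\<^sub>R f \<eta> + f' \<eta> (h - (h \<bullet> \<eta>) *\<^sub>R \<eta>))"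
    and bound: "\<And>\<eta>. norm \<eta> = 1 \<Longrightarrow> J \<eta> \<le> B"
    and g_borel [measurable]: "g \<in> borel_measurable borel"
  shows "(\<integral>\<^sup>+\<eta>. ennreal (J \<eta>) * g (f \<eta>) \<partial>sphere_measure) = (\<integral>\<^sup>+\<eta>. g \<eta> \<partial>sphere_measure)"
proof -
  let ?U = "ball 0 1 - {0} :: 'a set"
  let ?F = "radial_extension f"
  have [measurable]: "?F \<in> borel \<rightarrow>\<^sub>M borel"
    unfolding radial_extension_def[abs_def] by measurable
  have "(\<integral>\<^sup>+x\<in>?U. ennreal (J (sgn x)) * g (sgn (?F x)) \<partial>lborel) = (\<integral>\<^sup>+y\<in>?F ` ?U. g (sgn y) \<partial>lborel)"
  proof (rule nn_integral_change_of_variables[where B = B])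
    show "emeasure lborel ?U < \<infinity>"
      unfolding emeasure_punctured_ball using emeasure_lborel_ball_finite by blast
    show "?F ` ?U \<in> sets borel"
      unfolding radial_extension_punctured_ball[OF image] by simp
    show "inj_on ?F ?U"
      by (rule inj_on_radial_extension[OF image injective])
    fix x assume "x \<in> ?U"
    then have x_direction: "x \<noteq> 0" "norm (sgn x) = 1"
      by (simp_all add: norm_sgn)
    show "(?F has_derivative (\<lambda>h. (h \<bullet> sgn x) *\<^sub>R f (sgn x) + f' (sgn x) (h - (h \<bullet> sgn x) *\<^sub>R sgn x))) (at x within ?U)"
      by (rule has_derivative_radial_extension[OF x_direction(1) has_derivative[OF x_direction(2)]])
    show "J (sgn x) = jac (\<lambda>h. (h \<bullet> sgn x) *\<^sub>R f (sgn x) + f' (sgn x) (h - (h \<bullet> sgn x) *\<^sub>R sgn x))" "J (sgn x) \<le> B"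
      by (rule J_eq[OF x_direction(2)], rule bound[OF x_direction(2)])
  qed measurable
  also have "\<dots> = (\<integral>\<^sup>+y\<in>?U. g (sgn y) \<partial>lborel)"
    by (simp only: radial_extension_punctured_ball[OF image])
  also have "(\<integral>\<^sup>+x\<in>?U. ennreal (J (sgn x)) * g (sgn (?F x)) \<partial>lborel) = (\<integral>\<^sup>+x\<in>?U. ennreal (J (sgn x)) * g (f (sgn x)) \<partial>lborel)"
    by (intro nn_integral_cong) (simp add: sgn_radial_extension[OF image] indicator_def)
  finally show ?thesis
    by (simp add: nn_integral_sphere_measure)
qed

lemma bounded_linear_orthogonal_transformation:
  "orthogonal_transformation (R :: 'a::euclidean_space \<Rightarrow> 'a) \<Longrightarrow> bounded_linear R"
  using orthogonal_transformation_linear linear_conv_bounded_linear by blast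

lemma borel_measurable_orthogonal_transformation:
  "orthogonal_transformation (R :: 'a::euclidean_space \<Rightarrow> 'a) \<Longrightarrow> R \<in> borel \<rightarrow>\<^sub>M borel"
  by (intro borel_measurable_continuous_onI linear_continuous_on bounded_linear_orthogonal_transformation)

lemma has_derivative_orthogonal_transformation:
  "orthogonal_transformation (R :: 'a::euclidean_space \<Rightarrow> 'a) \<Longrightarrow> (R has_derivative R) (at x within A)"
  by (intro bounded_linear_imp_has_derivative bounded_linear_orthogonal_transformation)

lemma nn_integral_orthogonal_ball:
  fixes g :: "'a::euclidean_space \<Rightarrow> ennreal" and R :: "'a \<Rightarrow> 'a"
  assumes R_orthogonal: "orthogonal_transformation R" and [measurable]: "g \<in> borel_measurable borel"
  shows "(\<integral>\<^sup>+x\<in>ball 0 1. g (R x) \<partial>lborel) = (\<integral>\<^sup>+x\<in>ball 0 1. g x \<partial>lborel)"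
proof -
  have image: "R ` ball 0 1 = ball 0 1"
    using image_orthogonal_transformation_ball[OF R_orthogonal, of 0 1] linear_0[OF orthogonal_transformation_linear[OF R_orthogonal]] by simp
  have "(\<integral>\<^sup>+x\<in>ball 0 1. ennreal 1 * g (R x) \<partial>lborel) = (\<integral>\<^sup>+y\<in>R ` ball 0 1. g y \<partial>lborel)"
  proof (rule nn_integral_change_of_variables[where f' = "\<lambda>_. R" and B = 1])
    show "emeasure lborel (ball 0 1 :: 'a set) < \<infinity>"
      using emeasure_lborel_ball_finite by blast
  qed (use assms image in \<open>auto simp: jac_orthogonal orthogonal_transformation_inj inj_on_subset[OF _ subset_UNIV]
      borel_measurable_orthogonal_transformation has_derivative_orthogonal_transformation\<close>)
  then show ?thesis
    by (simp add: image)
qed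

lemma nn_integral_orthogonal_sphere:
  fixes g :: "'a::euclidean_space \<Rightarrow> ennreal" and R :: "'a \<Rightarrow> 'a"
  assumes R_orthogonal: "orthogonal_transformation R" and "g \<in> borel_measurable borel"
  shows "(\<integral>\<^sup>+\<eta>. g (R \<eta>) \<partial>sphere_measure) = (\<integral>\<^sup>+\<eta>. g \<eta> \<partial>sphere_measure)"
proof -
  have "(\<integral>\<^sup>+\<eta>. ennreal 1 * g (R \<eta>) \<partial>sphere_measure) = (\<integral>\<^sup>+\<eta>. g \<eta> \<partial>sphere_measure)"
  proof (rule nn_integral_sphere_substitution[where f' = "\<lambda>_. R" and B = 1])
    have "y \<in> R ` sphere 0 1" if "norm y = 1" for y
      using that surj_f_inv_f[OF orthogonal_transformation_surj[OF R_orthogonal], of y] orthogonal_transformation_norm[OF R_orthogonal, of "inv R y"]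
      by (intro image_eqI[of _ _ "inv R y"]) simp_all
    then show "R ` sphere 0 1 = sphere 0 1"
      using orthogonal_transformation_norm[OF R_orthogonal] by auto
    have "(h \<bullet> \<eta>) *\<^sub>R R \<eta> + R (h - (h \<bullet> \<eta>) *\<^sub>R \<eta>) = R h" for h \<eta>
      using orthogonal_transformation_linear[OF R_orthogonal] by (simp add: linear_diff linear_scale)
    then show "1 = jac (\<lambda>h. (h \<bullet> \<eta>) *\<^sub>R R \<eta> + R (h - (h \<bullet> \<eta>) *\<^sub>R \<eta>))" for \<eta>
      by (simp add: jac_orthogonal[OF R_orthogonal])
  qed (use assms in \<open>auto simp: orthogonal_transformation_inj inj_on_subset[OF _ subset_UNIV]
      borel_measurable_orthogonal_transformation has_derivative_orthogonal_transformation\<close>)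
  then show ?thesis
    by simp
qed

definition reflect :: "'a::euclidean_space \<Rightarrow> 'a \<Rightarrow> 'a" where
  "reflect \<nu> x = x - (2 * (x \<bullet> \<nu>)) *\<^sub>R \<nu>"

lemma linear_reflect: "linear (reflect \<nu>)"
  by (intro linearI) (simp_all add: reflect_def algebra_simps)

lemma inner_reflect [simp]: "norm \<nu> = 1 \<Longrightarrow> reflect \<nu> x \<bullet> reflect \<nu> y = x \<bullet> y"
  by (simp add: reflect_def inner_diff_left inner_diff_right norm_eq_1 inner_commute[of \<nu> y])

lemma norm_reflect [simp]: "norm \<nu> = 1 \<Longrightarrow> norm (reflect \<nu> x) = norm x"
  by (simp add: norm_eq_sqrt_inner[of "reflect \<nu> x"] norm_eq_sqrt_inner[of x])

lemma reflect_reflect [simp]: "norm \<nu> = 1 \<Longrightarrow> reflect \<nu> (reflect \<nu> x) = x"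
  by (simp add: reflect_def inner_diff_left norm_eq_1)

lemma inner_reflect_axis [simp]: "norm \<nu> = 1 \<Longrightarrow> reflect \<nu> x \<bullet> \<nu> = - (x \<bullet> \<nu>)"
  by (simp add: reflect_def inner_diff_left norm_eq_1)

lemma reflect_eq_self: "x \<bullet> \<nu> = 0 \<Longrightarrow> reflect \<nu> x = x"
  by (simp add: reflect_def)

lemma orthogonal_transformation_reflect: "norm \<nu> = 1 \<Longrightarrow> orthogonal_transformation (reflect \<nu>)"
  by (simp add: orthogonal_transformation_def linear_reflect)

lemma reflect_borel [measurable]:
  assumes [measurable]: "f \<in> M \<rightarrow>\<^sub>M borel" "g \<in> M \<rightarrow>\<^sub>M borel"
  shows "(\<lambda>x. reflect (f x) (g x)) \<in> M \<rightarrow>\<^sub>M (borel :: 'a::euclidean_space measure)"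
  unfolding reflect_def by measurable

lemma norm_reflect_diff_swap:
  assumes "norm \<nu> = 1"
  shows "norm (reflect \<nu> x - y) = norm (x - reflect \<nu> y)"
  using norm_reflect[OF assms, of "x - reflect \<nu> y"] assms by (simp add: linear_diff[OF linear_reflect])

lemma reflect_sgn: "reflect (sgn d) x = x - (2 * (x \<bullet> d) / (d \<bullet> d)) *\<^sub>R d"
  by (simp add: reflect_def sgn_div_norm dot_square_norm power2_eq_square divide_inverse mult_ac)

lemma reflect_swap:
  assumes "norm \<eta> = norm \<zeta>" "\<eta> \<noteq> \<zeta>"
  shows "reflect (sgn (\<eta> - \<zeta>)) \<eta> = \<zeta>"
proof -
  have "\<eta> \<bullet> \<eta> = \<zeta> \<bullet> \<zeta>"
    using assms(1) by (simp add: norm_eq)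
  then have "2 * (\<eta> \<bullet> (\<eta> - \<zeta>)) = (\<eta> - \<zeta>) \<bullet> (\<eta> - \<zeta>)"
    by (simp add: inner_diff_left inner_diff_right inner_commute)
  then show ?thesis
    using assms(2) by (simp add: reflect_sgn)
qed

definition inversion_factor :: "'a::euclidean_space \<Rightarrow> 'a \<Rightarrow> real" where
  "inversion_factor a x = (a \<bullet> a - 1) / ((x - a) \<bullet> (x - a))"

text \<open>The inversion in the sphere with centre \<open>a\<close> that is orthogonal to the unit sphere.\<close>

definition inversion :: "'a::euclidean_space \<Rightarrow> 'a \<Rightarrow> 'a" where
  "inversion a x = a + inversion_factor a x *\<^sub>R (x - a)"

lemma inversion_factor_borel [measurable]: "inversion_factor a \<in> borel_measurable borel"
  unfolding inversion_factor_def by measurable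

lemma inversion_borel [measurable]: "inversion a \<in> borel \<rightarrow>\<^sub>M borel"
  unfolding inversion_def by measurable

context
  fixes a :: "'a::euclidean_space"
  assumes outside: "1 < norm a"
begin

lemma inversion_center_inner_gt_1: "1 < a \<bullet> a"
  using outside by (simp add: dot_square_norm one_less_power)

lemma not_inversion_center: "norm x \<le> 1 \<Longrightarrow> x \<noteq> a"
  using outside by auto

lemma inversion_denom_pos: "x \<noteq> a \<Longrightarrow> 0 < (x - a) \<bullet> (x - a)"
  by simp

lemma inversion_factor_pos: "x \<noteq> a \<Longrightarrow> 0 < inversion_factor a x"
  using inversion_center_inner_gt_1 by (simp add: inversion_factor_def)

lemma inversion_factor_times_square: "x \<noteq> a \<Longrightarrow> inversion_factor a x * ((x - a) \<bullet> (x - a)) = a \<bullet> a - 1"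
  by (simp add: inversion_factor_def)

lemma inversion_diff_center: "inversion a x - a = inversion_factor a x *\<^sub>R (x - a)"
  by (simp add: inversion_def)

lemma inversion_factor_inversion: "x \<noteq> a \<Longrightarrow> inversion_factor a (inversion a x) = 1 / inversion_factor a x"
  using inversion_factor_pos[of x] inversion_center_inner_gt_1
  by (simp add: inversion_factor_def[of a "inversion a x"] inversion_diff_center) (simp add: inversion_factor_def)

lemma inversion_inversion: "x \<noteq> a \<Longrightarrow> inversion a (inversion a x) = x"
  using inversion_factor_pos[of x]
  by (simp add: inversion_def[of a "inversion a x"] inversion_diff_center inversion_factor_inversion)

lemma one_minus_inner_inversion:
  assumes "x \<noteq> a"
  shows "1 - inversion a x \<bullet> inversion a x = inversion_factor a x * (1 - x \<bullet> x)"
proof -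
  define l where "l = inversion_factor a x"
  have l_square: "l * ((x - a) \<bullet> (x - a)) = a \<bullet> a - 1"
    unfolding l_def using assms by (rule inversion_factor_times_square)
  have "inversion a x \<bullet> inversion a x = a \<bullet> a + 2 * l * (a \<bullet> (x - a)) + l * (l * ((x - a) \<bullet> (x - a)))"
    unfolding inversion_def l_def[symmetric] by (simp add: algebra_simps inner_commute)
  also have "\<dots> = a \<bullet> a + 2 * l * (a \<bullet> (x - a)) + l * (a \<bullet> a - 1)"
    by (simp only: l_square)
  finally have "1 - inversion a x \<bullet> inversion a x = - (l * ((x - a) \<bullet> (x - a))) - 2 * l * (a \<bullet> (x - a)) - l * (a \<bullet> a - 1)"
    using l_square by simp
  also have "\<dots> = l * (1 - x \<bullet> x)"
    by (simp add: algebra_simps inner_commute)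
  finally show ?thesis
    by (simp add: l_def)
qed

lemma norm_inversion_diff:
  assumes x_neq_a: "x \<noteq> a" and y_neq_a: "y \<noteq> a"
  shows "(norm (inversion a x - inversion a y))\<^sup>2 = inversion_factor a x * inversion_factor a y * (norm (x - y))\<^sup>2"
proof -
  define l m where "l = inversion_factor a x" and "m = inversion_factor a y"
  define X Y where "X = x - a" and "Y = y - a"
  have l_square: "l * (X \<bullet> X) = a \<bullet> a - 1" and m_square: "m * (Y \<bullet> Y) = a \<bullet> a - 1"
    unfolding l_def m_def X_def Y_def using x_neq_a y_neq_a by (simp_all add: inversion_factor_times_square)
  have "inversion a x - inversion a y = l *\<^sub>R X - m *\<^sub>R Y"
    by (simp add: inversion_def l_def m_def X_def Y_def)
  moreover have "(norm (l *\<^sub>R X - m *\<^sub>R Y))\<^sup>2 = l * (l * (X \<bullet> X)) - 2 * l * m * (X \<bullet> Y) + m * (m * (Y \<bullet> Y))"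
    by (simp add: power2_norm_eq_inner inner_diff_left inner_diff_right inner_commute[of Y X] algebra_simps)
  ultimately have "(norm (inversion a x - inversion a y))\<^sup>2 = l * (l * (X \<bullet> X)) - 2 * l * m * (X \<bullet> Y) + m * (m * (Y \<bullet> Y))"
    by simp
  also have "\<dots> = l * (m * (Y \<bullet> Y)) - 2 * l * m * (X \<bullet> Y) + m * (l * (X \<bullet> X))"
    by (simp only: l_square m_square)
  also have "\<dots> = l * m * ((X - Y) \<bullet> (X - Y))"
    by (simp add: inner_diff_left inner_diff_right inner_commute[of Y X] algebra_simps)
  also have "X - Y = x - y"
    by (simp add: X_def Y_def)
  finally show ?thesis
    by (simp add: l_def m_def power2_norm_eq_inner)
qed

lemma inversion_has_derivative:
  assumes x_neq_a: "x \<noteq> a"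
  shows "(inversion a has_derivative (\<lambda>h. inversion_factor a x *\<^sub>R reflect (sgn (x - a)) h)) (at x within A)"
proof -
  define N where "N = (x - a) \<bullet> (x - a)"
  have N_pos: "0 < N"
    using x_neq_a by (simp add: N_def)
  have "(inversion a has_derivative (\<lambda>h. inversion_factor a x *\<^sub>R h
       + (- ((a \<bullet> a - 1) * (2 * ((x - a) \<bullet> h))) / (N * N)) *\<^sub>R (x - a))) (at x within A)"
    unfolding inversion_def[abs_def] inversion_factor_def[abs_def]
    using x_neq_a N_pos unfolding N_def
    by (auto intro!: derivative_eq_intros simp: inner_commute field_simps)
  moreover have "inversion_factor a x *\<^sub>R h + (- ((a \<bullet> a - 1) * (2 * ((x - a) \<bullet> h))) / (N * N)) *\<^sub>R (x - a)
      = inversion_factor a x *\<^sub>R reflect (sgn (x - a)) h" for h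
    using N_pos by (simp add: reflect_sgn inversion_factor_def N_def[symmetric] scaleR_diff_right inner_commute)
  ultimately show ?thesis
    by simp
qed

lemma norm_inversion_less_1_iff:
  assumes "x \<noteq> a"
  shows "norm (inversion a x) < 1 \<longleftrightarrow> norm x < 1"
proof -
  have "norm y < 1 \<longleftrightarrow> 0 < 1 - y \<bullet> y" for y :: 'a
    by (simp add: dot_square_norm abs_square_less_1)
  then show ?thesis
    using one_minus_inner_inversion[OF assms] inversion_factor_pos[OF assms] by (simp only: zero_less_mult_iff) auto
qed

lemma norm_inversion_eq_1_iff: "x \<noteq> a \<Longrightarrow> norm (inversion a x) = 1 \<longleftrightarrow> norm x = 1"
  using one_minus_inner_inversion[of x] inversion_factor_pos[of x]
  by (auto simp: norm_eq_1)

lemma norm_inversion_le_1_iff: "x \<noteq> a \<Longrightarrow> norm (inversion a x) \<le> 1 \<longleftrightarrow> norm x \<le> 1"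
  using norm_inversion_less_1_iff[of x] norm_inversion_eq_1_iff[of x] by linarith

lemma inversion_ball: "inversion a ` ball 0 1 = ball 0 1"
proof -
  have "x \<in> inversion a ` ball 0 1" if "x \<in> ball 0 1" for x
    using that norm_inversion_less_1_iff[of x] not_inversion_center[of x] inversion_inversion[of x]
    by (intro image_eqI[of _ _ "inversion a x"]) simp_all
  then show ?thesis
    using norm_inversion_less_1_iff not_inversion_center by auto
qed

lemma inj_on_inversion: "inj_on (inversion a) (cball 0 1)"
  using inversion_inversion not_inversion_center
  by (intro inj_on_inverseI[of _ "inversion a"]) simp

lemma inversion_factor_le:
  assumes "norm x \<le> 1"
  shows "inversion_factor a x \<le> (a \<bullet> a - 1) / (norm a - 1)\<^sup>2"
proof -
  have "norm a - 1 \<le> norm (x - a)"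
    using assms norm_triangle_ineq2[of a x] by (simp add: norm_minus_commute)
  then have "(norm a - 1)\<^sup>2 \<le> (x - a) \<bullet> (x - a)"
    using outside by (simp add: dot_square_norm power_mono)
  then show ?thesis
    unfolding inversion_factor_def
    using outside inversion_center_inner_gt_1 inversion_denom_pos[OF not_inversion_center[OF assms]]
    by (intro divide_left_mono) auto
qed

lemma nn_integral_inversion_ball:
  fixes g :: "'a \<Rightarrow> ennreal"
  assumes [measurable]: "g \<in> borel_measurable borel"
  shows "(\<integral>\<^sup>+x\<in>ball 0 1. ennreal (inversion_factor a x ^ DIM('a)) * g (inversion a x) \<partial>lborel) = (\<integral>\<^sup>+x\<in>ball 0 1. g x \<partial>lborel)"
proof -
  let ?B = "(a \<bullet> a - 1) / (norm a - 1)\<^sup>2"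
  have "(\<integral>\<^sup>+x\<in>ball 0 1. ennreal (inversion_factor a x ^ DIM('a)) * g (inversion a x) \<partial>lborel)
      = (\<integral>\<^sup>+y\<in>inversion a ` ball 0 1. g y \<partial>lborel)"
  proof (rule nn_integral_change_of_variables[where B = "?B ^ DIM('a)"])
    show "emeasure lborel (ball 0 1 :: 'a set) < \<infinity>"
      using emeasure_lborel_ball_finite by blast
    show "inversion a ` ball 0 1 \<in> sets borel"
      unfolding inversion_ball by simp
    show "inj_on (inversion a) (ball 0 1)"
      using inj_on_inversion ball_subset_cball inj_on_subset by blast
    fix x :: 'a
    assume "x \<in> ball 0 1"
    then have x_in_cball: "x \<noteq> a" "norm x \<le> 1"
      using not_inversion_center[of x] by auto
    show "(inversion a has_derivative (\<lambda>h. inversion_factor a x *\<^sub>R reflect (sgn (x - a)) h)) (at x within ball 0 1)"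
      by (rule inversion_has_derivative[OF x_in_cball(1)])
    show "inversion_factor a x ^ DIM('a) = jac (\<lambda>h. inversion_factor a x *\<^sub>R reflect (sgn (x - a)) h)"
      using jac_orthogonal[OF orthogonal_transformation_reflect[of "sgn (x - a)"]] inversion_factor_pos[OF x_in_cball(1)] x_in_cball(1)
      by (simp add: jac_scaleR linear_reflect norm_sgn)
    show "inversion_factor a x ^ DIM('a) \<le> ?B ^ DIM('a)"
      using inversion_factor_pos[OF x_in_cball(1)] inversion_factor_le[OF x_in_cball(2)] by (intro power_mono) simp_all
  qed measurable
  then show ?thesis
    by (simp add: inversion_ball)
qed

lemma inversion_eq_reflect:
  assumes "norm \<eta> = 1"
  shows "inversion a \<eta> = reflect (sgn (\<eta> - a)) \<eta>"
proof -
  have "inversion_factor a \<eta> = 1 - 2 * (\<eta> \<bullet> (\<eta> - a)) / ((\<eta> - a) \<bullet> (\<eta> - a))"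
    using assms not_inversion_center[of \<eta>]
    by (simp add: inversion_factor_def diff_divide_eq_iff) (simp add: norm_eq_1 inner_diff_left inner_diff_right inner_commute)
  then show ?thesis
    by (simp add: reflect_sgn inversion_def scaleR_diff_left)
qed

lemma nn_integral_inversion_sphere:
  fixes g :: "'a \<Rightarrow> ennreal"
  assumes [measurable]: "g \<in> borel_measurable borel"
  shows "(\<integral>\<^sup>+\<eta>. ennreal (inversion_factor a \<eta> ^ (DIM('a) - 1)) * g (inversion a \<eta>) \<partial>sphere_measure) = (\<integral>\<^sup>+\<eta>. g \<eta> \<partial>sphere_measure)"
proof (rule nn_integral_sphere_substitution)
  let ?B = "(a \<bullet> a - 1) / (norm a - 1)\<^sup>2"
  show "inversion a ` sphere 0 1 = sphere 0 1"
  proof -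
    have "\<eta> \<in> inversion a ` sphere 0 1" if "norm \<eta> = 1" for \<eta>
      using that norm_inversion_eq_1_iff[of \<eta>] not_inversion_center[of \<eta>] inversion_inversion[of \<eta>]
      by (intro image_eqI[of _ _ "inversion a \<eta>"]) simp_all
    then show ?thesis
      using norm_inversion_eq_1_iff not_inversion_center by auto
  qed
  show "inj_on (inversion a) (sphere 0 1)"
    using inj_on_inversion sphere_cball inj_on_subset by blast
  fix \<eta> :: 'a
  assume norm_\<eta>: "norm \<eta> = 1"
  then have \<eta>_neq_a: "\<eta> \<noteq> a"
    using not_inversion_center[of \<eta>] by simp
  let ?R = "reflect (sgn (\<eta> - a))"
  show "(inversion a has_derivative (\<lambda>h. inversion_factor a \<eta> *\<^sub>R ?R h)) (at \<eta>)"
    by (rule inversion_has_derivative[OF \<eta>_neq_a])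
  have "(h \<bullet> \<eta>) *\<^sub>R inversion a \<eta> + inversion_factor a \<eta> *\<^sub>R ?R (h - (h \<bullet> \<eta>) *\<^sub>R \<eta>)
      = ?R ((h \<bullet> \<eta>) *\<^sub>R \<eta> + inversion_factor a \<eta> *\<^sub>R (h - (h \<bullet> \<eta>) *\<^sub>R \<eta>))" for h
    by (simp add: inversion_eq_reflect[OF norm_\<eta>] linear_add[OF linear_reflect] linear_scale[OF linear_reflect])
  moreover have "linear (\<lambda>h. (h \<bullet> \<eta>) *\<^sub>R \<eta> + inversion_factor a \<eta> *\<^sub>R (h - (h \<bullet> \<eta>) *\<^sub>R \<eta>))"
    by (intro linearI) (simp_all add: algebra_simps)
  ultimately show "inversion_factor a \<eta> ^ (DIM('a) - 1)
      = jac (\<lambda>h. (h \<bullet> \<eta>) *\<^sub>R inversion a \<eta> + inversion_factor a \<eta> *\<^sub>R ?R (h - (h \<bullet> \<eta>) *\<^sub>R \<eta>))"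
    using jac_compose[OF linear_reflect, of _ "sgn (\<eta> - a)"] jac_orthogonal[OF orthogonal_transformation_reflect[of "sgn (\<eta> - a)"]]
      jac_stretch_complement[OF norm_\<eta> inversion_factor_pos[OF \<eta>_neq_a]] \<eta>_neq_a
    by (simp add: comp_def norm_sgn)
  show "inversion_factor a \<eta> ^ (DIM('a) - 1) \<le> ?B ^ (DIM('a) - 1)"
    using inversion_factor_pos[OF \<eta>_neq_a] inversion_factor_le[of \<eta>] norm_\<eta> by (intro power_mono) simp_all
qed measurable

end

section \<open>Spherical and hyperbolic measure\<close>

definition sph :: "'a::euclidean_space measure" where
  "sph = distr sphere_measure borel (\<lambda>x. x)"

lemma sets_sph [measurable_cong, simp]: "sets sph = sets borel"
  by (simp add: sph_def)

lemma space_sph [simp]: "space sph = UNIV"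
  by (simp add: sph_def)

lemma id_sphere_measurable: "(\<lambda>x. x) \<in> sphere_measure \<rightarrow>\<^sub>M (borel :: 'a::euclidean_space measure)"
  by (rule borel_measurable_sphere_measureI) simp

lemma nn_integral_sph:
  "g \<in> borel_measurable borel \<Longrightarrow> (\<integral>\<^sup>+\<eta>. g \<eta> \<partial>sph) = (\<integral>\<^sup>+\<eta>. g \<eta> \<partial>(sphere_measure :: 'a::euclidean_space measure))"
  unfolding sph_def by (rule nn_integral_distr[OF id_sphere_measurable]) simp

lemma integral_sph:
  "g \<in> borel_measurable borel \<Longrightarrow> (\<integral>\<eta>. g \<eta> \<partial>sph) = (\<integral>\<eta>. (g \<eta> :: real) \<partial>(sphere_measure :: 'a::euclidean_space measure))"
  unfolding sph_def by (rule integral_distr[OF id_sphere_measurable]) simp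

lemma integrable_sph:
  "g \<in> borel_measurable borel \<Longrightarrow> integrable sph g \<longleftrightarrow> integrable (sphere_measure :: 'a::euclidean_space measure) (g :: 'a \<Rightarrow> real)"
  unfolding sph_def by (rule integrable_distr_eq[OF id_sphere_measurable]) simp

interpretation sph: finite_measure "sph :: 'a::euclidean_space measure"
  unfolding sph_def by (rule sphere.finite_measure_distr[OF id_sphere_measurable])

lemma measure_sph: "measure (sph :: 'a::euclidean_space measure) UNIV = sphere_area TYPE('a)"
  unfolding sph_def sphere_area_def by (subst measure_distr[OF id_sphere_measurable]) auto

lemma emeasure_sph: "emeasure (sph :: 'a::euclidean_space measure) UNIV = ennreal (sphere_area TYPE('a))"
  using sph.emeasure_eq_measure[of "UNIV :: 'a set"] by (simp add: measure_sph)

lemma AE_sph: "AE \<eta> in sph. norm \<eta> = 1"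
  unfolding sph_def by (subst AE_distr_iff[OF id_sphere_measurable]) (auto intro!: AE_I2)

lemma measurable_sph [simp]: "measurable sph N = measurable borel N"
  by (rule measurable_cong_sets) simp_all

lemma nn_integral_sph_ball:
  fixes g :: "'a::euclidean_space \<Rightarrow> ennreal"
  assumes "g \<in> borel_measurable borel"
  shows "(\<integral>\<^sup>+\<eta>. g \<eta> \<partial>sph) = of_nat DIM('a) * (\<integral>\<^sup>+x\<in>ball 0 1 - {0}. g (sgn x) \<partial>lborel)"
  using assms by (simp add: nn_integral_sph nn_integral_sphere_measure)

text \<open>On the ball, \<open>weight powr - n\<close> is the density of hyperbolic measure.\<close>

definition weight :: "'a::euclidean_space \<Rightarrow> real" where
  "weight x = (1 - (norm x)\<^sup>2) / 2"

lemma weight_borel [measurable]: "weight \<in> borel_measurable borel"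
  unfolding weight_def by measurable

lemma weight_pos: "norm x < 1 \<Longrightarrow> 0 < weight x"
  by (simp add: weight_def abs_square_less_1)

lemma weight_le_half: "weight x \<le> 1 / 2"
  by (simp add: weight_def)

lemma weight_inversion: "1 < norm a \<Longrightarrow> x \<noteq> a \<Longrightarrow> weight (inversion a x) = inversion_factor a x * weight x"
  using one_minus_inner_inversion[of a x] by (simp add: weight_def dot_square_norm)

lemma ball_borel [measurable]: "ball x r \<in> sets borel"
  by simp

definition hyp :: "'a::euclidean_space measure" where
  "hyp = density lborel (\<lambda>x. ennreal (weight x powr - real DIM('a)) * indicator (ball 0 1) x)"

lemma sets_hyp [measurable_cong, simp]: "sets hyp = sets borel"
  by (simp add: hyp_def)

lemma space_hyp [simp]: "space hyp = UNIV"
  by (simp add: hyp_def)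

lemma measurable_hyp [simp]: "measurable hyp N = measurable borel N"
  by (rule measurable_cong_sets) simp_all

lemma nn_integral_hyp:
  fixes g :: "'a::euclidean_space \<Rightarrow> ennreal"
  assumes [measurable]: "g \<in> borel_measurable borel"
  shows "(\<integral>\<^sup>+x. g x \<partial>hyp) = (\<integral>\<^sup>+x\<in>ball 0 1. ennreal (weight x powr - real DIM('a)) * g x \<partial>lborel)"
  unfolding hyp_def by (subst nn_integral_density) (auto intro!: nn_integral_cong simp: mult_ac)

lemma AE_hyp: "AE x in (hyp :: 'a::euclidean_space measure). norm x < 1"
proof -
  have density: "(\<lambda>x::'a. ennreal (weight x powr - real DIM('a)) * indicator (ball 0 1) x) \<in> borel_measurable lborel"
    by measurable
  show ?thesis
    unfolding hyp_def AE_density[OF density] by (auto intro!: AE_I2 simp: indicator_def split: if_splits)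
qed

interpretation hyp: sigma_finite_measure "hyp :: 'a::euclidean_space measure"
  unfolding hyp_def
  by (subst sigma_finite_measure.sigma_finite_iff_density_finite[OF sigma_finite_lborel]) (auto simp: indicator_def intro!: AE_I2 ennreal_mult_less_top)

lemma emeasure_lborel_le_hyp:
  fixes A :: "'a::euclidean_space set"
  assumes [measurable]: "A \<in> sets borel" and A_subset_ball: "A \<subseteq> ball 0 1"
  shows "emeasure lborel A \<le> emeasure hyp A"
proof -
  have "emeasure lborel A = (\<integral>\<^sup>+x. indicator A x \<partial>lborel)"
    by simp
  also have "\<dots> \<le> (\<integral>\<^sup>+x\<in>ball 0 1. ennreal (weight x powr - real DIM('a)) * indicator A x \<partial>lborel)"
  proof (rule nn_integral_mono)
    fix x :: 'a
    show "indicator A x \<le> ennreal (weight x powr - real DIM('a)) * indicator A x * indicator (ball 0 1) x"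
    proof (cases "x \<in> A")
      case True
      then have "norm x < 1"
        using A_subset_ball by auto
      moreover from this have "1 powr - real DIM('a) \<le> weight x powr - real DIM('a)"
        using weight_pos[of x] weight_le_half[of x] by (intro powr_mono2') auto
      then have "ennreal 1 \<le> ennreal (weight x powr - real DIM('a))"
        by (intro ennreal_leI) simp
      ultimately show ?thesis
        using True by simp
    qed simp
  qed
  also have "\<dots> = emeasure hyp A"
    by (subst nn_integral_hyp[symmetric]) simp_all
  finally show ?thesis .
qed

lemma nn_integral_orthogonal_sph:
  fixes R :: "'a::euclidean_space \<Rightarrow> 'a"
  assumes "orthogonal_transformation R" "g \<in> borel_measurable borel"
  shows "(\<integral>\<^sup>+\<eta>. g (R \<eta>) \<partial>sph) = (\<integral>\<^sup>+\<eta>. g \<eta> \<partial>sph)"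
  using nn_integral_orthogonal_sphere[OF assms] assms(2) borel_measurable_orthogonal_transformation[OF assms(1)]
  by (simp add: nn_integral_sph)

lemma nn_integral_orthogonal_hyp:
  fixes R :: "'a::euclidean_space \<Rightarrow> 'a"
  assumes R_orthogonal: "orthogonal_transformation R" and g_borel [measurable]: "g \<in> borel_measurable borel"
  shows "(\<integral>\<^sup>+x. g (R x) \<partial>hyp) = (\<integral>\<^sup>+x. g x \<partial>hyp)"
proof -
  note [measurable] = borel_measurable_orthogonal_transformation[OF R_orthogonal]
  have "(\<integral>\<^sup>+x. g (R x) \<partial>hyp) = (\<integral>\<^sup>+x\<in>ball 0 1. ennreal (weight (R x) powr - real DIM('a)) * g (R x) \<partial>lborel)"
    by (subst nn_integral_hyp) (simp_all add: weight_def orthogonal_transformation_norm[OF R_orthogonal])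
  also have "\<dots> = (\<integral>\<^sup>+x\<in>ball 0 1. ennreal (weight x powr - real DIM('a)) * g x \<partial>lborel)"
    by (rule nn_integral_orthogonal_ball[OF R_orthogonal]) measurable
  finally show ?thesis
    by (simp add: nn_integral_hyp)
qed

lemma nn_integral_inversion_sph:
  fixes a :: "'a::euclidean_space"
  assumes "1 < norm a" "g \<in> borel_measurable borel"
  shows "(\<integral>\<^sup>+\<eta>. ennreal (inversion_factor a \<eta> ^ (DIM('a) - 1)) * g (inversion a \<eta>) \<partial>sph) = (\<integral>\<^sup>+\<eta>. g \<eta> \<partial>sph)"
  using nn_integral_inversion_sphere[OF assms] assms(2) by (simp add: nn_integral_sph)

lemma nn_integral_inversion_hyp:
  fixes a :: "'a::euclidean_space"
  assumes outside: "1 < norm a" and [measurable]: "g \<in> borel_measurable borel"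
  shows "(\<integral>\<^sup>+x. g (inversion a x) \<partial>hyp) = (\<integral>\<^sup>+x. g x \<partial>hyp)"
proof -
  have "(\<integral>\<^sup>+x. g x \<partial>hyp) = (\<integral>\<^sup>+x\<in>ball 0 1. ennreal (inversion_factor a x ^ DIM('a)) *
      (ennreal (weight (inversion a x) powr - real DIM('a)) * g (inversion a x)) \<partial>lborel)"
    unfolding nn_integral_hyp[OF assms(2)] by (rule nn_integral_inversion_ball[OF outside, symmetric]) measurable
  also have "\<dots> = (\<integral>\<^sup>+x\<in>ball 0 1. ennreal (weight x powr - real DIM('a)) * g (inversion a x) \<partial>lborel)"
  proof (rule nn_integral_cong)
    fix x :: 'a
    show "ennreal (inversion_factor a x ^ DIM('a)) * (ennreal (weight (inversion a x) powr - real DIM('a)) * g (inversion a x)) * indicator (ball 0 1) x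
        = ennreal (weight x powr - real DIM('a)) * g (inversion a x) * indicator (ball 0 1) x"
    proof (cases "norm x < 1")
      case True
      then have x_off_center: "x \<noteq> a" "0 < weight x"
        using outside weight_pos by auto
      have "inversion_factor a x ^ DIM('a) * weight (inversion a x) powr - real DIM('a) = weight x powr - real DIM('a)"
        using inversion_factor_pos[OF outside x_off_center(1)] x_off_center(2)
        by (simp add: weight_inversion[OF outside x_off_center(1)] powr_mult powr_minus powr_realpow)
      then show ?thesis
        by (metis ennreal_mult' mult.assoc powr_ge_zero ennreal_mult'' )
    qed simp
  qed
  also have "\<dots> = (\<integral>\<^sup>+x. g (inversion a x) \<partial>hyp)"
    by (subst nn_integral_hyp) simp_all
  finally show ?thesis
    by simp
qed

lemma bochner_integral_change_of_variables:
  fixes h :: "'b \<Rightarrow> real"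
  assumes substitution: "\<And>g. g \<in> borel_measurable N \<Longrightarrow> (\<integral>\<^sup>+x. ennreal (w x) * g (f x) \<partial>M) = (\<integral>\<^sup>+y. g y \<partial>N)"
    and w_nonneg: "w \<in> borel_measurable M" "AE x in M. 0 \<le> w x" and f_measurable [measurable]: "f \<in> M \<rightarrow>\<^sub>M N"
    and h_borel [measurable]: "h \<in> borel_measurable N"
  shows "integrable M (\<lambda>x. w x * h (f x)) \<longleftrightarrow> integrable N h"
    and "(\<integral>x. w x * h (f x) \<partial>M) = (\<integral>y. h y \<partial>N)"
proof -
  note [measurable] = w_nonneg(1)
  have nn_integral_eq: "(\<integral>\<^sup>+x. ennreal (w x * k (f x)) \<partial>M) = (\<integral>\<^sup>+y. ennreal (k y) \<partial>N)"
    if "k \<in> borel_measurable N" for k :: "'b \<Rightarrow> real"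
  proof -
    have "(\<integral>\<^sup>+x. ennreal (w x * k (f x)) \<partial>M) = (\<integral>\<^sup>+x. ennreal (w x) * ennreal (k (f x)) \<partial>M)"
      using w_nonneg(2) by (intro nn_integral_cong_AE) (auto simp: ennreal_mult')
    also have "\<dots> = (\<integral>\<^sup>+y. ennreal (k y) \<partial>N)"
      using that by (intro substitution) simp
    finally show ?thesis .
  qed
  have "(\<integral>\<^sup>+x. ennreal (norm (w x * h (f x))) \<partial>M) = (\<integral>\<^sup>+x. ennreal (w x * \<bar>h (f x)\<bar>) \<partial>M)"
    using w_nonneg(2) by (intro nn_integral_cong_AE) (auto simp: abs_mult)
  also have "\<dots> = (\<integral>\<^sup>+y. ennreal (norm (h y)) \<partial>N)"
    by (subst nn_integral_eq[of "\<lambda>y. \<bar>h y\<bar>"]) simp_all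
  finally show integrable_iff: "integrable M (\<lambda>x. w x * h (f x)) \<longleftrightarrow> integrable N h"
    by (simp add: integrable_iff_bounded)
  show "(\<integral>x. w x * h (f x) \<partial>M) = (\<integral>y. h y \<partial>N)"
  proof (cases "integrable N h")
    case True
    then show ?thesis
      using integrable_iff nn_integral_eq[of h] nn_integral_eq[of "\<lambda>y. - h y"] by (simp add: real_lebesgue_integral_def)
  qed (use integrable_iff in \<open>simp add: not_integrable_integral_eq\<close>)
qed

lemma
  fixes h :: "'a::euclidean_space \<Rightarrow> real" and R :: "'a \<Rightarrow> 'a"
  assumes R_orthogonal: "orthogonal_transformation R" and h_borel: "h \<in> borel_measurable borel"
  shows integrable_orthogonal_sph: "integrable sph (\<lambda>\<eta>. h (R \<eta>)) \<longleftrightarrow> integrable sph h"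
    and integral_orthogonal_sph: "(\<integral>\<eta>. h (R \<eta>) \<partial>sph) = (\<integral>\<eta>. h \<eta> \<partial>sph)"
  using bochner_integral_change_of_variables[where M = sph and w = "\<lambda>_. 1" and f = R and N = sph and h = h]
    nn_integral_orthogonal_sph[OF R_orthogonal] borel_measurable_orthogonal_transformation[OF R_orthogonal] h_borel by simp_all

lemma
  fixes h :: "'a::euclidean_space \<Rightarrow> real"
  assumes outside: "1 < norm a" and [measurable]: "h \<in> borel_measurable borel"
  shows integrable_inversion_sph: "integrable sph (\<lambda>\<eta>. inversion_factor a \<eta> ^ (DIM('a) - 1) * h (inversion a \<eta>)) \<longleftrightarrow> integrable sph h"
    and integral_inversion_sph: "(\<integral>\<eta>. inversion_factor a \<eta> ^ (DIM('a) - 1) * h (inversion a \<eta>) \<partial>sph) = (\<integral>\<eta>. h \<eta> \<partial>sph)"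
proof -
  have "AE \<eta> in sph. 0 \<le> inversion_factor a \<eta> ^ (DIM('a) - 1)"
    using AE_sph
    by eventually_elim (use inversion_factor_pos[OF outside] not_inversion_center[OF outside] in \<open>auto intro!: less_imp_le\<close>)
  then show "integrable sph (\<lambda>\<eta>. inversion_factor a \<eta> ^ (DIM('a) - 1) * h (inversion a \<eta>)) \<longleftrightarrow> integrable sph h"
    "(\<integral>\<eta>. inversion_factor a \<eta> ^ (DIM('a) - 1) * h (inversion a \<eta>) \<partial>sph) = (\<integral>\<eta>. h \<eta> \<partial>sph)"
    using bochner_integral_change_of_variables[where M = sph and w = "\<lambda>\<eta>. inversion_factor a \<eta> ^ (DIM('a) - 1)" and f = "inversion a"
        and N = sph and h = h] nn_integral_inversion_sph[OF outside] by simp_all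
qed

definition kernel :: "real \<Rightarrow> 'a::euclidean_space \<Rightarrow> 'a \<Rightarrow> real" where
  "kernel s \<xi> \<eta> = (weight \<xi> / (norm (\<xi> - \<eta>))\<^sup>2) powr s"

lemma kernel_borel [measurable]:
  assumes [measurable]: "f \<in> M \<rightarrow>\<^sub>M borel" "g \<in> M \<rightarrow>\<^sub>M borel"
  shows "(\<lambda>x. kernel s (f x) (g x)) \<in> borel_measurable M"
  unfolding kernel_def by measurable

lemma kernel_nonneg [simp]: "0 \<le> kernel s \<xi> \<eta>"
  by (simp add: kernel_def)

lemma kernel_powr: "kernel s \<xi> \<eta> powr r = kernel (s * r) \<xi> \<eta>"
  by (simp add: kernel_def powr_powr)

lemma kernel_orthogonal:
  assumes "orthogonal_transformation R"
  shows "kernel s (R \<xi>) (R \<eta>) = kernel s \<xi> \<eta>"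
proof -
  have "norm (R \<xi> - R \<eta>) = norm (\<xi> - \<eta>)"
    using orthogonal_transformation_norm[OF assms] linear_diff[OF orthogonal_transformation_linear[OF assms]] by metis
  then show ?thesis
    by (simp add: kernel_def weight_def orthogonal_transformation_norm[OF assms])
qed

lemma kernel_reflect_swap: "norm \<nu> = 1 \<Longrightarrow> kernel s (reflect \<nu> \<xi>) \<eta> = kernel s \<xi> (reflect \<nu> \<eta>)"
  by (simp add: kernel_def weight_def norm_reflect_diff_swap)

lemma kernel_inversion:
  assumes outside: "1 < norm a" and norm_\<xi>: "norm \<xi> < 1" and norm_\<eta>: "norm \<eta> = 1"
  shows "kernel s (inversion a \<xi>) (inversion a \<eta>) = inversion_factor a \<eta> powr - s * kernel s \<xi> \<eta>"
proof -
  have distinct: "\<eta> \<noteq> a" "\<xi> \<noteq> a" "\<xi> \<noteq> \<eta>"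
    using outside norm_\<xi> norm_\<eta> by auto
  note pos = inversion_factor_pos[OF outside distinct(1)] inversion_factor_pos[OF outside distinct(2)]
  have "weight (inversion a \<xi>) / (norm (inversion a \<xi> - inversion a \<eta>))\<^sup>2
      = (1 / inversion_factor a \<eta>) * (weight \<xi> / (norm (\<xi> - \<eta>))\<^sup>2)"
    using distinct pos by (simp add: weight_inversion[OF outside] norm_inversion_diff[OF outside])
  then show ?thesis
    unfolding kernel_def using pos by (simp add: powr_mult powr_minus_divide powr_divide)
qed

definition extend :: "real \<Rightarrow> ('a::euclidean_space \<Rightarrow> real) \<Rightarrow> 'a \<Rightarrow> real" where
  "extend s u \<xi> = (\<integral>\<eta>. kernel s \<xi> \<eta> * u \<eta> \<partial>sph)"

lemma extend_borel [measurable]: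
  assumes [measurable]: "u \<in> borel_measurable borel"
  shows "extend s u \<in> borel_measurable borel"
  unfolding extend_def[abs_def] by measurable

lemma extend_orthogonal:
  fixes R :: "'a::euclidean_space \<Rightarrow> 'a"
  assumes R_orthogonal: "orthogonal_transformation R" and [measurable]: "u \<in> borel_measurable borel"
  shows "extend s (\<lambda>\<eta>. u (R \<eta>)) \<xi> = extend s u (R \<xi>)"
  using integral_orthogonal_sph[OF R_orthogonal, of "\<lambda>\<eta>. kernel s (R \<xi>) \<eta> * u \<eta>"]
  by (simp add: extend_def kernel_orthogonal[OF R_orthogonal])

lemma extend_inversion:
  fixes a :: "'a::euclidean_space"
  assumes outside: "1 < norm a" and norm_\<xi>: "norm \<xi> < 1" and [measurable]: "u \<in> borel_measurable borel"
  shows "extend s (\<lambda>\<eta>. inversion_factor a \<eta> powr (real (DIM('a) - 1) - s) * u (inversion a \<eta>)) \<xi> = extend s u (inversion a \<xi>)"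
proof -
  have "extend s u (inversion a \<xi>)
      = (\<integral>\<eta>. inversion_factor a \<eta> ^ (DIM('a) - 1) * (kernel s (inversion a \<xi>) (inversion a \<eta>) * u (inversion a \<eta>)) \<partial>sph)"
    unfolding extend_def by (rule integral_inversion_sph[OF outside, symmetric]) measurable
  also have "\<dots> = (\<integral>\<eta>. kernel s \<xi> \<eta> * (inversion_factor a \<eta> powr (real (DIM('a) - 1) - s) * u (inversion a \<eta>)) \<partial>sph)"
  proof (rule integral_cong_AE)
    show "AE \<eta> in sph. inversion_factor a \<eta> ^ (DIM('a) - 1) * (kernel s (inversion a \<xi>) (inversion a \<eta>) * u (inversion a \<eta>))
        = kernel s \<xi> \<eta> * (inversion_factor a \<eta> powr (real (DIM('a) - 1) - s) * u (inversion a \<eta>))"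
      using AE_sph
    proof eventually_elim
      fix \<eta> :: 'a
      assume norm_\<eta>: "norm \<eta> = 1"
      have "0 < inversion_factor a \<eta>"
        using inversion_factor_pos[OF outside not_inversion_center[OF outside]] norm_\<eta> by simp
      from powr_realpow[OF this, of "DIM('a) - 1", symmetric]
      have "inversion_factor a \<eta> powr (real (DIM('a) - 1) - s) = inversion_factor a \<eta> ^ (DIM('a) - 1) * inversion_factor a \<eta> powr - s"
        by (simp only: powr_diff powr_minus_divide) simp
      then show "inversion_factor a \<eta> ^ (DIM('a) - 1) * (kernel s (inversion a \<xi>) (inversion a \<eta>) * u (inversion a \<eta>))
        = kernel s \<xi> \<eta> * (inversion_factor a \<eta> powr (real (DIM('a) - 1) - s) * u (inversion a \<eta>))"
        by (simp add: kernel_inversion[OF outside norm_\<xi> norm_\<eta>] mult_ac)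
    qed
  qed measurable
  finally show ?thesis
    by (simp add: extend_def)
qed

lemma nn_integral_radial_kernel:
  fixes \<eta> :: "'a::euclidean_space"
  assumes norm_\<eta>: "norm \<eta> = 1" and [measurable]: "F \<in> borel_measurable borel"
    and radial: "\<And>\<xi> \<zeta>. norm \<xi> = norm \<zeta> \<Longrightarrow> F \<xi> = F \<zeta>"
  shows "ennreal (sphere_area TYPE('a)) * (\<integral>\<^sup>+\<xi>. F \<xi> * ennreal (kernel s \<xi> \<eta>) \<partial>hyp)
       = (\<integral>\<^sup>+\<xi>. F \<xi> * (\<integral>\<^sup>+\<zeta>. ennreal (kernel s \<xi> \<zeta>) \<partial>sph) \<partial>(hyp :: 'a measure))"
proof -
  define A where "A \<zeta> = (\<integral>\<^sup>+\<xi>. F \<xi> * ennreal (kernel s \<xi> \<zeta>) \<partial>(hyp :: 'a measure))" for \<zeta> :: 'a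
  interpret pair_sigma_finite "sph :: 'a measure" "hyp :: 'a measure" ..
  have A_const: "A \<zeta> = A \<eta>" if "norm \<zeta> = 1" for \<zeta>
  proof (cases "\<zeta> = \<eta>")
    case False
    define \<nu> where "\<nu> = sgn (\<zeta> - \<eta>)"
    have \<nu>_reflects: "norm \<nu> = 1" "reflect \<nu> \<zeta> = \<eta>"
      using False reflect_swap[of \<zeta> \<eta>] that norm_\<eta> by (simp_all add: \<nu>_def norm_sgn)
    have "A \<zeta> = (\<integral>\<^sup>+\<xi>. F (reflect \<nu> \<xi>) * ennreal (kernel s (reflect \<nu> \<xi>) \<zeta>) \<partial>(hyp :: 'a measure))"
      unfolding A_def using \<nu>_reflects(1) by (intro nn_integral_orthogonal_hyp[symmetric] orthogonal_transformation_reflect) simp_all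
    also have "\<dots> = A \<eta>"
      unfolding A_def using \<nu>_reflects radial[of "reflect \<nu> _"] by (simp add: kernel_reflect_swap)
    finally show ?thesis .
  qed simp
  have "ennreal (sphere_area TYPE('a)) * A \<eta> = (\<integral>\<^sup>+\<zeta>. A \<eta> \<partial>(sph :: 'a measure))"
    by (simp add: emeasure_sph mult.commute)
  also have "\<dots> = (\<integral>\<^sup>+\<zeta>. A \<zeta> \<partial>sph)"
    by (rule nn_integral_cong_AE, use AE_sph in eventually_elim) (rule A_const[symmetric])
  also have "\<dots> = (\<integral>\<^sup>+\<xi>. (\<integral>\<^sup>+\<zeta>. F \<xi> * ennreal (kernel s \<xi> \<zeta>) \<partial>sph) \<partial>(hyp :: 'a measure))"
    unfolding A_def by (rule Fubini'[symmetric]) measurable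
  also have "\<dots> = (\<integral>\<^sup>+\<xi>. F \<xi> * (\<integral>\<^sup>+\<zeta>. ennreal (kernel s \<xi> \<zeta>) \<partial>sph) \<partial>(hyp :: 'a measure))"
    by (simp add: nn_integral_cmult)
  finally show ?thesis
    by (simp add: A_def)
qed

lemma inversion_center_of_point:
  fixes \<zeta> :: "'a::euclidean_space"
  assumes "norm \<zeta> < 1" "\<zeta> \<noteq> 0"
  defines "a \<equiv> \<zeta> /\<^sub>R (norm \<zeta>)\<^sup>2"
  shows "1 < norm a" "inversion a 0 = \<zeta>" "norm \<eta> = 1 \<Longrightarrow> inversion_factor a \<eta> = 2 * weight \<zeta> / (norm (\<zeta> - \<eta>))\<^sup>2"
proof -
  have norm_a: "norm a = 1 / norm \<zeta>"
    using assms by (simp add: power2_eq_square divide_inverse)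
  then show "1 < norm a"
    using assms by simp
  have inner_a: "a \<bullet> a = 1 / (norm \<zeta>)\<^sup>2"
    using norm_a by (simp add: dot_square_norm power_divide)
  have "inversion a 0 = (1 - (a \<bullet> a - 1) / (a \<bullet> a)) *\<^sub>R a"
    by (simp add: inversion_def inversion_factor_def scaleR_diff_left)
  also have "1 - (a \<bullet> a - 1) / (a \<bullet> a) = (norm \<zeta>)\<^sup>2"
    unfolding inner_a using assms by (simp add: field_simps)
  finally show "inversion a 0 = \<zeta>"
    using assms by (simp add: a_def)
  assume norm_\<eta>: "norm \<eta> = 1"
  have "a \<bullet> \<eta> = (\<zeta> \<bullet> \<eta>) / (norm \<zeta>)\<^sup>2"
    by (simp add: a_def divide_inverse mult.commute)
  moreover have "(\<eta> - a) \<bullet> (\<eta> - a) = 1 - 2 * (a \<bullet> \<eta>) + a \<bullet> a"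
    using norm_\<eta> by (simp add: inner_diff_left inner_diff_right norm_eq_1 inner_commute)
  ultimately have "(norm \<zeta>)\<^sup>2 * ((\<eta> - a) \<bullet> (\<eta> - a)) = (norm \<zeta>)\<^sup>2 - 2 * (\<zeta> \<bullet> \<eta>) + 1"
    unfolding inner_a using assms by (simp add: field_simps)
  also have "\<dots> = (norm (\<zeta> - \<eta>))\<^sup>2"
    using norm_\<eta> by (simp add: power2_norm_eq_inner inner_diff_left inner_diff_right norm_eq_1 inner_commute)
  finally have denominator: "(norm \<zeta>)\<^sup>2 * ((\<eta> - a) \<bullet> (\<eta> - a)) = (norm (\<zeta> - \<eta>))\<^sup>2" .
  have "inversion_factor a \<eta> = ((norm \<zeta>)\<^sup>2 * (a \<bullet> a - 1)) / ((norm \<zeta>)\<^sup>2 * ((\<eta> - a) \<bullet> (\<eta> - a)))"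
    using assms by (simp add: inversion_factor_def)
  also have "(norm \<zeta>)\<^sup>2 * (a \<bullet> a - 1) = 2 * weight \<zeta>"
    unfolding inner_a using assms by (simp add: weight_def field_simps)
  finally show "inversion_factor a \<eta> = 2 * weight \<zeta> / (norm (\<zeta> - \<eta>))\<^sup>2"
    unfolding denominator .
qed

text \<open>The integrand is the Jacobian on the sphere of an inversion taking \<open>0\<close> to \<open>\<zeta>\<close>.\<close>

lemma nn_integral_kernel_conformal_power:
  fixes \<zeta> :: "'a::euclidean_space"
  assumes "norm \<zeta> < 1"
  shows "(\<integral>\<^sup>+\<eta>. ennreal (2 ^ (DIM('a) - 1) * kernel (real (DIM('a) - 1)) \<zeta> \<eta>) \<partial>sph) = ennreal (sphere_area TYPE('a))"
proof -
  have kernel_power: "2 ^ (DIM('a) - 1) * kernel (real (DIM('a) - 1)) \<zeta> \<eta> = (2 * weight \<zeta> / (norm (\<zeta> - \<eta>))\<^sup>2) ^ (DIM('a) - 1)"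
    if "norm \<eta> = 1" for \<eta>
  proof -
    have "\<zeta> \<noteq> \<eta>"
      using assms that by auto
    then have "0 < weight \<zeta> / (norm (\<zeta> - \<eta>))\<^sup>2"
      using weight_pos[OF assms] by simp
    then show ?thesis
      by (simp only: kernel_def powr_realpow) (simp add: power_mult_distrib power_divide)
  qed
  show ?thesis
  proof (cases "\<zeta> = 0")
    case True
    have "(\<integral>\<^sup>+\<eta>. ennreal (2 ^ (DIM('a) - 1) * kernel (real (DIM('a) - 1)) \<zeta> \<eta>) \<partial>sph) = (\<integral>\<^sup>+\<eta>. 1 \<partial>(sph :: 'a measure))"
      by (rule nn_integral_cong_AE, use AE_sph in eventually_elim) (simp only: kernel_power, simp add: True weight_def)
    then show ?thesis
      by (simp add: emeasure_sph)
  next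
    case False
    note center = inversion_center_of_point[OF assms False]
    have "(\<integral>\<^sup>+\<eta>. ennreal (2 ^ (DIM('a) - 1) * kernel (real (DIM('a) - 1)) \<zeta> \<eta>) \<partial>sph)
        = (\<integral>\<^sup>+\<eta>. ennreal (inversion_factor (\<zeta> /\<^sub>R (norm \<zeta>)\<^sup>2) \<eta> ^ (DIM('a) - 1)) * 1 \<partial>sph)"
      by (rule nn_integral_cong_AE, use AE_sph in eventually_elim) (simp only: kernel_power center(3) mult_1_right)
    also have "\<dots> = (\<integral>\<^sup>+\<eta>. 1 \<partial>(sph :: 'a measure))"
      by (rule nn_integral_inversion_sph[OF center(1)]) simp
    finally show ?thesis
      by (simp add: emeasure_sph)
  qed
qed

lemma jac_borel:
  fixes L :: "'a::euclidean_space \<Rightarrow> 'a \<Rightarrow> 'a"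
  assumes [measurable]: "\<And>b. (\<lambda>x. L x b) \<in> borel_measurable borel"
  shows "(\<lambda>x. jac (L x)) \<in> borel_measurable borel"
proof -
  have "jac (L x) = \<bar>\<Sum>p | p permutes (UNIV :: 'a basis_index set). of_int (sign p) *
      (\<Prod>i\<in>UNIV. L x (of_vec (axis (p i) 1)) \<bullet> nth_basis i)\<bar>" for x
    by (simp add: jac_def det_def matrix_def to_vec_def)
  then show ?thesis
    by simp
qed

text \<open>\<open>spherical_square \<eta>\<close> maps \<open>r \<nu>\<close> to \<open>r\<^sup>2\<close> times the image of \<open>\<eta>\<close> under the reflection along \<open>\<nu>\<close>.\<close>

definition spherical_square :: "'a::euclidean_space \<Rightarrow> 'a \<Rightarrow> 'a" where
  "spherical_square \<eta> x = (x \<bullet> x) *\<^sub>R \<eta> - (2 * (x \<bullet> \<eta>)) *\<^sub>R x"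

definition spherical_square_deriv :: "'a::euclidean_space \<Rightarrow> 'a \<Rightarrow> 'a \<Rightarrow> 'a" where
  "spherical_square_deriv \<eta> x h = (2 * (x \<bullet> h)) *\<^sub>R \<eta> - (2 * (h \<bullet> \<eta>)) *\<^sub>R x - (2 * (x \<bullet> \<eta>)) *\<^sub>R h"

lemma spherical_square_has_derivative:
  "(spherical_square \<eta> has_derivative spherical_square_deriv \<eta> x) (at x within A)"
  unfolding spherical_square_def[abs_def] spherical_square_deriv_def[abs_def]
  by (auto intro!: derivative_eq_intros simp: fun_eq_iff inner_commute algebra_simps)

lemma spherical_square_eq_reflect: "spherical_square \<eta> x = (norm x)\<^sup>2 *\<^sub>R reflect (sgn x) \<eta>"
  by (simp add: spherical_square_def reflect_sgn scaleR_diff_right inner_commute dot_square_norm)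

context
  fixes \<eta> :: "'a::euclidean_space"
  assumes unit: "norm \<eta> = 1"
begin

lemma sgn_spherical_square: "x \<noteq> 0 \<Longrightarrow> sgn (spherical_square \<eta> x) = reflect (sgn x) \<eta>"
  using unit by (simp add: spherical_square_eq_reflect sgn_scaleR sgn_div_norm[of "reflect _ _"] norm_sgn)

lemma norm_spherical_square: "norm (spherical_square \<eta> x) = (norm x)\<^sup>2"
  using unit by (cases "x = 0") (simp_all add: spherical_square_eq_reflect norm_sgn)

lemma jac_spherical_square_le:
  assumes "norm x \<le> 1"
  shows "jac (spherical_square_deriv \<eta> x) \<le> fact DIM('a) * 6 ^ DIM('a)"
proof (rule jac_le)
  fix h :: 'a
  have inner_le: "\<bar>y \<bullet> z\<bar> * norm w \<le> norm h" if "norm y * norm z * norm w \<le> norm h" for y z w :: 'a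
    using mult_right_mono[OF Cauchy_Schwarz_ineq2[of y z] norm_ge_zero[of w]] that by linarith
  have "norm ((2 * (x \<bullet> h)) *\<^sub>R \<eta>) \<le> 2 * norm h" "norm ((2 * (h \<bullet> \<eta>)) *\<^sub>R x) \<le> 2 * norm h" "norm ((2 * (x \<bullet> \<eta>)) *\<^sub>R h) \<le> 2 * norm h"
    using inner_le[of x h \<eta>] inner_le[of h \<eta> x] inner_le[of x \<eta> h] mult_right_mono[OF assms norm_ge_zero[of h]]
    by (simp_all add: unit mult.commute)
  then show "norm (spherical_square_deriv \<eta> x h) \<le> 6 * norm h"
    unfolding spherical_square_deriv_def
    by (intro order_trans[OF norm_triangle_ineq4] order_trans[OF add_right_mono[OF norm_triangle_ineq4]]) linarith
qed

lemma inj_on_spherical_square: "inj_on (spherical_square \<eta>) {x. norm x < 1 \<and> 0 < x \<bullet> \<eta>}"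
proof (rule inj_onI)
  fix x y :: 'a
  assume "x \<in> {x. norm x < 1 \<and> 0 < x \<bullet> \<eta>}" "y \<in> {x. norm x < 1 \<and> 0 < x \<bullet> \<eta>}" and same_image: "spherical_square \<eta> x = spherical_square \<eta> y"
  then have pos: "0 < x \<bullet> \<eta>" "0 < y \<bullet> \<eta>"
    by auto
  have "(norm x)\<^sup>2 = (norm y)\<^sup>2"
    using arg_cong[OF same_image, of norm] by (simp only: norm_spherical_square)
  then have norm_eq: "norm x = norm y"
    by simp
  then have parallel: "(x \<bullet> \<eta>) *\<^sub>R x = (y \<bullet> \<eta>) *\<^sub>R y"
    using same_image by (simp add: spherical_square_def dot_square_norm flip: scaleR_scaleR)
  from arg_cong[OF parallel, of norm] have "\<bar>x \<bullet> \<eta>\<bar> * norm x = \<bar>y \<bullet> \<eta>\<bar> * norm y"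
    by (simp only: norm_scaleR)
  moreover have "norm x \<noteq> 0"
    using pos by auto
  ultimately have "x \<bullet> \<eta> = y \<bullet> \<eta>"
    using pos norm_eq by simp
  then show "x = y"
    using parallel pos by simp
qed

lemma spherical_square_half_ball:
  "spherical_square \<eta> ` {x. norm x < 1 \<and> 0 < x \<bullet> \<eta>} = {y. norm y < 1 \<and> y \<noteq> 0 \<and> sgn y \<noteq> \<eta>}"
proof (intro equalityI subsetI)
  fix y :: 'a
  assume "y \<in> spherical_square \<eta> ` {x. norm x < 1 \<and> 0 < x \<bullet> \<eta>}"
  then obtain x where x_half_ball: "norm x < 1" "0 < x \<bullet> \<eta>" "y = spherical_square \<eta> x"
    by auto
  then have "x \<noteq> 0" and norm_y: "norm y = (norm x)\<^sup>2"
    by (auto simp: norm_spherical_square)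
  moreover have "reflect (sgn x) \<eta> \<noteq> \<eta>"
    using x_half_ball(2) \<open>x \<noteq> 0\<close> by (simp add: reflect_sgn inner_commute)
  ultimately show "y \<in> {y. norm y < 1 \<and> y \<noteq> 0 \<and> sgn y \<noteq> \<eta>}"
    using x_half_ball sgn_spherical_square[of x] by (auto simp: abs_square_less_1)
next
  fix y :: 'a
  assume "y \<in> {y. norm y < 1 \<and> y \<noteq> 0 \<and> sgn y \<noteq> \<eta>}"
  then have y_in_ball: "norm y < 1" "y \<noteq> 0" "norm (sgn y) = 1" "\<eta> \<noteq> sgn y"
    by (auto simp: norm_sgn)
  define x where "x = sqrt (norm y) *\<^sub>R sgn (\<eta> - sgn y)"
  have "0 < (\<eta> - sgn y) \<bullet> (\<eta> - sgn y)"
    using y_in_ball(4) by simp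
  then have "0 < (\<eta> - sgn y) \<bullet> \<eta>"
    using y_in_ball(3) unit by (simp add: inner_diff_left inner_diff_right inner_commute norm_eq_1)
  then have "0 < x \<bullet> \<eta>"
    using y_in_ball by (simp add: x_def sgn_div_norm[of "\<eta> - sgn y"])
  moreover have "spherical_square \<eta> x = y"
  proof -
    have "sgn x = sgn (\<eta> - sgn y)"
      using y_in_ball(2,4) by (simp add: x_def sgn_scaleR sgn_div_norm[of "sgn _"] norm_sgn)
    moreover have "(norm x)\<^sup>2 = norm y"
      using y_in_ball(4) by (simp add: x_def norm_sgn)
    ultimately have "spherical_square \<eta> x = norm y *\<^sub>R sgn y"
      using reflect_swap[of \<eta> "sgn y"] y_in_ball unit by (simp add: spherical_square_eq_reflect)
    then show ?thesis
      using y_in_ball(2) by (simp add: sgn_div_norm)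
  qed
  moreover have "norm x < 1"
    using y_in_ball by (simp add: x_def norm_sgn)
  ultimately show "y \<in> spherical_square \<eta> ` {x. norm x < 1 \<and> 0 < x \<bullet> \<eta>}"
    by force
qed

lemma nn_integral_sph_le_reflect:
  assumes h_borel [measurable]: "h \<in> borel_measurable borel" and zero: "h \<eta> = 0"
  shows "(\<integral>\<^sup>+\<zeta>. h \<zeta> \<partial>sph) \<le> ennreal (fact DIM('a) * 6 ^ DIM('a)) * (\<integral>\<^sup>+\<nu>. h (reflect \<nu> \<eta>) \<partial>sph)"
proof -
  let ?B = "fact DIM('a) * 6 ^ DIM('a) :: real"
  define U where "U = {x. norm x < 1 \<and> 0 < x \<bullet> \<eta>}"
  let ?F = "spherical_square \<eta>" and ?J = "\<lambda>x. jac (spherical_square_deriv \<eta> x)"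
  have [measurable]: "?F \<in> borel \<rightarrow>\<^sub>M borel" "U \<in> sets borel"
    unfolding spherical_square_def U_def by measurable
  have J_le: "?J x \<le> ?B" if "x \<in> U" for x
    using that by (intro jac_spherical_square_le) (simp add: U_def)
  have "(\<integral>\<^sup>+\<zeta>. h \<zeta> \<partial>sph) = of_nat DIM('a) * (\<integral>\<^sup>+y\<in>ball 0 1 - {0}. h (sgn y) \<partial>lborel)"
    by (rule nn_integral_sph_ball) measurable
  also have "(\<integral>\<^sup>+y\<in>ball 0 1 - {0}. h (sgn y) \<partial>lborel) = (\<integral>\<^sup>+y\<in>?F ` U. h (sgn y) \<partial>lborel)"
    unfolding U_def spherical_square_half_ball by (rule nn_integral_cong) (use zero in \<open>auto simp: indicator_def\<close>)
  also have "\<dots> = (\<integral>\<^sup>+x\<in>U. ennreal (?J x) * h (sgn (?F x)) \<partial>lborel)"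
  proof (rule nn_integral_change_of_variables[symmetric, where B = ?B])
    have "emeasure lborel U \<le> emeasure lborel (ball 0 1 :: 'a set)"
      by (intro emeasure_mono) (auto simp: U_def)
    then show "emeasure lborel U < \<infinity>"
      using emeasure_lborel_ball_finite le_less_trans by blast
    show "?F ` U \<in> sets borel"
      unfolding U_def spherical_square_half_ball by measurable
    show "?J \<in> borel_measurable borel"
      by (rule jac_borel) (simp add: spherical_square_deriv_def)
  qed (auto intro: J_le spherical_square_has_derivative inj_on_spherical_square[folded U_def])
  also have "\<dots> \<le> (\<integral>\<^sup>+x\<in>ball 0 1 - {0}. ennreal ?B * h (reflect (sgn x) \<eta>) \<partial>lborel)"
    using J_le by (intro nn_integral_mono) (auto simp: indicator_def U_def sgn_spherical_square intro!: mult_right_mono ennreal_leI)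
  also have "of_nat DIM('a) * \<dots> = (\<integral>\<^sup>+\<nu>. ennreal ?B * h (reflect \<nu> \<eta>) \<partial>sph)"
    by (rule nn_integral_sph_ball[symmetric]) measurable
  also have "\<dots> = ennreal ?B * (\<integral>\<^sup>+\<nu>. h (reflect \<nu> \<eta>) \<partial>sph)"
    by (rule nn_integral_cmult) measurable
  finally show ?thesis
    by (simp add: mult_left_mono)
qed

lemma nn_integral_reflect_average:
  assumes \<rho>_pos: "0 < \<rho>" and [measurable]: "f \<in> borel_measurable borel"
  shows "(\<integral>\<^sup>+\<zeta>. f \<zeta> * indicator {\<zeta>. \<rho> \<le> norm (\<zeta> - \<eta>)} \<zeta> \<partial>sph)
    \<le> ennreal (fact DIM('a) * 6 ^ DIM('a)) * (ennreal (2 / \<rho>) * (\<integral>\<^sup>+\<nu>. f (reflect \<nu> \<eta>) * ennreal \<bar>\<nu> \<bullet> \<eta>\<bar> \<partial>sph))"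
proof -
  let ?h = "\<lambda>\<zeta>. f \<zeta> * indicator {\<zeta>. \<rho> \<le> norm (\<zeta> - \<eta>)} \<zeta>"
  have "?h (reflect \<nu> \<eta>) \<le> ennreal (2 / \<rho>) * (f (reflect \<nu> \<eta>) * ennreal \<bar>\<nu> \<bullet> \<eta>\<bar>)" if "norm \<nu> = 1" for \<nu>
  proof (cases "\<rho> \<le> 2 * \<bar>\<nu> \<bullet> \<eta>\<bar>")
    case True
    then have "ennreal 1 \<le> ennreal (2 / \<rho> * \<bar>\<nu> \<bullet> \<eta>\<bar>)"
      using \<rho>_pos by (intro ennreal_leI) (simp add: field_simps)
    also have "\<dots> = ennreal (2 / \<rho>) * ennreal \<bar>\<nu> \<bullet> \<eta>\<bar>"
      using \<rho>_pos by (intro ennreal_mult) simp_all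
    finally have "f (reflect \<nu> \<eta>) * 1 \<le> f (reflect \<nu> \<eta>) * (ennreal (2 / \<rho>) * ennreal \<bar>\<nu> \<bullet> \<eta>\<bar>)"
      by (intro mult_left_mono) simp_all
    then show ?thesis
      by (auto simp: indicator_def mult_ac)
  qed (use that in \<open>simp add: reflect_def inner_commute\<close>)
  then have "(\<integral>\<^sup>+\<nu>. ?h (reflect \<nu> \<eta>) \<partial>sph) \<le> (\<integral>\<^sup>+\<nu>. ennreal (2 / \<rho>) * (f (reflect \<nu> \<eta>) * ennreal \<bar>\<nu> \<bullet> \<eta>\<bar>) \<partial>sph)"
    by (intro nn_integral_mono_AE) (use AE_sph in eventually_elim)
  also have "\<dots> = ennreal (2 / \<rho>) * (\<integral>\<^sup>+\<nu>. f (reflect \<nu> \<eta>) * ennreal \<bar>\<nu> \<bullet> \<eta>\<bar> \<partial>sph)"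
    by (rule nn_integral_cmult) measurable
  finally have "(\<integral>\<^sup>+\<nu>. ?h (reflect \<nu> \<eta>) \<partial>sph) \<le> ennreal (2 / \<rho>) * (\<integral>\<^sup>+\<nu>. f (reflect \<nu> \<eta>) * ennreal \<bar>\<nu> \<bullet> \<eta>\<bar> \<partial>sph)" .
  moreover have "(\<integral>\<^sup>+\<zeta>. ?h \<zeta> \<partial>sph) \<le> ennreal (fact DIM('a) * 6 ^ DIM('a)) * (\<integral>\<^sup>+\<nu>. ?h (reflect \<nu> \<eta>) \<partial>sph)"
    by (rule nn_integral_sph_le_reflect) (use \<rho>_pos in auto)
  ultimately show ?thesis
    by (meson mult_left_mono order_trans zero_le)
qed

end

lemma has_derivative_unique_within_convex:
  fixes f :: "'a::real_normed_vector \<Rightarrow> 'b::real_normed_vector"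
  assumes convex_C: "convex C" "interior C \<noteq> {}" and x_in: "x \<in> C"
    and D1_derivative: "(f has_derivative D1) (at x within C)" and D2_derivative: "(f has_derivative D2) (at x within C)"
  shows "D1 = D2"
proof
  fix v :: 'a
  note linear = has_derivative_linear[OF D1_derivative] has_derivative_linear[OF D2_derivative]
  have path: "((\<lambda>t. f (x + t *\<^sub>R (y - x))) has_vector_derivative D (y - x)) (at 0 within {0..1})"
    if y_in: "y \<in> C" and D_derivative: "(f has_derivative D) (at x within C)" for y D
  proof -
    define \<gamma> where "\<gamma> t = x + t *\<^sub>R (y - x)" for t :: real
    have \<gamma>_derivative: "(\<gamma> has_derivative (\<lambda>t. t *\<^sub>R (y - x))) (at 0 within {0..1})"
      unfolding \<gamma>_def[abs_def] by (auto intro!: derivative_eq_intros)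
    have "\<gamma> t \<in> C" if "t \<in> {0..1}" for t
      using convexD_alt[OF convex_C(1) x_in y_in, of t] that by (simp add: \<gamma>_def algebra_simps)
    then have "(f has_derivative D) (at (\<gamma> 0) within \<gamma> ` {0..1})"
      using has_derivative_subset[OF D_derivative, of "\<gamma> ` {0..1}"] by (auto simp: \<gamma>_def[of 0] image_subset_iff)
    from diff_chain_within[OF \<gamma>_derivative this] show ?thesis
      using linear_scale[OF has_derivative_linear[OF D_derivative]] by (simp add: has_vector_derivative_def comp_def \<gamma>_def)
  qed
  have derivatives_agree: "D1 (y - x) = D2 (y - x)" if "y \<in> C" for y
    using vector_derivative_unique_within[OF _ path[OF that D1_derivative] path[OF that D2_derivative]]
    by (simp add: trivial_limit_within islimpt_Icc)
  obtain y e where ball_subset: "0 < e" "ball y e \<subseteq> C"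
    using convex_C(2) by (metis equals0I mem_interior)
  define t where "t = e / (2 * (norm v + 1))"
  have t_pos: "0 < t"
    using ball_subset(1) by (simp add: t_def add_nonneg_pos)
  have "t * norm v \<le> t * (norm v + 1)"
    using t_pos by simp
  also have "\<dots> = e / 2"
    using norm_ge_zero[of v] by (simp add: t_def field_simps add_nonneg_eq_0_iff)
  finally have "y \<in> C" "y + t *\<^sub>R v \<in> C"
    using ball_subset t_pos by (auto simp: dist_norm intro!: subsetD[OF ball_subset(2)])
  then have "D1 (y + t *\<^sub>R v - x - (y - x)) = D2 (y + t *\<^sub>R v - x - (y - x))"
    using derivatives_agree by (simp only: linear[THEN linear_diff])
  then show "D1 v = D2 v"
    using t_pos linear by (simp add: linear_scale)
qed

lemma frechet_derivative_cball:
  fixes f :: "'a::euclidean_space \<Rightarrow> 'b::real_normed_vector"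
  assumes "x \<in> cball 0 1" "(f has_derivative D) (at x within cball 0 1)"
  shows "frechet_derivative f (at x within cball 0 1) = D"
proof (rule has_derivative_unique_within_convex[OF convex_cball _ assms(1) _ assms(2)])
  show "(f has_derivative frechet_derivative f (at x within cball 0 1)) (at x within cball 0 1)"
    using assms(2) frechet_derivative_works differentiableI by blast
qed simp

lemma frechet_derivative_inversion:
  assumes "1 < norm a" "norm x \<le> 1"
  shows "frechet_derivative (inversion a) (at x within cball 0 1) = (\<lambda>h. inversion_factor a x *\<^sub>R reflect (sgn (x - a)) h)"
  using assms not_inversion_center[OF assms] inversion_has_derivative[OF assms(1)]
  by (intro frechet_derivative_cball) simp_all

lemma conformal_ball_auto_inversion:
  fixes a :: "'a::euclidean_space"
  assumes outside: "1 < norm a"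
  shows "conformal_ball_auto (inversion a)"
  unfolding conformal_ball_auto_def
proof (intro conjI allI ballI)
  have x_neq_a: "x \<noteq> a" if "x \<in> cball 0 1" for x
    using not_inversion_center[OF outside] that by simp
  have involution: "inversion a (inversion a x) = x" "inversion a x \<in> cball 0 1" if "x \<in> cball 0 1" for x
    using inversion_inversion[OF outside x_neq_a[OF that]] norm_inversion_le_1_iff[OF outside x_neq_a[OF that]] that by simp_all
  show "bij_betw (inversion a) (cball 0 1) (cball 0 1)"
    by (rule bij_betw_byWitness[where f' = "inversion a"]) (use involution in auto)
  have differentiable: "inversion a differentiable at x within cball 0 1" if "x \<in> cball 0 1" for x
    using inversion_has_derivative[OF outside x_neq_a[OF that]] differentiableI by blast
  show "inversion a differentiable at x within cball 0 1" if "x \<in> cball 0 1" for x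
    using differentiable that .
  have inv_into: "inv_into (cball 0 1) (inversion a) y = inversion a y" if "y \<in> cball 0 1" for y
    using inv_into_f_f[OF inj_on_inversion[OF outside] involution(2)[OF that]] involution(1)[OF that] by simp
  show "inv_into (cball 0 1) (inversion a) differentiable at y within cball 0 1" if y_in: "y \<in> cball 0 1" for y
  proof -
    obtain D where "(inversion a has_derivative D) (at y within cball 0 1)"
      using differentiable[OF y_in] by (auto simp: differentiable_def)
    then have "(inv_into (cball 0 1) (inversion a) has_derivative D) (at y within cball 0 1)"
      by (rule has_derivative_transform[OF y_in, rotated]) (simp add: inv_into)
    then show ?thesis
      by (rule differentiableI)
  qed
  fix v
  have "continuous_on (cball 0 1) (\<lambda>x. inversion_factor a x *\<^sub>R reflect (sgn (x - a)) v)"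
    unfolding inversion_factor_def reflect_def using x_neq_a by (intro continuous_intros) auto
  then show "continuous_on (cball 0 1) (\<lambda>x. frechet_derivative (inversion a) (at x within cball 0 1) v)"
    by (rule continuous_on_eq) (simp add: frechet_derivative_inversion[OF outside])
next
  fix x :: 'a
  assume "x \<in> cball 0 1"
  then have x_in_cball: "norm x \<le> 1" "x \<noteq> a"
    using not_inversion_center[OF outside] by auto
  show "\<exists>c>0. \<forall>v. norm (frechet_derivative (inversion a) (at x within cball 0 1) v) = c * norm v"
    using inversion_factor_pos[OF outside x_in_cball(2)] norm_reflect[of "sgn (x - a)"] x_in_cball(2)
    by (intro exI[of _ "inversion_factor a x"]) (simp add: norm_sgn frechet_derivative_inversion[OF outside x_in_cball(1)])
qed

lemma onorm_conformal:
  fixes f :: "'a::euclidean_space \<Rightarrow> 'a"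
  assumes "linear f" "\<And>v. norm (f v) = c * norm v"
  shows "onorm f = c"
proof (rule antisym)
  show "onorm f \<le> c"
    using assms(2) by (intro onorm_le) simp
  obtain b :: 'a where "b \<in> Basis"
    using nonempty_Basis by blast
  then have "norm (f b) \<le> onorm f * norm b" "norm b = 1"
    using assms(1) onorm[of f b] linear_conv_bounded_linear by auto
  then show "c \<le> onorm f"
    using assms(2)[of b] by simp
qed

lemma sphere_jac_inversion:
  fixes \<eta> :: "'a::euclidean_space"
  assumes outside: "1 < norm a" and norm_\<eta>: "norm \<eta> = 1"
  shows "sphere_jac (inversion a) \<eta> = inversion_factor a \<eta> ^ (DIM('a) - 1)"
proof -
  have \<eta>_neq_a: "\<eta> \<noteq> a"
    using outside norm_\<eta> by auto
  have "onorm (\<lambda>h. inversion_factor a \<eta> *\<^sub>R reflect (sgn (\<eta> - a)) h) = inversion_factor a \<eta>"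
    using inversion_factor_pos[OF outside \<eta>_neq_a] norm_reflect[of "sgn (\<eta> - a)"] \<eta>_neq_a
    by (intro onorm_conformal linear_compose_scale_right linear_reflect) (simp add: norm_sgn)
  then show ?thesis
    using norm_\<eta> by (simp add: sphere_jac_def frechet_derivative_inversion[OF outside])
qed

lemma frechet_derivative_id_cball:
  "norm x \<le> 1 \<Longrightarrow> frechet_derivative (\<lambda>x. x) (at x within cball 0 1) = (\<lambda>h::'a::euclidean_space. h)"
  by (intro frechet_derivative_cball) simp_all

lemma conformal_ball_auto_id: "conformal_ball_auto (\<lambda>x::'a::euclidean_space. x)"
  unfolding conformal_ball_auto_def
proof (intro conjI allI ballI)
  show "bij_betw (\<lambda>x. x) (cball 0 1) (cball 0 1 :: 'a set)"
    by (simp add: bij_betw_def)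
  show "inv_into (cball 0 1) (\<lambda>x. x) differentiable at y within cball 0 1" if "y \<in> cball 0 1" for y :: 'a
  proof -
    have "(inv_into (cball 0 1) (\<lambda>x. x) has_derivative (\<lambda>h. h)) (at y within cball 0 1)"
      by (rule has_derivative_transform[OF that _ has_derivative_ident]) (simp add: inv_into_f_f[of "\<lambda>x. x"])
    then show ?thesis
      by (rule differentiableI)
  qed
  show "continuous_on (cball 0 1) (\<lambda>x. frechet_derivative (\<lambda>x. x) (at x within cball 0 1) v)" for v :: 'a
    by (rule continuous_on_eq[OF continuous_on_const]) (simp add: frechet_derivative_id_cball)
  show "\<exists>c>0. \<forall>v. norm (frechet_derivative (\<lambda>x. x) (at x within cball 0 1) v) = c * norm v"
    if "x \<in> cball 0 1" for x :: 'a
    using that by (intro exI[of _ 1]) (simp add: frechet_derivative_id_cball)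
qed simp

lemma sphere_jac_id: "norm \<eta> = 1 \<Longrightarrow> sphere_jac (\<lambda>x::'a::euclidean_space. x) \<eta> = 1"
  using onorm_conformal[of "\<lambda>h::'a. h" 1] by (simp add: sphere_jac_def frechet_derivative_id_cball linear_id[unfolded id_def])

section \<open>Boundedness of the operator\<close>

lemma Youngs_inequality_scaled:
  fixes x y A B a b :: real
  assumes conjugate: "1 < a" "1 < b" "1 / a + 1 / b = 1" and pos: "0 < A" "0 < B" and "0 \<le> x" "0 \<le> y"
  shows "x * y \<le> A powr (1 / a) * B powr (1 / b) * (x powr a / (a * A) + y powr b / (b * B))"
proof -
  define k l where "k = A powr (1 / a)" and "l = B powr (1 / b)"
  have roots: "0 < k" "0 < l" "k powr a = A" "l powr b = B"
    using pos conjugate by (simp_all add: k_def l_def powr_powr)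
  have "(x / k) * (y / l) \<le> (x / k) powr a / a + (y / l) powr b / b"
    using conjugate assms(6,7) roots by (intro Youngs_inequality) auto
  then have "k * l * ((x / k) * (y / l)) \<le> k * l * ((x / k) powr a / a + (y / l) powr b / b)"
    using roots by (intro mult_left_mono) auto
  then show ?thesis
    using roots by (simp add: powr_divide k_def[symmetric] l_def[symmetric] mult.commute)
qed

lemma nn_integral_mult_eq_0_if_powr:
  fixes f g :: "'b \<Rightarrow> real"
  assumes [measurable]: "f \<in> borel_measurable M" "g \<in> borel_measurable M"
    and zero: "(\<integral>\<^sup>+x. ennreal (f x powr a) \<partial>M) \<le> 0"
  shows "(\<integral>\<^sup>+x. ennreal (f x * g x) \<partial>M) = 0"
proof -
  have "AE x in M. ennreal (f x powr a) = 0"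
    using zero by (subst nn_integral_0_iff_AE[symmetric]) auto
  then have "AE x in M. ennreal (f x * g x) = 0"
    by eventually_elim (simp add: ennreal_eq_0_iff antisym_conv)
  then show ?thesis
    by (subst nn_integral_0_iff_AE) auto
qed

lemma nn_integral_Holder:
  fixes f g :: "'b \<Rightarrow> real"
  assumes [measurable]: "f \<in> borel_measurable M" "g \<in> borel_measurable M"
    and nonneg: "\<And>x. 0 \<le> f x" "\<And>x. 0 \<le> g x"
    and conjugate: "1 < a" "1 < b" "1 / a + 1 / b = 1" and A_nonneg: "0 \<le> A" and B_nonneg: "0 \<le> B"
    and f_le: "(\<integral>\<^sup>+x. ennreal (f x powr a) \<partial>M) \<le> ennreal A"
    and g_le: "(\<integral>\<^sup>+x. ennreal (g x powr b) \<partial>M) \<le> ennreal B"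
  shows "(\<integral>\<^sup>+x. ennreal (f x * g x) \<partial>M) \<le> ennreal (A powr (1 / a) * B powr (1 / b))"
proof -
  consider (A_zero) "A = 0" | (B_zero) "B = 0" | (positive) "0 < A" "0 < B"
    using A_nonneg B_nonneg by fastforce
  then show ?thesis
  proof cases
    case A_zero
    then show ?thesis
      using nn_integral_mult_eq_0_if_powr[of f M g a] f_le by simp
  next
    case B_zero
    then show ?thesis
      using nn_integral_mult_eq_0_if_powr[of g M f b] g_le by (simp add: mult.commute)
  next
    case positive
    define k where "k = A powr (1 / a) * B powr (1 / b)"
    have k_split: "0 \<le> k" "k / a + k / b = k"
      using arg_cong[OF conjugate(3), of "(*) k"] by (simp_all add: k_def distrib_left)
    have "(\<integral>\<^sup>+x. ennreal (f x * g x) \<partial>M)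
        \<le> (\<integral>\<^sup>+x. ennreal (k / (a * A)) * ennreal (f x powr a) + ennreal (k / (b * B)) * ennreal (g x powr b) \<partial>M)"
    proof (rule nn_integral_mono)
      fix x
      have "f x * g x \<le> k * (f x powr a / (a * A) + g x powr b / (b * B))"
        unfolding k_def by (intro Youngs_inequality_scaled conjugate positive nonneg)
      then show "ennreal (f x * g x) \<le> ennreal (k / (a * A)) * ennreal (f x powr a) + ennreal (k / (b * B)) * ennreal (g x powr b)"
        using positive conjugate k_split by (simp add: ennreal_mult[symmetric] ennreal_plus[symmetric] distrib_left ennreal_leI del: ennreal_plus)
    qed
    also have "\<dots> = ennreal (k / (a * A)) * (\<integral>\<^sup>+x. ennreal (f x powr a) \<partial>M) + ennreal (k / (b * B)) * (\<integral>\<^sup>+x. ennreal (g x powr b) \<partial>M)"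
      by (simp add: nn_integral_add nn_integral_cmult)
    also have "\<dots> \<le> ennreal (k / (a * A)) * ennreal A + ennreal (k / (b * B)) * ennreal B"
      by (intro add_mono mult_left_mono f_le g_le) auto
    also have "\<dots> = ennreal k"
      using positive conjugate k_split by (simp add: ennreal_mult[symmetric] ennreal_plus[symmetric] del: ennreal_plus)
    finally show ?thesis
      by (simp add: k_def)
  qed
qed

lemma (in sigma_finite_measure) nn_integral_layer_cake:
  fixes f :: "'a \<Rightarrow> real"
  assumes [measurable]: "f \<in> borel_measurable M" and nonneg: "\<And>x. x \<in> space M \<Longrightarrow> 0 \<le> f x"
  shows "(\<integral>\<^sup>+x. ennreal (f x) \<partial>M) = (\<integral>\<^sup>+y\<in>{0<..}. emeasure M {x \<in> space M. y < f x} \<partial>lborel)"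
proof -
  interpret pair_sigma_finite lborel M
    by (simp add: pair_sigma_finite_def sigma_finite_lborel sigma_finite_measure_axioms)
  have "(\<integral>\<^sup>+x. ennreal (f x) \<partial>M) = (\<integral>\<^sup>+x. (\<integral>\<^sup>+y. indicator {y. 0 < y \<and> y < f x} y \<partial>lborel) \<partial>M)"
  proof (rule nn_integral_cong)
    fix x assume "x \<in> space M"
    moreover have "{y. 0 < y \<and> y < f x} = {0<..<f x}"
      by auto
    ultimately show "ennreal (f x) = (\<integral>\<^sup>+y. indicator {y. 0 < y \<and> y < f x} y \<partial>lborel)"
      using nonneg by simp
  qed
  also have "\<dots> = (\<integral>\<^sup>+y. (\<integral>\<^sup>+x. indicator {y. 0 < y \<and> y < f x} y \<partial>M) \<partial>lborel)"
    by (rule Fubini') measurable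
  also have "\<dots> = (\<integral>\<^sup>+y\<in>{0<..}. emeasure M {x \<in> space M. y < f x} \<partial>lborel)"
  proof (rule nn_integral_cong)
    fix y :: real
    have "(\<integral>\<^sup>+x. indicator {y. 0 < y \<and> y < f x} y \<partial>M) = (\<integral>\<^sup>+x. indicator {x \<in> space M. y < f x} x * indicator {0<..} y \<partial>M)"
      by (intro nn_integral_cong) (auto simp: indicator_def)
    then show "(\<integral>\<^sup>+x. indicator {y. 0 < y \<and> y < f x} y \<partial>M) = emeasure M {x \<in> space M. y < f x} * indicator {0<..} y"
      by (simp add: nn_integral_multc)
  qed
  finally show ?thesis .
qed

lemma (in sigma_finite_measure) nn_integral_weak_bound:
  fixes f :: "'a \<Rightarrow> real"
  assumes [measurable]: "f \<in> borel_measurable M" and nonneg: "\<And>x. x \<in> space M \<Longrightarrow> 0 \<le> f x"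
    and Y_bound: "0 \<le> Y" "AE x in M. f x \<le> Y" and a_bounds: "0 < a" "a < 1" and C_nonneg: "0 \<le> C"
    and weak: "\<And>y. 0 < y \<Longrightarrow> emeasure M {x \<in> space M. y < f x} \<le> ennreal (C * y powr - a)"
  shows "(\<integral>\<^sup>+x. ennreal (f x) \<partial>M) \<le> ennreal (C / (1 - a) * Y powr (1 - a))"
proof -
  have "(\<integral>\<^sup>+x. ennreal (f x) \<partial>M) = (\<integral>\<^sup>+y\<in>{0<..}. emeasure M {x \<in> space M. y < f x} \<partial>lborel)"
    by (rule nn_integral_layer_cake) (use nonneg in auto)
  also have "\<dots> \<le> (\<integral>\<^sup>+y. ennreal (C * y powr - a) * indicator {0..Y} y \<partial>lborel)"
  proof (rule nn_integral_mono)
    fix y :: real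
    consider (nonpositive) "y \<le> 0" | (level) "0 < y" "y \<le> Y" | (above) "0 < y" "Y < y"
      by linarith
    then show "emeasure M {x \<in> space M. y < f x} * indicator {0<..} y \<le> ennreal (C * y powr - a) * indicator {0..Y} y"
    proof cases
      case above
      have "AE x in M. \<not> y < f x"
        using Y_bound(2) by eventually_elim (use above in auto)
      then have "emeasure M {x \<in> space M. y < f x} = 0"
        by (subst (asm) AE_iff_measurable[OF _ refl]) auto
      then show ?thesis
        by simp
    qed (use weak[of y] in simp_all)
  qed
  also have "\<dots> = ennreal (C * (Y powr (1 - a) / (1 - a)))"
  proof (rule nn_integral_has_integral_lebesgue')
    show "((\<lambda>y. C * y powr - a) has_integral C * (Y powr (1 - a) / (1 - a))) {0..Y}"
      using has_integral_powr_from_0[of "- a" Y] a_bounds Y_bound by (intro has_integral_mult_right) (simp add: add.commute)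
  qed (use C_nonneg in auto)
  finally show ?thesis
    by simp
qed

lemma weight_le_dist:
  assumes "norm \<xi> < 1" "norm \<eta> = 1"
  shows "weight \<xi> \<le> norm (\<xi> - \<eta>)"
proof -
  have "weight \<xi> = (1 - norm \<xi>) * ((1 + norm \<xi>) / 2)"
    by (simp add: weight_def power2_eq_square algebra_simps)
  also have "\<dots> \<le> (1 - norm \<xi>) * 1"
    using assms by (intro mult_left_mono) auto
  also have "\<dots> \<le> norm (\<xi> - \<eta>)"
    using norm_triangle_ineq2[of \<eta> \<xi>] assms by (simp add: norm_minus_commute)
  finally show ?thesis .
qed

lemma kernel_ge_near_boundary:
  fixes \<xi> :: "'a::euclidean_space"
  assumes norm_\<xi>: "norm \<xi> \<le> 1" and r_bounds: "0 < r" "r \<le> 1" and near_\<xi>: "norm \<eta> = 1" "norm (\<xi> - \<eta>) < r" and t_nonneg: "0 \<le> t"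
  defines "\<zeta> \<equiv> (1 - r / 2) *\<^sub>R \<xi>"
  shows "norm \<zeta> < 1" "(1 / (9 * r)) powr t \<le> kernel t \<zeta> \<eta>"
proof -
  have norm_\<zeta>: "norm \<zeta> \<le> 1 - r / 2"
    using mult_left_mono[OF norm_\<xi>, of "1 - r / 2"] r_bounds by (simp add: \<zeta>_def)
  then show \<zeta>_in_ball: "norm \<zeta> < 1"
    using r_bounds by simp
  have "(r / 2) * 1 \<le> (1 - norm \<zeta>) * (1 + norm \<zeta>)"
    using norm_\<zeta> r_bounds by (intro mult_mono) auto
  then have weight_ge: "r / 4 \<le> weight \<zeta>"
    by (simp add: weight_def power2_eq_square algebra_simps)
  have "norm (\<zeta> - \<xi>) \<le> r / 2"
    using mult_left_mono[OF norm_\<xi>, of "r / 2"] r_bounds by (simp add: \<zeta>_def algebra_simps)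
  then have dist_le: "norm (\<zeta> - \<eta>) \<le> 3 * r / 2"
    using norm_triangle_ineq[of "\<zeta> - \<xi>" "\<xi> - \<eta>"] near_\<xi> by simp
  have dist_pos: "0 < norm (\<zeta> - \<eta>)"
    using \<zeta>_in_ball near_\<xi> by auto
  have "1 / (9 * r) = (r / 4) / (3 * r / 2)\<^sup>2"
    using r_bounds by (simp add: power2_eq_square field_simps)
  also have "\<dots> \<le> weight \<zeta> / (norm (\<zeta> - \<eta>))\<^sup>2"
    using weight_ge dist_le dist_pos r_bounds weight_pos[OF \<zeta>_in_ball] by (intro frac_le power_mono) auto
  finally show "(1 / (9 * r)) powr t \<le> kernel t \<zeta> \<eta>"
    unfolding kernel_def using r_bounds t_nonneg by (intro powr_mono2) auto
qed

lemma emeasure_cap_le: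
  fixes \<xi> :: "'a::euclidean_space"
  assumes norm_\<xi>: "norm \<xi> \<le> 1" and r_pos: "0 < r"
  shows "emeasure sph {\<eta>. norm (\<xi> - \<eta>) < r} \<le> ennreal (sphere_area TYPE('a) * (9 * r / 2) ^ (DIM('a) - 1))"
proof (cases "r \<le> 1")
  case False
  have "emeasure sph {\<eta>. norm (\<xi> - \<eta>) < r} \<le> emeasure (sph :: 'a measure) UNIV"
    by (intro emeasure_mono) auto
  also have "\<dots> \<le> ennreal (sphere_area TYPE('a) * (9 * r / 2) ^ (DIM('a) - 1))"
    unfolding emeasure_sph using False sphere_area_pos[where 'a='a]
    by (intro ennreal_leI) (auto intro: one_le_power)
  finally show ?thesis .
next
  case True
  let ?m = "DIM('a) - 1" and ?cap = "{\<eta>. norm (\<xi> - \<eta>) < r}"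
  define \<zeta> where "\<zeta> = (1 - r / 2) *\<^sub>R \<xi>"
  have "norm \<zeta> \<le> 1 - r / 2"
    using mult_left_mono[OF norm_\<xi>, of "1 - r / 2"] True r_pos by (simp add: \<zeta>_def)
  then have "norm \<zeta> < 1"
    using r_pos by simp
  have kernel_ge: "(2 / (9 * r)) ^ ?m \<le> 2 ^ ?m * kernel (real ?m) \<zeta> \<eta>" if "norm \<eta> = 1" "norm (\<xi> - \<eta>) < r" for \<eta>
  proof -
    have "(2 / (9 * r)) ^ ?m = 2 ^ ?m * (1 / (9 * r)) powr real ?m"
      using r_pos by (subst powr_realpow) (simp_all add: power_mult_distrib[symmetric])
    then show ?thesis
      using kernel_ge_near_boundary(2)[OF norm_\<xi> r_pos True that, of "real ?m"] by (simp add: \<zeta>_def)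
  qed
  have "ennreal ((2 / (9 * r)) ^ ?m) * emeasure sph ?cap = (\<integral>\<^sup>+\<eta>. ennreal ((2 / (9 * r)) ^ ?m) * indicator ?cap \<eta> \<partial>sph)"
    by (subst nn_integral_cmult_indicator) auto
  also have "\<dots> \<le> (\<integral>\<^sup>+\<eta>. ennreal (2 ^ ?m * kernel (real ?m) \<zeta> \<eta>) \<partial>sph)"
    by (rule nn_integral_mono_AE, use AE_sph in eventually_elim) (use kernel_ge in \<open>auto simp: indicator_def intro: ennreal_leI\<close>)
  also have "\<dots> = ennreal (sphere_area TYPE('a))"
    by (rule nn_integral_kernel_conformal_power) fact
  finally have cap_le: "ennreal ((2 / (9 * r)) ^ ?m) * emeasure sph ?cap \<le> ennreal (sphere_area TYPE('a))" .
  have "emeasure sph ?cap = ennreal ((9 * r / 2) ^ ?m) * (ennreal ((2 / (9 * r)) ^ ?m) * emeasure sph ?cap)"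
    unfolding mult.assoc[symmetric] using r_pos
    by (subst ennreal_mult[symmetric]) (auto simp: power_mult_distrib[symmetric])
  also have "\<dots> \<le> ennreal ((9 * r / 2) ^ ?m) * ennreal (sphere_area TYPE('a))"
    by (intro mult_left_mono cap_le) simp
  also have "\<dots> = ennreal (sphere_area TYPE('a) * (9 * r / 2) ^ ?m)"
    using r_pos sphere_area_pos[where 'a='a] by (subst ennreal_mult[symmetric]) (auto simp: mult.commute)
  finally show ?thesis .
qed

lemma emeasure_kernel_superlevel_le:
  fixes \<xi> :: "'a::euclidean_space"
  assumes norm_\<xi>: "norm \<xi> < 1" and t_pos: "0 < t" and y_pos: "0 < y"
  defines "m \<equiv> real (DIM('a) - 1)"
  shows "emeasure sph {\<eta>. y < kernel t \<xi> \<eta>}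
    \<le> ennreal (sphere_area TYPE('a) * (9 / 2) powr m * weight \<xi> powr (m / 2) * y powr - (m / (2 * t)))"
proof -
  define r where "r = weight \<xi> powr (1 / 2) * y powr - (1 / (2 * t))"
  have r_pos: "0 < r"
    using y_pos weight_pos[OF norm_\<xi>] by (simp add: r_def)
  have "{\<eta>. y < kernel t \<xi> \<eta>} \<subseteq> {\<eta>. norm (\<xi> - \<eta>) < r}"
  proof (intro subsetI CollectI, rule ccontr)
    fix \<eta> assume "\<eta> \<in> {\<eta>. y < kernel t \<xi> \<eta>}" and far: "\<not> norm (\<xi> - \<eta>) < r"
    have "kernel t \<xi> \<eta> \<le> (weight \<xi> / r\<^sup>2) powr t"
      unfolding kernel_def using far r_pos t_pos weight_pos[OF norm_\<xi>] by (intro powr_mono2 frac_le power_mono) auto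
    also have "r\<^sup>2 = weight \<xi> * y powr - (1 / t)"
      using weight_pos[OF norm_\<xi>] y_pos by (simp add: r_def power_mult_distrib powr_power)
    also have "(weight \<xi> / (weight \<xi> * y powr - (1 / t))) powr t = y"
      using weight_pos[OF norm_\<xi>] y_pos t_pos by (simp add: powr_minus_divide powr_powr)
    finally show False
      using \<open>\<eta> \<in> _\<close> by simp
  qed
  then have "emeasure sph {\<eta>. y < kernel t \<xi> \<eta>} \<le> emeasure sph {\<eta>. norm (\<xi> - \<eta>) < r}"
    by (intro emeasure_mono) auto
  also have "\<dots> \<le> ennreal (sphere_area TYPE('a) * (9 * r / 2) ^ (DIM('a) - 1))"
    using norm_\<xi> r_pos by (intro emeasure_cap_le) auto
  also have "(9 * r / 2) ^ (DIM('a) - 1) = (9 / 2 * r) powr m"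
    unfolding m_def using r_pos by (subst powr_realpow) auto
  also have "\<dots> = (9 / 2) powr m * (weight \<xi> powr (m / 2) * y powr - (m / (2 * t)))"
    unfolding r_def powr_mult powr_powr by simp
  finally show ?thesis
    by (simp add: mult.assoc)
qed

lemma nn_integral_kernel_le:
  fixes T :: "'a::euclidean_space itself" and t :: real
  assumes m_eq: "m = real (DIM('a) - 1)" "0 < m" and t_gt: "m / 2 < t"
  obtains C where "0 < C" "\<And>\<xi>::'a. norm \<xi> < 1 \<Longrightarrow> (\<integral>\<^sup>+\<eta>. ennreal (kernel t \<xi> \<eta>) \<partial>sph) \<le> ennreal (C * weight \<xi> powr (m - t))"
proof -
  define K where "K = sphere_area TYPE('a) * (9 / 2) powr m"
  define a where "a = m / (2 * t)"
  have K_pos: "0 < K" and t_pos: "0 < t" and a_bounds: "0 < a" "a < 1"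
    using t_gt m_eq sphere_area_pos[where 'a='a] by (auto simp: K_def a_def field_simps)
  show thesis
  proof
    show "0 < K / (1 - a)"
      using K_pos a_bounds by simp
    fix \<xi> :: 'a
    assume norm_\<xi>: "norm \<xi> < 1"
    note weight = weight_pos[OF norm_\<xi>]
    have "(\<integral>\<^sup>+\<eta>. ennreal (kernel t \<xi> \<eta>) \<partial>sph) \<le> ennreal (K * weight \<xi> powr (m / 2) / (1 - a) * (weight \<xi> powr - t) powr (1 - a))"
    proof (rule sph.nn_integral_weak_bound)
      show "AE \<eta> in sph. kernel t \<xi> \<eta> \<le> weight \<xi> powr - t"
        using AE_sph
      proof eventually_elim
        fix \<eta> :: 'a
        assume "norm \<eta> = 1"
        then have "weight \<xi> / (norm (\<xi> - \<eta>))\<^sup>2 \<le> weight \<xi> / (weight \<xi>)\<^sup>2"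
          using weight weight_le_dist[OF norm_\<xi>, of \<eta>] by (intro frac_le power_mono) auto
        then have "kernel t \<xi> \<eta> \<le> (1 / weight \<xi>) powr t"
          unfolding kernel_def using weight t_pos by (intro powr_mono2) (auto simp: power2_eq_square)
        then show "kernel t \<xi> \<eta> \<le> weight \<xi> powr - t"
          using weight by (simp add: powr_divide powr_minus_divide)
      qed
      show "emeasure sph {\<eta> \<in> space sph. y < kernel t \<xi> \<eta>} \<le> ennreal (K * weight \<xi> powr (m / 2) * y powr - a)" if "0 < y" for y
        using emeasure_kernel_superlevel_le[OF norm_\<xi> t_pos that] by (simp add: K_def a_def m_eq(1))
    qed (use K_pos a_bounds in auto)
    also have "K * weight \<xi> powr (m / 2) / (1 - a) * (weight \<xi> powr - t) powr (1 - a) = K / (1 - a) * weight \<xi> powr (m / 2 + - t * (1 - a))"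
      by (simp only: powr_powr powr_add) simp
    also have "m / 2 + - t * (1 - a) = m - t"
      using t_pos by (simp add: a_def field_simps)
    finally show "(\<integral>\<^sup>+\<eta>. ennreal (kernel t \<xi> \<eta>) \<partial>sph) \<le> ennreal (K / (1 - a) * weight \<xi> powr (m - t))" .
  qed
qed

lemma emeasure_boundary_layer_le:
  assumes y_pos: "0 < y"
  shows "emeasure lborel {x::'a::euclidean_space. norm x < 1 \<and> weight x < y}
    \<le> ennreal (2 * real DIM('a) * measure lborel (ball 0 1 :: 'a set) * y)"
proof -
  let ?V = "measure lborel (ball 0 1 :: 'a set)" and ?n = "DIM('a)"
  have ball_eq: "emeasure lborel (ball (0::'a) r) = ennreal (r ^ ?n * ?V)" if "0 \<le> r" for r
    using that emeasure_lborel_ball_finite[of "0::'a" r] content_ball_conv_unit_ball[of r "0::'a"]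
    by (simp add: emeasure_eq_ennreal_measure)
  show ?thesis
  proof (cases "y < 1 / 2")
    case False
    have "emeasure lborel {x::'a. norm x < 1 \<and> weight x < y} \<le> emeasure lborel (ball 0 1 :: 'a set)"
      by (intro emeasure_mono) auto
    also have "\<dots> \<le> ennreal (2 * real ?n * ?V * y)"
      using mult_right_mono[OF mult_mono[of 1 "real ?n" 1 "2 * y"], of ?V] False
      by (simp add: ball_eq Suc_leI mult_ac ennreal_leI)
    finally show ?thesis .
  next
    case True
    define \<rho> where "\<rho> = 1 - 2 * y"
    have \<rho>_bounds: "0 < \<rho>" "\<rho> < 1"
      using True y_pos by (auto simp: \<rho>_def)
    have "{x::'a. norm x < 1 \<and> weight x < y} \<subseteq> ball 0 1 - ball 0 \<rho>"
    proof (rule subsetI)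
      fix x :: 'a
      assume "x \<in> {x. norm x < 1 \<and> weight x < y}"
      then have x_bounds: "norm x < 1" "\<rho> < (norm x)\<^sup>2"
        by (auto simp: weight_def \<rho>_def)
      have "(norm x)\<^sup>2 \<le> norm x"
        using x_bounds(1) mult_left_mono[of "norm x" 1 "norm x"] by (simp add: power2_eq_square)
      then show "x \<in> ball 0 1 - ball 0 \<rho>"
        using x_bounds by auto
    qed
    then have "emeasure lborel {x::'a. norm x < 1 \<and> weight x < y} \<le> emeasure lborel (ball 0 1 - ball 0 \<rho> :: 'a set)"
      by (intro emeasure_mono) auto
    also have "\<dots> = ennreal (?V - \<rho> ^ ?n * ?V)"
      using \<rho>_bounds emeasure_lborel_ball_finite[of "0::'a" \<rho>] by (subst emeasure_Diff) (auto simp: ball_eq ennreal_minus)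
    also have "\<dots> \<le> ennreal (2 * real ?n * ?V * y)"
      using mult_left_mono[OF Bernoulli_inequality[of "- 2 * y" ?n], of ?V] True
      by (intro ennreal_leI) (simp add: \<rho>_def algebra_simps)
    finally show ?thesis .
  qed
qed

lemma emeasure_weight_powr_superlevel_le:
  assumes c_pos: "0 < c" and y_pos: "0 < y"
  shows "emeasure lborel {\<xi>::'a::euclidean_space. 0 < weight \<xi> \<and> y < weight \<xi> powr (- 1 - c)}
    \<le> ennreal (2 * real DIM('a) * measure lborel (ball 0 1 :: 'a set) * y powr - (1 / (1 + c)))"
proof -
  have "{\<xi>::'a. 0 < weight \<xi> \<and> y < weight \<xi> powr (- 1 - c)} \<subseteq> {\<xi>. norm \<xi> < 1 \<and> weight \<xi> < y powr - (1 / (1 + c))}"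
  proof (intro subsetI CollectI)
    fix \<xi> :: 'a
    assume \<xi>_in: "\<xi> \<in> {\<xi>. 0 < weight \<xi> \<and> y < weight \<xi> powr (- 1 - c)}"
    then have "norm \<xi> < 1"
      using abs_square_less_1[of "norm \<xi>"] by (simp add: weight_def)
    moreover have "(weight \<xi> powr (- 1 - c)) powr - (1 / (1 + c)) < y powr - (1 / (1 + c))"
      using \<xi>_in y_pos c_pos by (intro powr_less_mono2_neg) auto
    moreover have "(- 1 - c) * - (1 / (1 + c)) = 1"
      using c_pos by (simp add: field_simps)
    ultimately show "norm \<xi> < 1 \<and> weight \<xi> < y powr - (1 / (1 + c))"
      using \<xi>_in by (simp add: powr_powr)
  qed
  then have "emeasure lborel {\<xi>::'a. 0 < weight \<xi> \<and> y < weight \<xi> powr (- 1 - c)}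
      \<le> emeasure lborel {\<xi>::'a. norm \<xi> < 1 \<and> weight \<xi> < y powr - (1 / (1 + c))}"
    by (intro emeasure_mono) auto
  also have "\<dots> \<le> ennreal (2 * real DIM('a) * measure lborel (ball 0 1 :: 'a set) * y powr - (1 / (1 + c)))"
    using y_pos by (intro emeasure_boundary_layer_le) simp
  finally show ?thesis .
qed

lemma nn_integral_weight_superlevel_le:
  fixes T :: "'a::euclidean_space itself" and c :: real
  assumes c_pos: "0 < c"
  obtains C where "0 \<le> C" "\<And>\<tau>. 0 < \<tau> \<Longrightarrow>
    (\<integral>\<^sup>+\<xi>\<in>{\<xi>. \<tau> < weight \<xi>}. ennreal (weight \<xi> powr (real (DIM('a) - 1) - c)) \<partial>(hyp :: 'a measure)) \<le> ennreal (C * \<tau> powr - c)"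
proof -
  define K where "K = 2 * real DIM('a) * measure lborel (ball 0 1 :: 'a set)"
  define a where "a = 1 / (1 + c)"
  have K_nonneg: "0 \<le> K" and a_bounds: "0 < a" "a < 1"
    using c_pos by (auto simp: K_def a_def)
  have exponent: "(- 1 - c) * (1 - a) = - c"
    using c_pos by (simp add: a_def field_simps)
  show thesis
  proof
    show "0 \<le> K / (1 - a)"
      using K_nonneg a_bounds by simp
    fix \<tau> :: real
    assume \<tau>_pos: "0 < \<tau>"
    define f where "f \<xi> = weight \<xi> powr (- 1 - c) * indicator {\<xi>. \<tau> < weight \<xi>} \<xi>" for \<xi> :: 'a
    have [measurable]: "f \<in> borel_measurable borel"
      unfolding f_def by measurable
    have inside: "norm \<xi> < 1" if "\<tau> < weight \<xi>" for \<xi> :: 'a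
      using that \<tau>_pos abs_square_less_1[of "norm \<xi>"] by (simp add: weight_def)
    have "weight \<xi> powr - real DIM('a) * weight \<xi> powr (real (DIM('a) - 1) - c) = weight \<xi> powr (- 1 - c)" for \<xi> :: 'a
      unfolding powr_add[symmetric] by (simp add: of_nat_diff Suc_leI)
    then have "(\<integral>\<^sup>+\<xi>\<in>{\<xi>. \<tau> < weight \<xi>}. ennreal (weight \<xi> powr (real (DIM('a) - 1) - c)) \<partial>(hyp :: 'a measure)) = (\<integral>\<^sup>+\<xi>. ennreal (f \<xi>) \<partial>lborel)"
      by (subst nn_integral_hyp) (auto simp: f_def indicator_def inside ennreal_mult[symmetric] intro!: nn_integral_cong)
    also have "\<dots> \<le> ennreal (K / (1 - a) * (\<tau> powr (- 1 - c)) powr (1 - a))"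
    proof (rule sigma_finite_measure.nn_integral_weak_bound[OF sigma_finite_lborel])
      show "AE \<xi> in lborel. f \<xi> \<le> \<tau> powr (- 1 - c)"
        using \<tau>_pos c_pos by (intro AE_I2) (auto simp: f_def indicator_def intro!: powr_mono2')
      fix y :: real
      assume y_pos: "0 < y"
      have "emeasure lborel {\<xi> \<in> space lborel. y < f \<xi>} \<le> emeasure lborel {\<xi>::'a. 0 < weight \<xi> \<and> y < weight \<xi> powr (- 1 - c)}"
        using \<tau>_pos y_pos by (intro emeasure_mono) (auto simp: f_def indicator_def split: if_splits)
      also have "\<dots> \<le> ennreal (K * y powr - a)"
        unfolding K_def a_def by (rule emeasure_weight_powr_superlevel_le[OF c_pos y_pos])
      finally show "emeasure lborel {\<xi> \<in> space lborel. y < f \<xi>} \<le> ennreal (K * y powr - a)" .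
    qed (use K_nonneg a_bounds in \<open>auto simp: f_def\<close>)
    also have "(\<tau> powr (- 1 - c)) powr (1 - a) = \<tau> powr - c"
      by (simp only: powr_powr exponent)
    finally show "(\<integral>\<^sup>+\<xi>\<in>{\<xi>. \<tau> < weight \<xi>}. ennreal (weight \<xi> powr (real (DIM('a) - 1) - c)) \<partial>(hyp :: 'a measure)) \<le> ennreal (K / (1 - a) * \<tau> powr - c)" .
  qed
qed

lemma le_one_plus_powr: "0 \<le> (x::real) \<Longrightarrow> 1 \<le> p \<Longrightarrow> x \<le> 1 + x powr p"
  using powr_mono[of 1 p x] by (cases "x \<le> 1") (auto intro: order_trans[of _ 1])

text \<open>In the notation of the theorem \<open>m = n - 1\<close> and \<open>s = (n - \<alpha>) / 2\<close>, so that \<open>m / s\<close> is conjugate to \<open>p\<close>.\<close>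

locale conformal_extension =
  fixes T :: "'a::euclidean_space itself" and S m s p q :: real
  assumes S_eq: "S = sphere_area TYPE('a)" and dim_ge_3: "3 \<le> DIM('a)" and m_eq: "m = real (DIM('a) - 1)"
    and s_bounds: "0 < s" "s < m" and p_eq: "p = m / (m - s)" and p_less_q: "p < q" and conjugate_less_q: "m / s < q"
begin

lemma S_pos: "0 < S"
  unfolding S_eq by (rule sphere_area_pos)

lemma measure_sph_S: "measure (sph :: 'a measure) UNIV = S"
  by (simp add: measure_sph S_eq)

lemma m_ge_2: "2 \<le> m"
  using dim_ge_3 by (simp add: m_eq of_nat_diff)

lemma p_gt_1: "1 < p"
  using s_bounds by (simp add: p_eq)

lemma exponents_conjugate: "s / m + 1 / p = 1" "1 < m / s"
  using s_bounds by (simp_all add: p_eq field_simps)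

lemma p_minus_1: "p - 1 = s / (m - s)" "(m - s) * p = m" "(s - m) * p = - m"
  using s_bounds by (simp_all add: p_eq field_simps)

lemma q_gt_2: "2 < q"
proof (cases "p < 2")
  case True
  then have "2 < m / s"
    using s_bounds by (simp add: p_eq field_simps)
  then show ?thesis
    using conjugate_less_q by simp
qed (use p_less_q in simp)

lemma kernel_le:
  assumes "norm \<xi> \<le> R" "R < 1" "norm \<eta> = 1"
  shows "kernel s \<xi> \<eta> \<le> (1 / (2 * (1 - R)\<^sup>2)) powr s"
proof -
  have "1 - R \<le> norm (\<xi> - \<eta>)"
    using norm_triangle_ineq2[of \<eta> \<xi>] assms by (simp add: norm_minus_commute)
  then have "weight \<xi> / (norm (\<xi> - \<eta>))\<^sup>2 \<le> (1 / 2) / (1 - R)\<^sup>2"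
    using assms weight_le_half[of \<xi>] by (intro frac_le power_mono) auto
  then show ?thesis
    unfolding kernel_def using s_bounds assms weight_pos[of \<xi>] by (intro powr_mono2) (auto simp: divide_simps)
qed

lemma kernel_ge:
  assumes "norm \<xi> \<le> R" "R < 1" "norm \<eta> = 1"
  shows "((1 - R\<^sup>2) / 8) powr s \<le> kernel s \<xi> \<eta>"
proof -
  have R_nonneg: "0 \<le> R"
    using assms norm_ge_zero order_trans by blast
  have dist: "norm (\<xi> - \<eta>) \<le> 2" "0 < norm (\<xi> - \<eta>)"
    using norm_triangle_ineq4[of \<xi> \<eta>] assms by auto
  have "((1 - R\<^sup>2) / 2) / 2\<^sup>2 \<le> weight \<xi> / (norm (\<xi> - \<eta>))\<^sup>2"
    using dist R_nonneg assms weight_pos[of \<xi>] power_mono[OF dist(1), of 2]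
    by (intro frac_le) (auto simp: weight_def intro: power_mono less_imp_le)
  then show ?thesis
    unfolding kernel_def using s_bounds R_nonneg assms by (intro powr_mono2) (auto simp: abs_square_le_1)
qed

lemma integrable_kernel_mult:
  assumes "norm \<xi> < 1" and [measurable]: "u \<in> borel_measurable borel" and u_integrable: "integrable sph u"
  shows "integrable sph (\<lambda>\<eta>. kernel s \<xi> \<eta> * u \<eta>)"
proof (rule Bochner_Integration.integrable_bound[of _ "\<lambda>\<eta>. (1 / (2 * (1 - norm \<xi>)\<^sup>2)) powr s * \<bar>u \<eta>\<bar>"])
  show "integrable sph (\<lambda>\<eta>. (1 / (2 * (1 - norm \<xi>)\<^sup>2)) powr s * \<bar>u \<eta>\<bar>)"
    using u_integrable by simp
  show "AE \<eta> in sph. norm (kernel s \<xi> \<eta> * u \<eta>) \<le> norm ((1 / (2 * (1 - norm \<xi>)\<^sup>2)) powr s * \<bar>u \<eta>\<bar>)"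
    using AE_sph by eventually_elim (use kernel_le[OF order_refl assms(1)] in \<open>auto simp: abs_mult intro!: mult_right_mono\<close>)
qed simp

lemma
  assumes "norm \<xi> < 1" "u \<in> borel_measurable borel" "integrable sph u" "v \<in> borel_measurable borel" "integrable sph v"
  shows extend_add: "extend s (\<lambda>\<eta>. u \<eta> + v \<eta>) \<xi> = extend s u \<xi> + extend s v \<xi>"
    and extend_diff: "extend s (\<lambda>\<eta>. u \<eta> - v \<eta>) \<xi> = extend s u \<xi> - extend s v \<xi>"
  unfolding extend_def using integrable_kernel_mult[OF assms(1-3)] integrable_kernel_mult[OF assms(1,4,5)]
  by (simp_all add: distrib_left right_diff_distrib)

lemma extend_cmult: "extend s (\<lambda>\<eta>. c * u \<eta>) \<xi> = c * extend s u \<xi>"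
  unfolding extend_def by (simp add: mult.left_commute)

lemma extend_nonneg: "(\<And>\<eta>. 0 \<le> u \<eta>) \<Longrightarrow> 0 \<le> extend s u \<xi>"
  unfolding extend_def by (intro integral_nonneg_AE) auto

lemma abs_extend_le: "\<bar>extend s u \<xi>\<bar> \<le> extend s (\<lambda>\<eta>. \<bar>u \<eta>\<bar>) \<xi>"
  using integral_abs_bound[of sph "\<lambda>\<eta>. kernel s \<xi> \<eta> * u \<eta>"] by (simp add: extend_def abs_mult)

lemma nn_integral_kernel_mult:
  assumes "norm \<xi> < 1" "v \<in> borel_measurable borel" "integrable sph v" "\<And>\<eta>. 0 \<le> v \<eta>"
  shows "(\<integral>\<^sup>+\<eta>. ennreal (kernel s \<xi> \<eta> * v \<eta>) \<partial>sph) = ennreal (extend s v \<xi>)"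
  unfolding extend_def using assms by (intro nn_integral_eq_integral integrable_kernel_mult) auto

lemma extend_ge:
  assumes "norm \<xi> \<le> R" "R < 1" "v \<in> borel_measurable borel" "integrable sph v" "\<And>\<eta>. 0 \<le> v \<eta>"
  shows "((1 - R\<^sup>2) / 8) powr s * (\<integral>\<eta>. v \<eta> \<partial>sph) \<le> extend s v \<xi>"
proof -
  have "(\<integral>\<eta>. ((1 - R\<^sup>2) / 8) powr s * v \<eta> \<partial>sph) \<le> extend s v \<xi>"
    unfolding extend_def
  proof (rule integral_mono_AE)
    show "AE \<eta> in sph. ((1 - R\<^sup>2) / 8) powr s * v \<eta> \<le> kernel s \<xi> \<eta> * v \<eta>"
      using AE_sph by eventually_elim (use kernel_ge[OF assms(1,2)] assms(5) in \<open>auto intro: mult_right_mono\<close>)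
  qed (use assms in \<open>auto intro: integrable_kernel_mult\<close>)
  then show ?thesis
    by simp
qed

lemma abs_extend_le_L1:
  assumes "norm \<xi> \<le> R" "R < 1" "v \<in> borel_measurable borel" "integrable sph v"
  shows "\<bar>extend s v \<xi>\<bar> \<le> (1 / (2 * (1 - R)\<^sup>2)) powr s * (\<integral>\<eta>. \<bar>v \<eta>\<bar> \<partial>sph)"
proof -
  have "extend s (\<lambda>\<eta>. \<bar>v \<eta>\<bar>) \<xi> \<le> (\<integral>\<eta>. (1 / (2 * (1 - R)\<^sup>2)) powr s * \<bar>v \<eta>\<bar> \<partial>sph)"
    unfolding extend_def
  proof (rule integral_mono_AE)
    show "AE \<eta> in sph. kernel s \<xi> \<eta> * \<bar>v \<eta>\<bar> \<le> (1 / (2 * (1 - R)\<^sup>2)) powr s * \<bar>v \<eta>\<bar>"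
      using AE_sph by eventually_elim (use kernel_le[OF assms(1,2)] in \<open>auto intro: mult_right_mono\<close>)
  qed (use assms in \<open>auto intro: integrable_kernel_mult\<close>)
  then show ?thesis
    using abs_extend_le[of v \<xi>] by simp
qed

definition Lp :: "('a \<Rightarrow> real) \<Rightarrow> bool" where
  "Lp u \<longleftrightarrow> u \<in> borel_measurable borel \<and> integrable sph (\<lambda>\<eta>. \<bar>u \<eta>\<bar> powr p)"

definition mass :: "('a \<Rightarrow> real) \<Rightarrow> real" where
  "mass u = (\<integral>\<eta>. \<bar>u \<eta>\<bar> powr p \<partial>sph)"

definition energy :: "('a \<Rightarrow> real) \<Rightarrow> real" where
  "energy u = (\<integral>\<xi>. \<bar>extend s u \<xi>\<bar> powr q \<partial>hyp)"

lemma LpD: "Lp u \<Longrightarrow> u \<in> borel_measurable borel" "Lp u \<Longrightarrow> integrable sph (\<lambda>\<eta>. \<bar>u \<eta>\<bar> powr p)"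
  by (simp_all add: Lp_def)

lemma Lp_integrable:
  assumes "Lp u"
  shows "integrable sph u"
proof (rule Bochner_Integration.integrable_bound[of _ "\<lambda>\<eta>. 1 + \<bar>u \<eta>\<bar> powr p"])
  show "AE \<eta> in sph. norm (u \<eta>) \<le> norm (1 + \<bar>u \<eta>\<bar> powr p)"
    using le_one_plus_powr[of "\<bar>_\<bar>" p] p_gt_1 by (intro AE_I2) auto
qed (use LpD[OF assms] in simp_all)

lemma Lp_bound:
  assumes "Lp v" "u \<in> borel_measurable borel" "\<And>\<eta>. \<bar>u \<eta>\<bar> \<le> \<bar>v \<eta>\<bar>"
  shows "Lp u"
proof -
  have "integrable sph (\<lambda>\<eta>. \<bar>u \<eta>\<bar> powr p)"
    by (rule Bochner_Integration.integrable_bound[OF LpD(2)[OF assms(1)]]) (use assms p_gt_1 in \<open>auto intro!: AE_I2 powr_mono2\<close>)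
  then show ?thesis
    using assms(2) unfolding Lp_def by blast
qed

lemma Lp_cmult: "Lp u \<Longrightarrow> Lp (\<lambda>\<eta>. c * u \<eta>)"
  unfolding Lp_def by (auto simp: abs_mult powr_mult)

lemma Lp_abs: "Lp u \<Longrightarrow> Lp (\<lambda>\<eta>. \<bar>u \<eta>\<bar>)"
  unfolding Lp_def by auto

lemma Lp_const: "Lp (\<lambda>_. c)"
  unfolding Lp_def by simp

lemma mass_nonneg: "0 \<le> mass u"
  by (simp add: mass_def)

lemma mass_cmult: "mass (\<lambda>\<eta>. c * u \<eta>) = \<bar>c\<bar> powr p * mass u"
  by (simp add: mass_def abs_mult powr_mult)

lemma mass_abs: "mass (\<lambda>\<eta>. \<bar>u \<eta>\<bar>) = mass u"
  by (simp add: mass_def)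

lemma mass_1: "mass (\<lambda>_. 1) = S"
  by (simp add: mass_def measure_sph_S)

lemma energy_nonneg: "0 \<le> energy u"
  by (simp add: energy_def)

lemma energy_cmult: "energy (\<lambda>\<eta>. c * u \<eta>) = \<bar>c\<bar> powr q * energy u"
  by (simp add: energy_def extend_cmult abs_mult powr_mult)

lemma nn_integral_mass: "Lp u \<Longrightarrow> (\<integral>\<^sup>+\<eta>. ennreal (\<bar>u \<eta>\<bar> powr p) \<partial>sph) = ennreal (mass u)"
  unfolding mass_def by (rule nn_integral_eq_integral) (auto simp: Lp_def)

lemma abs_extend_le_mass:
  assumes Lp_u: "Lp u" and norm_\<xi>: "norm \<xi> < 1"
  shows "\<bar>extend s u \<xi>\<bar> \<le> (S / 2 powr m) powr (s / m) * mass u powr (1 / p)"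
proof -
  note [measurable] = LpD(1)[OF Lp_u]
  have "ennreal (2 powr m) * (\<integral>\<^sup>+\<eta>. ennreal (kernel m \<xi> \<eta>) \<partial>sph) = ennreal S"
    using nn_integral_kernel_conformal_power[OF norm_\<xi>] by (simp only: m_eq S_eq powr_realpow) (simp add: ennreal_mult nn_integral_cmult)
  then have "ennreal (1 / 2 powr m) * (ennreal (2 powr m) * (\<integral>\<^sup>+\<eta>. ennreal (kernel m \<xi> \<eta>) \<partial>sph)) = ennreal (S / 2 powr m)"
    using S_pos by (simp add: ennreal_mult'[symmetric])
  then have "(\<integral>\<^sup>+\<eta>. ennreal (kernel s \<xi> \<eta> powr (m / s)) \<partial>sph) = ennreal (S / 2 powr m)"
    using s_bounds by (simp add: kernel_powr mult.assoc[symmetric] ennreal_mult'[symmetric])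
  then have "(\<integral>\<^sup>+\<eta>. ennreal (kernel s \<xi> \<eta> * \<bar>u \<eta>\<bar>) \<partial>sph) \<le> ennreal ((S / 2 powr m) powr (1 / (m / s)) * mass u powr (1 / p))"
    using Lp_u exponents_conjugate p_gt_1 S_pos by (intro nn_integral_Holder) (simp_all add: nn_integral_mass mass_nonneg)
  then have "extend s (\<lambda>\<eta>. \<bar>u \<eta>\<bar>) \<xi> \<le> (S / 2 powr m) powr (s / m) * mass u powr (1 / p)"
    using nn_integral_kernel_mult[OF norm_\<xi>, of "\<lambda>\<eta>. \<bar>u \<eta>\<bar>"] Lp_u Lp_integrable[OF Lp_u] by simp
  then show ?thesis
    using abs_extend_le[of u \<xi>] by simp
qed

text \<open>The weak-type estimate of order \<open>order\<close>. At each \<open>\<xi>\<close> the function is cut at the height \<open>b * weight \<xi> powr (s - m)\<close>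
  for which Hoelder's inequality bounds the low part by half the level; the high part is estimated by Jensen's inequality and Fubini.\<close>

context
  fixes l K :: real
  assumes l_bounds: "1 < l" "1 / q + s / m < 1 / l" and K_pos: "0 < K"
    and nn_integral_kernel_bound: "\<And>\<xi>::'a. norm \<xi> < 1 \<Longrightarrow> (\<integral>\<^sup>+\<eta>. ennreal (kernel (s * l) \<xi> \<eta>) \<partial>sph) \<le> ennreal (K * weight \<xi> powr (m - s * l))"
begin

definition order :: real where
  "order = 1 / (1 / l - s / m)"

lemma order_bounds: "0 < order" "order < q"
proof -
  have reciprocal_gap: "1 / q < 1 / l - s / m"
    using l_bounds(2) by simp
  moreover have "0 < 1 / q"
    using q_gt_2 by simp
  ultimately have "0 < 1 / l - s / m"
    by linarith
  then show "0 < order"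
    by (simp add: order_def)
  have "inverse (1 / l - s / m) < inverse (1 / q)"
    using reciprocal_gap \<open>0 < 1 / q\<close> by (rule less_imp_inverse_less)
  then show "order < q"
    by (simp add: order_def inverse_eq_divide)
qed

lemma order_eqs: "m / order = m / l - s" "p / order = p / l - (p - 1)"
proof -
  show "m / order = m / l - s"
    using s_bounds by (simp add: order_def field_simps)
  have "p * (1 - s / m) = 1"
    using s_bounds by (simp add: p_eq field_simps)
  then show "p / order = p / l - (p - 1)"
    by (simp add: order_def algebra_simps)
qed

definition height :: "real \<Rightarrow> 'a \<Rightarrow> real" where
  "height b \<xi> = b * weight \<xi> powr (s - m)"

lemma height_borel [measurable]: "height b \<in> borel_measurable borel"
  unfolding height_def by measurable

lemma height_pos: "0 < b \<Longrightarrow> norm \<xi> < 1 \<Longrightarrow> 0 < height b \<xi>"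
  using weight_pos[of \<xi>] by (simp add: height_def)

lemma height_powr: "height b \<xi> powr r = b powr r * weight \<xi> powr ((s - m) * r)"
  by (simp add: height_def powr_mult powr_powr)

definition high_part :: "real \<Rightarrow> ('a \<Rightarrow> real) \<Rightarrow> 'a \<Rightarrow> 'a \<Rightarrow> real" where
  "high_part b v \<xi> \<eta> = (if height b \<xi> < v \<eta> then v \<eta> else 0)"

definition low_part :: "real \<Rightarrow> ('a \<Rightarrow> real) \<Rightarrow> 'a \<Rightarrow> 'a \<Rightarrow> real" where
  "low_part b v \<xi> \<eta> = (if height b \<xi> < v \<eta> then 0 else v \<eta>)"

lemma parts_borel [measurable]:
  assumes [measurable]: "v \<in> borel_measurable borel"
  shows "high_part b v \<xi> \<in> borel_measurable borel" "low_part b v \<xi> \<in> borel_measurable borel"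
  unfolding high_part_def[abs_def] low_part_def[abs_def] by measurable

context
  fixes b :: real and v :: "'a \<Rightarrow> real"
  assumes b_pos: "0 < b" and Lp_v: "Lp v" and v_nonneg: "\<And>\<eta>. 0 \<le> v \<eta>" and mass_le_1: "mass v \<le> 1"
begin

lemma v_borel [measurable]: "v \<in> borel_measurable borel"
  by (rule LpD(1)[OF Lp_v])

lemma parts_nonneg: "0 \<le> high_part b v \<xi> \<eta>" "0 \<le> low_part b v \<xi> \<eta>"
  by (simp_all add: high_part_def low_part_def v_nonneg)

lemma nn_integral_powr_le_1: "(\<integral>\<^sup>+\<eta>. ennreal (v \<eta> powr p) \<partial>sph) \<le> 1"
  using nn_integral_mass[OF Lp_v] v_nonneg mass_le_1 by (simp add: ennreal_le_1)

lemma nn_integral_le_if_le_powr: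
  assumes "\<And>\<eta>. f \<eta> \<le> c * v \<eta> powr p" "0 \<le> c"
  shows "(\<integral>\<^sup>+\<eta>. ennreal (f \<eta>) \<partial>sph) \<le> ennreal c"
proof -
  have "(\<integral>\<^sup>+\<eta>. ennreal (f \<eta>) \<partial>sph) \<le> (\<integral>\<^sup>+\<eta>. ennreal c * ennreal (v \<eta> powr p) \<partial>sph)"
    using assms by (intro nn_integral_mono) (simp add: ennreal_mult[symmetric] ennreal_leI)
  also have "\<dots> \<le> ennreal c * 1"
    by (subst nn_integral_cmult) (simp, rule mult_left_mono[OF nn_integral_powr_le_1], simp)
  finally show ?thesis
    by simp
qed

lemma nn_integral_low_part_le:
  assumes norm_\<xi>: "norm \<xi> < 1"
  shows "(\<integral>\<^sup>+\<eta>. ennreal (kernel s \<xi> \<eta> * low_part b v \<xi> \<eta>) \<partial>sph) \<le> ennreal (K powr (1 / l) * b powr (p / order))"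
proof -
  define l' where "l' = l / (l - 1)"
  have l'_conjugate: "1 < l'" "1 / l + 1 / l' = 1"
    using l_bounds(1) by (simp_all add: l'_def field_simps)
  have exponent: "(l' - p) * (1 / l') = p / order"
    unfolding order_eqs using l_bounds(1) by (simp add: l'_def field_simps)
  then have "p \<le> l'"
    using l'_conjugate(1) order_bounds p_gt_1 by (smt (verit) divide_pos_pos mult_neg_pos zero_less_divide_1_iff)
  have "(\<integral>\<^sup>+\<eta>. ennreal (kernel s \<xi> \<eta> * low_part b v \<xi> \<eta>) \<partial>sph)
      \<le> ennreal ((K * weight \<xi> powr (m - s * l)) powr (1 / l) * (height b \<xi> powr (l' - p)) powr (1 / l'))"
  proof (rule nn_integral_Holder)
    show "(\<integral>\<^sup>+\<eta>. ennreal (kernel s \<xi> \<eta> powr l) \<partial>sph) \<le> ennreal (K * weight \<xi> powr (m - s * l))"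
      using nn_integral_kernel_bound[OF norm_\<xi>] by (simp add: kernel_powr)
    show "(\<integral>\<^sup>+\<eta>. ennreal (low_part b v \<xi> \<eta> powr l') \<partial>sph) \<le> ennreal (height b \<xi> powr (l' - p))"
    proof (rule nn_integral_le_if_le_powr)
      fix \<eta>
      have "v \<eta> powr l' \<le> height b \<xi> powr (l' - p) * v \<eta> powr p" if "v \<eta> \<le> height b \<xi>"
        using mult_right_mono[OF powr_mono2[OF _ v_nonneg that, of "l' - p"], of "v \<eta> powr p"] \<open>p \<le> l'\<close>
        by (simp add: powr_add[symmetric])
      then show "low_part b v \<xi> \<eta> powr l' \<le> height b \<xi> powr (l' - p) * v \<eta> powr p"
        by (simp add: low_part_def)
    qed simp
  qed (use l_bounds(1) l'_conjugate K_pos parts_nonneg in simp_all)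
  also have "(K * weight \<xi> powr (m - s * l)) powr (1 / l) = K powr (1 / l) * weight \<xi> powr (m / order)"
    unfolding order_eqs using l_bounds(1) by (simp add: powr_mult powr_powr diff_divide_distrib)
  also have "(height b \<xi> powr (l' - p)) powr (1 / l') = b powr (p / order) * weight \<xi> powr ((s - m) * (p / order))"
    unfolding powr_powr exponent by (rule height_powr)
  also have "(s - m) * (p / order) = - (m / order)"
    unfolding times_divide_eq_right p_minus_1(3) by simp
  finally show ?thesis
    using weight_pos[OF norm_\<xi>] by (simp add: powr_minus_divide)
qed

lemma integrable_kernel_high_part:
  assumes norm_\<xi>: "norm \<xi> < 1" and t_pos: "0 < t"
  shows "integrable sph (\<lambda>\<eta>. kernel t \<xi> \<eta> * high_part b v \<xi> \<eta>)"
proof (rule Bochner_Integration.integrable_bound[of _ "\<lambda>\<eta>. ((1 / (2 * (1 - norm \<xi>)\<^sup>2)) powr s) powr (t / s) * \<bar>v \<eta>\<bar>"])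
  show "AE \<eta> in sph. norm (kernel t \<xi> \<eta> * high_part b v \<xi> \<eta>) \<le> norm (((1 / (2 * (1 - norm \<xi>)\<^sup>2)) powr s) powr (t / s) * \<bar>v \<eta>\<bar>)"
    using AE_sph
  proof eventually_elim
    fix \<eta> :: 'a assume "norm \<eta> = 1"
    then have "kernel s \<xi> \<eta> powr (t / s) \<le> ((1 / (2 * (1 - norm \<xi>)\<^sup>2)) powr s) powr (t / s)"
      using kernel_le[OF order_refl norm_\<xi>] s_bounds t_pos by (intro powr_mono2) auto
    moreover have "kernel s \<xi> \<eta> powr (t / s) = kernel t \<xi> \<eta>"
      using s_bounds by (simp add: kernel_powr)
    ultimately show "norm (kernel t \<xi> \<eta> * high_part b v \<xi> \<eta>) \<le> norm (((1 / (2 * (1 - norm \<xi>)\<^sup>2)) powr s) powr (t / s) * \<bar>v \<eta>\<bar>)"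
      by (auto simp: abs_mult high_part_def intro: mult_right_mono)
  qed
qed (use Lp_integrable[OF Lp_v] in simp_all)

lemma high_part_le_powr:
  assumes norm_\<xi>: "norm \<xi> < 1"
  shows "high_part b v \<xi> \<eta> \<le> height b \<xi> powr (1 - p) * v \<eta> powr p"
proof (cases "height b \<xi> < v \<eta>")
  case True
  then have "v \<eta> powr (1 - p) * v \<eta> powr p \<le> height b \<xi> powr (1 - p) * v \<eta> powr p"
    using height_pos[OF b_pos norm_\<xi>] p_gt_1 by (intro mult_right_mono powr_mono2') auto
  then show ?thesis
    using True v_nonneg by (simp add: high_part_def powr_add[symmetric])
qed (simp add: high_part_def)

lemma nn_integral_kernel_high_part:
  assumes "norm \<xi> < 1" "0 < t"
  shows "(\<integral>\<^sup>+\<eta>. ennreal (kernel t \<xi> \<eta> * high_part b v \<xi> \<eta>) \<partial>sph) = ennreal (extend t (high_part b v \<xi>) \<xi>)"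
  unfolding extend_def using parts_nonneg assms by (intro nn_integral_eq_integral integrable_kernel_high_part) simp_all

lemma extend_high_part_powr_le:
  assumes norm_\<xi>: "norm \<xi> < 1"
  shows "extend s (high_part b v \<xi>) \<xi> powr l \<le> extend (s * l) (high_part b v \<xi>) \<xi> * height b \<xi> powr ((1 - p) * (l - 1))"
proof -
  let ?v = "high_part b v \<xi>" and ?A = "extend (s * l) (high_part b v \<xi>) \<xi>"
  define l' where "l' = l / (l - 1)"
  have l'_conjugate: "1 < l'" "1 / l + 1 / l' = 1" "(1 - p) * (1 / l') * l = (1 - p) * (l - 1)"
    using l_bounds(1) by (simp_all add: l'_def field_simps)
  have nonneg: "0 \<le> ?A" "0 \<le> extend s ?v \<xi>"
    unfolding extend_def using parts_nonneg by simp_all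
  have "(\<integral>\<^sup>+\<eta>. ennreal ((kernel s \<xi> \<eta> * ?v \<eta> powr (1 / l)) * (?v \<eta> powr (1 / l'))) \<partial>sph)
     \<le> ennreal (?A powr (1 / l) * (height b \<xi> powr (1 - p)) powr (1 / l'))"
  proof (rule nn_integral_Holder)
    have "(kernel s \<xi> \<eta> * ?v \<eta> powr (1 / l)) powr l = kernel (s * l) \<xi> \<eta> * ?v \<eta>" for \<eta>
      using l_bounds(1) parts_nonneg by (simp add: powr_mult powr_powr kernel_powr)
    then show "(\<integral>\<^sup>+\<eta>. ennreal ((kernel s \<xi> \<eta> * ?v \<eta> powr (1 / l)) powr l) \<partial>sph) \<le> ennreal ?A"
      using s_bounds l_bounds(1) by (simp add: nn_integral_kernel_high_part[OF norm_\<xi>])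
    show "(\<integral>\<^sup>+\<eta>. ennreal ((?v \<eta> powr (1 / l')) powr l') \<partial>sph) \<le> ennreal (height b \<xi> powr (1 - p))"
      using l'_conjugate(1) parts_nonneg high_part_le_powr[OF norm_\<xi>] by (intro nn_integral_le_if_le_powr) (simp_all add: powr_powr)
  qed (use l_bounds(1) l'_conjugate nonneg in simp_all)
  moreover have "(kernel s \<xi> \<eta> * ?v \<eta> powr (1 / l)) * (?v \<eta> powr (1 / l')) = kernel s \<xi> \<eta> * ?v \<eta>" for \<eta>
    using parts_nonneg l'_conjugate(2) by (simp add: mult.assoc powr_add[symmetric])
  ultimately have "extend s ?v \<xi> \<le> ?A powr (1 / l) * (height b \<xi> powr (1 - p)) powr (1 / l')"
    using s_bounds by (simp add: nn_integral_kernel_high_part[OF norm_\<xi>])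
  then have "extend s ?v \<xi> powr l \<le> (?A powr (1 / l) * (height b \<xi> powr (1 - p)) powr (1 / l')) powr l"
    using nonneg(2) l_bounds(1) by (intro powr_mono2) simp_all
  also have "\<dots> = ?A * height b \<xi> powr ((1 - p) * (1 / l') * l)"
    unfolding powr_mult powr_powr using l_bounds(1) nonneg(1) by simp
  finally show ?thesis
    unfolding l'_conjugate(3) .
qed

lemma level_powr_le_high_part:
  assumes norm_\<xi>: "norm \<xi> < 1" and level: "K powr (1 / l) * b powr (p / order) < extend s (high_part b v \<xi>) \<xi>"
  shows "K * b \<le> weight \<xi> powr (s * (l - 1)) * extend (s * l) (high_part b v \<xi>) \<xi>"
proof -
  let ?A = "extend (s * l) (high_part b v \<xi>) \<xi>"
  have "(K powr (1 / l) * b powr (p / order)) powr l \<le> extend s (high_part b v \<xi>) \<xi> powr l"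
    using level l_bounds(1) by (intro powr_mono2) simp_all
  also note extend_high_part_powr_le[OF norm_\<xi>]
  finally have "K * b powr (p / order * l) \<le> ?A * height b \<xi> powr ((1 - p) * (l - 1))"
    using l_bounds(1) K_pos by (simp add: powr_mult powr_powr)
  then have "K * b powr (p / order * l) * b powr ((p - 1) * (l - 1))
      \<le> ?A * (b powr ((1 - p) * (l - 1)) * weight \<xi> powr ((s - m) * ((1 - p) * (l - 1)))) * b powr ((p - 1) * (l - 1))"
    unfolding height_powr by (intro mult_right_mono) simp_all
  also have "\<dots> = ?A * weight \<xi> powr ((s - m) * (1 - p) * (l - 1)) * (b powr ((1 - p) * (l - 1)) * b powr ((p - 1) * (l - 1)))"
    by (simp add: ac_simps)
  also have "b powr ((1 - p) * (l - 1)) * b powr ((p - 1) * (l - 1)) = 1"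
    using b_pos by (simp add: powr_add[symmetric] algebra_simps)
  also have "(s - m) * (1 - p) = s"
    using p_minus_1(3) by (simp add: algebra_simps)
  finally have "K * (b powr (p / order * l) * b powr ((p - 1) * (l - 1))) \<le> weight \<xi> powr (s * (l - 1)) * ?A"
    by (simp only: ac_simps mult_1)
  moreover have "p / order * l + (p - 1) * (l - 1) = 1"
    unfolding order_eqs using l_bounds(1) by (simp add: field_simps)
  ultimately show ?thesis
    using b_pos by (simp add: powr_add[symmetric])
qed

lemma superlevel_le_high_part:
  assumes norm_\<xi>: "norm \<xi> < 1" and level: "2 * K powr (1 / l) * b powr (p / order) < extend s v \<xi>"
  shows "K * b \<le> weight \<xi> powr (s * (l - 1)) * extend (s * l) (high_part b v \<xi>) \<xi>"
proof (rule level_powr_le_high_part[OF norm_\<xi>])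
  let ?y = "K powr (1 / l) * b powr (p / order)"
  have part_integrable: "integrable sph (high_part b v \<xi>)" "integrable sph (low_part b v \<xi>)"
    by (rule Bochner_Integration.integrable_bound[OF Lp_integrable[OF Lp_v]]; simp add: high_part_def low_part_def)+
  have "extend s (low_part b v \<xi>) \<xi> \<le> ?y"
    using nn_integral_low_part_le[OF norm_\<xi>] K_pos nn_integral_kernel_mult[OF norm_\<xi> parts_borel(2)[OF v_borel] part_integrable(2) parts_nonneg(2)]
    by simp
  moreover have "v = (\<lambda>\<eta>. high_part b v \<xi> \<eta> + low_part b v \<xi> \<eta>)"
    by (auto simp: high_part_def low_part_def)
  then have "extend s v \<xi> = extend s (high_part b v \<xi>) \<xi> + extend s (low_part b v \<xi>) \<xi>"
    using extend_add[OF norm_\<xi> parts_borel(1)[OF v_borel] part_integrable(1) parts_borel(2)[OF v_borel] part_integrable(2)] by simp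
  ultimately show "?y < extend s (high_part b v \<xi>) \<xi>"
    using level by simp
qed

context
  fixes C :: real
  assumes C_nonneg: "0 \<le> C"
    and weight_bound: "\<And>\<tau>. 0 < \<tau> \<Longrightarrow> (\<integral>\<^sup>+\<xi>\<in>{\<xi>. \<tau> < weight \<xi>}. ennreal (weight \<xi> powr (m - s)) \<partial>(hyp :: 'a measure)) \<le> ennreal (C * \<tau> powr - s)"
begin

definition truncated_kernel :: "real \<Rightarrow> 'a \<Rightarrow> 'a \<Rightarrow> ennreal" where
  "truncated_kernel x \<xi> \<eta> = ennreal (weight \<xi> powr (s * (l - 1))) * indicator {\<xi>. height b \<xi> < x} \<xi> * ennreal (kernel (s * l) \<xi> \<eta>)"

lemma nn_integral_truncated_kernel_sph_le:
  fixes \<xi> :: 'a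
  assumes norm_\<xi>: "norm \<xi> < 1" and x_pos: "0 < x"
  shows "(\<integral>\<^sup>+\<zeta>. truncated_kernel x \<xi> \<zeta> \<partial>sph) \<le> ennreal K * (ennreal (weight \<xi> powr (m - s)) * indicator {\<xi>. (b / x) powr (1 / (m - s)) < weight \<xi>} \<xi>)"
proof (cases "height b \<xi> < x")
  case True
  then have "b / x < weight \<xi> powr (m - s)"
    using x_pos weight_pos[OF norm_\<xi>] powr_minus_divide[of "weight \<xi>" "m - s"] by (simp add: height_def pos_divide_less_eq mult.commute)
  then have "(b / x) powr (1 / (m - s)) < (weight \<xi> powr (m - s)) powr (1 / (m - s))"
    using b_pos x_pos s_bounds by (intro powr_less_mono2) auto
  then have above: "(b / x) powr (1 / (m - s)) < weight \<xi>"
    using weight_pos[OF norm_\<xi>] s_bounds by (simp add: powr_powr)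
  have "(\<integral>\<^sup>+\<zeta>. truncated_kernel x \<xi> \<zeta> \<partial>sph) = ennreal (weight \<xi> powr (s * (l - 1))) * (\<integral>\<^sup>+\<zeta>. ennreal (kernel (s * l) \<xi> \<zeta>) \<partial>sph)"
    using True by (simp add: truncated_kernel_def nn_integral_cmult)
  also have "\<dots> \<le> ennreal (weight \<xi> powr (s * (l - 1))) * ennreal (K * weight \<xi> powr (m - s * l))"
    using nn_integral_kernel_bound[OF norm_\<xi>] by (rule mult_left_mono) simp
  also have "\<dots> = ennreal (K * (weight \<xi> powr (s * (l - 1)) * weight \<xi> powr (m - s * l)))"
    using K_pos by (simp add: ennreal_mult[symmetric] mult.left_commute)
  also have "\<dots> = ennreal (K * weight \<xi> powr (m - s))"
    unfolding powr_add[symmetric] by (simp add: algebra_simps)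
  finally show ?thesis
    using above K_pos by (simp add: ennreal_mult)
qed (simp add: truncated_kernel_def)

lemma nn_integral_truncated_kernel_hyp_le:
  fixes \<eta> :: 'a
  assumes norm_\<eta>: "norm \<eta> = 1" and x_pos: "0 < x"
  shows "ennreal S * (\<integral>\<^sup>+\<xi>. truncated_kernel x \<xi> \<eta> \<partial>hyp) \<le> ennreal (K * C * (x / b) powr (p - 1))"
proof -
  define F where "F \<xi> = ennreal (weight \<xi> powr (s * (l - 1))) * indicator {\<xi>. height b \<xi> < x} \<xi>" for \<xi> :: 'a
  have [measurable]: "F \<in> borel_measurable borel"
    unfolding F_def by measurable
  define \<tau> where "\<tau> = (b / x) powr (1 / (m - s))"
  have \<tau>_powr: "0 < \<tau>" "\<tau> powr - s = (x / b) powr (p - 1)"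
    using b_pos x_pos by (simp_all add: \<tau>_def powr_powr p_minus_1 powr_minus powr_divide)
  have "ennreal S * (\<integral>\<^sup>+\<xi>. F \<xi> * ennreal (kernel (s * l) \<xi> \<eta>) \<partial>hyp) = (\<integral>\<^sup>+\<xi>. F \<xi> * (\<integral>\<^sup>+\<zeta>. ennreal (kernel (s * l) \<xi> \<zeta>) \<partial>sph) \<partial>(hyp :: 'a measure))"
    unfolding S_eq by (rule nn_integral_radial_kernel[OF norm_\<eta>]) (simp_all add: F_def height_def weight_def indicator_def)
  also have "\<dots> \<le> (\<integral>\<^sup>+\<xi>. ennreal K * (ennreal (weight \<xi> powr (m - s)) * indicator {\<xi>. \<tau> < weight \<xi>} \<xi>) \<partial>(hyp :: 'a measure))"
  proof (rule nn_integral_mono_AE, use AE_hyp in eventually_elim)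
    fix \<xi> :: 'a
    assume "norm \<xi> < 1"
    from nn_integral_truncated_kernel_sph_le[OF this x_pos]
    show "F \<xi> * (\<integral>\<^sup>+\<zeta>. ennreal (kernel (s * l) \<xi> \<zeta>) \<partial>sph) \<le> ennreal K * (ennreal (weight \<xi> powr (m - s)) * indicator {\<xi>. \<tau> < weight \<xi>} \<xi>)"
      by (simp add: truncated_kernel_def F_def \<tau>_def nn_integral_cmult)
  qed
  also have "\<dots> \<le> ennreal K * ennreal (C * \<tau> powr - s)"
    by (subst nn_integral_cmult) (auto intro!: mult_left_mono weight_bound \<tau>_powr(1))
  finally show ?thesis
    using K_pos C_nonneg by (simp add: F_def truncated_kernel_def \<tau>_powr(2) ennreal_mult[symmetric] mult.assoc)
qed

lemma truncated_kernel_borel [measurable]: "(\<lambda>(\<xi>, \<eta>). truncated_kernel (v \<eta>) \<xi> \<eta>) \<in> borel_measurable (borel \<Otimes>\<^sub>M borel)"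
  unfolding truncated_kernel_def by measurable

lemma nn_integral_truncated_kernel_le:
  "ennreal S * (\<integral>\<^sup>+\<eta>. (\<integral>\<^sup>+\<xi>. truncated_kernel (v \<eta>) \<xi> \<eta> \<partial>hyp) * ennreal (v \<eta>) \<partial>sph) \<le> ennreal (K * C * b powr (1 - p))"
proof -
  have "ennreal S * (\<integral>\<^sup>+\<eta>. (\<integral>\<^sup>+\<xi>. truncated_kernel (v \<eta>) \<xi> \<eta> \<partial>hyp) * ennreal (v \<eta>) \<partial>sph)
      = (\<integral>\<^sup>+\<eta>. ennreal S * (\<integral>\<^sup>+\<xi>. truncated_kernel (v \<eta>) \<xi> \<eta> \<partial>hyp) * ennreal (v \<eta>) \<partial>sph)"
    by (subst nn_integral_cmult[symmetric]) (simp_all add: mult.assoc)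
  also have "\<dots> \<le> (\<integral>\<^sup>+\<eta>. ennreal (K * C * b powr (1 - p) * v \<eta> powr p) \<partial>sph)"
  proof (rule nn_integral_mono_AE, use AE_sph in eventually_elim)
    fix \<eta> :: 'a
    assume norm_\<eta>: "norm \<eta> = 1"
    show "ennreal S * (\<integral>\<^sup>+\<xi>. truncated_kernel (v \<eta>) \<xi> \<eta> \<partial>hyp) * ennreal (v \<eta>) \<le> ennreal (K * C * b powr (1 - p) * v \<eta> powr p)"
    proof (cases "v \<eta> = 0")
      case False
      then have v_pos: "0 < v \<eta>"
        using v_nonneg[of \<eta>] by simp
      have "ennreal S * (\<integral>\<^sup>+\<xi>. truncated_kernel (v \<eta>) \<xi> \<eta> \<partial>hyp) * ennreal (v \<eta>) \<le> ennreal (K * C * (v \<eta> / b) powr (p - 1)) * ennreal (v \<eta>)"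
        using nn_integral_truncated_kernel_hyp_le[OF norm_\<eta> v_pos] by (rule mult_right_mono) simp
      also have "(v \<eta> / b) powr (p - 1) = b powr (1 - p) * v \<eta> powr (p - 1)"
        using powr_minus_divide[of b "p - 1"] by (simp add: powr_divide)
      also have "ennreal (K * C * (b powr (1 - p) * v \<eta> powr (p - 1))) * ennreal (v \<eta>) = ennreal (K * C * b powr (1 - p) * (v \<eta> powr (p - 1) * v \<eta>))"
        using v_pos K_pos C_nonneg by (simp add: ennreal_mult[symmetric] mult.assoc)
      also have "v \<eta> powr (p - 1) * v \<eta> = v \<eta> powr p"
        using v_pos powr_add[of "v \<eta>" "p - 1" 1] by simp
      finally show ?thesis .
    qed simp
  qed
  also have "\<dots> \<le> ennreal (K * C * b powr (1 - p))"
    using K_pos C_nonneg by (intro nn_integral_le_if_le_powr) simp_all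
  finally show ?thesis .
qed

text \<open>Chebyshev's inequality for the high part, integrated over \<open>\<xi>\<close> first.\<close>

lemma emeasure_superlevel_le: "emeasure hyp {\<xi>. 2 * K powr (1 / l) * b powr (p / order) < extend s v \<xi>} \<le> ennreal (C / S * b powr - p)"
proof -
  let ?A = "{\<xi>. 2 * K powr (1 / l) * b powr (p / order) < extend s v \<xi>}"
  interpret pair: pair_sigma_finite hyp "sph :: 'a measure" ..
  have "ennreal (S * (K * b)) * emeasure hyp ?A = ennreal S * (\<integral>\<^sup>+\<xi>. ennreal (K * b) * indicator ?A \<xi> \<partial>hyp)"
    using S_pos K_pos b_pos by (subst nn_integral_cmult_indicator) (simp_all add: ennreal_mult mult.assoc)
  also have "\<dots> \<le> ennreal S * (\<integral>\<^sup>+\<xi>. (\<integral>\<^sup>+\<eta>. truncated_kernel (v \<eta>) \<xi> \<eta> * ennreal (v \<eta>) \<partial>sph) \<partial>hyp)"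
  proof (intro mult_left_mono nn_integral_mono_AE, use AE_hyp in eventually_elim)
    fix \<xi> :: 'a
    assume norm_\<xi>: "norm \<xi> < 1"
    show "ennreal (K * b) * indicator ?A \<xi> \<le> (\<integral>\<^sup>+\<eta>. truncated_kernel (v \<eta>) \<xi> \<eta> * ennreal (v \<eta>) \<partial>sph)"
    proof (cases "\<xi> \<in> ?A")
      case True
      then have "ennreal (K * b) \<le> ennreal (weight \<xi> powr (s * (l - 1)) * extend (s * l) (high_part b v \<xi>) \<xi>)"
        by (intro ennreal_leI superlevel_le_high_part[OF norm_\<xi>]) simp
      also have "\<dots> = ennreal (weight \<xi> powr (s * (l - 1))) * (\<integral>\<^sup>+\<eta>. ennreal (kernel (s * l) \<xi> \<eta> * high_part b v \<xi> \<eta>) \<partial>sph)"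
        using s_bounds l_bounds(1) nn_integral_kernel_high_part[OF norm_\<xi>, of "s * l"] by (simp add: ennreal_mult')
      also have "\<dots> = (\<integral>\<^sup>+\<eta>. truncated_kernel (v \<eta>) \<xi> \<eta> * ennreal (v \<eta>) \<partial>sph)"
        by (subst nn_integral_cmult[symmetric])
          (auto simp: truncated_kernel_def high_part_def indicator_def ennreal_mult v_nonneg mult.assoc intro!: nn_integral_cong)
      finally show ?thesis
        using True by simp
    qed simp
  qed simp
  also have "(\<integral>\<^sup>+\<xi>. (\<integral>\<^sup>+\<eta>. truncated_kernel (v \<eta>) \<xi> \<eta> * ennreal (v \<eta>) \<partial>sph) \<partial>hyp) = (\<integral>\<^sup>+\<eta>. (\<integral>\<^sup>+\<xi>. truncated_kernel (v \<eta>) \<xi> \<eta> \<partial>hyp) * ennreal (v \<eta>) \<partial>sph)"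
    by (subst pair.Fubini'[symmetric]) (simp_all add: nn_integral_multc)
  also note nn_integral_truncated_kernel_le
  also have "K * C * b powr (1 - p) = S * (K * b) * (C / S * b powr - p)"
    using S_pos b_pos powr_add[of b 1 "- p"] by simp
  finally have "ennreal (S * (K * b)) * emeasure hyp ?A \<le> ennreal (S * (K * b)) * ennreal (C / S * b powr - p)"
    using S_pos K_pos b_pos C_nonneg by (subst ennreal_mult[symmetric]) simp_all
  then show ?thesis
    using S_pos K_pos b_pos by (subst (asm) ennreal_mult_le_mult_iff) auto
qed

end

end

lemma weak_type_order:
  obtains C where "0 \<le> C"
    "\<forall>v y. Lp v \<longrightarrow> (\<forall>\<eta>. 0 \<le> v \<eta>) \<longrightarrow> mass v \<le> 1 \<longrightarrow> 0 < y \<longrightarrow> emeasure hyp {\<xi>. y < extend s v \<xi>} \<le> ennreal (C * y powr - order)"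
proof -
  obtain C where C_bound: "0 \<le> C" "\<And>\<tau>. 0 < \<tau> \<Longrightarrow>
      (\<integral>\<^sup>+\<xi>\<in>{\<xi>. \<tau> < weight \<xi>}. ennreal (weight \<xi> powr (m - s)) \<partial>(hyp :: 'a measure)) \<le> ennreal (C * \<tau> powr - s)"
    using nn_integral_weight_superlevel_le[OF s_bounds(1), where 'a='a] unfolding m_eq[symmetric] by auto
  define k where "k = 2 * K powr (1 / l)"
  have k_pos: "0 < k"
    using K_pos by (simp add: k_def)
  show thesis
  proof (intro that allI impI)
    show "0 \<le> C / S * k powr order"
      using C_bound(1) S_pos by simp
    fix v :: "'a \<Rightarrow> real" and y :: real
    assume v_admissible: "Lp v" "\<forall>\<eta>. 0 \<le> v \<eta>" "mass v \<le> 1" and y_pos: "0 < y"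
    define b where "b = (y / k) powr (order / p)"
    have b_powr: "0 < b" "k * b powr (p / order) = y" "b powr - p = k powr order * y powr - order"
      using y_pos k_pos p_gt_1 order_bounds by (simp_all add: b_def powr_powr powr_divide powr_minus_divide)
    have "emeasure hyp {\<xi>. k * b powr (p / order) < extend s v \<xi>} \<le> ennreal (C / S * b powr - p)"
      unfolding k_def using v_admissible by (intro emeasure_superlevel_le[OF b_powr(1) _ _ _ C_bound]) auto
    then show "emeasure hyp {\<xi>. y < extend s v \<xi>} \<le> ennreal (C / S * k powr order * y powr - order)"
      by (simp add: b_powr(2,3) mult.assoc)
  qed
qed

end

lemma weak_type_exponent_exists:
  obtains l where "1 < l" "1 / q + s / m < 1 / l" "m / 2 < s * l"
proof -
  have q_pos: "0 < q"
    using q_gt_2 by simp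
  define l0 where "l0 = 1 / (1 / q + s / m)"
  have "1 / q + s / m < 1"
    using exponents_conjugate(1) p_less_q p_gt_1 divide_strict_left_mono[OF p_less_q, of 1] by simp
  then have "1 < l0"
    using q_pos s_bounds by (simp add: l0_def pos_less_divide_eq add_pos_pos)
  moreover have "1 / q < s / m"
    using q_pos s_bounds conjugate_less_q by (simp add: field_simps)
  then have "m / s / 2 < l0"
    using q_pos s_bounds divide_strict_left_mono[of "1 / q + s / m" "2 * (s / m)" 1] by (simp add: l0_def add_pos_pos)
  ultimately obtain l where l_bounds: "1 < l" "m / s / 2 < l" "l < l0"
    using dense[of "max 1 (m / s / 2)" l0] by auto
  show thesis
  proof
    show "1 / q + s / m < 1 / l"
      using l_bounds q_pos s_bounds divide_strict_left_mono[of l l0 1] by (simp add: l0_def add_pos_pos)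
    show "m / 2 < s * l"
      using l_bounds(2) s_bounds by (simp add: field_simps)
  qed (rule l_bounds(1))
qed

lemma weak_type:
  obtains C e where "0 \<le> C" "0 < e" "e < q"
    "\<forall>v y. Lp v \<longrightarrow> (\<forall>\<eta>. 0 \<le> v \<eta>) \<longrightarrow> mass v \<le> 1 \<longrightarrow> 0 < y \<longrightarrow> emeasure hyp {\<xi>. y < extend s v \<xi>} \<le> ennreal (C * y powr - e)"
proof -
  obtain l where l_bounds: "1 < l" "1 / q + s / m < 1 / l" and "m / 2 < s * l"
    by (rule weak_type_exponent_exists)
  then obtain K where K_bound: "0 < K" "\<And>\<xi>::'a. norm \<xi> < 1 \<Longrightarrow> (\<integral>\<^sup>+\<eta>. ennreal (kernel (s * l) \<xi> \<eta>) \<partial>sph) \<le> ennreal (K * weight \<xi> powr (m - s * l))"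
    using nn_integral_kernel_le[OF m_eq, of "s * l"] m_ge_2 by auto
  obtain C where "0 \<le> C"
    "\<forall>v y. Lp v \<longrightarrow> (\<forall>\<eta>. 0 \<le> v \<eta>) \<longrightarrow> mass v \<le> 1 \<longrightarrow> 0 < y \<longrightarrow> emeasure hyp {\<xi>. y < extend s v \<xi>} \<le> ennreal (C * y powr - order l)"
    by (rule weak_type_order[OF l_bounds K_bound])
  then show thesis
    using order_bounds[OF l_bounds K_bound] by (intro that[of C "order l"])
qed

lemma strong_type:
  obtains C e where "0 < C" "0 < e" "e < q"
    "\<forall>v N. Lp v \<longrightarrow> (\<forall>\<eta>. 0 \<le> v \<eta>) \<longrightarrow> mass v \<le> 1 \<longrightarrow> 0 \<le> N \<longrightarrow> (\<forall>\<xi>. norm \<xi> < 1 \<longrightarrow> extend s v \<xi> \<le> N) \<longrightarrow>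
      (\<integral>\<^sup>+\<xi>. ennreal (extend s v \<xi> powr q) \<partial>hyp) \<le> ennreal (C * N powr (q - e))"
proof -
  obtain C e where C_nonneg: "0 \<le> C" and e_bounds: "0 < e" "e < q"
    and weak: "\<forall>v y. Lp v \<longrightarrow> (\<forall>\<eta>. 0 \<le> v \<eta>) \<longrightarrow> mass v \<le> 1 \<longrightarrow> 0 < y \<longrightarrow> emeasure hyp {\<xi>. y < extend s v \<xi>} \<le> ennreal (C * y powr - e)"
    by (rule weak_type)
  define a where "a = e / q"
  have a_bounds: "0 < a" "a < 1" "q * (1 - a) = q - e"
    using e_bounds by (auto simp: a_def right_diff_distrib)
  show thesis
  proof (intro that allI impI)
    show "0 < C / (1 - a) + 1" "0 < e" "e < q"
      using C_nonneg a_bounds e_bounds by (simp_all add: add_nonneg_pos)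
    fix v :: "'a \<Rightarrow> real" and N :: real
    assume Lp_v: "Lp v" and v_nonneg: "\<forall>\<eta>. 0 \<le> v \<eta>" and mass: "mass v \<le> 1" and N_nonneg: "0 \<le> N"
      and extend_le: "\<forall>\<xi>. norm \<xi> < 1 \<longrightarrow> extend s v \<xi> \<le> N"
    note [measurable] = LpD(1)[OF Lp_v]
    have nonneg: "0 \<le> extend s v \<xi>" for \<xi>
      by (rule extend_nonneg) (simp add: v_nonneg)
    have "(\<integral>\<^sup>+\<xi>. ennreal (extend s v \<xi> powr q) \<partial>hyp) \<le> ennreal (C / (1 - a) * (N powr q) powr (1 - a))"
    proof (rule hyp.nn_integral_weak_bound)
      show "AE \<xi> in hyp. extend s v \<xi> powr q \<le> N powr q"
        using AE_hyp by eventually_elim (use extend_le q_gt_2 nonneg in \<open>auto intro!: powr_mono2\<close>)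
      fix y :: real
      assume y_pos: "0 < y"
      have "{\<xi> \<in> space hyp. y < extend s v \<xi> powr q} \<subseteq> {\<xi>. y powr (1 / q) < extend s v \<xi>}"
        using powr_less_mono2[of "1 / q" y "extend s v _ powr q"] y_pos q_gt_2 nonneg by (auto simp: powr_powr)
      then have "emeasure hyp {\<xi> \<in> space hyp. y < extend s v \<xi> powr q} \<le> emeasure hyp {\<xi>. y powr (1 / q) < extend s v \<xi>}"
        by (intro emeasure_mono) auto
      also have "\<dots> \<le> ennreal (C * (y powr (1 / q)) powr - e)"
        using y_pos by (intro weak[rule_format] Lp_v v_nonneg[rule_format] mass) simp
      finally show "emeasure hyp {\<xi> \<in> space hyp. y < extend s v \<xi> powr q} \<le> ennreal (C * y powr - a)"
        by (simp add: powr_powr a_def)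
    qed (use a_bounds C_nonneg in auto)
    also have "\<dots> \<le> ennreal ((C / (1 - a) + 1) * N powr (q - e))"
      unfolding powr_powr a_bounds(3) by (intro ennreal_leI mult_right_mono) auto
    finally show "(\<integral>\<^sup>+\<xi>. ennreal (extend s v \<xi> powr q) \<partial>hyp) \<le> ennreal ((C / (1 - a) + 1) * N powr (q - e))" .
  qed
qed

lemma abs_extend_powr_le_normalized:
  assumes Lp_u: "Lp u" and mass: "mass u \<noteq> 0"
  obtains v where "Lp v" "mass v = 1" "\<forall>\<eta>. 0 \<le> v \<eta>" "\<forall>\<xi>. \<bar>extend s u \<xi>\<bar> powr q \<le> mass u powr (q / p) * extend s v \<xi> powr q"
proof
  define c where "c = mass u powr (- 1 / p)"
  have "c powr p = mass u powr - 1" "c powr q = mass u powr - (q / p)"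
    using p_gt_1 by (simp_all only: c_def powr_powr) simp_all
  then have c_powr: "0 < c" "c powr p * mass u = 1" "mass u powr (q / p) * c powr q = 1"
    using mass mass_nonneg[of u] by (simp_all add: c_def powr_add[symmetric] powr_minus_divide)
  show "Lp (\<lambda>\<eta>. c * \<bar>u \<eta>\<bar>)" "mass (\<lambda>\<eta>. c * \<bar>u \<eta>\<bar>) = 1" "\<forall>\<eta>. 0 \<le> c * \<bar>u \<eta>\<bar>"
    using Lp_u c_powr by (simp_all add: Lp_cmult Lp_abs mass_cmult mass_abs)
  have "\<bar>extend s u \<xi>\<bar> powr q \<le> (mass u powr (q / p) * c powr q) * extend s (\<lambda>\<eta>. \<bar>u \<eta>\<bar>) \<xi> powr q" for \<xi>
    unfolding c_powr(3) using abs_extend_le[of u \<xi>] q_gt_2 by (simp add: powr_mono2)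
  then show "\<forall>\<xi>. \<bar>extend s u \<xi>\<bar> powr q \<le> mass u powr (q / p) * extend s (\<lambda>\<eta>. c * \<bar>u \<eta>\<bar>) \<xi> powr q"
    using c_powr(1) by (simp add: extend_cmult powr_mult mult.assoc)
qed

lemma nn_integral_extend_powr_le:
  obtains A where "0 \<le> A" "\<forall>u. Lp u \<longrightarrow> (\<integral>\<^sup>+\<xi>. ennreal (\<bar>extend s u \<xi>\<bar> powr q) \<partial>hyp) \<le> ennreal (A * mass u powr (q / p))"
proof -
  obtain C e where C_pos: "0 < C" and "0 < e" "e < q"
    and strong: "\<forall>v N. Lp v \<longrightarrow> (\<forall>\<eta>. 0 \<le> v \<eta>) \<longrightarrow> mass v \<le> 1 \<longrightarrow> 0 \<le> N \<longrightarrow> (\<forall>\<xi>. norm \<xi> < 1 \<longrightarrow> extend s v \<xi> \<le> N) \<longrightarrow>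
      (\<integral>\<^sup>+\<xi>. ennreal (extend s v \<xi> powr q) \<partial>hyp) \<le> ennreal (C * N powr (q - e))"
    by (rule strong_type)
  define N where "N = (S / 2 powr m) powr (s / m)"
  define A where "A = C * N powr (q - e)"
  have A_nonneg: "0 \<le> A"
    using C_pos by (simp add: A_def)
  have bound: "(\<integral>\<^sup>+\<xi>. ennreal (\<bar>extend s u \<xi>\<bar> powr q) \<partial>hyp) \<le> ennreal (A * mass u powr (q / p))" if Lp_u: "Lp u" for u
  proof (cases "mass u = 0")
    case True
    have "(\<integral>\<^sup>+\<xi>. ennreal (\<bar>extend s u \<xi>\<bar> powr q) \<partial>hyp) = (\<integral>\<^sup>+\<xi>. 0 \<partial>(hyp :: 'a measure))"
      by (rule nn_integral_cong_AE) (use AE_hyp in eventually_elim, use abs_extend_le_mass[OF Lp_u] True p_gt_1 in simp)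
    then show ?thesis
      by simp
  next
    case False
    obtain v where v_normalized: "Lp v" "mass v = 1" "\<forall>\<eta>. 0 \<le> v \<eta>"
      and extend_le: "\<forall>\<xi>. \<bar>extend s u \<xi>\<bar> powr q \<le> mass u powr (q / p) * extend s v \<xi> powr q"
      by (rule abs_extend_powr_le_normalized[OF Lp_u False])
    have "(\<integral>\<^sup>+\<xi>. ennreal (\<bar>extend s u \<xi>\<bar> powr q) \<partial>hyp) \<le> (\<integral>\<^sup>+\<xi>. ennreal (mass u powr (q / p)) * ennreal (extend s v \<xi> powr q) \<partial>hyp)"
      using extend_le by (intro nn_integral_mono) (simp add: ennreal_mult'[symmetric] ennreal_leI)
    also have "\<dots> = ennreal (mass u powr (q / p)) * (\<integral>\<^sup>+\<xi>. ennreal (extend s v \<xi> powr q) \<partial>hyp)"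
      using LpD(1)[OF v_normalized(1)] by (intro nn_integral_cmult) simp
    also have "(\<integral>\<^sup>+\<xi>. ennreal (extend s v \<xi> powr q) \<partial>hyp) \<le> ennreal A"
      unfolding A_def
    proof (intro strong[rule_format] v_normalized)
      show "extend s v \<xi> \<le> N" if "norm \<xi> < 1" for \<xi>
        using abs_extend_le_mass[OF v_normalized(1) that] v_normalized(2) abs_le_D1 by (auto simp: N_def)
    qed (use v_normalized in \<open>simp_all add: N_def\<close>)
    finally show ?thesis
      using A_nonneg by (simp add: mult_left_mono ennreal_mult mult.commute[of _ "ennreal (mass u powr (q / p))"])
  qed
  show thesis
    by (rule that[OF A_nonneg]) (simp add: bound)
qed

lemma energy_integrable:
  assumes Lp_u: "Lp u"
  shows "integrable hyp (\<lambda>\<xi>. \<bar>extend s u \<xi>\<bar> powr q)"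
proof -
  obtain A where "\<forall>u. Lp u \<longrightarrow> (\<integral>\<^sup>+\<xi>. ennreal (\<bar>extend s u \<xi>\<bar> powr q) \<partial>hyp) \<le> ennreal (A * mass u powr (q / p))"
    by (rule nn_integral_extend_powr_le)
  from this[rule_format, OF Lp_u] show ?thesis
    using LpD(1)[OF Lp_u] by (intro integrableI_bounded) (auto intro: le_less_trans)
qed

lemma nn_integral_energy: "Lp u \<Longrightarrow> (\<integral>\<^sup>+\<xi>. ennreal (\<bar>extend s u \<xi>\<bar> powr q) \<partial>hyp) = ennreal (energy u)"
  unfolding energy_def by (rule nn_integral_eq_integral[OF energy_integrable]) simp_all

lemma energy_bound:
  obtains A where "0 \<le> A" "\<forall>u. Lp u \<longrightarrow> energy u \<le> A * mass u powr (q / p)"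
proof -
  obtain A where A_bound: "0 \<le> A" "\<forall>u. Lp u \<longrightarrow> (\<integral>\<^sup>+\<xi>. ennreal (\<bar>extend s u \<xi>\<bar> powr q) \<partial>hyp) \<le> ennreal (A * mass u powr (q / p))"
    by (rule nn_integral_extend_powr_le)
  then show thesis
    using A_bound by (intro that[of A]) (auto simp: nn_integral_energy)
qed

end

section \<open>Elementary inequalities\<close>

lemma powr_ge_tangent_1:
  fixes r t :: real
  assumes "1 \<le> r" "0 \<le> t"
  shows "1 + r * (t - 1) \<le> t powr r"
proof (cases "r = 1")
  case False
  then have r_gt_1: "1 < r"
    using assms by simp
  define r' where "r' = r / (r - 1)"
  have r'_conjugate: "1 < r'" "1 / r + 1 / r' = 1"
    using r_gt_1 by (simp_all add: r'_def field_simps)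
  have "t * 1 \<le> t powr r / r + 1 powr r' / r'"
    using r_gt_1 r'_conjugate assms by (intro Youngs_inequality) auto
  also have "1 powr r' / r' = 1 - 1 / r"
    using r'_conjugate(2) by simp
  finally have "t \<le> t powr r / r + (1 - 1 / r)"
    by simp
  then have "r * t \<le> r * (t powr r / r + (1 - 1 / r))"
    using r_gt_1 by (intro mult_left_mono) auto
  then show ?thesis
    using r_gt_1 by (simp add: algebra_simps)
qed (use assms in simp)

lemma powr_ge_tangent:
  fixes r x y :: real
  assumes r_ge_1: "1 \<le> r" and x_pos: "0 < x" and y_nonneg: "0 \<le> y"
  shows "x powr r + r * x powr (r - 1) * (y - x) \<le> y powr r"
proof -
  have "x powr r * (1 + r * (y / x - 1)) \<le> x powr r * (y / x) powr r"
    using r_ge_1 x_pos y_nonneg by (intro mult_left_mono powr_ge_tangent_1) auto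
  also have "x powr r * (y / x) powr r = y powr r"
    using x_pos y_nonneg by (simp add: powr_divide)
  also have "x powr r * (1 + r * (y / x - 1)) = x powr r + r * (x powr r / x) * (y - x)"
    using x_pos by (simp add: field_simps)
  also have "x powr r / x = x powr (r - 1)"
    using x_pos by (simp add: powr_diff)
  finally show ?thesis .
qed

lemma powr_diff_le:
  fixes r x y :: real
  assumes r_ge_1: "1 \<le> r" and "0 \<le> y" "y \<le> x"
  shows "x powr r - y powr r \<le> r * x powr (r - 1) * (x - y)"
proof (cases "x = 0")
  case False
  then show ?thesis
    using powr_ge_tangent[OF r_ge_1, of x y] assms by (simp add: algebra_simps)
qed (use assms in simp)

lemma powr_diff_le_abs:
  fixes r x y :: real
  assumes r_ge_1: "1 \<le> r" and "0 \<le> y" "0 \<le> x" "x \<le> B" "y \<le> B"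
  shows "\<bar>x powr r - y powr r\<bar> \<le> r * B powr (r - 1) * \<bar>x - y\<bar>"
proof -
  have "x powr r - y powr r \<le> r * B powr (r - 1) * (x - y)" if "0 \<le> y" "y \<le> x" "x \<le> B" for x y
  proof -
    have "x powr r - y powr r \<le> r * x powr (r - 1) * (x - y)"
      by (rule powr_diff_le[OF r_ge_1 that(1,2)])
    also have "\<dots> \<le> r * B powr (r - 1) * (x - y)"
      using that r_ge_1 by (intro mult_right_mono mult_left_mono powr_mono2) auto
    finally show ?thesis .
  qed
  from this[of y x] this[of x y] show ?thesis
    using assms powr_mono2[of r x y] powr_mono2[of r y x] by (cases "y \<le> x") (auto simp: abs_if)
qed

lemma powr_second_difference:
  fixes q a x y :: real
  assumes q_gt_2: "2 < q" and a_pos: "0 < a" and x_nonneg: "0 \<le> x" and y_nonneg: "0 \<le> y"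
  shows "q * (q - 1) * a powr (q - 2) * x * y \<le> (a + x + y) powr q + a powr q - (a + x) powr q - (a + y) powr q"
proof -
  define h where "h t = (a + t + y) powr q - (a + t) powr q - q * (q - 1) * a powr (q - 2) * t * y" for t
  have "h 0 \<le> h x"
  proof (rule DERIV_nonneg_imp_nondecreasing[OF x_nonneg])
    fix t :: real
    assume t_nonneg: "0 \<le> t"
    have "(a + t) powr (q - 1) + (q - 1) * (a + t) powr (q - 1 - 1) * ((a + t + y) - (a + t)) \<le> (a + t + y) powr (q - 1)"
      using a_pos t_nonneg y_nonneg q_gt_2 by (intro powr_ge_tangent) auto
    moreover have "(q - 1) * a powr (q - 2) * y \<le> (q - 1) * (a + t) powr (q - 2) * y"
      using a_pos t_nonneg y_nonneg q_gt_2 by (intro mult_right_mono mult_left_mono powr_mono2) auto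
    ultimately have "(a + t) powr (q - 1) + (q - 1) * a powr (q - 2) * y \<le> (a + t + y) powr (q - 1)"
      by simp
    then have "q * ((a + t) powr (q - 1) + (q - 1) * a powr (q - 2) * y) \<le> q * (a + t + y) powr (q - 1)"
      using q_gt_2 by (intro mult_left_mono) auto
    then have "0 \<le> q * (a + t + y) powr (q - 1) - q * (a + t) powr (q - 1) - q * (q - 1) * a powr (q - 2) * y"
      by (simp add: algebra_simps)
    moreover have "(h has_real_derivative q * (a + t + y) powr (q - 1) - q * (a + t) powr (q - 1) - q * (q - 1) * a powr (q - 2) * y) (at t)"
      unfolding h_def[abs_def] using a_pos t_nonneg y_nonneg by (auto intro!: derivative_eq_intros simp: algebra_simps)
    ultimately show "\<exists>D. (h has_real_derivative D) (at t) \<and> 0 \<le> D"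
      by blast
  qed
  then show ?thesis
    by (simp add: h_def)
qed

lemma powr_pred_le:
  fixes r \<theta> A y :: real
  assumes r_gt_1: "1 < r" and \<theta>_pos: "0 < \<theta>" and A_nonneg: "0 \<le> A" and y_ge_1: "1 \<le> y"
  shows "A * y powr (r - 1) \<le> \<theta> * y powr r + A * (A / \<theta>) powr (r - 1) * y"
proof (cases "A / \<theta> \<le> y")
  case True
  then have "A * y powr (r - 1) \<le> (\<theta> * y) * y powr (r - 1)"
    using \<theta>_pos by (intro mult_right_mono) (auto simp: field_simps)
  also have "\<dots> = \<theta> * y powr r"
    using y_ge_1 powr_add[of y 1 "r - 1"] by simp
  finally show ?thesis
    using A_nonneg y_ge_1 by (simp add: add_increasing2)
next
  case False
  then have "A * y powr (r - 1) \<le> A * (A / \<theta>) powr (r - 1)"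
    using r_gt_1 A_nonneg y_ge_1 by (intro mult_left_mono powr_mono2) auto
  also have "\<dots> \<le> A * (A / \<theta>) powr (r - 1) * y"
    using A_nonneg y_ge_1 mult_left_mono[of 1 y "A * (A / \<theta>) powr (r - 1)"] by simp
  finally show ?thesis
    using \<theta>_pos by (simp add: add_increasing)
qed

lemma abs_powr_shift:
  fixes r \<theta> :: real
  assumes r_gt_1: "1 < r" and \<theta>_pos: "0 < \<theta>"
  obtains C where "0 \<le> C" "\<forall>x. \<bar>\<bar>1 + x\<bar> powr r - 1 - \<bar>x\<bar> powr r\<bar> \<le> \<theta> * \<bar>x\<bar> powr r + C * \<bar>x\<bar>"
proof -
  define A where "A = r * 2 powr (r - 1)"
  define B where "B = A * (A / \<theta>) powr (r - 1)"
  have nonneg: "0 \<le> A" "0 \<le> B"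
    using r_gt_1 by (simp_all add: A_def B_def)
  have "\<bar>\<bar>1 + x\<bar> powr r - 1 - \<bar>x\<bar> powr r\<bar> \<le> \<theta> * \<bar>x\<bar> powr r + (A + B + 1) * \<bar>x\<bar>" for x
  proof (cases "\<bar>x\<bar> \<le> 1")
    case True
    have "\<bar>\<bar>1 + x\<bar> powr r - 1 powr r\<bar> \<le> A * \<bar>\<bar>1 + x\<bar> - 1\<bar>"
      unfolding A_def using True r_gt_1 by (intro powr_diff_le_abs) auto
    also have "\<dots> \<le> A * \<bar>x\<bar>"
      using nonneg by (intro mult_left_mono) auto
    finally have "\<bar>\<bar>1 + x\<bar> powr r - 1\<bar> \<le> A * \<bar>x\<bar>"
      by simp
    moreover have "\<bar>x\<bar> powr r \<le> \<bar>x\<bar>"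
      using True r_gt_1 powr_mono'[of 1 r "\<bar>x\<bar>"] by simp
    moreover have "0 \<le> \<theta> * \<bar>x\<bar> powr r" "0 \<le> B * \<bar>x\<bar>" "0 \<le> \<bar>x\<bar> powr r"
      using \<theta>_pos nonneg by auto
    ultimately show ?thesis
      unfolding distrib_right by linarith
  next
    case False
    have "\<bar>\<bar>1 + x\<bar> powr r - \<bar>x\<bar> powr r\<bar> \<le> r * (2 * \<bar>x\<bar>) powr (r - 1) * \<bar>\<bar>1 + x\<bar> - \<bar>x\<bar>\<bar>"
      using False r_gt_1 by (intro powr_diff_le_abs) auto
    also have "\<dots> \<le> r * (2 * \<bar>x\<bar>) powr (r - 1) * 1"
      using r_gt_1 by (intro mult_left_mono) auto
    also have "\<dots> = A * \<bar>x\<bar> powr (r - 1)"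
      by (simp add: A_def powr_mult)
    also have "\<dots> \<le> \<theta> * \<bar>x\<bar> powr r + B * \<bar>x\<bar>"
      unfolding B_def using False by (intro powr_pred_le r_gt_1 \<theta>_pos nonneg) simp
    finally have "\<bar>\<bar>1 + x\<bar> powr r - \<bar>x\<bar> powr r\<bar> \<le> \<theta> * \<bar>x\<bar> powr r + B * \<bar>x\<bar>" .
    moreover have "0 \<le> A * \<bar>x\<bar>"
      using nonneg by simp
    ultimately show ?thesis
      using False unfolding distrib_right by linarith
  qed
  then show thesis
    using nonneg by (intro that[of "A + B + 1"]) auto
qed

definition excess :: "real \<Rightarrow> real \<Rightarrow> real" where
  "excess p x = \<bar>1 + x\<bar> powr p - 1 - p * x"

lemma powr_Taylor_2:
  fixes p x :: real
  assumes x_gt: "- 1 < x"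
  obtains t where "min 0 x \<le> t" "t \<le> max 0 x" "(1 + x) powr p = 1 + p * x + p * (p - 1) / 2 * (1 + t) powr (p - 2) * x\<^sup>2"
proof (cases "x = 0")
  case False
  define diff where "diff n t = (if n = 0 then (1 + t) powr p else if n = 1 then p * (1 + t) powr (p - 1) else p * ((p - 1) * (1 + t) powr (p - 2)))"
    for n :: nat and t :: real
  have "DERIV (diff n) t :> diff (Suc n) t" if "n < 2" "min 0 x \<le> t" for n t
  proof -
    have "0 < 1 + t" "n = 0 \<or> n = 1"
      using that x_gt by auto
    then show ?thesis
      by (auto simp: diff_def[abs_def] intro!: derivative_eq_intros)
  qed
  then have "\<exists>t. (if x < 0 then x < t \<and> t < 0 else 0 < t \<and> t < x) \<and>
      (1 + x) powr p = (\<Sum>n<2. diff n 0 / fact n * (x - 0) ^ n) + diff 2 t / fact 2 * (x - 0) ^ 2"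
    using False by (intro Taylor[where a = "min 0 x" and b = "max 0 x"]) (auto simp: diff_def[abs_def])
  then obtain t where "if x < 0 then x < t \<and> t < 0 else 0 < t \<and> t < x"
    and "(1 + x) powr p = (\<Sum>n<2. diff n 0 / fact n * (x - 0) ^ n) + diff 2 t / fact 2 * (x - 0) ^ 2"
    by blast
  then show thesis
    by (intro that[of t]) (auto simp: diff_def numeral_2_eq_2 split: if_splits)
qed (use that[of 0] in simp)

lemma excess_le_square_plus_powr:
  fixes q :: real
  assumes q_gt_2: "2 < q"
  obtains C where "0 \<le> C" "\<forall>x. excess q x \<le> C * (x\<^sup>2 + \<bar>x\<bar> powr q)"
proof -
  define A where "A = q * (q - 1) / 2 * 2 powr (q - 2)"
  have A_nonneg: "0 \<le> A"
    using q_gt_2 by (simp add: A_def)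
  have "excess q x \<le> (A + (3 powr q + 2 * q)) * (x\<^sup>2 + \<bar>x\<bar> powr q)" for x
  proof (cases "\<bar>x\<bar> \<le> 1 / 2")
    case True
    then have "- 1 < x" and abs_eq: "\<bar>1 + x\<bar> = 1 + x"
      by (auto simp: abs_le_iff)
    then obtain t where Taylor_t: "min 0 x \<le> t" "t \<le> max 0 x" "(1 + x) powr q = 1 + q * x + q * (q - 1) / 2 * (1 + t) powr (q - 2) * x\<^sup>2"
      using powr_Taylor_2 by blast
    have "excess q x \<le> A * x\<^sup>2"
      unfolding excess_def abs_eq Taylor_t(3) A_def using Taylor_t(1,2) True q_gt_2
      by (simp, intro mult_right_mono mult_left_mono powr_mono2) (auto simp: abs_le_iff)
    also have "\<dots> \<le> (A + (3 powr q + 2 * q)) * (x\<^sup>2 + \<bar>x\<bar> powr q)"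
      using q_gt_2 A_nonneg by (intro mult_mono) auto
    finally show ?thesis .
  next
    case False
    have "\<bar>1 + x\<bar> powr q \<le> (3 * \<bar>x\<bar>) powr q"
      using False q_gt_2 by (intro powr_mono2) auto
    moreover have "\<bar>x\<bar> \<le> 2 * x\<^sup>2"
      using False mult_left_mono[of 1 "2 * \<bar>x\<bar>" "\<bar>x\<bar>"] by (simp add: power2_eq_square)
    then have "q * \<bar>x\<bar> \<le> q * (2 * x\<^sup>2)"
      using q_gt_2 by (intro mult_left_mono) auto
    moreover have "- (q * \<bar>x\<bar>) \<le> q * x"
      using q_gt_2 by (cases "x \<ge> 0") auto
    ultimately have "excess q x \<le> 3 powr q * \<bar>x\<bar> powr q + 2 * q * x\<^sup>2"
      by (simp add: excess_def powr_mult)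
    also have "\<dots> \<le> (A + (3 powr q + 2 * q)) * \<bar>x\<bar> powr q + (A + (3 powr q + 2 * q)) * x\<^sup>2"
      using q_gt_2 A_nonneg by (intro add_mono mult_right_mono) auto
    finally show ?thesis
      by (simp add: algebra_simps)
  qed
  then show thesis
    using A_nonneg q_gt_2 by (intro that[of "A + (3 powr q + 2 * q)"]) auto
qed

lemma excess_ge_square:
  fixes p x :: real
  assumes p_gt_1: "1 < p" and x_small: "\<bar>x\<bar> \<le> 1 / 2"
  shows "p * (p - 1) / 2 * min ((1 / 2) powr (p - 2)) ((3 / 2) powr (p - 2)) * x\<^sup>2 \<le> excess p x"
proof -
  have "- 1 < x" and abs_eq: "\<bar>1 + x\<bar> = 1 + x"
    using x_small by (auto simp: abs_le_iff)
  then obtain t where t_bounds: "min 0 x \<le> t" "t \<le> max 0 x" and Taylor: "(1 + x) powr p = 1 + p * x + p * (p - 1) / 2 * (1 + t) powr (p - 2) * x\<^sup>2"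
    using powr_Taylor_2 by blast
  have range: "1 / 2 \<le> 1 + t" "1 + t \<le> 3 / 2"
    using t_bounds x_small by (auto simp: abs_le_iff)
  have "min ((1 / 2) powr (p - 2)) ((3 / 2) powr (p - 2)) \<le> (1 + t) powr (p - 2)"
  proof (cases "2 \<le> p")
    case True
    then show ?thesis
      using range powr_mono2[of "p - 2" "1 / 2" "1 + t"] by simp
  next
    case False
    then show ?thesis
      using range powr_mono2'[of "p - 2" "1 + t" "3 / 2"] by simp
  qed
  then have "p * (p - 1) / 2 * min ((1 / 2) powr (p - 2)) ((3 / 2) powr (p - 2)) * x\<^sup>2 \<le> p * (p - 1) / 2 * (1 + t) powr (p - 2) * x\<^sup>2"
    using p_gt_1 by (intro mult_right_mono mult_left_mono) auto
  then show ?thesis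
    by (simp add: excess_def abs_eq Taylor)
qed

lemma powr_convex_combination_le:
  fixes p t y :: real
  assumes p_ge_1: "1 \<le> p" and t_bounds: "0 \<le> t" "t \<le> 1" and y_nonneg: "0 \<le> y"
  shows "((1 - t) + t * y) powr p \<le> (1 - t) + t * y powr p"
proof (cases "(1 - t) + t * y = 0")
  case False
  define a where "a = (1 - t) + t * y"
  have a_pos: "0 < a"
    using False t_bounds y_nonneg by (simp add: a_def order_less_le)
  have "a powr p = t * (a powr p + p * a powr (p - 1) * (y - a)) + (1 - t) * (a powr p + p * a powr (p - 1) * (1 - a))
      + p * a powr (p - 1) * (a - ((1 - t) + t * y))"
    by (simp add: algebra_simps)
  also have "\<dots> = t * (a powr p + p * a powr (p - 1) * (y - a)) + (1 - t) * (a powr p + p * a powr (p - 1) * (1 - a))"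
    by (simp add: a_def)
  also have "\<dots> \<le> t * y powr p + (1 - t) * 1 powr p"
    using p_ge_1 a_pos t_bounds y_nonneg by (intro add_mono mult_left_mono powr_ge_tangent) auto
  finally show ?thesis
    by (simp add: a_def)
qed (use t_bounds in simp)

lemma excess_scale_le:
  fixes p t x :: real
  assumes p_ge_1: "1 \<le> p" and t_bounds: "0 \<le> t" "t \<le> 1"
  shows "excess p (t * x) \<le> t * excess p x"
proof -
  have "\<bar>1 + t * x\<bar> = \<bar>(1 - t) + t * (1 + x)\<bar>"
    by (simp add: algebra_simps)
  also have "\<dots> \<le> (1 - t) + t * \<bar>1 + x\<bar>"
    using t_bounds abs_triangle_ineq[of "1 - t" "t * (1 + x)"] by (simp add: abs_mult)
  finally have "\<bar>1 + t * x\<bar> powr p \<le> ((1 - t) + t * \<bar>1 + x\<bar>) powr p"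
    using p_ge_1 by (intro powr_mono2) auto
  also have "\<dots> \<le> (1 - t) + t * \<bar>1 + x\<bar> powr p"
    using p_ge_1 t_bounds by (intro powr_convex_combination_le) auto
  finally show ?thesis
    by (simp add: excess_def algebra_simps)
qed

lemma excess_ge_linear:
  fixes p c x :: real
  assumes p_ge_1: "1 \<le> p" and near_0: "\<forall>x. \<bar>x\<bar> \<le> 1 / 2 \<longrightarrow> c * x\<^sup>2 \<le> excess p x" and x_large: "1 / 2 \<le> \<bar>x\<bar>"
  shows "c / 2 * \<bar>x\<bar> \<le> excess p x"
proof -
  define t where "t = 1 / (2 * \<bar>x\<bar>)"
  have t_scale: "0 < t" "t \<le> 1" "\<bar>t * x\<bar> = 1 / 2"
    using x_large by (auto simp: t_def abs_mult)
  have square: "(t * x)\<^sup>2 = 1 / 4"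
    using arg_cong[OF t_scale(3), of power2] by (simp add: power2_eq_square)
  have "c / 4 \<le> t * excess p x"
    using near_0[rule_format, of "t * x"] excess_scale_le[OF p_ge_1, of t x] t_scale unfolding square by simp
  then have "2 * \<bar>x\<bar> * (c / 4) \<le> 2 * \<bar>x\<bar> * (t * excess p x)"
    by (intro mult_left_mono) auto
  also have "2 * \<bar>x\<bar> * (t * excess p x) = excess p x"
    using x_large by (simp add: t_def)
  finally show ?thesis
    by simp
qed

lemma excess_ge_powr:
  fixes p c :: real
  assumes p_gt_1: "1 < p" and c_pos: "0 < c" and near_0: "\<forall>x. \<bar>x\<bar> \<le> 1 / 2 \<longrightarrow> c * x\<^sup>2 \<le> excess p x"
  obtains k where "0 < k" "\<forall>x. 1 / 2 \<le> \<bar>x\<bar> \<longrightarrow> k * \<bar>x\<bar> powr p \<le> excess p x"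
proof -
  obtain C where C_bound: "0 \<le> C" "\<forall>x. \<bar>\<bar>1 + x\<bar> powr p - 1 - \<bar>x\<bar> powr p\<bar> \<le> 1 / 2 * \<bar>x\<bar> powr p + C * \<bar>x\<bar>"
    by (rule abs_powr_shift[OF p_gt_1, of "1 / 2"]) simp
  define M where "M = 1 + (C + p) / (c / 2)"
  have M_ge_1: "1 \<le> M"
    using C_bound c_pos p_gt_1 by (simp add: M_def)
  have "1 / (2 * M) * \<bar>x\<bar> powr p \<le> excess p x" if x_large: "1 / 2 \<le> \<bar>x\<bar>" for x
  proof -
    have "p * x \<le> p * \<bar>x\<bar>"
      using p_gt_1 by (intro mult_left_mono) auto
    moreover have "- (1 / 2 * \<bar>x\<bar> powr p + C * \<bar>x\<bar>) \<le> \<bar>1 + x\<bar> powr p - 1 - \<bar>x\<bar> powr p"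
      using C_bound(2)[rule_format, of x] unfolding abs_le_iff by linarith
    ultimately have "\<bar>x\<bar> powr p / 2 \<le> excess p x + (C + p) * \<bar>x\<bar>"
      by (simp add: excess_def distrib_right)
    also have "(C + p) * \<bar>x\<bar> = (C + p) / (c / 2) * (c / 2 * \<bar>x\<bar>)"
      using c_pos by simp
    also have "\<dots> \<le> (C + p) / (c / 2) * excess p x"
      using excess_ge_linear[OF _ near_0 x_large] C_bound c_pos p_gt_1 by (intro mult_left_mono) auto
    finally have "\<bar>x\<bar> powr p / 2 \<le> M * excess p x"
      by (simp add: M_def distrib_right)
    then show ?thesis
      using M_ge_1 by (simp add: field_simps)
  qed
  then show thesis
    using M_ge_1 by (intro that[of "1 / (2 * M)"]) auto
qed

definition mixed_power :: "real \<Rightarrow> real \<Rightarrow> real" where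
  "mixed_power p x = (if \<bar>x\<bar> \<le> 1 / 2 then x\<^sup>2 else \<bar>x\<bar> powr p)"

lemma mixed_power_borel [measurable]: "mixed_power p \<in> borel_measurable borel"
  unfolding mixed_power_def[abs_def] by measurable

lemma mixed_power_nonneg: "0 \<le> mixed_power p x"
  by (simp add: mixed_power_def)

lemma mixed_power_le: "mixed_power p x \<le> 1 + \<bar>x\<bar> powr p"
proof -
  have "x\<^sup>2 \<le> 1" if "\<bar>x\<bar> \<le> 1 / 2"
    using that by (simp add: abs_square_le_1)
  then show ?thesis
    by (auto simp: mixed_power_def intro: add_increasing2)
qed

lemma excess_ge_mixed_power:
  fixes p :: real
  assumes p_gt_1: "1 < p"
  obtains c where "0 < c" "\<forall>x. c * mixed_power p x \<le> excess p x"
proof -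
  define c where "c = p * (p - 1) / 2 * min ((1 / 2) powr (p - 2)) ((3 / 2) powr (p - 2))"
  have c_pos: "0 < c" and near_0: "\<forall>x. \<bar>x\<bar> \<le> 1 / 2 \<longrightarrow> c * x\<^sup>2 \<le> excess p x"
    using p_gt_1 excess_ge_square[OF p_gt_1] by (simp_all add: c_def)
  obtain k where excess_ge_powr: "0 < k" "\<forall>x. 1 / 2 \<le> \<bar>x\<bar> \<longrightarrow> k * \<bar>x\<bar> powr p \<le> excess p x"
    by (rule excess_ge_powr[OF p_gt_1 c_pos near_0])
  have "min c k * mixed_power p x \<le> excess p x" for x
  proof -
    have "min c k * mixed_power p x \<le> (if \<bar>x\<bar> \<le> 1 / 2 then c else k) * mixed_power p x"
      by (intro mult_right_mono) (auto simp: mixed_power_nonneg)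
    also have "\<dots> \<le> excess p x"
      using near_0 excess_ge_powr(2) by (simp add: mixed_power_def)
    finally show ?thesis .
  qed
  then show thesis
    using c_pos excess_ge_powr(1) by (intro that[of "min c k"]) auto
qed

lemma square_plus_powr_le_mixed_power:
  assumes p_ge_2: "2 \<le> p"
  shows "x\<^sup>2 + \<bar>x\<bar> powr p \<le> (2 + 2 powr (p - 2)) * mixed_power p x"
proof (cases "\<bar>x\<bar> \<le> 1 / 2")
  case True
  then have "\<bar>x\<bar> powr p \<le> x\<^sup>2"
    using p_ge_2 powr_mono'[of 2 p "\<bar>x\<bar>"] by simp
  moreover have "0 \<le> 2 powr (p - 2) * x\<^sup>2"
    by simp
  ultimately show ?thesis
    using True by (simp only: mixed_power_def distrib_right if_True)
next
  case False
  have "x\<^sup>2 = \<bar>x\<bar> powr p * \<bar>x\<bar> powr (2 - p)"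
    unfolding powr_add[symmetric] by simp
  also have "\<dots> \<le> \<bar>x\<bar> powr p * (1 / 2) powr (2 - p)"
    using False p_ge_2 by (intro mult_left_mono powr_mono2') auto
  also have "(1 / 2 :: real) powr (2 - p) = 2 powr (p - 2)"
    by (simp add: powr_divide powr_diff)
  finally have "x\<^sup>2 \<le> 2 powr (p - 2) * \<bar>x\<bar> powr p"
    by (simp add: mult.commute)
  moreover have "0 \<le> \<bar>x\<bar> powr p"
    by simp
  ultimately show ?thesis
    using False by (simp only: mixed_power_def distrib_right if_False)
qed

lemma abs_powr_le_mixed_power:
  assumes p_bounds: "0 \<le> p" "p \<le> 2" and \<delta>_pos: "0 < \<delta>"
  shows "\<bar>x\<bar> powr p \<le> \<delta> powr p + (\<delta> powr (p - 2) + 1) * mixed_power p x"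
proof -
  have nonneg: "0 \<le> \<delta> powr (p - 2) * mixed_power p x" "0 \<le> mixed_power p x" "0 \<le> \<delta> powr p"
    by (simp_all add: mixed_power_nonneg)
  consider (small) "\<bar>x\<bar> \<le> \<delta>" | (middle) "\<delta> < \<bar>x\<bar>" "\<bar>x\<bar> \<le> 1 / 2" | (large) "1 / 2 < \<bar>x\<bar>"
    by linarith
  then show ?thesis
  proof cases
    case small
    then have "\<bar>x\<bar> powr p \<le> \<delta> powr p"
      using p_bounds by (intro powr_mono2) auto
    with nonneg show ?thesis
      unfolding distrib_right by linarith
  next
    case middle
    have "\<bar>x\<bar> powr p = \<bar>x\<bar> powr (p - 2) * \<bar>x\<bar> powr 2"
      unfolding powr_add[symmetric] by simp
    also have "\<dots> \<le> \<delta> powr (p - 2) * \<bar>x\<bar> powr 2"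
      using middle \<delta>_pos p_bounds by (intro mult_right_mono powr_mono2') auto
    finally have "\<bar>x\<bar> powr p \<le> \<delta> powr (p - 2) * mixed_power p x"
      using middle by (simp add: mixed_power_def)
    with nonneg show ?thesis
      unfolding distrib_right by linarith
  next
    case large
    then have "\<bar>x\<bar> powr p = mixed_power p x"
      by (simp add: mixed_power_def)
    with nonneg show ?thesis
      unfolding distrib_right by linarith
  qed
qed

lemma powr_mult_powr_le:
  fixes a x q r :: real
  assumes "0 \<le> a" "0 \<le> x" "0 \<le> r" "r \<le> q"
  shows "a powr (q - r) * x powr r \<le> a powr q + x powr q"
proof -
  have "a powr (q - r) * x powr r \<le> max a x powr (q - r) * max a x powr r"
    using assms by (intro mult_mono powr_mono2) auto
  also have "\<dots> = max a x powr q"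
    unfolding powr_add[symmetric] by simp
  also have "\<dots> \<le> a powr q + x powr q"
    by (simp add: max_def)
  finally show ?thesis .
qed

lemma abs_add_powr_scale:
  fixes a x q r :: real
  assumes "0 < a"
  shows "\<bar>a + x\<bar> powr q = a powr q * \<bar>1 + x / a\<bar> powr q" "a powr q * \<bar>x / a\<bar> powr r = a powr (q - r) * \<bar>x\<bar> powr r"
proof -
  have "a + x = a * (1 + x / a)"
    using assms by (simp add: distrib_left)
  then have "\<bar>a + x\<bar> = a * \<bar>1 + x / a\<bar>"
    using assms by (simp only: abs_mult abs_of_pos)
  then show "\<bar>a + x\<bar> powr q = a powr q * \<bar>1 + x / a\<bar> powr q"
    by (simp add: powr_mult)
  show "a powr q * \<bar>x / a\<bar> powr r = a powr (q - r) * \<bar>x\<bar> powr r"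
    using assms by (simp add: abs_divide powr_divide powr_diff)
qed

lemma abs_add_powr_le_shift:
  fixes a x q \<theta> C :: real
  assumes a_pos: "0 < a" and shift: "\<forall>x. \<bar>\<bar>1 + x\<bar> powr q - 1 - \<bar>x\<bar> powr q\<bar> \<le> \<theta> * \<bar>x\<bar> powr q + C * \<bar>x\<bar>"
  shows "\<bar>a + x\<bar> powr q \<le> a powr q + (1 + \<theta>) * \<bar>x\<bar> powr q + C * (a powr (q - 1) * \<bar>x\<bar>)"
proof -
  have "\<bar>1 + x / a\<bar> powr q - 1 - \<bar>x / a\<bar> powr q \<le> \<theta> * \<bar>x / a\<bar> powr q + C * \<bar>x / a\<bar>"
    using shift[rule_format, of "x / a"] by (simp only: abs_le_iff)
  then have "\<bar>1 + x / a\<bar> powr q \<le> 1 + (1 + \<theta>) * \<bar>x / a\<bar> powr q + C * \<bar>x / a\<bar> powr 1"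
    unfolding distrib_right powr_one[OF abs_ge_zero] by linarith
  then have "a powr q * \<bar>1 + x / a\<bar> powr q \<le> a powr q * (1 + (1 + \<theta>) * \<bar>x / a\<bar> powr q + C * \<bar>x / a\<bar> powr 1)"
    by (rule mult_left_mono) simp
  also have "\<dots> = a powr q + (1 + \<theta>) * (a powr q * \<bar>x / a\<bar> powr q) + C * (a powr q * \<bar>x / a\<bar> powr 1)"
    by (simp only: distrib_left mult_1_right mult.left_commute)
  finally show ?thesis
    unfolding abs_add_powr_scale[OF a_pos] using a_pos by simp
qed

lemma abs_add_powr_le_excess:
  fixes a x q C :: real
  assumes a_pos: "0 < a" and excess_le: "\<forall>x. excess q x \<le> C * (x\<^sup>2 + \<bar>x\<bar> powr q)"
  shows "\<bar>a + x\<bar> powr q \<le> a powr q + q * (a powr (q - 1) * x) + C * (a powr (q - 2) * \<bar>x\<bar> powr 2 + \<bar>x\<bar> powr q)"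
proof -
  have "\<bar>1 + x / a\<bar> powr q \<le> 1 + q * (x / a) + C * (\<bar>x / a\<bar> powr 2 + \<bar>x / a\<bar> powr q)"
    using excess_le[rule_format, of "x / a"] by (simp add: excess_def abs_divide power_divide)
  then have "a powr q * \<bar>1 + x / a\<bar> powr q \<le> a powr q * (1 + q * (x / a) + C * (\<bar>x / a\<bar> powr 2 + \<bar>x / a\<bar> powr q))"
    by (rule mult_left_mono) simp
  also have "\<dots> = a powr q + q * (a powr q / a * x) + C * (a powr q * \<bar>x / a\<bar> powr 2 + a powr q * \<bar>x / a\<bar> powr q)"
    by (simp add: distrib_left mult_ac)
  finally show ?thesis
    unfolding abs_add_powr_scale[OF a_pos] using a_pos by (simp add: powr_diff)
qed

lemma powr_le_mult_powr_pred:
  fixes x b k :: real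
  assumes "0 \<le> x" "x \<le> b" "1 \<le> k"
  shows "x powr k \<le> x * b powr (k - 1)"
proof -
  have "x powr k = x * x powr (k - 1)"
    using assms powr_add[of x 1 "k - 1"] by (cases "x = 0") auto
  also have "\<dots> \<le> x * b powr (k - 1)"
    using assms by (intro mult_left_mono powr_mono2) auto
  finally show ?thesis .
qed

lemma powr_diff_ge:
  fixes x y q :: real
  assumes "0 \<le> y" "y \<le> x" "1 \<le> q"
  shows "x powr (q - 1) * (x - y) \<le> x powr q - y powr q"
proof -
  have "x powr (q - 1) * x = x powr q"
    using assms powr_add[of x "q - 1" 1] by (cases "x = 0") auto
  then show ?thesis
    using powr_le_mult_powr_pred[OF assms] by (simp add: algebra_simps)
qed

lemma powr_minus_diff_ge:
  fixes r x y :: real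
  assumes r_pos: "0 < r" and x_pos: "0 < x" and y_pos: "0 < y"
  shows "r * y powr (- r - 1) * (y - x) \<le> x powr - r - y powr - r"
proof -
  have "1 + r * (1 - x / y) \<le> 1 + - r * ln (x / y)"
    using ln_le_minus_one[of "x / y"] x_pos y_pos r_pos mult_left_mono[of "1 - x / y" "- ln (x / y)" r] by simp
  also have "\<dots> \<le> exp (- r * ln (x / y))"
    by (rule exp_ge_add_one_self)
  also have "\<dots> = (x / y) powr - r"
    using x_pos y_pos by (simp add: powr_def)
  finally have "y powr - r * (1 + r * (1 - x / y)) \<le> y powr - r * (x / y) powr - r"
    by (intro mult_left_mono) auto
  also have "y powr - r * (x / y) powr - r = x powr - r"
    using x_pos y_pos unfolding powr_mult[symmetric] by simp
  finally have "y powr - r + r * (y powr - r / y) * (y - x) \<le> x powr - r"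
    using y_pos by (simp add: field_simps)
  moreover have "y powr - r / y = y powr (- r - 1)"
    using y_pos by (simp add: powr_diff)
  ultimately show ?thesis
    by simp
qed

lemma smaller_part_le_defect:
  fixes X Y d k r \<theta> :: real
  assumes k_gt_1: "1 < k" and r_bounds: "0 \<le> r" "r \<le> 1" and \<theta>_bounds: "0 \<le> \<theta>" "4 * \<theta> \<le> 1 - r" and d_bounds: "0 \<le> d" "d \<le> 1"
    and X_nonneg: "0 \<le> X" and Y_bounds: "0 \<le> Y" "Y powr k \<le> Y * r"
    and sum_le: "X + (1 - \<theta>) * Y \<le> 1 + d" and powr_sum_ge: "1 - d \<le> X powr k + (1 + \<theta>) * Y powr k"
  shows "Y * ((1 - r) / 2) \<le> (k * 2 powr (k - 1) + 1) * d"
proof -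
  define g where "g = (1 + d) powr (k - 1)"
  have g_ge_1: "1 \<le> g"
    using d_bounds k_gt_1 by (auto simp: g_def intro: ge_one_powr_ge_zero)
  have "X \<le> 1 + d"
    using sum_le Y_bounds(1) r_bounds \<theta>_bounds mult_nonneg_nonneg[of "1 - \<theta>" Y] by linarith
  then have "X powr k \<le> X * g"
    unfolding g_def using X_nonneg k_gt_1 by (intro powr_le_mult_powr_pred) auto
  moreover have "(1 + \<theta>) * Y powr k \<le> (1 + \<theta>) * (Y * r)"
    using Y_bounds \<theta>_bounds by (intro mult_left_mono) auto
  ultimately have "1 - d \<le> X * g + (1 + \<theta>) * (Y * r)"
    using powr_sum_ge by linarith
  moreover have "X * g \<le> (1 + d - (1 - \<theta>) * Y) * g"
    using sum_le g_ge_1 by (intro mult_right_mono) auto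
  moreover have "(1 - \<theta>) * Y * 1 \<le> (1 - \<theta>) * Y * g"
    using g_ge_1 r_bounds \<theta>_bounds Y_bounds by (intro mult_left_mono) auto
  ultimately have "Y * ((1 - \<theta>) - (1 + \<theta>) * r) \<le> (1 + d) * g - 1 + d"
    unfolding left_diff_distrib[of "1 + d"] by (simp add: algebra_simps)
  also have "(1 + d) * g = (1 + d) powr k"
    using d_bounds powr_add[of "1 + d" 1 "k - 1"] by (simp add: g_def)
  also have "(1 + d) powr k - 1 + d \<le> (k * 2 powr (k - 1) + 1) * d"
    using powr_diff_le_abs[of k 1 "1 + d" 2] d_bounds k_gt_1 by (simp add: distrib_right)
  finally have "Y * ((1 - \<theta>) - (1 + \<theta>) * r) \<le> (k * 2 powr (k - 1) + 1) * d" .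
  moreover have "\<theta> * r \<le> \<theta>"
    using \<theta>_bounds r_bounds by (simp add: mult_left_le)
  then have "(1 - r) / 2 \<le> (1 - \<theta>) - (1 + \<theta>) * r"
    using \<theta>_bounds(2) unfolding distrib_right by (simp add: field_simps)
  then have "Y * ((1 - r) / 2) \<le> Y * ((1 - \<theta>) - (1 + \<theta>) * r)"
    using Y_bounds by (intro mult_left_mono)
  ultimately show ?thesis
    by linarith
qed

text \<open>Quantifies the strict inequality \<open>X powr k + Y powr k < (X + Y) powr k\<close>: a maximizing sequence cannot split
  into two parts of positive mass.\<close>

lemma no_splitting:
  fixes x0 k :: real
  assumes x0_bounds: "0 < x0" "x0 < 1" and k_gt_1: "1 < k"
  obtains \<theta> C d0 where "0 < \<theta>" "0 \<le> C" "0 < d0"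
    "\<forall>X Y d. 0 \<le> d \<longrightarrow> d \<le> d0 \<longrightarrow> x0 \<le> X \<longrightarrow> 0 \<le> Y \<longrightarrow> X + (1 - \<theta>) * Y \<le> 1 + d \<longrightarrow>
      1 - d \<le> X powr k + (1 + \<theta>) * Y powr k \<longrightarrow> Y \<le> C * d"
proof -
  define r where "r = (1 - x0 / 2) powr (k - 1)"
  have r_bounds: "0 < r" "r < 1"
    using x0_bounds k_gt_1 powr_less_mono2[of "k - 1" "1 - x0 / 2" 1] by (simp_all add: r_def)
  define \<theta> where "\<theta> = min (x0 / 8) ((1 - r) / 4)"
  have \<theta>_bounds: "0 < \<theta>" "\<theta> \<le> x0 / 8" "\<theta> \<le> (1 - r) / 4" "\<theta> < 1"
    using x0_bounds r_bounds by (auto simp: \<theta>_def min_def)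
  define C where "C = 2 / (1 - r) * (k * 2 powr (k - 1) + 1)"
  show thesis
  proof (intro that allI impI)
    show "0 < \<theta>" "0 \<le> C" "0 < x0 / 8"
      using \<theta>_bounds r_bounds k_gt_1 x0_bounds by (simp_all add: C_def)
    fix X Y d :: real
    assume d_bounds: "0 \<le> d" "d \<le> x0 / 8" and X_ge: "x0 \<le> X" and Y_nonneg: "0 \<le> Y"
      and sum_le: "X + (1 - \<theta>) * Y \<le> 1 + d" and powr_sum_ge: "1 - d \<le> X powr k + (1 + \<theta>) * Y powr k"
    have "(1 - \<theta>) * Y \<le> 1 - x0 / 2 - \<theta>"
      using sum_le d_bounds X_ge \<theta>_bounds by linarith
    also have "\<dots> \<le> (1 - \<theta>) * (1 - x0 / 2)"
      using \<theta>_bounds x0_bounds by (simp add: algebra_simps)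
    finally have "Y \<le> 1 - x0 / 2"
      using \<theta>_bounds by simp
    then have "Y powr k \<le> Y * r"
      unfolding r_def using Y_nonneg k_gt_1 by (intro powr_le_mult_powr_pred) auto
    then have "Y * ((1 - r) / 2) \<le> (k * 2 powr (k - 1) + 1) * d"
      using k_gt_1 r_bounds \<theta>_bounds d_bounds x0_bounds X_ge Y_nonneg by (intro smaller_part_le_defect[OF _ _ _ _ _ _ _ _ _ _ sum_le powr_sum_ge]) auto
    then show "Y \<le> C * d"
      using r_bounds by (simp add: C_def field_simps)
  qed
qed

lemma le_linear_of_small:
  fixes G :: real
  assumes small: "\<And>\<tau>. 0 < \<tau> \<Longrightarrow> d \<le> \<tau> \<Longrightarrow> \<tau> \<le> t \<Longrightarrow> G \<le> C * \<tau>" and bound: "G \<le> B" and nonneg: "0 \<le> d" "0 \<le> C" "0 \<le> B" and t_pos: "0 < t"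
  shows "G \<le> (C + B / t) * d"
proof (cases "d < t")
  case True
  have "G \<le> C * d"
  proof (rule field_le_epsilon)
    fix \<epsilon> :: real
    assume \<epsilon>_pos: "0 < \<epsilon>"
    define \<tau> where "\<tau> = min t (d + \<epsilon> / (C + 1))"
    have "0 < \<epsilon> / (C + 1)"
      using \<epsilon>_pos nonneg by simp
    then have "0 < \<tau>" "d \<le> \<tau>" "\<tau> \<le> t" "\<tau> \<le> d + \<epsilon> / (C + 1)"
      using True nonneg(1) t_pos unfolding \<tau>_def by linarith+
    then have "G \<le> C * \<tau>" "C * \<tau> \<le> C * (d + \<epsilon> / (C + 1))"
      using nonneg by (auto intro: small mult_left_mono)
    moreover have "C * (\<epsilon> / (C + 1)) \<le> \<epsilon>"
      using \<epsilon>_pos nonneg by (simp add: field_simps)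
    ultimately show "G \<le> C * d + \<epsilon>"
      unfolding distrib_left by linarith
  qed
  moreover have "0 \<le> B / t * d"
    using nonneg t_pos by simp
  ultimately show ?thesis
    unfolding distrib_right by linarith
next
  case False
  have "B * 1 \<le> B * (d / t)"
    using nonneg t_pos False by (intro mult_left_mono) auto
  moreover have "0 \<le> C * d"
    using nonneg by simp
  ultimately show ?thesis
    unfolding distrib_right using bound by (simp add: field_simps)
qed

lemma INF_INF_le:
  fixes f :: "'b \<Rightarrow> 'c \<Rightarrow> real"
  assumes "\<And>x y. 0 \<le> f x y" "x \<in> A"
  shows "(INF x\<in>A. INF y. f x y) \<le> f x y"
proof (rule cINF_lower2[OF _ assms(2)])
  show "bdd_below ((\<lambda>x. INF y. f x y) ` A)"
    using assms by (intro bdd_belowI2[of _ 0] cINF_greatest) auto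
  show "(INF y. f x y) \<le> f x y"
    using assms by (intro cINF_lower bdd_belowI2[of _ 0]) auto
qed

lemma le_of_absorbed_terms:
  fixes V C B \<tau> \<epsilon> \<omega> :: real
  assumes "V \<le> C * (\<tau> + B * \<tau> + \<epsilon> * V + \<omega> * V)" "0 \<le> V" "C * \<epsilon> \<le> 1 / 4" "C * \<omega> \<le> 1 / 4"
  shows "V \<le> 2 * C * (1 + B) * \<tau>"
proof -
  have "C * \<epsilon> * V \<le> 1 / 4 * V" "C * \<omega> * V \<le> 1 / 4 * V"
    using assms by (intro mult_right_mono; simp)+
  with assms(1) show ?thesis
    by (simp add: algebra_simps)
qed

lemma le_sqrt_self:
  fixes x :: real
  assumes "0 \<le> x" "x \<le> 1"
  shows "x \<le> sqrt x"
  using assms by (intro real_le_rsqrt) (simp add: power2_eq_square mult_left_le)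

lemma mult_sqrt_le:
  fixes K r \<tau> :: real
  assumes K_nonneg: "0 \<le> K" and r_nonneg: "0 \<le> r" and \<tau>_le: "\<tau> \<le> (r / (K + 1))\<^sup>2"
  shows "K * sqrt \<tau> \<le> r"
proof -
  have "sqrt \<tau> \<le> r / (K + 1)"
    using \<tau>_le r_nonneg K_nonneg by (intro real_le_lsqrt) auto
  then have "K * sqrt \<tau> \<le> K * (r / (K + 1))"
    using K_nonneg by (intro mult_left_mono)
  also have "\<dots> \<le> r"
    using K_nonneg r_nonneg by (simp add: field_simps)
  finally show ?thesis .
qed

lemma small_powr_of_le_sqrt:
  fixes K C \<kappa> :: real
  assumes K_nonneg: "0 \<le> K" and C_nonneg: "0 \<le> C" and \<kappa>_pos: "0 < \<kappa>"
  obtains t where "0 < t" "\<forall>\<tau> W. 0 \<le> W \<longrightarrow> W \<le> K * sqrt \<tau> \<longrightarrow> 0 < \<tau> \<longrightarrow> \<tau> \<le> t \<longrightarrow> W \<le> 1 \<and> C * W powr \<kappa> \<le> 1 / 4"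
proof -
  define b where "b = 1 / (4 * (C + 1))"
  define r where "r = b powr (1 / \<kappa>)"
  have b_bounds: "0 < b" "b \<le> 1" "C * b \<le> 1 / 4"
    using C_nonneg by (auto simp: b_def field_simps)
  have r_powr: "0 < r" "r \<le> 1" "r powr \<kappa> = b"
    using b_bounds \<kappa>_pos by (auto simp: r_def powr_le1 powr_powr)
  show thesis
  proof (intro that allI impI)
    show "0 < (r / (K + 1))\<^sup>2"
      using r_powr K_nonneg by simp
    fix \<tau> W :: real
    assume W_bounds: "0 \<le> W" "W \<le> K * sqrt \<tau>" and \<tau>_bounds: "0 < \<tau>" "\<tau> \<le> (r / (K + 1))\<^sup>2"
    have "W \<le> r"
      using mult_sqrt_le[OF K_nonneg less_imp_le[OF r_powr(1)] \<tau>_bounds(2)] W_bounds by simp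
    moreover from this have "C * W powr \<kappa> \<le> C * b"
      using powr_mono2[of \<kappa> W r] W_bounds \<kappa>_pos r_powr C_nonneg by (intro mult_left_mono) auto
    ultimately show "W \<le> 1 \<and> C * W powr \<kappa> \<le> 1 / 4"
      using b_bounds r_powr by linarith
  qed
qed

section \<open>Closeness to a constant\<close>

lemmas integrable_reflect_sph = integrable_orthogonal_sph[OF orthogonal_transformation_reflect]
  and integral_reflect_sph = integral_orthogonal_sph[OF orthogonal_transformation_reflect]

lemma ball_mult_le_integral_hyp:
  fixes \<Delta> :: "'a::euclidean_space \<Rightarrow> real"
  assumes \<Delta>_nonneg_integrable: "integrable hyp \<Delta>" "\<And>\<xi>. norm \<xi> < 1 \<Longrightarrow> 0 \<le> \<Delta> \<xi>"
    and c_le_\<Delta>: "0 \<le> c" "\<And>\<xi>. \<xi> \<in> ball x r \<Longrightarrow> c \<le> \<Delta> \<xi>" and ball: "ball x r \<subseteq> ball 0 1"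
  shows "c * measure lborel (ball x r) \<le> (\<integral>\<xi>. \<Delta> \<xi> \<partial>hyp)"
proof -
  have \<Delta>_nonneg: "AE \<xi> in hyp. 0 \<le> \<Delta> \<xi>"
    using AE_hyp by eventually_elim (rule \<Delta>_nonneg_integrable(2))
  have "ennreal (c * measure lborel (ball x r)) = ennreal c * emeasure lborel (ball x r)"
    using c_le_\<Delta>(1) emeasure_lborel_ball_finite[of x r] by (simp add: ennreal_mult emeasure_eq_ennreal_measure)
  also have "\<dots> \<le> ennreal c * emeasure hyp (ball x r)"
    by (intro mult_left_mono emeasure_lborel_le_hyp ball) auto
  also have "\<dots> = (\<integral>\<^sup>+\<xi>. ennreal c * indicator (ball x r) \<xi> \<partial>hyp)"
    by (rule nn_integral_cmult_indicator[symmetric]) simp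
  also have "\<dots> \<le> (\<integral>\<^sup>+\<xi>. ennreal (\<Delta> \<xi>) \<partial>hyp)"
    by (intro nn_integral_mono) (use c_le_\<Delta>(2) in \<open>auto simp: indicator_def ennreal_leI\<close>)
  also have "\<dots> = ennreal (\<integral>\<xi>. \<Delta> \<xi> \<partial>hyp)"
    by (rule nn_integral_eq_integral[OF \<Delta>_nonneg_integrable(1) \<Delta>_nonneg])
  finally show ?thesis
    using integral_nonneg_AE[OF \<Delta>_nonneg] by (simp add: ennreal_le_iff)
qed

lemma extend_at_0:
  assumes [measurable]: "u \<in> borel_measurable borel"
  shows "extend s u 0 = (1 / 2) powr s * (\<integral>\<eta>. u \<eta> \<partial>sph)"
proof -
  have "extend s u 0 = (\<integral>\<eta>. (1 / 2) powr s * u \<eta> \<partial>sph)"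
    unfolding extend_def
  proof (rule integral_cong_AE)
    show "AE \<eta> in sph. kernel s 0 \<eta> * u \<eta> = (1 / 2) powr s * u \<eta>"
      using AE_sph by eventually_elim (simp add: kernel_def weight_def)
  qed measurable
  then show ?thesis
    by simp
qed

lemma integrable_inner:
  fixes \<nu> :: "'a::euclidean_space"
  assumes "norm \<nu> = 1" and [measurable]: "z \<in> borel_measurable borel" and z_integrable: "integrable sph z"
  shows "integrable sph (\<lambda>\<eta>. (\<eta> \<bullet> \<nu>) * z \<eta>)"
proof (rule Bochner_Integration.integrable_bound[OF z_integrable])
  show "AE \<eta> in sph. norm ((\<eta> \<bullet> \<nu>) * z \<eta>) \<le> norm (z \<eta>)"
    using AE_sph
  proof eventually_elim
    fix \<eta> :: 'a
    assume "norm \<eta> = 1"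
    then have "\<bar>\<eta> \<bullet> \<nu>\<bar> \<le> 1"
      using Cauchy_Schwarz_ineq2[of \<eta> \<nu>] assms(1) by simp
    then show "norm ((\<eta> \<bullet> \<nu>) * z \<eta>) \<le> norm (z \<eta>)"
      using mult_right_mono[of "\<bar>\<eta> \<bullet> \<nu>\<bar>" 1 "\<bar>z \<eta>\<bar>"] by (simp add: abs_mult)
  qed
qed simp

locale sharp_conformal_extension = conformal_extension T S m s p q for T :: "'a::euclidean_space itself" and S m s p q +
  fixes \<Gamma> :: real
  assumes \<Gamma>_pos: "0 < \<Gamma>" and sharp: "\<And>u :: 'a \<Rightarrow> real. Lp u \<Longrightarrow> energy u \<le> \<Gamma> * mass u powr (q / p)"
begin

definition near_optimal :: "real \<Rightarrow> ('a \<Rightarrow> real) \<Rightarrow> bool" where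
  "near_optimal \<tau> u \<longleftrightarrow> Lp u \<and> mass u = 1 \<and> \<Gamma> - \<tau> \<le> energy u \<and> 0 < \<tau> \<and>
     (\<forall>\<xi>. norm \<xi> < 1 \<longrightarrow> extend s (\<lambda>\<eta>. \<bar>u \<eta>\<bar>) \<xi> \<le> extend s (\<lambda>\<eta>. \<bar>u \<eta>\<bar>) 0 + \<tau>)"

definition near_maximizer :: "real \<Rightarrow> ('a \<Rightarrow> real) \<Rightarrow> bool" where
  "near_maximizer \<tau> v \<longleftrightarrow> near_optimal \<tau> v \<and> (\<forall>\<eta>. 0 \<le> v \<eta>)"

lemma near_maximizerD:
  assumes "near_maximizer \<tau> v"
  shows "Lp v" "0 \<le> v \<eta>" "mass v = 1" "\<Gamma> - \<tau> \<le> energy v" "norm \<xi> < 1 \<Longrightarrow> extend s v \<xi> \<le> extend s v 0 + \<tau>"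
    "v \<in> borel_measurable borel" "integrable sph v" "0 < \<tau>"
  using assms Lp_integrable[of v] by (auto simp: near_maximizer_def near_optimal_def LpD)

lemma energy_le_energy_abs:
  assumes Lp_u: "Lp u"
  shows "energy u \<le> energy (\<lambda>\<eta>. \<bar>u \<eta>\<bar>)"
  unfolding energy_def
proof (rule integral_mono)
  show "integrable hyp (\<lambda>\<xi>. \<bar>extend s u \<xi>\<bar> powr q)" "integrable hyp (\<lambda>\<xi>. \<bar>extend s (\<lambda>\<eta>. \<bar>u \<eta>\<bar>) \<xi>\<bar> powr q)"
    using energy_integrable Lp_u Lp_abs by auto
  show "\<bar>extend s u \<xi>\<bar> powr q \<le> \<bar>extend s (\<lambda>\<eta>. \<bar>u \<eta>\<bar>) \<xi>\<bar> powr q" for \<xi>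
    using abs_extend_le[of u \<xi>] q_gt_2 by (intro powr_mono2) auto
qed

lemma near_maximizer_abs: "near_optimal \<tau> u \<Longrightarrow> near_maximizer \<tau> (\<lambda>\<eta>. \<bar>u \<eta>\<bar>)"
  using energy_le_energy_abs[of u] by (auto simp: near_maximizer_def near_optimal_def Lp_abs mass_abs)

lemma energy_le_extend_bound:
  obtains C e where "0 < C" "0 < e" "e < q"
    "\<forall>v N. Lp v \<longrightarrow> (\<forall>\<eta>. 0 \<le> v \<eta>) \<longrightarrow> mass v \<le> 1 \<longrightarrow> 0 \<le> N \<longrightarrow> (\<forall>\<xi>. norm \<xi> < 1 \<longrightarrow> extend s v \<xi> \<le> N) \<longrightarrow> energy v \<le> C * N powr (q - e)"
proof -
  obtain C e where C_pos: "0 < C" and e_bounds: "0 < e" "e < q"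
    and strong: "\<forall>v N. Lp v \<longrightarrow> (\<forall>\<eta>. 0 \<le> v \<eta>) \<longrightarrow> mass v \<le> 1 \<longrightarrow> 0 \<le> N \<longrightarrow> (\<forall>\<xi>. norm \<xi> < 1 \<longrightarrow> extend s v \<xi> \<le> N) \<longrightarrow>
      (\<integral>\<^sup>+\<xi>. ennreal (extend s v \<xi> powr q) \<partial>hyp) \<le> ennreal (C * N powr (q - e))"
    by (rule strong_type)
  show thesis
  proof (intro that[OF C_pos e_bounds] allI impI)
    fix v :: "'a \<Rightarrow> real" and N :: real
    assume v_admissible: "Lp v" "\<forall>\<eta>. 0 \<le> v \<eta>" "mass v \<le> 1" and N_bound: "0 \<le> N" "\<forall>\<xi>. norm \<xi> < 1 \<longrightarrow> extend s v \<xi> \<le> N"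
    have "ennreal (energy v) = (\<integral>\<^sup>+\<xi>. ennreal (extend s v \<xi> powr q) \<partial>hyp)"
      using nn_integral_energy[OF v_admissible(1)] v_admissible(2) by (simp add: extend_nonneg)
    also have "\<dots> \<le> ennreal (C * N powr (q - e))"
      using strong v_admissible N_bound by blast
    finally show "energy v \<le> C * N powr (q - e)"
      using C_pos by (simp add: ennreal_le_iff)
  qed
qed

lemma mean_near_maximizer_ge:
  obtains m0 t0 where "0 < m0" "0 < t0" "\<forall>v \<tau>. near_maximizer \<tau> v \<longrightarrow> \<tau> \<le> t0 \<longrightarrow> m0 \<le> (\<integral>\<eta>. v \<eta> \<partial>sph)"
proof -
  obtain C e where C_pos: "0 < C" and e_bounds: "0 < e" "e < q"
    and bound: "\<forall>v N. Lp v \<longrightarrow> (\<forall>\<eta>. 0 \<le> v \<eta>) \<longrightarrow> mass v \<le> 1 \<longrightarrow> 0 \<le> N \<longrightarrow> (\<forall>\<xi>. norm \<xi> < 1 \<longrightarrow> extend s v \<xi> \<le> N) \<longrightarrow> energy v \<le> C * N powr (q - e)"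
    by (rule energy_le_extend_bound)
  define n0 where "n0 = (\<Gamma> / (2 * C)) powr (1 / (q - e))"
  have n0_pos: "0 < n0"
    using \<Gamma>_pos C_pos by (simp add: n0_def)
  show thesis
  proof (intro that allI impI)
    show "0 < 2 powr s * (n0 / 2)" "0 < min (\<Gamma> / 2) (n0 / 2)"
      using n0_pos \<Gamma>_pos by simp_all
    fix v \<tau>
    assume near_maximizer_v: "near_maximizer \<tau> v" and \<tau>_le: "\<tau> \<le> min (\<Gamma> / 2) (n0 / 2)"
    note maximizer = near_maximizerD[OF near_maximizer_v]
    define N where "N = extend s v 0 + \<tau>"
    have "0 \<le> extend s v 0"
      by (rule extend_nonneg) (rule maximizer(2))
    then have N_nonneg: "0 \<le> N"
      using maximizer(8) by (simp add: N_def)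
    have "energy v \<le> C * N powr (q - e)"
      using maximizer N_nonneg by (intro bound[rule_format]) (simp_all add: N_def)
    then have "\<Gamma> / (2 * C) \<le> N powr (q - e)"
      using C_pos maximizer(4) \<tau>_le by (simp add: field_simps)
    then have "n0 \<le> (N powr (q - e)) powr (1 / (q - e))"
      unfolding n0_def using \<Gamma>_pos C_pos e_bounds by (intro powr_mono2) auto
    also have "\<dots> = N"
      using N_nonneg e_bounds by (simp add: powr_powr)
    finally have "n0 / 2 \<le> extend s v 0"
      using \<tau>_le by (simp add: N_def)
    then have "2 powr s * (n0 / 2) \<le> 2 powr s * ((1 / 2) powr s * (\<integral>\<eta>. v \<eta> \<partial>sph))"
      unfolding extend_at_0[OF maximizer(6)] by (intro mult_left_mono) auto
    also have "\<dots> = (\<integral>\<eta>. v \<eta> \<partial>sph)"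
      unfolding mult.assoc[symmetric] powr_mult[symmetric] by simp
    finally show "2 powr s * (n0 / 2) \<le> (\<integral>\<eta>. v \<eta> \<partial>sph)" .
  qed
qed

lemma integral_abs_le_of_mass_1:
  assumes "Lp u" "mass u = 1"
  shows "(\<integral>\<eta>. \<bar>u \<eta>\<bar> \<partial>sph) \<le> S + 1"
proof -
  have "(\<integral>\<eta>. \<bar>u \<eta>\<bar> \<partial>sph) \<le> (\<integral>\<eta>. 1 + \<bar>u \<eta>\<bar> powr p \<partial>sph)"
    using assms Lp_integrable[OF assms(1)] LpD(2)[OF assms(1)] p_gt_1 by (intro integral_mono) (auto intro!: le_one_plus_powr)
  also have "\<dots> = S + 1"
    using assms LpD(2)[OF assms(1)] by (simp add: measure_sph_S mass_def)
  finally show ?thesis .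
qed

text \<open>The first moment is bounded by comparing \<open>extend s v\<close> at the origin and at \<open>sqrt \<tau> *\<^sub>R \<nu>\<close>,
  using \<open>X powr s \<ge> 1 + s * ln X\<close>.\<close>

lemma kernel_ge_on_axis:
  fixes \<nu> \<eta> :: 'a
  assumes unit: "norm \<nu> = 1" "norm \<eta> = 1" and t_bounds: "0 \<le> t" "t \<le> 1 / 2"
  shows "(1 / 2) powr s * (1 + s * (2 * t * (\<eta> \<bullet> \<nu>) - 3 * t\<^sup>2)) \<le> kernel s (t *\<^sub>R \<nu>) \<eta>"
proof -
  define d where "d = 1 + t\<^sup>2 - 2 * t * (\<eta> \<bullet> \<nu>)"
  have dist_eq: "(norm (t *\<^sub>R \<nu> - \<eta>))\<^sup>2 = d"
    unfolding power2_norm_eq_inner d_def using unit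
    by (simp add: inner_diff_left inner_diff_right norm_eq_1 inner_commute[of \<nu> \<eta>] power2_eq_square right_diff_distrib)
  have d_pos: "0 < d"
    unfolding dist_eq[symmetric] using unit t_bounds by auto
  have t_square: "t\<^sup>2 \<le> 1 / 4"
    using t_bounds power_mono[of t "1 / 2" 2] by (simp add: power2_eq_square)
  have "- t\<^sup>2 - 2 * (t\<^sup>2)\<^sup>2 \<le> ln (1 - t\<^sup>2)"
    using t_square by (intro ln_one_minus_pos_lower_bound) auto
  moreover have "(t\<^sup>2)\<^sup>2 \<le> 1 / 4 * t\<^sup>2"
    using mult_right_mono[OF t_square, of "t\<^sup>2"] by (simp add: power2_eq_square)
  moreover have "ln d \<le> t\<^sup>2 - 2 * t * (\<eta> \<bullet> \<nu>)"
    using ln_le_minus_one[OF d_pos] by (simp add: d_def)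
  moreover have "ln ((1 - t\<^sup>2) / d) = ln (1 - t\<^sup>2) - ln d"
    using t_square d_pos by (simp add: ln_div)
  ultimately have "2 * t * (\<eta> \<bullet> \<nu>) - 3 * t\<^sup>2 \<le> ln ((1 - t\<^sup>2) / d)"
    using zero_le_power2[of t] by linarith
  then have "1 + s * (2 * t * (\<eta> \<bullet> \<nu>) - 3 * t\<^sup>2) \<le> 1 + s * ln ((1 - t\<^sup>2) / d)"
    using s_bounds by simp
  also have "\<dots> \<le> exp (s * ln ((1 - t\<^sup>2) / d))"
    by (rule exp_ge_add_one_self)
  also have "\<dots> = ((1 - t\<^sup>2) / d) powr s"
    using d_pos t_square by (simp add: powr_def)
  finally have "(1 / 2) powr s * (1 + s * (2 * t * (\<eta> \<bullet> \<nu>) - 3 * t\<^sup>2)) \<le> (1 / 2) powr s * ((1 - t\<^sup>2) / d) powr s"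
    by (intro mult_left_mono) auto
  also have "\<dots> = kernel s (t *\<^sub>R \<nu>) \<eta>"
    unfolding powr_mult[symmetric] kernel_def dist_eq weight_def using unit by (simp add: power_mult_distrib)
  finally show ?thesis .
qed

lemma extend_ge_on_axis:
  fixes \<nu> :: 'a
  assumes norm_\<nu>: "norm \<nu> = 1" and t_bounds: "0 \<le> t" "t \<le> 1 / 2"
    and v_integrable: "v \<in> borel_measurable borel" "integrable sph v" "\<And>\<eta>. 0 \<le> v \<eta>"
  defines "M \<equiv> (\<integral>\<eta>. v \<eta> \<partial>sph)" and "I \<equiv> (\<integral>\<eta>. (\<eta> \<bullet> \<nu>) * v \<eta> \<partial>sph)"
  shows "(1 / 2) powr s * (M + s * (2 * t * I - 3 * t\<^sup>2 * M)) \<le> extend s v (t *\<^sub>R \<nu>)"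
proof -
  note moment_integrable = integrable_inner[OF norm_\<nu> v_integrable(1,2)]
  have expand: "(1 / 2) powr s * (1 + s * (2 * t * (\<eta> \<bullet> \<nu>) - 3 * t\<^sup>2)) * v \<eta>
      = (1 / 2) powr s * ((1 - 3 * s * t\<^sup>2) * v \<eta> + 2 * s * t * ((\<eta> \<bullet> \<nu>) * v \<eta>))" for \<eta>
    by (simp add: algebra_simps)
  have "(1 / 2) powr s * (M + s * (2 * t * I - 3 * t\<^sup>2 * M)) = (\<integral>\<eta>. (1 / 2) powr s * (1 + s * (2 * t * (\<eta> \<bullet> \<nu>) - 3 * t\<^sup>2)) * v \<eta> \<partial>sph)"
    unfolding expand using v_integrable(2) moment_integrable by (simp add: I_def M_def) (simp add: algebra_simps)
  also have "\<dots> \<le> extend s v (t *\<^sub>R \<nu>)"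
    unfolding extend_def
  proof (rule integral_mono_AE)
    show "integrable sph (\<lambda>\<eta>. (1 / 2) powr s * (1 + s * (2 * t * (\<eta> \<bullet> \<nu>) - 3 * t\<^sup>2)) * v \<eta>)"
      unfolding expand using v_integrable(2) moment_integrable by simp
    show "integrable sph (\<lambda>\<eta>. kernel s (t *\<^sub>R \<nu>) \<eta> * v \<eta>)"
      using t_bounds norm_\<nu> by (intro integrable_kernel_mult v_integrable) simp
    show "AE \<eta> in sph. (1 / 2) powr s * (1 + s * (2 * t * (\<eta> \<bullet> \<nu>) - 3 * t\<^sup>2)) * v \<eta> \<le> kernel s (t *\<^sub>R \<nu>) \<eta> * v \<eta>"
      using AE_sph by eventually_elim (intro mult_right_mono kernel_ge_on_axis norm_\<nu> t_bounds v_integrable(3))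
  qed
  finally show ?thesis .
qed

definition moment_bound :: real where
  "moment_bound = 2 powr s / (2 * s) + 3 / 2 * (S + 1)"

lemma moment_bound_nonneg: "0 \<le> moment_bound"
  using s_bounds S_pos by (simp add: moment_bound_def)

lemma first_moment_le:
  fixes \<nu> :: 'a
  assumes near_maximizer_v: "near_maximizer \<tau> v" and \<tau>_le: "\<tau> \<le> 1 / 4" and norm_\<nu>: "norm \<nu> = 1"
  shows "(\<integral>\<eta>. (\<eta> \<bullet> \<nu>) * v \<eta> \<partial>sph) \<le> moment_bound * sqrt \<tau>"
proof -
  note maximizer = near_maximizerD[OF near_maximizer_v]
  define I M t where "I = (\<integral>\<eta>. (\<eta> \<bullet> \<nu>) * v \<eta> \<partial>sph)" and "M = (\<integral>\<eta>. v \<eta> \<partial>sph)" and "t = sqrt \<tau>"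
  have t_square: "0 < t" "t \<le> 1 / 2" "t * t = \<tau>"
    using maximizer(8) \<tau>_le real_sqrt_le_mono[of \<tau> "1 / 4"] by (simp_all add: t_def real_sqrt_divide)
  have M_le: "M \<le> S + 1"
    using integral_abs_le_of_mass_1[OF maximizer(1,3)] maximizer(2) by (simp add: M_def)
  have "(1 / 2) powr s * (M + s * (2 * t * I - 3 * t\<^sup>2 * M)) \<le> extend s v (t *\<^sub>R \<nu>)"
    unfolding I_def M_def using t_square maximizer by (intro extend_ge_on_axis norm_\<nu>) auto
  also have "\<dots> \<le> (1 / 2) powr s * M + \<tau>"
    using maximizer(5)[of "t *\<^sub>R \<nu>"] t_square norm_\<nu> extend_at_0[OF maximizer(6)] by (simp add: M_def)
  finally have "(1 / 2) powr s * (s * (2 * t * I - 3 * t\<^sup>2 * M)) \<le> \<tau>"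
    by (simp add: distrib_left)
  then have "2 powr s * ((1 / 2) powr s * (s * (2 * t * I - 3 * t\<^sup>2 * M))) \<le> 2 powr s * \<tau>"
    by (intro mult_left_mono) auto
  then have "s * (2 * t * I - 3 * t\<^sup>2 * M) \<le> 2 powr s * \<tau>"
    unfolding mult.assoc[symmetric] powr_mult[symmetric] by simp
  then have "t * (2 * s * I) \<le> t * (t * (2 powr s + 3 * s * M))"
    unfolding t_square(3)[symmetric] by (simp add: power2_eq_square algebra_simps)
  then have "2 * s * I \<le> t * (2 powr s + 3 * s * M)"
    using t_square(1) by simp
  then have "I \<le> t * (2 powr s / (2 * s) + 3 / 2 * M)"
    using s_bounds by (simp add: field_simps)
  also have "\<dots> \<le> t * moment_bound"
    unfolding moment_bound_def using t_square M_le by (intro mult_left_mono add_left_mono) auto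
  finally show ?thesis
    by (simp add: I_def t_def mult.commute)
qed

lemma abs_first_moment_le:
  fixes \<nu> :: 'a
  assumes "near_maximizer \<tau> v" "\<tau> \<le> 1 / 4" "norm \<nu> = 1"
  shows "\<bar>\<integral>\<eta>. (\<eta> \<bullet> \<nu>) * v \<eta> \<partial>sph\<bar> \<le> moment_bound * sqrt \<tau>"
  using first_moment_le[OF assms] first_moment_le[OF assms(1,2), of "- \<nu>"] assms(3) by (simp add: abs_le_iff)

definition kernel_gap :: "'a \<Rightarrow> 'a \<Rightarrow> real" where
  "kernel_gap \<nu> \<xi> = s * 4 powr - s * (weight \<xi> powr s * (\<xi> \<bullet> \<nu>))"

lemma kernel_gap_nonneg: "0 \<le> \<xi> \<bullet> \<nu> \<Longrightarrow> 0 \<le> kernel_gap \<nu> \<xi>"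
  using s_bounds by (simp add: kernel_gap_def)

lemma kernel_gap_ge_on_ball:
  fixes \<nu> \<xi> :: 'a
  assumes unit: "norm \<nu> = 1" and \<xi>_in: "\<xi> \<in> ball (\<nu> /\<^sub>R 2) (1 / 4)"
  shows "norm \<xi> \<le> 3 / 4" "0 \<le> \<xi> \<bullet> \<nu>" "s * 4 powr - s * ((7 / 32) powr s * (1 / 4)) \<le> kernel_gap \<nu> \<xi>"
proof -
  have dist: "norm (\<xi> - \<nu> /\<^sub>R 2) < 1 / 4"
    using \<xi>_in by (simp add: dist_norm norm_minus_commute)
  then show norm: "norm \<xi> \<le> 3 / 4"
    using norm_triangle_ineq[of "\<xi> - \<nu> /\<^sub>R 2" "\<nu> /\<^sub>R 2"] unit by simp
  have "\<bar>(\<xi> - \<nu> /\<^sub>R 2) \<bullet> \<nu>\<bar> \<le> 1 / 4"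
    using Cauchy_Schwarz_ineq2[of "\<xi> - \<nu> /\<^sub>R 2" \<nu>] dist unit by simp
  moreover have "(\<xi> - \<nu> /\<^sub>R 2) \<bullet> \<nu> = \<xi> \<bullet> \<nu> - 1 / 2"
    using unit by (simp add: inner_diff_left norm_eq_1)
  ultimately have inner: "1 / 4 \<le> \<xi> \<bullet> \<nu>"
    unfolding abs_le_iff by linarith
  then show "0 \<le> \<xi> \<bullet> \<nu>"
    by simp
  have "7 / 32 \<le> weight \<xi>"
    using power_mono[OF norm, of 2] by (simp add: weight_def power2_eq_square)
  then show "s * 4 powr - s * ((7 / 32) powr s * (1 / 4)) \<le> kernel_gap \<nu> \<xi>"
    unfolding kernel_gap_def using s_bounds inner by (intro mult_left_mono mult_mono powr_mono2) auto
qed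

lemma kernel_reflect_diff_ge:
  fixes \<nu> \<xi> \<eta> :: 'a
  assumes norm_\<nu>: "norm \<nu> = 1" and norm_\<eta>: "norm \<eta> = 1" and norm_\<xi>: "norm \<xi> < 1" and pos: "0 \<le> \<xi> \<bullet> \<nu>" "0 \<le> \<eta> \<bullet> \<nu>"
  shows "kernel_gap \<nu> \<xi> * (\<eta> \<bullet> \<nu>) \<le> kernel s \<xi> \<eta> - kernel s (reflect \<nu> \<xi>) \<eta>"
proof -
  define X Y where "X = (norm (\<xi> - \<eta>))\<^sup>2" and "Y = (norm (reflect \<nu> \<xi> - \<eta>))\<^sup>2"
  have inside: "norm (reflect \<nu> \<xi>) < 1"
    using norm_\<xi> norm_\<nu> by simp
  have pos_XY: "0 < X" "0 < Y"
    using norm_\<xi> inside norm_\<eta> by (auto simp: X_def Y_def)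
  have "norm (reflect \<nu> \<xi> - \<eta>) \<le> 2"
    using norm_triangle_ineq4[of "reflect \<nu> \<xi>" \<eta>] inside norm_\<eta> by simp
  then have Y_le: "Y \<le> 4"
    using power_mono[of "norm (reflect \<nu> \<xi> - \<eta>)" 2 2] by (simp add: Y_def)
  have diff: "Y - X = 4 * ((\<xi> \<bullet> \<nu>) * (\<eta> \<bullet> \<nu>))"
    unfolding X_def Y_def power2_norm_eq_inner using norm_reflect[OF norm_\<nu>, of \<xi>] norm_\<nu>
    by (simp add: inner_diff_left inner_diff_right inner_commute norm_eq_sqrt_inner[of "reflect \<nu> \<xi>"] norm_eq_sqrt_inner[of \<xi>])
      (simp add: reflect_def inner_diff_right inner_commute)
  have "4 powr (- s - 1) \<le> Y powr (- s - 1)"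
    using s_bounds pos_XY Y_le by (intro powr_mono2') auto
  moreover have "0 \<le> Y - X"
    unfolding diff using pos by simp
  ultimately have "s * 4 powr (- s - 1) * (Y - X) \<le> s * Y powr (- s - 1) * (Y - X)"
    using s_bounds by (intro mult_right_mono mult_left_mono) auto
  also have "\<dots> \<le> X powr - s - Y powr - s"
    using s_bounds pos_XY by (intro powr_minus_diff_ge)
  finally have "weight \<xi> powr s * (s * 4 powr (- s - 1) * (Y - X)) \<le> weight \<xi> powr s * (X powr - s - Y powr - s)"
    by (intro mult_left_mono) auto
  also have "\<dots> = kernel s \<xi> \<eta> - kernel s (reflect \<nu> \<xi>) \<eta>"
    unfolding kernel_def X_def[symmetric] Y_def[symmetric] weight_def norm_reflect[OF norm_\<nu>]
    by (simp only: powr_divide powr_minus_divide right_diff_distrib) simp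
  finally show ?thesis
    unfolding diff by (simp add: kernel_gap_def powr_diff mult_ac)
qed

lemma kernel_reflect_diff_mult_ge:
  fixes \<nu> \<xi> \<eta> :: 'a
  assumes norm_\<nu>: "norm \<nu> = 1" and norm_\<eta>: "norm \<eta> = 1" and \<xi>_half_ball: "norm \<xi> < 1" "0 \<le> \<xi> \<bullet> \<nu>" and sign: "0 \<le> (\<eta> \<bullet> \<nu>) * z"
  shows "kernel_gap \<nu> \<xi> * ((\<eta> \<bullet> \<nu>) * z) \<le> (kernel s \<xi> \<eta> - kernel s (reflect \<nu> \<xi>) \<eta>) * z"
proof (cases "\<eta> \<bullet> \<nu>" "0 :: real" rule: linorder_cases)
  case equal
  then show ?thesis
    using norm_\<nu> by (simp add: kernel_reflect_swap reflect_eq_self)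
next
  case greater
  then have "kernel_gap \<nu> \<xi> * (\<eta> \<bullet> \<nu>) * z \<le> (kernel s \<xi> \<eta> - kernel s (reflect \<nu> \<xi>) \<eta>) * z"
    using sign by (intro mult_right_mono kernel_reflect_diff_ge norm_\<nu> norm_\<eta> \<xi>_half_ball) (auto simp: zero_le_mult_iff)
  then show ?thesis
    by (simp add: mult.assoc)
next
  case less
  have "kernel_gap \<nu> \<xi> * (reflect \<nu> \<eta> \<bullet> \<nu>) \<le> kernel s \<xi> (reflect \<nu> \<eta>) - kernel s (reflect \<nu> \<xi>) (reflect \<nu> \<eta>)"
    using less norm_\<nu> norm_\<eta> by (intro kernel_reflect_diff_ge \<xi>_half_ball) auto
  then have "kernel s \<xi> \<eta> - kernel s (reflect \<nu> \<xi>) \<eta> \<le> kernel_gap \<nu> \<xi> * (\<eta> \<bullet> \<nu>)"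
    using norm_\<nu> by (simp add: kernel_reflect_swap)
  then have "kernel_gap \<nu> \<xi> * (\<eta> \<bullet> \<nu>) * z \<le> (kernel s \<xi> \<eta> - kernel s (reflect \<nu> \<xi>) \<eta>) * z"
    using sign less by (intro mult_right_mono_neg) (auto simp: zero_le_mult_iff)
  then show ?thesis
    by (simp add: mult.assoc)
qed

lemma extend_odd_ge:
  fixes \<nu> \<xi> :: 'a
  assumes norm_\<nu>: "norm \<nu> = 1" and z_integrable: "z \<in> borel_measurable borel" "integrable sph z"
    and odd: "extend s z (reflect \<nu> \<xi>) = - extend s z \<xi>" and sign: "\<And>\<eta>. 0 \<le> (\<eta> \<bullet> \<nu>) * z \<eta>"
    and \<xi>_half_ball: "norm \<xi> < 1" "0 \<le> \<xi> \<bullet> \<nu>"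
  shows "kernel_gap \<nu> \<xi> / 2 * (\<integral>\<eta>. (\<eta> \<bullet> \<nu>) * z \<eta> \<partial>sph) \<le> extend s z \<xi>"
proof -
  have "norm (reflect \<nu> \<xi>) < 1"
    using \<xi>_half_ball norm_\<nu> by simp
  then have kernel_integrable: "integrable sph (\<lambda>\<eta>. kernel s \<xi> \<eta> * z \<eta>)" "integrable sph (\<lambda>\<eta>. kernel s (reflect \<nu> \<xi>) \<eta> * z \<eta>)"
    using \<xi>_half_ball(1) z_integrable by (auto intro: integrable_kernel_mult)
  have "(\<integral>\<eta>. kernel_gap \<nu> \<xi> * ((\<eta> \<bullet> \<nu>) * z \<eta>) \<partial>sph) \<le> (\<integral>\<eta>. (kernel s \<xi> \<eta> - kernel s (reflect \<nu> \<xi>) \<eta>) * z \<eta> \<partial>sph)"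
  proof (rule integral_mono_AE)
    show "integrable sph (\<lambda>\<eta>. kernel_gap \<nu> \<xi> * ((\<eta> \<bullet> \<nu>) * z \<eta>))"
      using integrable_inner[OF norm_\<nu> z_integrable] by simp
    show "integrable sph (\<lambda>\<eta>. (kernel s \<xi> \<eta> - kernel s (reflect \<nu> \<xi>) \<eta>) * z \<eta>)"
      using kernel_integrable by (simp add: left_diff_distrib)
    show "AE \<eta> in sph. kernel_gap \<nu> \<xi> * ((\<eta> \<bullet> \<nu>) * z \<eta>) \<le> (kernel s \<xi> \<eta> - kernel s (reflect \<nu> \<xi>) \<eta>) * z \<eta>"
      using AE_sph by eventually_elim (rule kernel_reflect_diff_mult_ge[OF norm_\<nu> _ \<xi>_half_ball sign])
  qed
  also have "\<dots> = extend s z \<xi> - extend s z (reflect \<nu> \<xi>)"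
    unfolding extend_def using kernel_integrable by (simp add: left_diff_distrib)
  finally show ?thesis
    by (simp add: odd)
qed

definition polar :: "'a \<Rightarrow> ('a \<Rightarrow> real) \<Rightarrow> 'a \<Rightarrow> real" where
  "polar \<nu> v \<eta> = (if 0 \<le> \<eta> \<bullet> \<nu> then max (v \<eta>) (v (reflect \<nu> \<eta>)) else min (v \<eta>) (v (reflect \<nu> \<eta>)))"

definition polar_gain :: "'a \<Rightarrow> ('a \<Rightarrow> real) \<Rightarrow> 'a \<Rightarrow> real" where
  "polar_gain \<nu> v \<eta> = polar \<nu> v \<eta> - v \<eta>"

lemma polar_borel [measurable]:
  assumes [measurable]: "v \<in> borel_measurable borel"
  shows "polar \<nu> v \<in> borel_measurable borel" "polar_gain \<nu> v \<in> borel_measurable borel"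
  unfolding polar_gain_def[abs_def] polar_def[abs_def] by measurable

lemma polar_nonneg: "(\<And>\<eta>. 0 \<le> v \<eta>) \<Longrightarrow> 0 \<le> polar \<nu> v \<eta>"
  by (simp add: polar_def max_def min_def)

lemma inner_polar_gain_nonneg: "0 \<le> (\<eta> \<bullet> \<nu>) * polar_gain \<nu> v \<eta>"
  by (auto simp: polar_gain_def polar_def max_def min_def zero_le_mult_iff)

lemma Lp_reflect:
  assumes norm_\<nu>: "norm \<nu> = 1" and Lp_v: "Lp v"
  shows "Lp (\<lambda>\<eta>. v (reflect \<nu> \<eta>))"
proof -
  note [measurable] = LpD(1)[OF Lp_v]
  show ?thesis
    using integrable_reflect_sph[OF norm_\<nu>, of "\<lambda>\<eta>. \<bar>v \<eta>\<bar> powr p"] LpD(2)[OF Lp_v] by (simp add: Lp_def)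
qed

context
  fixes \<nu> :: 'a and v :: "'a \<Rightarrow> real"
  assumes unit: "norm \<nu> = 1"
begin

lemma polar_reflect: "polar \<nu> (\<lambda>\<eta>. v (reflect \<nu> \<eta>)) = polar \<nu> v"
  using unit by (simp add: fun_eq_iff polar_def max.commute min.commute)

lemma polar_add_reflect: "f (polar \<nu> v \<eta>) + f (polar \<nu> v (reflect \<nu> \<eta>)) = f (v \<eta>) + (f (v (reflect \<nu> \<eta>)) :: real)"
  using unit by (cases "\<eta> \<bullet> \<nu>" "0::real" rule: linorder_cases) (auto simp: polar_def max_def min_def reflect_eq_self)

lemma polar_gain_reflect: "polar_gain \<nu> v (reflect \<nu> \<eta>) = - polar_gain \<nu> v \<eta>"
  using polar_add_reflect[of "\<lambda>x. x" \<eta>] by (simp add: polar_gain_def)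

lemma integral_polar:
  fixes f :: "real \<Rightarrow> real"
  assumes [measurable]: "v \<in> borel_measurable borel" "f \<in> borel_measurable borel"
    and integrable: "integrable sph (\<lambda>\<eta>. f (polar \<nu> v \<eta>))" "integrable sph (\<lambda>\<eta>. f (v \<eta>))"
  shows "(\<integral>\<eta>. f (polar \<nu> v \<eta>) \<partial>sph) = (\<integral>\<eta>. f (v \<eta>) \<partial>sph)"
proof -
  have "(\<integral>\<eta>. f (polar \<nu> v \<eta>) + f (polar \<nu> v (reflect \<nu> \<eta>)) \<partial>sph) = (\<integral>\<eta>. f (v \<eta>) + f (v (reflect \<nu> \<eta>)) \<partial>sph)"
    by (simp only: polar_add_reflect)
  then show ?thesis
    using integrable integrable_reflect_sph[OF unit, of "\<lambda>\<eta>. f (polar \<nu> v \<eta>)"] integrable_reflect_sph[OF unit, of "\<lambda>\<eta>. f (v \<eta>)"]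
      integral_reflect_sph[OF unit, of "\<lambda>\<eta>. f (polar \<nu> v \<eta>)"] integral_reflect_sph[OF unit, of "\<lambda>\<eta>. f (v \<eta>)"] by simp
qed

lemma Lp_polar:
  assumes Lp_v: "Lp v"
  shows "Lp (polar \<nu> v)"
proof -
  note [measurable] = LpD(1)[OF Lp_v]
  have "integrable sph (\<lambda>\<eta>. \<bar>polar \<nu> v \<eta>\<bar> powr p)"
  proof (rule Bochner_Integration.integrable_bound[of _ "\<lambda>\<eta>. \<bar>v \<eta>\<bar> powr p + \<bar>v (reflect \<nu> \<eta>)\<bar> powr p"])
    show "AE \<eta> in sph. norm (\<bar>polar \<nu> v \<eta>\<bar> powr p) \<le> norm (\<bar>v \<eta>\<bar> powr p + \<bar>v (reflect \<nu> \<eta>)\<bar> powr p)"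
      by (intro AE_I2) (auto simp: polar_def max_def min_def)
  qed (use LpD(2)[OF Lp_v] LpD(2)[OF Lp_reflect[OF unit Lp_v]] in auto)
  then show ?thesis
    unfolding Lp_def by simp
qed

lemma
  assumes Lp_v: "Lp v"
  shows mass_polar: "mass (polar \<nu> v) = mass v"
    and mean_polar: "(\<integral>\<eta>. polar \<nu> v \<eta> \<partial>sph) = (\<integral>\<eta>. v \<eta> \<partial>sph)"
  unfolding mass_def
  using integral_polar[OF LpD(1)[OF Lp_v], of "\<lambda>x. \<bar>x\<bar> powr p"] integral_polar[OF LpD(1)[OF Lp_v], of "\<lambda>x. x"]
    LpD(2)[OF Lp_v] LpD(2)[OF Lp_polar[OF Lp_v]] Lp_integrable[OF Lp_v] Lp_integrable[OF Lp_polar[OF Lp_v]] by simp_all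

lemma
  assumes Lp_v: "Lp v"
  shows integrable_polar_gain: "integrable sph (polar_gain \<nu> v)"
    and extend_polar_gain: "norm \<xi> < 1 \<Longrightarrow> extend s (polar_gain \<nu> v) \<xi> = extend s (polar \<nu> v) \<xi> - extend s v \<xi>"
  unfolding polar_gain_def[abs_def]
  using Lp_v Lp_polar[OF Lp_v] by (auto intro!: extend_diff simp: Lp_integrable LpD)

lemma extend_polar_gain_reflect:
  assumes Lp_v: "Lp v"
  shows "extend s (polar_gain \<nu> v) (reflect \<nu> \<xi>) = - extend s (polar_gain \<nu> v) \<xi>"
  using extend_orthogonal[OF orthogonal_transformation_reflect[OF unit], of "polar_gain \<nu> v" s \<xi>] LpD(1)[OF Lp_v]
  by (simp add: polar_gain_reflect) (simp add: extend_def)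

lemma extend_polar_gain_ge:
  assumes Lp_v: "Lp v" and \<xi>_half_ball: "norm \<xi> < 1" "0 \<le> \<xi> \<bullet> \<nu>"
  shows "kernel_gap \<nu> \<xi> / 2 * (\<integral>\<eta>. (\<eta> \<bullet> \<nu>) * polar_gain \<nu> v \<eta> \<partial>sph) \<le> extend s (polar_gain \<nu> v) \<xi>"
  using LpD(1)[OF Lp_v]
  by (intro extend_odd_ge unit integrable_polar_gain extend_polar_gain_reflect inner_polar_gain_nonneg Lp_v \<xi>_half_ball) simp

lemma moment_polar_gain_nonneg: "0 \<le> (\<integral>\<eta>. (\<eta> \<bullet> \<nu>) * polar_gain \<nu> v \<eta> \<partial>sph)"
  by (simp add: inner_polar_gain_nonneg)

lemma extend_polar_gain_nonneg:
  assumes "Lp v" "norm \<xi> < 1" "0 \<le> \<xi> \<bullet> \<nu>"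
  shows "0 \<le> extend s (polar_gain \<nu> v) \<xi>"
  using extend_polar_gain_ge[OF assms] moment_polar_gain_nonneg kernel_gap_nonneg[OF assms(3)]
  by (meson divide_nonneg_pos mult_nonneg_nonneg order_trans zero_less_numeral)

lemma
  assumes Lp_v: "Lp v"
  shows energy_reflect_integrable: "integrable hyp (\<lambda>\<xi>. \<bar>extend s v (reflect \<nu> \<xi>)\<bar> powr q)"
    and energy_reflect: "(\<integral>\<xi>. \<bar>extend s v (reflect \<nu> \<xi>)\<bar> powr q \<partial>hyp) = energy v"
proof -
  note [measurable] = LpD(1)[OF Lp_v]
  have substitution: "(\<integral>\<^sup>+x. ennreal 1 * g (reflect \<nu> x) \<partial>hyp) = (\<integral>\<^sup>+y. g y \<partial>hyp)" if "g \<in> borel_measurable hyp" for g :: "'a \<Rightarrow> ennreal"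
    using that nn_integral_orthogonal_hyp[OF orthogonal_transformation_reflect[OF unit]] by simp
  show "integrable hyp (\<lambda>\<xi>. \<bar>extend s v (reflect \<nu> \<xi>)\<bar> powr q)"
    "(\<integral>\<xi>. \<bar>extend s v (reflect \<nu> \<xi>)\<bar> powr q \<partial>hyp) = energy v"
    using bochner_integral_change_of_variables[OF substitution, of "\<lambda>\<xi>. \<bar>extend s v \<xi>\<bar> powr q"] energy_integrable[OF Lp_v]
    by (simp_all add: energy_def)
qed

end

definition polar_energy_gain :: "'a \<Rightarrow> ('a \<Rightarrow> real) \<Rightarrow> 'a \<Rightarrow> real" where
  "polar_energy_gain \<nu> v \<xi> = \<bar>extend s (polar \<nu> v) \<xi>\<bar> powr q + \<bar>extend s (polar \<nu> v) (reflect \<nu> \<xi>)\<bar> powr q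
     - \<bar>extend s v \<xi>\<bar> powr q - \<bar>extend s v (reflect \<nu> \<xi>)\<bar> powr q"

context
  fixes \<nu> :: 'a and v :: "'a \<Rightarrow> real"
  assumes unit: "norm \<nu> = 1" and Lp_v: "Lp v" and v_nonneg: "\<And>\<eta>. 0 \<le> v \<eta>"
begin

lemma integrable_polar_energy_gain: "integrable hyp (polar_energy_gain \<nu> v)"
  and integral_polar_energy_gain: "(\<integral>\<xi>. polar_energy_gain \<nu> v \<xi> \<partial>hyp) = 2 * energy (polar \<nu> v) - 2 * energy v"
  unfolding polar_energy_gain_def[abs_def]
  using energy_reflect_integrable[OF unit] energy_integrable Lp_v Lp_polar[OF unit Lp_v] energy_reflect[OF unit] by (simp_all add: energy_def)

lemma extend_polar_ge:
  assumes "norm \<xi> \<le> R" "R < 1"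
  shows "((1 - R\<^sup>2) / 8) powr s * (\<integral>\<eta>. v \<eta> \<partial>sph) \<le> extend s (polar \<nu> v) (reflect \<nu> \<xi>)"
  using extend_ge[of "reflect \<nu> \<xi>" R "polar \<nu> v"] assms unit LpD(1)[OF Lp_v] polar_nonneg[OF v_nonneg] Lp_integrable[OF Lp_polar[OF unit Lp_v]]
  by (simp add: mean_polar[OF unit Lp_v])

lemma polar_energy_gain_ge:
  assumes \<xi>_half_ball: "norm \<xi> < 1" "0 \<le> \<xi> \<bullet> \<nu>" and mean: "0 < (\<integral>\<eta>. v \<eta> \<partial>sph)"
  shows "q * (q - 1) * extend s (polar \<nu> v) (reflect \<nu> \<xi>) powr (q - 2) * extend s (polar_gain \<nu> (\<lambda>\<eta>. v (reflect \<nu> \<eta>))) \<xi> * extend s (polar_gain \<nu> v) \<xi>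
    \<le> polar_energy_gain \<nu> v \<xi>"
proof -
  define a G G' where "a = extend s (polar \<nu> v) (reflect \<nu> \<xi>)" and "G = extend s (polar_gain \<nu> v) \<xi>"
    and "G' = extend s (polar_gain \<nu> (\<lambda>\<eta>. v (reflect \<nu> \<eta>))) \<xi>"
  note Lp_v_reflect = Lp_reflect[OF unit Lp_v]
  have "0 < ((1 - (norm \<xi>)\<^sup>2) / 8) powr s * (\<integral>\<eta>. v \<eta> \<partial>sph)"
    using weight_pos[OF \<xi>_half_ball(1)] mean by (simp add: weight_def)
  then have a_pos: "0 < a"
    using extend_polar_ge[OF order_refl \<xi>_half_ball(1)] by (simp add: a_def)
  have gains: "0 \<le> G" "0 \<le> G'"
    unfolding G_def G'_def using extend_polar_gain_nonneg[OF unit _ \<xi>_half_ball] Lp_v Lp_v_reflect by blast+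
  have "- G = a - extend s v (reflect \<nu> \<xi>)"
    unfolding G_def a_def using extend_polar_gain[OF unit Lp_v, of "reflect \<nu> \<xi>"] \<xi>_half_ball(1) unit by (simp add: extend_polar_gain_reflect[OF unit Lp_v])
  moreover have "G = extend s (polar \<nu> v) \<xi> - extend s v \<xi>"
    unfolding G_def by (rule extend_polar_gain[OF unit Lp_v \<xi>_half_ball(1)])
  moreover have "G' = extend s (polar \<nu> v) \<xi> - extend s v (reflect \<nu> \<xi>)"
    unfolding G'_def using extend_polar_gain[OF unit Lp_v_reflect \<xi>_half_ball(1)] extend_orthogonal[OF orthogonal_transformation_reflect[OF unit] LpD(1)[OF Lp_v]]
    by (simp add: polar_reflect[OF unit])
  ultimately have extend_eqs: "extend s v \<xi> = a + G'" "extend s v (reflect \<nu> \<xi>) = a + G" "extend s (polar \<nu> v) \<xi> = a + G' + G"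
    by simp_all
  have "q * (q - 1) * a powr (q - 2) * G' * G \<le> (a + G' + G) powr q + a powr q - (a + G') powr q - (a + G) powr q"
    by (rule powr_second_difference[OF q_gt_2 a_pos gains(2,1)])
  also have "\<dots> = polar_energy_gain \<nu> v \<xi>"
    unfolding polar_energy_gain_def a_def[symmetric] extend_eqs using a_pos gains by simp
  finally show ?thesis
    by (simp add: a_def G_def G'_def)
qed

lemma polar_energy_gain_nonneg:
  assumes norm_\<xi>: "norm \<xi> < 1" and mean: "0 < (\<integral>\<eta>. v \<eta> \<partial>sph)"
  shows "0 \<le> polar_energy_gain \<nu> v \<xi>"
proof -
  have half_ball: "0 \<le> polar_energy_gain \<nu> v \<xi>" if "norm \<xi> < 1" "0 \<le> \<xi> \<bullet> \<nu>" for \<xi>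
    using polar_energy_gain_ge[OF that mean] extend_polar_gain_nonneg[OF unit _ that] Lp_v Lp_reflect[OF unit Lp_v] q_gt_2
    by (smt (verit) mult_nonneg_nonneg powr_ge_zero)
  show ?thesis
  proof (cases "0 \<le> \<xi> \<bullet> \<nu>")
    case False
    have "polar_energy_gain \<nu> v (reflect \<nu> \<xi>) = polar_energy_gain \<nu> v \<xi>"
      using unit by (simp add: polar_energy_gain_def)
    then show ?thesis
      using half_ball[of "reflect \<nu> \<xi>"] False norm_\<xi> unit by simp
  qed (use half_ball norm_\<xi> in simp)
qed

end

definition polar_const :: "real \<Rightarrow> real" where
  "polar_const m0 = q * (q - 1) * (((1 - (3 / 4)\<^sup>2) / 8) powr s * m0) powr (q - 2) * (s * 4 powr - s * ((7 / 32) powr s * (1 / 4)) / 2)\<^sup>2"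

lemma polar_const_pos: "0 < m0 \<Longrightarrow> 0 < polar_const m0"
  using q_gt_2 s_bounds by (simp add: polar_const_def power2_eq_square)

definition polarization_bound :: "real \<Rightarrow> real" where
  "polarization_bound m0 = 2 / (polar_const m0 * measure lborel (ball (0::'a) (1 / 4)))"

lemma polarization_bound_nonneg: "0 < m0 \<Longrightarrow> 0 \<le> polarization_bound m0"
  using polar_const_pos[of m0] by (simp add: polarization_bound_def)

context
  fixes \<nu> :: 'a and v :: "'a \<Rightarrow> real" and m0 \<tau> :: real
  assumes unit: "norm \<nu> = 1" and near_maximizer_v: "near_maximizer \<tau> v" and m0_bounds: "0 < m0" "m0 \<le> (\<integral>\<eta>. v \<eta> \<partial>sph)"
begin

lemma polar_energy_gain_ge_on_ball:
  assumes \<xi>_in: "\<xi> \<in> ball (\<nu> /\<^sub>R 2) (1 / 4)"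
  shows "polar_const m0 * ((\<integral>\<eta>. (\<eta> \<bullet> \<nu>) * polar_gain \<nu> v \<eta> \<partial>sph) * (\<integral>\<eta>. (\<eta> \<bullet> \<nu>) * polar_gain \<nu> (\<lambda>\<eta>. v (reflect \<nu> \<eta>)) \<eta> \<partial>sph))
    \<le> polar_energy_gain \<nu> v \<xi>"
proof -
  note maximizer = near_maximizerD[OF near_maximizer_v]
  note Lp_v_reflect = Lp_reflect[OF unit maximizer(1)]
  note ball = kernel_gap_ge_on_ball[OF unit \<xi>_in]
  define c A B where "c = s * 4 powr - s * ((7 / 32) powr s * (1 / 4)) / 2" and "A = (\<integral>\<eta>. (\<eta> \<bullet> \<nu>) * polar_gain \<nu> v \<eta> \<partial>sph)"
    and "B = (\<integral>\<eta>. (\<eta> \<bullet> \<nu>) * polar_gain \<nu> (\<lambda>\<eta>. v (reflect \<nu> \<eta>)) \<eta> \<partial>sph)"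
  have inside: "norm \<xi> < 1"
    using ball(1) by simp
  have moments: "0 \<le> A" "0 \<le> B"
    unfolding A_def B_def by (rule moment_polar_gain_nonneg[OF unit])+
  have c_bounds: "0 \<le> c" "c \<le> kernel_gap \<nu> \<xi> / 2"
    using ball(3) s_bounds by (simp_all add: c_def)
  have gains: "c * A \<le> extend s (polar_gain \<nu> v) \<xi>" "c * B \<le> extend s (polar_gain \<nu> (\<lambda>\<eta>. v (reflect \<nu> \<eta>))) \<xi>"
    using mult_right_mono[OF c_bounds(2) moments(1)] mult_right_mono[OF c_bounds(2) moments(2)]
      extend_polar_gain_ge[OF unit maximizer(1) inside ball(2)] extend_polar_gain_ge[OF unit Lp_v_reflect inside ball(2)]
    unfolding A_def B_def by linarith+
  have "((1 - (3 / 4)\<^sup>2) / 8) powr s * m0 \<le> ((1 - (3 / 4)\<^sup>2) / 8) powr s * (\<integral>\<eta>. v \<eta> \<partial>sph)"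
    using m0_bounds by (intro mult_left_mono) auto
  also have "\<dots> \<le> extend s (polar \<nu> v) (reflect \<nu> \<xi>)"
    using ball(1) by (intro extend_polar_ge unit maximizer) auto
  finally have "q * (q - 1) * (((1 - (3 / 4)\<^sup>2) / 8) powr s * m0) powr (q - 2) * (c * B) * (c * A)
    \<le> q * (q - 1) * extend s (polar \<nu> v) (reflect \<nu> \<xi>) powr (q - 2) * extend s (polar_gain \<nu> (\<lambda>\<eta>. v (reflect \<nu> \<eta>))) \<xi> * extend s (polar_gain \<nu> v) \<xi>"
    using q_gt_2 m0_bounds c_bounds(1) moments gains extend_polar_gain_nonneg[OF unit Lp_v_reflect inside ball(2)] by (intro mult_mono powr_mono2) auto
  also have "\<dots> \<le> polar_energy_gain \<nu> v \<xi>"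
    using m0_bounds by (intro polar_energy_gain_ge unit maximizer inside ball(2)) auto
  finally show ?thesis
    by (simp add: polar_const_def c_def A_def B_def power2_eq_square mult_ac)
qed

lemma polarization_estimate:
  "(\<integral>\<eta>. (\<eta> \<bullet> \<nu>) * polar_gain \<nu> v \<eta> \<partial>sph) * (\<integral>\<eta>. (\<eta> \<bullet> \<nu>) * polar_gain \<nu> (\<lambda>\<eta>. v (reflect \<nu> \<eta>)) \<eta> \<partial>sph) \<le> polarization_bound m0 * \<tau>"
proof -
  note maximizer = near_maximizerD[OF near_maximizer_v]
  define P V where "P = (\<integral>\<eta>. (\<eta> \<bullet> \<nu>) * polar_gain \<nu> v \<eta> \<partial>sph) * (\<integral>\<eta>. (\<eta> \<bullet> \<nu>) * polar_gain \<nu> (\<lambda>\<eta>. v (reflect \<nu> \<eta>)) \<eta> \<partial>sph)"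
    and "V = measure lborel (ball (0::'a) (1 / 4))"
  have V_pos: "0 < V"
    unfolding V_def by (rule content_ball_pos) simp
  have mean: "0 < (\<integral>\<eta>. v \<eta> \<partial>sph)"
    using m0_bounds by simp
  have "ball (\<nu> /\<^sub>R 2) (1 / 4) \<subseteq> ball 0 1"
    using kernel_gap_ge_on_ball(1)[OF unit] by (intro subsetI) fastforce
  moreover have "0 \<le> polar_const m0 * P"
    unfolding P_def using polar_const_pos[OF m0_bounds(1)] moment_polar_gain_nonneg[OF unit] by (intro mult_nonneg_nonneg) auto
  ultimately have "polar_const m0 * P * measure lborel (ball (\<nu> /\<^sub>R 2) (1 / 4)) \<le> (\<integral>\<xi>. polar_energy_gain \<nu> v \<xi> \<partial>hyp)"
    using polar_energy_gain_nonneg[OF unit maximizer(1,2) _ mean] polar_energy_gain_ge_on_ball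
    by (intro ball_mult_le_integral_hyp integrable_polar_energy_gain[OF unit maximizer(1,2)]) (auto simp: P_def)
  also have "\<dots> \<le> 2 * \<tau>"
    using sharp[OF Lp_polar[OF unit maximizer(1)]] maximizer(3,4) by (simp add: integral_polar_energy_gain[OF unit maximizer(1,2)] mass_polar[OF unit maximizer(1)])
  also have "measure lborel (ball (\<nu> /\<^sub>R 2) (1 / 4)) = V"
    unfolding V_def using content_ball_conv_unit_ball[of "1 / 4" "\<nu> /\<^sub>R 2"] content_ball_conv_unit_ball[of "1 / 4" "0::'a"] by simp
  finally show ?thesis
    using polar_const_pos[OF m0_bounds(1)] V_pos by (simp add: polarization_bound_def P_def V_def[symmetric] field_simps)
qed

lemma
  shows integrable_reflect_diff: "integrable sph (\<lambda>\<eta>. \<bar>v (reflect \<nu> \<eta>) - v \<eta>\<bar> * \<bar>\<eta> \<bullet> \<nu>\<bar>)"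
    and integral_reflect_diff_le: "\<tau> \<le> 1 / 4 \<Longrightarrow>
      (\<integral>\<eta>. \<bar>v (reflect \<nu> \<eta>) - v \<eta>\<bar> * \<bar>\<eta> \<bullet> \<nu>\<bar> \<partial>sph) \<le> sqrt (4 * moment_bound\<^sup>2 + 4 * polarization_bound m0) * sqrt \<tau>"
proof -
  note maximizer = near_maximizerD[OF near_maximizer_v]
  note [measurable] = maximizer(6)
  note Lp_v_reflect = Lp_reflect[OF unit maximizer(1)]
  let ?z = "polar_gain \<nu> v" and ?z' = "polar_gain \<nu> (\<lambda>\<eta>. v (reflect \<nu> \<eta>))"
  define A B I where "A = (\<integral>\<eta>. (\<eta> \<bullet> \<nu>) * ?z \<eta> \<partial>sph)" and "B = (\<integral>\<eta>. (\<eta> \<bullet> \<nu>) * ?z' \<eta> \<partial>sph)" and "I = (\<integral>\<eta>. (\<eta> \<bullet> \<nu>) * v \<eta> \<partial>sph)"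
  have gain_integrable: "integrable sph (\<lambda>\<eta>. (\<eta> \<bullet> \<nu>) * ?z \<eta>)" "integrable sph (\<lambda>\<eta>. (\<eta> \<bullet> \<nu>) * ?z' \<eta>)"
    using integrable_polar_gain[OF unit maximizer(1)] integrable_polar_gain[OF unit Lp_v_reflect] by (intro integrable_inner[OF unit]; simp)+
  have pointwise: "\<bar>v (reflect \<nu> \<eta>) - v \<eta>\<bar> * \<bar>\<eta> \<bullet> \<nu>\<bar> = (\<eta> \<bullet> \<nu>) * ?z \<eta> + (\<eta> \<bullet> \<nu>) * ?z' \<eta>" for \<eta>
    using unit by (auto simp: polar_gain_def polar_def max_def min_def abs_if algebra_simps)
  show "integrable sph (\<lambda>\<eta>. \<bar>v (reflect \<nu> \<eta>) - v \<eta>\<bar> * \<bar>\<eta> \<bullet> \<nu>\<bar>)"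
    unfolding pointwise using gain_integrable by simp
  have moments: "integrable sph (\<lambda>\<eta>. (\<eta> \<bullet> \<nu>) * v \<eta>)" "integrable sph (\<lambda>\<eta>. (\<eta> \<bullet> \<nu>) * v (reflect \<nu> \<eta>))"
    using maximizer(7) Lp_integrable[OF Lp_v_reflect] by (intro integrable_inner[OF unit]; simp)+
  have "(\<integral>\<eta>. (\<eta> \<bullet> \<nu>) * v (reflect \<nu> \<eta>) \<partial>sph) = - I"
    using integral_reflect_sph[OF unit, of "\<lambda>\<eta>. - (\<eta> \<bullet> \<nu>) * v \<eta>"] unit by (simp add: I_def)
  moreover have "B - A = (\<integral>\<eta>. (\<eta> \<bullet> \<nu>) * v \<eta> - (\<eta> \<bullet> \<nu>) * v (reflect \<nu> \<eta>) \<partial>sph)"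
    unfolding A_def B_def using gain_integrable
    by (subst Bochner_Integration.integral_diff[symmetric]) (auto simp: polar_gain_def polar_reflect[OF unit] algebra_simps intro!: Bochner_Integration.integral_cong)
  ultimately have diff: "B - A = 2 * I"
    using moments by (simp add: I_def)
  show "(\<integral>\<eta>. \<bar>v (reflect \<nu> \<eta>) - v \<eta>\<bar> * \<bar>\<eta> \<bullet> \<nu>\<bar> \<partial>sph) \<le> sqrt (4 * moment_bound\<^sup>2 + 4 * polarization_bound m0) * sqrt \<tau>"
    if \<tau>_le: "\<tau> \<le> 1 / 4"
  proof -
    have "(B - A)\<^sup>2 \<le> (2 * (moment_bound * sqrt \<tau>))\<^sup>2"
      unfolding abs_le_square_iff[symmetric] diff I_def using abs_first_moment_le[OF near_maximizer_v \<tau>_le unit] moment_bound_nonneg maximizer(8) by (simp add: abs_mult)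
    also have "\<dots> = 4 * moment_bound\<^sup>2 * \<tau>"
      using maximizer(8) by (simp add: power_mult_distrib)
    finally have "(A + B)\<^sup>2 \<le> (4 * moment_bound\<^sup>2 + 4 * polarization_bound m0) * \<tau>"
      using polarization_estimate by (simp add: A_def[symmetric] B_def[symmetric] power2_eq_square algebra_simps)
    then have "A + B \<le> sqrt ((4 * moment_bound\<^sup>2 + 4 * polarization_bound m0) * \<tau>)"
      by (rule real_le_rsqrt)
    then show ?thesis
      unfolding pointwise using gain_integrable by (simp add: A_def B_def real_sqrt_mult)
  qed
qed

end

lemma emeasure_far_from_two_points_ge:
  fixes \<eta> \<eta>' :: 'a
  assumes "norm \<eta> = 1" "norm \<eta>' = 1"
  shows "ennreal (S / 2) \<le> emeasure sph {\<zeta>. 1 / 18 \<le> norm (\<zeta> - \<eta>) \<and> 1 / 18 \<le> norm (\<zeta> - \<eta>')}"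
proof -
  have cap: "measure sph {\<zeta>. norm (\<eta> - \<zeta>) < 1 / 18} \<le> S / 4" if "norm \<eta> = 1" for \<eta> :: 'a
  proof -
    have "ennreal (measure sph {\<zeta>. norm (\<eta> - \<zeta>) < 1 / 18}) \<le> ennreal (S * (9 * (1 / 18) / 2) ^ (DIM('a) - 1))"
      unfolding S_eq sph.emeasure_eq_measure[symmetric] using that by (intro emeasure_cap_le) auto
    then have "measure sph {\<zeta>. norm (\<eta> - \<zeta>) < 1 / 18} \<le> S * (1 / 4) ^ (DIM('a) - 1)"
      using S_pos by (subst (asm) ennreal_le_iff) simp_all
    also have "\<dots> \<le> S * (1 / 4) ^ 1"
      using S_pos dim_ge_3 by (intro mult_left_mono power_decreasing) auto
    finally show ?thesis
      by simp
  qed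
  let ?A = "{\<zeta>. norm (\<eta> - \<zeta>) < 1 / 18}" and ?B = "{\<zeta>. norm (\<eta>' - \<zeta>) < 1 / 18}"
  have "measure sph (?A \<union> ?B) \<le> measure sph ?A + measure sph ?B"
    by (rule measure_Un_le) simp_all
  then have "measure sph (?A \<union> ?B) \<le> S / 2"
    using cap[OF assms(1)] cap[OF assms(2)] by simp
  moreover have "measure sph (UNIV - (?A \<union> ?B)) = measure (sph :: 'a measure) UNIV - measure sph (?A \<union> ?B)"
    by (rule sph.finite_measure_Diff) simp_all
  moreover have "UNIV - (?A \<union> ?B) = {\<zeta>. 1 / 18 \<le> norm (\<zeta> - \<eta>) \<and> 1 / 18 \<le> norm (\<zeta> - \<eta>')}"
    by (auto simp: norm_minus_commute not_less)
  ultimately show ?thesis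
    using measure_sph_S by (simp add: sph.emeasure_eq_measure ennreal_leI)
qed

definition far_deviation :: "('a \<Rightarrow> real) \<Rightarrow> 'a \<Rightarrow> ennreal" where
  "far_deviation v \<eta> = (\<integral>\<^sup>+\<zeta>. ennreal \<bar>v \<zeta> - v \<eta>\<bar> * indicator {\<zeta>. 1 / 18 \<le> norm (\<zeta> - \<eta>)} \<zeta> \<partial>sph)"

lemma far_deviation_borel [measurable]:
  assumes [measurable]: "v \<in> borel_measurable borel"
  shows "far_deviation v \<in> borel_measurable borel"
  unfolding far_deviation_def[abs_def] by measurable

lemma diff_le_far_deviation:
  fixes \<eta> \<eta>' :: 'a
  assumes [measurable]: "v \<in> borel_measurable borel" and unit: "norm \<eta> = 1" "norm \<eta>' = 1"
  shows "ennreal (S / 2) * ennreal \<bar>v \<eta> - v \<eta>'\<bar> \<le> far_deviation v \<eta> + far_deviation v \<eta>'"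
proof -
  let ?F = "{\<zeta>. 1 / 18 \<le> norm (\<zeta> - \<eta>) \<and> 1 / 18 \<le> norm (\<zeta> - \<eta>')}"
  have "ennreal (S / 2) * ennreal \<bar>v \<eta> - v \<eta>'\<bar> \<le> emeasure sph ?F * ennreal \<bar>v \<eta> - v \<eta>'\<bar>"
    by (intro mult_right_mono emeasure_far_from_two_points_ge unit) simp
  also have "\<dots> = (\<integral>\<^sup>+\<zeta>. ennreal \<bar>v \<eta> - v \<eta>'\<bar> * indicator ?F \<zeta> \<partial>sph)"
    by (subst nn_integral_cmult_indicator) (simp_all add: mult.commute)
  also have "\<dots> \<le> (\<integral>\<^sup>+\<zeta>. ennreal \<bar>v \<zeta> - v \<eta>\<bar> * indicator {\<zeta>. 1 / 18 \<le> norm (\<zeta> - \<eta>)} \<zeta>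
      + ennreal \<bar>v \<zeta> - v \<eta>'\<bar> * indicator {\<zeta>. 1 / 18 \<le> norm (\<zeta> - \<eta>')} \<zeta> \<partial>sph)"
    by (rule nn_integral_mono) (auto simp: indicator_def intro!: ennreal_leI simp flip: ennreal_plus)
  also have "\<dots> = far_deviation v \<eta> + far_deviation v \<eta>'"
    unfolding far_deviation_def by (rule nn_integral_add) simp_all
  finally show ?thesis .
qed

lemma diff_mean_le_integral_diff:
  fixes v :: "'a \<Rightarrow> real"
  assumes v_integrable: "integrable sph v"
  shows "ennreal S * ennreal \<bar>v \<eta> - (\<integral>\<zeta>. v \<zeta> \<partial>sph) / S\<bar> \<le> (\<integral>\<^sup>+\<zeta>. ennreal \<bar>v \<eta> - v \<zeta>\<bar> \<partial>sph)"
proof -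
  have "v \<eta> - (\<integral>\<zeta>. v \<zeta> \<partial>sph) / S = (\<integral>\<zeta>. v \<eta> - v \<zeta> \<partial>sph) / S"
    using v_integrable S_pos by (simp add: measure_sph_S field_simps)
  then have "S * \<bar>v \<eta> - (\<integral>\<zeta>. v \<zeta> \<partial>sph) / S\<bar> = \<bar>\<integral>\<zeta>. v \<eta> - v \<zeta> \<partial>sph\<bar>"
    using S_pos by (simp add: abs_divide)
  also have "\<dots> \<le> (\<integral>\<zeta>. \<bar>v \<eta> - v \<zeta>\<bar> \<partial>sph)"
    by (rule integral_abs_bound)
  finally have "ennreal (S * \<bar>v \<eta> - (\<integral>\<zeta>. v \<zeta> \<partial>sph) / S\<bar>) \<le> ennreal (\<integral>\<zeta>. \<bar>v \<eta> - v \<zeta>\<bar> \<partial>sph)"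
    by (rule ennreal_leI)
  also have "\<dots> = (\<integral>\<^sup>+\<zeta>. ennreal \<bar>v \<eta> - v \<zeta>\<bar> \<partial>sph)"
    using v_integrable by (intro nn_integral_eq_integral[symmetric]) auto
  finally show ?thesis
    using S_pos by (simp add: ennreal_mult)
qed

lemma L1_deviation_le_far_deviation:
  fixes v :: "'a \<Rightarrow> real"
  assumes [measurable]: "v \<in> borel_measurable borel" and v_integrable: "integrable sph v"
  shows "ennreal (S / 2) * (ennreal S * (\<integral>\<^sup>+\<eta>. ennreal \<bar>v \<eta> - (\<integral>\<zeta>. v \<zeta> \<partial>sph) / S\<bar> \<partial>sph)) \<le> 2 * (ennreal S * (\<integral>\<^sup>+\<eta>. far_deviation v \<eta> \<partial>sph))"
proof -
  let ?G = "far_deviation v" and ?M = "\<integral>\<zeta>. v \<zeta> \<partial>sph"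
  have "ennreal (S / 2) * (ennreal S * (\<integral>\<^sup>+\<eta>. ennreal \<bar>v \<eta> - ?M / S\<bar> \<partial>sph)) = (\<integral>\<^sup>+\<eta>. ennreal (S / 2) * (ennreal S * ennreal \<bar>v \<eta> - ?M / S\<bar>) \<partial>sph)"
    by (simp add: nn_integral_cmult)
  also have "\<dots> \<le> (\<integral>\<^sup>+\<eta>. ?G \<eta> * ennreal S + (\<integral>\<^sup>+\<zeta>. ?G \<zeta> \<partial>sph) \<partial>sph)"
  proof (rule nn_integral_mono_AE, use AE_sph in eventually_elim)
    fix \<eta> :: 'a
    assume norm_\<eta>: "norm \<eta> = 1"
    have "ennreal (S / 2) * (ennreal S * ennreal \<bar>v \<eta> - ?M / S\<bar>) \<le> ennreal (S / 2) * (\<integral>\<^sup>+\<zeta>. ennreal \<bar>v \<eta> - v \<zeta>\<bar> \<partial>sph)"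
      by (intro mult_left_mono diff_mean_le_integral_diff v_integrable) simp
    also have "\<dots> = (\<integral>\<^sup>+\<zeta>. ennreal (S / 2) * ennreal \<bar>v \<eta> - v \<zeta>\<bar> \<partial>sph)"
      by (rule nn_integral_cmult[symmetric]) simp
    also have "\<dots> \<le> (\<integral>\<^sup>+\<zeta>. ?G \<eta> + ?G \<zeta> \<partial>sph)"
      by (rule nn_integral_mono_AE, use AE_sph in eventually_elim) (rule diff_le_far_deviation[OF _ norm_\<eta>], measurable)
    also have "\<dots> = ?G \<eta> * ennreal S + (\<integral>\<^sup>+\<zeta>. ?G \<zeta> \<partial>sph)"
      by (subst nn_integral_add) (simp_all add: emeasure_sph S_eq)
    finally show "ennreal (S / 2) * (ennreal S * ennreal \<bar>v \<eta> - ?M / S\<bar>) \<le> ?G \<eta> * ennreal S + (\<integral>\<^sup>+\<zeta>. ?G \<zeta> \<partial>sph)" .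
  qed
  also have "\<dots> = 2 * (ennreal S * (\<integral>\<^sup>+\<eta>. ?G \<eta> \<partial>sph))"
    by (simp add: nn_integral_add nn_integral_multc nn_integral_cmult emeasure_sph S_eq mult.commute mult_2)
  finally show ?thesis .
qed

definition reflection_bound :: "real \<Rightarrow> real" where
  "reflection_bound m0 = sqrt (4 * moment_bound\<^sup>2 + 4 * polarization_bound m0)"

definition deviation_bound :: "real \<Rightarrow> real" where
  "deviation_bound m0 = 4 * (fact DIM('a) * 6 ^ DIM('a) * 36 * reflection_bound m0)"

context
  fixes v :: "'a \<Rightarrow> real" and m0 \<tau> :: real
  assumes near_maximizer_v: "near_maximizer \<tau> v" and \<tau>_le: "\<tau> \<le> 1 / 4" and m0_bounds: "0 < m0" "m0 \<le> (\<integral>\<eta>. v \<eta> \<partial>sph)"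
begin

lemma nn_integral_reflect_diff_le:
  fixes \<nu> :: 'a
  assumes norm_\<nu>: "norm \<nu> = 1"
  shows "(\<integral>\<^sup>+\<eta>. ennreal \<bar>v (reflect \<nu> \<eta>) - v \<eta>\<bar> * ennreal \<bar>\<nu> \<bullet> \<eta>\<bar> \<partial>sph) \<le> ennreal (reflection_bound m0 * sqrt \<tau>)"
proof -
  have "(\<integral>\<^sup>+\<eta>. ennreal \<bar>v (reflect \<nu> \<eta>) - v \<eta>\<bar> * ennreal \<bar>\<nu> \<bullet> \<eta>\<bar> \<partial>sph) = (\<integral>\<^sup>+\<eta>. ennreal (\<bar>v (reflect \<nu> \<eta>) - v \<eta>\<bar> * \<bar>\<eta> \<bullet> \<nu>\<bar>) \<partial>sph)"
    by (simp add: ennreal_mult inner_commute)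
  also have "\<dots> = ennreal (\<integral>\<eta>. \<bar>v (reflect \<nu> \<eta>) - v \<eta>\<bar> * \<bar>\<eta> \<bullet> \<nu>\<bar> \<partial>sph)"
    using integrable_reflect_diff[OF norm_\<nu> near_maximizer_v m0_bounds] by (intro nn_integral_eq_integral) auto
  also have "\<dots> \<le> ennreal (reflection_bound m0 * sqrt \<tau>)"
    unfolding reflection_bound_def by (intro ennreal_leI integral_reflect_diff_le[OF norm_\<nu> near_maximizer_v m0_bounds \<tau>_le])
  finally show ?thesis .
qed

lemma nn_integral_far_deviation_le:
  "(\<integral>\<^sup>+\<eta>. far_deviation v \<eta> \<partial>sph) \<le> ennreal (fact DIM('a) * 6 ^ DIM('a) * 36 * (reflection_bound m0 * sqrt \<tau> * S))"
proof -
  note maximizer = near_maximizerD[OF near_maximizer_v]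
  note [measurable] = maximizer(6)
  interpret sphere_pair: pair_sigma_finite "sph :: 'a measure" "sph :: 'a measure" ..
  let ?c = "ennreal (fact DIM('a) * 6 ^ DIM('a))"
  have [measurable]: "(\<lambda>(\<nu>, \<eta>). ennreal \<bar>v (reflect \<nu> \<eta>) - v \<eta>\<bar> * ennreal \<bar>\<nu> \<bullet> \<eta>\<bar>) \<in> borel_measurable (sph \<Otimes>\<^sub>M sph)"
    unfolding split_beta' by measurable
  have "(\<integral>\<^sup>+\<eta>. far_deviation v \<eta> \<partial>sph)
      \<le> (\<integral>\<^sup>+\<eta>. ?c * (ennreal (2 / (1 / 18)) * (\<integral>\<^sup>+\<nu>. ennreal \<bar>v (reflect \<nu> \<eta>) - v \<eta>\<bar> * ennreal \<bar>\<nu> \<bullet> \<eta>\<bar> \<partial>sph)) \<partial>sph)"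
  proof (rule nn_integral_mono_AE, use AE_sph in eventually_elim)
    fix \<eta> :: 'a
    assume norm_\<eta>: "norm \<eta> = 1"
    show "far_deviation v \<eta> \<le> ?c * (ennreal (2 / (1 / 18)) * (\<integral>\<^sup>+\<nu>. ennreal \<bar>v (reflect \<nu> \<eta>) - v \<eta>\<bar> * ennreal \<bar>\<nu> \<bullet> \<eta>\<bar> \<partial>sph))"
      unfolding far_deviation_def by (rule nn_integral_reflect_average[OF norm_\<eta>, where f = "\<lambda>\<zeta>. ennreal \<bar>v \<zeta> - v \<eta>\<bar>"]) simp_all
  qed
  also have "\<dots> = ?c * (ennreal (2 / (1 / 18)) * (\<integral>\<^sup>+\<eta>. (\<integral>\<^sup>+\<nu>. ennreal \<bar>v (reflect \<nu> \<eta>) - v \<eta>\<bar> * ennreal \<bar>\<nu> \<bullet> \<eta>\<bar> \<partial>sph) \<partial>sph))"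
    by (simp add: nn_integral_cmult)
  also have "(\<integral>\<^sup>+\<eta>. (\<integral>\<^sup>+\<nu>. ennreal \<bar>v (reflect \<nu> \<eta>) - v \<eta>\<bar> * ennreal \<bar>\<nu> \<bullet> \<eta>\<bar> \<partial>sph) \<partial>sph)
      = (\<integral>\<^sup>+\<nu>. (\<integral>\<^sup>+\<eta>. ennreal \<bar>v (reflect \<nu> \<eta>) - v \<eta>\<bar> * ennreal \<bar>\<nu> \<bullet> \<eta>\<bar> \<partial>sph) \<partial>sph)"
    by (rule sphere_pair.Fubini') measurable
  also have "\<dots> \<le> (\<integral>\<^sup>+\<nu>. ennreal (reflection_bound m0 * sqrt \<tau>) \<partial>(sph :: 'a measure))"
    by (rule nn_integral_mono_AE, use AE_sph in eventually_elim) (rule nn_integral_reflect_diff_le)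
  also have "\<dots> = ennreal (reflection_bound m0 * sqrt \<tau> * S)"
    using S_pos by (simp add: emeasure_sph S_eq[symmetric] ennreal_mult'')
  finally show ?thesis
    by (simp add: mult_left_mono ennreal_mult' mult.assoc)
qed

lemma L1_deviation_le: "(\<integral>\<eta>. \<bar>v \<eta> - (\<integral>\<zeta>. v \<zeta> \<partial>sph) / S\<bar> \<partial>sph) \<le> deviation_bound m0 * sqrt \<tau>"
proof -
  note maximizer = near_maximizerD[OF near_maximizer_v]
  let ?M = "\<integral>\<zeta>. v \<zeta> \<partial>sph"
  have nonneg: "0 \<le> deviation_bound m0"
    using polarization_bound_nonneg[OF m0_bounds(1)] by (simp add: deviation_bound_def reflection_bound_def)
  have double: "2 * (ennreal S * ennreal x) = ennreal (2 * (S * x))" for x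
    using S_pos by (simp add: ennreal_mult')
  have "ennreal (S / 2) * (ennreal S * (\<integral>\<^sup>+\<eta>. ennreal \<bar>v \<eta> - ?M / S\<bar> \<partial>sph)) \<le> 2 * (ennreal S * (\<integral>\<^sup>+\<eta>. far_deviation v \<eta> \<partial>sph))"
    by (rule L1_deviation_le_far_deviation[OF maximizer(6,7)])
  also have "\<dots> \<le> 2 * (ennreal S * ennreal (fact DIM('a) * 6 ^ DIM('a) * 36 * (reflection_bound m0 * sqrt \<tau> * S)))"
    by (intro mult_left_mono nn_integral_far_deviation_le) simp_all
  also have "\<dots> = ennreal (2 * (S * (fact DIM('a) * 6 ^ DIM('a) * 36 * (reflection_bound m0 * sqrt \<tau> * S))))"
    by (rule double)
  also have "2 * (S * (fact DIM('a) * 6 ^ DIM('a) * 36 * (reflection_bound m0 * sqrt \<tau> * S))) = S / 2 * (S * (deviation_bound m0 * sqrt \<tau>))"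
    by (simp add: deviation_bound_def)
  also have "(\<integral>\<^sup>+\<eta>. ennreal \<bar>v \<eta> - ?M / S\<bar> \<partial>sph) = ennreal (\<integral>\<eta>. \<bar>v \<eta> - ?M / S\<bar> \<partial>sph)"
    using maximizer(7) by (intro nn_integral_eq_integral) auto
  finally have "S / 2 * (S * (\<integral>\<eta>. \<bar>v \<eta> - ?M / S\<bar> \<partial>sph)) \<le> S / 2 * (S * (deviation_bound m0 * sqrt \<tau>))"
    using S_pos nonneg maximizer(8) by (simp add: ennreal_mult'[symmetric] ennreal_le_iff)
  then show ?thesis
    using S_pos by simp
qed

end

lemma sign_energy_gain_ge:
  fixes u :: "'a \<Rightarrow> real"
  assumes Lp_u: "Lp u" and norm_\<xi>: "norm \<xi> \<le> 1 / 2" and m0_bounds: "0 < m0" "m0 \<le> (\<integral>\<eta>. \<bar>u \<eta>\<bar> \<partial>sph)"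
  defines "k \<equiv> ((1 - (1 / 2)\<^sup>2) / 8) powr s" and "I \<equiv> min (\<integral>\<eta>. \<bar>u \<eta>\<bar> + u \<eta> \<partial>sph) (\<integral>\<eta>. \<bar>u \<eta>\<bar> - u \<eta> \<partial>sph)"
  shows "(k * m0) powr (q - 1) * (k * I) \<le> \<bar>extend s (\<lambda>\<eta>. \<bar>u \<eta>\<bar>) \<xi>\<bar> powr q - \<bar>extend s u \<xi>\<bar> powr q"
proof -
  note [measurable] = LpD(1)[OF Lp_u]
  note u_integrable = Lp_integrable[OF Lp_u]
  define X Y where "X = extend s (\<lambda>\<eta>. \<bar>u \<eta>\<bar>) \<xi>" and "Y = \<bar>extend s u \<xi>\<bar>"
  have inside: "norm \<xi> < 1"
    using norm_\<xi> by simp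
  have "k * (\<integral>\<eta>. \<bar>u \<eta>\<bar> + u \<eta> \<partial>sph) \<le> X + extend s u \<xi>"
    using extend_ge[OF norm_\<xi>, of "\<lambda>\<eta>. \<bar>u \<eta>\<bar> + u \<eta>"] extend_add[OF inside, of "\<lambda>\<eta>. \<bar>u \<eta>\<bar>" u] u_integrable by (simp add: k_def X_def)
  moreover have "k * (\<integral>\<eta>. \<bar>u \<eta>\<bar> - u \<eta> \<partial>sph) \<le> X - extend s u \<xi>"
    using extend_ge[OF norm_\<xi>, of "\<lambda>\<eta>. \<bar>u \<eta>\<bar> - u \<eta>"] extend_diff[OF inside, of "\<lambda>\<eta>. \<bar>u \<eta>\<bar>" u] u_integrable by (simp add: k_def X_def)
  moreover have "k * I \<le> k * (\<integral>\<eta>. \<bar>u \<eta>\<bar> + u \<eta> \<partial>sph)" "k * I \<le> k * (\<integral>\<eta>. \<bar>u \<eta>\<bar> - u \<eta> \<partial>sph)"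
    by (auto simp: I_def k_def intro: mult_left_mono)
  ultimately have gap: "k * I \<le> X - Y"
    unfolding Y_def by linarith
  have "k * m0 \<le> k * (\<integral>\<eta>. \<bar>u \<eta>\<bar> \<partial>sph)"
    using m0_bounds by (simp add: k_def mult_left_mono)
  also have "\<dots> \<le> X"
    unfolding X_def k_def using norm_\<xi> u_integrable by (intro extend_ge) auto
  finally have X_ge: "k * m0 \<le> X" .
  have "0 \<le> I"
    by (simp add: I_def)
  then have "(k * m0) powr (q - 1) * (k * I) \<le> X powr (q - 1) * (X - Y)"
    using X_ge gap m0_bounds q_gt_2 by (intro mult_mono powr_mono2) (auto simp: k_def)
  also have "\<dots> \<le> X powr q - Y powr q"
    using abs_extend_le[of u \<xi>] q_gt_2 by (intro powr_diff_ge) (auto simp: X_def Y_def)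
  also have "X = \<bar>X\<bar>"
    using abs_extend_le[of u \<xi>] by (simp add: X_def)
  finally show ?thesis
    by (simp add: X_def Y_def)
qed

lemma sign_estimate:
  assumes m0_pos: "0 < m0"
  obtains K where "0 \<le> K" "\<forall>u \<tau>. near_optimal \<tau> u \<longrightarrow> m0 \<le> (\<integral>\<eta>. \<bar>u \<eta>\<bar> \<partial>sph) \<longrightarrow>
    (\<integral>\<eta>. \<bar>u \<eta>\<bar> - u \<eta> \<partial>sph) \<le> K * \<tau> \<or> (\<integral>\<eta>. \<bar>u \<eta>\<bar> + u \<eta> \<partial>sph) \<le> K * \<tau>"
proof -
  define k V where "k = ((1 - (1 / 2)\<^sup>2) / 8) powr s" and "V = measure lborel (ball (0::'a) (1 / 2))"
  have V_pos: "0 < V"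
    unfolding V_def by (rule content_ball_pos) simp
  define c where "c = (k * m0) powr (q - 1) * k"
  have c_pos: "0 < c"
    using m0_pos by (simp add: c_def k_def power2_eq_square)
  show thesis
  proof (intro that allI impI)
    show "0 \<le> 1 / (c * V)"
      using c_pos V_pos by simp
    fix u \<tau>
    assume near: "near_optimal \<tau> u" and mean: "m0 \<le> (\<integral>\<eta>. \<bar>u \<eta>\<bar> \<partial>sph)"
    have Lp_u: "Lp u" and mass_u: "mass u = 1" and energy_u: "\<Gamma> - \<tau> \<le> energy u"
      using near by (simp_all add: near_optimal_def)
    define I where "I = min (\<integral>\<eta>. \<bar>u \<eta>\<bar> + u \<eta> \<partial>sph) (\<integral>\<eta>. \<bar>u \<eta>\<bar> - u \<eta> \<partial>sph)"
    define \<Delta> where "\<Delta> \<xi> = \<bar>extend s (\<lambda>\<eta>. \<bar>u \<eta>\<bar>) \<xi>\<bar> powr q - \<bar>extend s u \<xi>\<bar> powr q" for \<xi>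
    have "0 \<le> \<Delta> \<xi>" for \<xi>
      unfolding \<Delta>_def using abs_extend_le[of u \<xi>] q_gt_2 powr_mono2[of q "\<bar>extend s u \<xi>\<bar>" "\<bar>extend s (\<lambda>\<eta>. \<bar>u \<eta>\<bar>) \<xi>\<bar>"] by simp
    moreover have "c * I \<le> \<Delta> \<xi>" if "\<xi> \<in> ball 0 (1 / 2)" for \<xi>
      using sign_energy_gain_ge[OF Lp_u _ m0_pos mean, of \<xi>] that by (simp add: \<Delta>_def c_def k_def I_def mult.assoc)
    moreover have "0 \<le> c * I"
      using c_pos by (simp add: I_def)
    moreover have "integrable hyp \<Delta>" and integral_\<Delta>: "(\<integral>\<xi>. \<Delta> \<xi> \<partial>hyp) = energy (\<lambda>\<eta>. \<bar>u \<eta>\<bar>) - energy u"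
      unfolding \<Delta>_def using energy_integrable[OF Lp_u] energy_integrable[OF Lp_abs[OF Lp_u]] by (simp_all add: energy_def)
    ultimately have "c * I * V \<le> (\<integral>\<xi>. \<Delta> \<xi> \<partial>hyp)"
      unfolding V_def by (intro ball_mult_le_integral_hyp) auto
    also have "\<dots> \<le> \<tau>"
      using sharp[OF Lp_abs[OF Lp_u]] energy_u by (simp add: integral_\<Delta> mass_abs mass_u)
    finally have "I \<le> 1 / (c * V) * \<tau>"
      using c_pos V_pos by (simp add: field_simps)
    then show "(\<integral>\<eta>. \<bar>u \<eta>\<bar> - u \<eta> \<partial>sph) \<le> 1 / (c * V) * \<tau> \<or> (\<integral>\<eta>. \<bar>u \<eta>\<bar> + u \<eta> \<partial>sph) \<le> 1 / (c * V) * \<tau>"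
      unfolding I_def min_def by (auto split: if_splits)
  qed
qed

lemma L1_close_if_almost_signed:
  fixes u :: "'a \<Rightarrow> real"
  assumes u_integrable: "integrable sph u" and g_sign: "g = 1 \<or> g = - 1"
    and signed: "(\<integral>\<eta>. \<bar>u \<eta>\<bar> - g * u \<eta> \<partial>sph) \<le> D" and close: "(\<integral>\<eta>. \<bar>\<bar>u \<eta>\<bar> - (\<integral>\<zeta>. \<bar>u \<zeta>\<bar> \<partial>sph) / S\<bar> \<partial>sph) \<le> E"
  defines "l \<equiv> (\<integral>\<eta>. u \<eta> \<partial>sph) / S"
  shows "((\<integral>\<eta>. \<bar>u \<eta>\<bar> \<partial>sph) - D) / S \<le> \<bar>l\<bar>" and "(\<integral>\<eta>. \<bar>u \<eta> - l\<bar> \<partial>sph) \<le> 2 * D + E"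
proof -
  define M where "M = (\<integral>\<eta>. \<bar>u \<eta>\<bar> \<partial>sph)"
  have defect_eq: "(\<integral>\<eta>. \<bar>u \<eta>\<bar> - g * u \<eta> \<partial>sph) = M - g * (l * S)"
    using u_integrable S_pos by (simp add: M_def l_def)
  have pointwise: "g * u \<eta> \<le> \<bar>u \<eta>\<bar>" for \<eta>
    using g_sign by auto
  have "0 \<le> (\<integral>\<eta>. \<bar>u \<eta>\<bar> - g * u \<eta> \<partial>sph)"
    using pointwise by simp
  then have defect: "0 \<le> M / S - g * l" "(M / S - g * l) * S \<le> D"
    using signed S_pos unfolding defect_eq by (simp add: field_simps, simp add: left_diff_distrib)
  have "(M - D) / S \<le> g * l"
    using signed S_pos unfolding defect_eq by (simp add: field_simps)
  also have "\<dots> \<le> \<bar>l\<bar>"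
    using g_sign by auto
  finally show "((\<integral>\<eta>. \<bar>u \<eta>\<bar> \<partial>sph) - D) / S \<le> \<bar>l\<bar>"
    by (simp add: M_def)
  have "\<bar>u \<eta> - l\<bar> \<le> (\<bar>u \<eta>\<bar> - g * u \<eta>) + \<bar>\<bar>u \<eta>\<bar> - M / S\<bar> + (M / S - g * l)" for \<eta>
  proof -
    have "\<bar>u \<eta> - l\<bar> = \<bar>g * u \<eta> - g * l\<bar>"
      using g_sign by auto
    then show ?thesis
      using pointwise[of \<eta>] defect(1) by linarith
  qed
  then have "(\<integral>\<eta>. \<bar>u \<eta> - l\<bar> \<partial>sph) \<le> (\<integral>\<eta>. (\<bar>u \<eta>\<bar> - g * u \<eta>) + \<bar>\<bar>u \<eta>\<bar> - M / S\<bar> + (M / S - g * l) \<partial>sph)"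
    using u_integrable by (intro integral_mono) auto
  also have "\<dots> = (\<integral>\<eta>. \<bar>u \<eta>\<bar> - g * u \<eta> \<partial>sph) + (\<integral>\<eta>. \<bar>\<bar>u \<eta>\<bar> - M / S\<bar> \<partial>sph) + (M / S - g * l) * S"
    using u_integrable by (simp add: measure_sph_S)
  finally show "(\<integral>\<eta>. \<bar>u \<eta> - l\<bar> \<partial>sph) \<le> 2 * D + E"
    using signed close defect(2) unfolding M_def by linarith
qed

lemma L1_close_of_sign:
  assumes near: "near_optimal \<tau> u" and m0_bounds: "0 < m0" "m0 \<le> (\<integral>\<eta>. \<bar>u \<eta>\<bar> \<partial>sph)" and K_bounds: "0 \<le> K" "K * \<tau> \<le> m0 / 2" and \<tau>_le: "\<tau> \<le> 1 / 4"
    and g_sign: "g = 1 \<or> g = - 1" and signed: "(\<integral>\<eta>. \<bar>u \<eta>\<bar> - g * u \<eta> \<partial>sph) \<le> K * \<tau>"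
  defines "l \<equiv> (\<integral>\<eta>. u \<eta> \<partial>sph) / S"
  shows "m0 / (2 * S) \<le> \<bar>l\<bar>" "(\<integral>\<eta>. \<bar>u \<eta> - l\<bar> \<partial>sph) \<le> (2 * K + \<bar>deviation_bound m0\<bar>) * sqrt \<tau>"
proof -
  have Lp_u: "Lp u" and \<tau>_pos: "0 < \<tau>"
    using near by (simp_all add: near_optimal_def)
  note l_close = L1_close_if_almost_signed[OF Lp_integrable[OF Lp_u] g_sign signed L1_deviation_le[OF near_maximizer_abs[OF near] \<tau>_le m0_bounds], folded l_def]
  have "m0 / (2 * S) = (m0 - m0 / 2) / S"
    by simp
  also have "\<dots> \<le> ((\<integral>\<eta>. \<bar>u \<eta>\<bar> \<partial>sph) - K * \<tau>) / S"
    using m0_bounds(2) K_bounds(2) S_pos by (intro divide_right_mono) auto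
  also note l_close(1)
  finally show "m0 / (2 * S) \<le> \<bar>l\<bar>" .
  have "2 * (K * \<tau>) + deviation_bound m0 * sqrt \<tau> \<le> (2 * K + \<bar>deviation_bound m0\<bar>) * sqrt \<tau>"
    unfolding distrib_right mult.assoc using K_bounds(1) \<tau>_le \<tau>_pos by (intro add_mono mult_left_mono mult_right_mono le_sqrt_self) auto
  with l_close(2) show "(\<integral>\<eta>. \<bar>u \<eta> - l\<bar> \<partial>sph) \<le> (2 * K + \<bar>deviation_bound m0\<bar>) * sqrt \<tau>"
    by linarith
qed

lemma near_optimal_L1_close:
  obtains K t0 l0 where "0 \<le> K" "0 < t0" "0 < l0"
    "\<forall>u \<tau>. near_optimal \<tau> u \<longrightarrow> \<tau> \<le> t0 \<longrightarrow> (\<exists>l. l0 \<le> \<bar>l\<bar> \<and> (\<integral>\<eta>. u \<eta> \<partial>sph) = l * S \<and> (\<integral>\<eta>. \<bar>u \<eta> - l\<bar> \<partial>sph) \<le> K * sqrt \<tau>)"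
proof -
  obtain m0 t1 where m0_pos: "0 < m0" and t1_pos: "0 < t1" and mean: "\<forall>v \<tau>. near_maximizer \<tau> v \<longrightarrow> \<tau> \<le> t1 \<longrightarrow> m0 \<le> (\<integral>\<eta>. v \<eta> \<partial>sph)"
    by (rule mean_near_maximizer_ge)
  obtain K where K_nonneg: "0 \<le> K" and sign: "\<forall>u \<tau>. near_optimal \<tau> u \<longrightarrow> m0 \<le> (\<integral>\<eta>. \<bar>u \<eta>\<bar> \<partial>sph) \<longrightarrow>
      (\<integral>\<eta>. \<bar>u \<eta>\<bar> - u \<eta> \<partial>sph) \<le> K * \<tau> \<or> (\<integral>\<eta>. \<bar>u \<eta>\<bar> + u \<eta> \<partial>sph) \<le> K * \<tau>"
    by (rule sign_estimate[OF m0_pos])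
  define t0 where "t0 = min t1 (min (1 / 4) (m0 / (2 * (K + 1))))"
  show thesis
  proof (intro that allI impI)
    show "0 \<le> 2 * K + \<bar>deviation_bound m0\<bar>" "0 < t0" "0 < m0 / (2 * S)"
      using K_nonneg t1_pos m0_pos S_pos by (simp_all add: t0_def)
    fix u \<tau>
    assume near: "near_optimal \<tau> u" and "\<tau> \<le> t0"
    then have \<tau>_le: "\<tau> \<le> t1" "\<tau> \<le> 1 / 4" "\<tau> \<le> m0 / (2 * (K + 1))" "0 < \<tau>"
      by (auto simp: t0_def near_optimal_def)
    have mean_abs_ge: "m0 \<le> (\<integral>\<eta>. \<bar>u \<eta>\<bar> \<partial>sph)"
      using mean near_maximizer_abs[OF near] \<tau>_le(1) by blast
    have "K * \<tau> \<le> (K + 1) * (m0 / (2 * (K + 1)))"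
      using K_nonneg \<tau>_le by (intro mult_mono) auto
    also have "\<dots> = m0 / 2"
      using K_nonneg by (simp add: field_simps)
    finally have defect_small: "K * \<tau> \<le> m0 / 2" .
    obtain g where "g = 1 \<or> g = - 1" "(\<integral>\<eta>. \<bar>u \<eta>\<bar> - g * u \<eta> \<partial>sph) \<le> K * \<tau>"
      using sign[rule_format, OF near mean_abs_ge] by (elim disjE) (auto intro: that[of 1] that[of "- 1"])
    note L1_close_of_sign[OF near m0_pos mean_abs_ge K_nonneg defect_small \<tau>_le(2) this]
    moreover have "(\<integral>\<eta>. u \<eta> \<partial>sph) = (\<integral>\<eta>. u \<eta> \<partial>sph) / S * S"
      using S_pos by simp
    ultimately show "\<exists>l. m0 / (2 * S) \<le> \<bar>l\<bar> \<and> (\<integral>\<eta>. u \<eta> \<partial>sph) = l * S \<and> (\<integral>\<eta>. \<bar>u \<eta> - l\<bar> \<partial>sph) \<le> (2 * K + \<bar>deviation_bound m0\<bar>) * sqrt \<tau>"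
      by blast
  qed
qed

end

section \<open>Smallness of the remainder\<close>

context conformal_extension
begin

definition \<phi> :: "'a \<Rightarrow> real" where
  "\<phi> = extend s (\<lambda>_. 1)"

lemma \<phi>_borel [measurable]: "\<phi> \<in> borel_measurable borel"
  unfolding \<phi>_def by measurable

lemma \<phi>_radial:
  assumes "norm \<xi> = norm \<zeta>"
  shows "\<phi> \<xi> = \<phi> \<zeta>"
proof (cases "\<xi> = \<zeta>")
  case False
  then have "reflect (sgn (\<xi> - \<zeta>)) \<xi> = \<zeta>" "orthogonal_transformation (reflect (sgn (\<xi> - \<zeta>)))"
    using reflect_swap[OF assms] by (simp_all add: orthogonal_transformation_reflect norm_sgn)
  then show ?thesis
    using extend_orthogonal[of "reflect (sgn (\<xi> - \<zeta>))" "\<lambda>_. 1" s \<xi>] by (simp add: \<phi>_def)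
qed simp

lemma \<phi>_ge:
  assumes "norm \<xi> \<le> R" "R < 1"
  shows "((1 - R\<^sup>2) / 8) powr s * S \<le> \<phi> \<xi>"
  using extend_ge[OF assms, of "\<lambda>_. 1"] by (simp add: \<phi>_def measure_sph_S)

lemma \<phi>_pos:
  assumes "norm \<xi> < 1"
  shows "0 < \<phi> \<xi>"
proof -
  have "0 < ((1 - (norm \<xi>)\<^sup>2) / 8) powr s * S"
    using weight_pos[OF assms] S_pos by (simp add: weight_def)
  then show ?thesis
    using \<phi>_ge[OF order_refl assms] by linarith
qed

lemma \<phi>_nonneg: "0 \<le> \<phi> \<xi>"
  unfolding \<phi>_def by (rule extend_nonneg) simp

lemma \<phi>_powr_mult: "norm \<xi> < 1 \<Longrightarrow> \<phi> \<xi> powr r * \<phi> \<xi> = \<phi> \<xi> powr (r + 1)"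
  using \<phi>_pos[of \<xi>] powr_add[of "\<phi> \<xi>" r 1] by simp

lemma \<phi>_integrable: "integrable hyp (\<lambda>\<xi>. \<phi> \<xi> powr q)"
  using energy_integrable[OF Lp_const[of 1]] \<phi>_nonneg by (simp add: \<phi>_def)

lemma energy_1_pos: "0 < energy (\<lambda>_. 1)"
proof -
  define c V where "c = (((1 - (1 / 2)\<^sup>2) / 8) powr s * S) powr q" and "V = measure lborel (ball (0::'a) (1 / 2))"
  have "c * V \<le> (\<integral>\<xi>. \<phi> \<xi> powr q \<partial>hyp)"
    unfolding c_def V_def using q_gt_2 S_pos
    by (intro ball_mult_le_integral_hyp \<phi>_integrable powr_mono2 \<phi>_ge) auto
  moreover have "0 < V"
    unfolding V_def by (rule content_ball_pos) simp
  moreover have "0 < c"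
    using S_pos by (simp add: c_def power2_eq_square)
  ultimately have "0 < (\<integral>\<xi>. \<phi> \<xi> powr q \<partial>hyp)"
    using mult_pos_pos[of c V] by linarith
  then show ?thesis
    using \<phi>_nonneg by (simp add: energy_def \<phi>_def)
qed

lemma extend_1_add:
  assumes "norm \<xi> < 1" "Lp w"
  shows "extend s (\<lambda>\<eta>. 1 + w \<eta>) \<xi> = \<phi> \<xi> + extend s w \<xi>"
  unfolding \<phi>_def using assms LpD(1)[OF assms(2)] Lp_integrable[OF assms(2)] by (subst extend_add) simp_all

lemma nn_integral_radial_mult_extend:
  fixes F :: "'a \<Rightarrow> ennreal"
  assumes F_borel [measurable]: "F \<in> borel_measurable borel" and radial: "\<And>\<xi> \<zeta>. norm \<xi> = norm \<zeta> \<Longrightarrow> F \<xi> = F \<zeta>"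
    and g_borel [measurable]: "g \<in> borel_measurable borel" and g_integrable: "integrable sph g" and g_nonneg: "\<And>\<eta>. 0 \<le> g \<eta>"
  shows "ennreal S * (\<integral>\<^sup>+\<xi>. F \<xi> * ennreal (extend s g \<xi>) \<partial>hyp) = (\<integral>\<^sup>+\<xi>. F \<xi> * ennreal (\<phi> \<xi>) \<partial>hyp) * (\<integral>\<^sup>+\<eta>. ennreal (g \<eta>) \<partial>(sph :: 'a measure))"
proof -
  interpret pair: pair_sigma_finite hyp "sph :: 'a measure" ..
  have nn_integral_kernel: "(\<integral>\<^sup>+\<zeta>. ennreal (kernel s \<xi> \<zeta>) \<partial>sph) = ennreal (\<phi> \<xi>)" if "norm \<xi> < 1" for \<xi>
    using nn_integral_kernel_mult[OF that, of "\<lambda>_. 1"] by (simp add: \<phi>_def)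
  have mean: "ennreal S * (\<integral>\<^sup>+\<xi>. F \<xi> * ennreal (kernel s \<xi> \<eta>) \<partial>hyp) = (\<integral>\<^sup>+\<xi>. F \<xi> * ennreal (\<phi> \<xi>) \<partial>hyp)" if "norm \<eta> = 1" for \<eta>
  proof -
    have "ennreal S * (\<integral>\<^sup>+\<xi>. F \<xi> * ennreal (kernel s \<xi> \<eta>) \<partial>hyp) = (\<integral>\<^sup>+\<xi>. F \<xi> * (\<integral>\<^sup>+\<zeta>. ennreal (kernel s \<xi> \<zeta>) \<partial>sph) \<partial>(hyp :: 'a measure))"
      unfolding S_eq by (rule nn_integral_radial_kernel[OF that F_borel radial])
    also have "\<dots> = (\<integral>\<^sup>+\<xi>. F \<xi> * ennreal (\<phi> \<xi>) \<partial>hyp)"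
      by (rule nn_integral_cong_AE, use AE_hyp in eventually_elim) (simp add: nn_integral_kernel)
    finally show ?thesis .
  qed
  have "(\<integral>\<^sup>+\<xi>. F \<xi> * ennreal (extend s g \<xi>) \<partial>hyp) = (\<integral>\<^sup>+\<xi>. (\<integral>\<^sup>+\<eta>. F \<xi> * ennreal (kernel s \<xi> \<eta>) * ennreal (g \<eta>) \<partial>sph) \<partial>hyp)"
  proof (rule nn_integral_cong_AE, use AE_hyp in eventually_elim)
    fix \<xi> :: 'a
    assume "norm \<xi> < 1"
    then show "F \<xi> * ennreal (extend s g \<xi>) = (\<integral>\<^sup>+\<eta>. F \<xi> * ennreal (kernel s \<xi> \<eta>) * ennreal (g \<eta>) \<partial>sph)"
      using nn_integral_kernel_mult[OF _ g_borel g_integrable g_nonneg, of \<xi>] g_nonneg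
      by (simp add: mult.assoc nn_integral_cmult flip: ennreal_mult)
  qed
  also have "\<dots> = (\<integral>\<^sup>+\<eta>. (\<integral>\<^sup>+\<xi>. F \<xi> * ennreal (kernel s \<xi> \<eta>) * ennreal (g \<eta>) \<partial>hyp) \<partial>sph)"
    by (rule pair.Fubini'[symmetric]) measurable
  also have "\<dots> = (\<integral>\<^sup>+\<eta>. (\<integral>\<^sup>+\<xi>. F \<xi> * ennreal (kernel s \<xi> \<eta>) \<partial>hyp) * ennreal (g \<eta>) \<partial>sph)"
    by (intro nn_integral_cong nn_integral_multc) simp
  finally have "ennreal S * (\<integral>\<^sup>+\<xi>. F \<xi> * ennreal (extend s g \<xi>) \<partial>hyp)
      = (\<integral>\<^sup>+\<eta>. ennreal S * (\<integral>\<^sup>+\<xi>. F \<xi> * ennreal (kernel s \<xi> \<eta>) \<partial>hyp) * ennreal (g \<eta>) \<partial>sph)"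
    by (simp add: hyp.borel_measurable_nn_integral mult.assoc nn_integral_cmult)
  also have "\<dots> = (\<integral>\<^sup>+\<eta>. (\<integral>\<^sup>+\<xi>. F \<xi> * ennreal (\<phi> \<xi>) \<partial>hyp) * ennreal (g \<eta>) \<partial>sph)"
    by (rule nn_integral_cong_AE, use AE_sph in eventually_elim) (simp add: mean)
  also have "\<dots> = (\<integral>\<^sup>+\<xi>. F \<xi> * ennreal (\<phi> \<xi>) \<partial>hyp) * (\<integral>\<^sup>+\<eta>. ennreal (g \<eta>) \<partial>sph)"
    by (rule nn_integral_cmult) simp
  finally show ?thesis .
qed

definition outer_energy :: "real \<Rightarrow> real" where
  "outer_energy R = (\<integral>\<xi>. indicator {R..} (norm \<xi>) * \<phi> \<xi> powr q \<partial>hyp)"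

lemma integrable_outer_energy: "integrable hyp (\<lambda>\<xi>. indicator {R..} (norm \<xi>) * \<phi> \<xi> powr q)"
  by (rule Bochner_Integration.integrable_bound[OF \<phi>_integrable]) (auto simp: indicator_def)

lemma outer_energy_nonneg: "0 \<le> outer_energy R"
  by (simp add: outer_energy_def)

lemma outer_energy_0: "outer_energy 0 = energy (\<lambda>_. 1)"
  using \<phi>_nonneg by (simp add: outer_energy_def energy_def \<phi>_def)

lemma nn_integral_outer_energy: "(\<integral>\<^sup>+\<xi>. ennreal (indicator {R..} (norm \<xi>) * \<phi> \<xi> powr q) \<partial>hyp) = ennreal (outer_energy R)"
  unfolding outer_energy_def by (rule nn_integral_eq_integral[OF integrable_outer_energy]) simp

lemma outer_energy_small:
  assumes "0 < \<epsilon>"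
  obtains R where "0 \<le> R" "R < 1" "outer_energy R < \<epsilon>"
proof -
  define R where "R i = 1 - inverse (real (Suc i))" for i
  have R_bounds: "0 \<le> R i" "R i < 1" for i
    by (simp_all add: R_def inverse_le_1_iff)
  have R_lim: "R \<longlonglongrightarrow> 1"
    unfolding R_def[abs_def] using tendsto_diff[OF tendsto_const LIMSEQ_inverse_real_of_nat, of 1] by simp
  have "(\<lambda>i. outer_energy (R i)) \<longlonglongrightarrow> (\<integral>\<xi>. 0 \<partial>(hyp :: 'a measure))"
    unfolding outer_energy_def
  proof (rule integral_dominated_convergence[OF _ _ \<phi>_integrable])
    show "AE \<xi> in hyp. (\<lambda>i. indicator {R i..} (norm \<xi>) * \<phi> \<xi> powr q) \<longlonglongrightarrow> 0"
      using AE_hyp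
    proof eventually_elim
      fix \<xi> :: 'a
      assume "norm \<xi> < 1"
      then have "\<forall>\<^sub>F i in sequentially. norm \<xi> < R i"
        by (rule order_tendstoD(1)[OF R_lim])
      then have "\<forall>\<^sub>F i in sequentially. indicator {R i..} (norm \<xi>) * \<phi> \<xi> powr q = 0"
        by eventually_elim simp
      then show "(\<lambda>i. indicator {R i..} (norm \<xi>) * \<phi> \<xi> powr q) \<longlonglongrightarrow> 0"
        by (rule tendsto_eventually)
    qed
  qed (auto simp: indicator_def)
  then have "\<forall>\<^sub>F i in sequentially. outer_energy (R i) < \<epsilon>"
    using assms by (intro order_tendstoD(2)) auto
  then obtain i where "outer_energy (R i) < \<epsilon>"
    by (auto simp: eventually_sequentially)
  then show thesis
    using R_bounds that by blast
qed

lemma nn_integral_outer_extend: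
  fixes g :: "'a \<Rightarrow> real"
  assumes g_integrable: "g \<in> borel_measurable borel" "integrable sph g" "\<And>\<eta>. 0 \<le> g \<eta>"
  shows "(\<integral>\<^sup>+\<xi>. ennreal (indicator {R..} (norm \<xi>) * \<phi> \<xi> powr (q - 1) * extend s g \<xi>) \<partial>hyp) = ennreal (outer_energy R / S * (\<integral>\<eta>. g \<eta> \<partial>sph))"
proof -
  define F where "F \<xi> = ennreal (indicator {R..} (norm \<xi>) * \<phi> \<xi> powr (q - 1))" for \<xi>
  have [measurable]: "F \<in> borel_measurable borel"
    unfolding F_def by measurable
  define Z where "Z = (\<integral>\<^sup>+\<xi>. F \<xi> * ennreal (extend s g \<xi>) \<partial>hyp)"
  have F_mult: "F \<xi> * ennreal (\<phi> \<xi>) = ennreal (indicator {R..} (norm \<xi>) * \<phi> \<xi> powr q)" if "norm \<xi> < 1" for \<xi>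
    using \<phi>_powr_mult[OF that, of "q - 1"] \<phi>_nonneg by (simp add: F_def mult.assoc flip: ennreal_mult)
  have F_integral: "(\<integral>\<^sup>+\<xi>. F \<xi> * ennreal (\<phi> \<xi>) \<partial>hyp) = ennreal (outer_energy R)"
    unfolding nn_integral_outer_energy[symmetric] by (rule nn_integral_cong_AE, use AE_hyp in eventually_elim) (rule F_mult)
  have F_radial: "F \<xi> = F \<zeta>" if "norm \<xi> = norm \<zeta>" for \<xi> \<zeta>
    using \<phi>_radial[OF that] that by (simp add: F_def)
  have "ennreal S * Z = ennreal (outer_energy R) * (\<integral>\<^sup>+\<eta>. ennreal (g \<eta>) \<partial>sph)"
    unfolding Z_def F_integral[symmetric] by (rule nn_integral_radial_mult_extend[OF _ F_radial g_integrable]) simp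
  also have "(\<integral>\<^sup>+\<eta>. ennreal (g \<eta>) \<partial>sph) = ennreal (\<integral>\<eta>. g \<eta> \<partial>sph)"
    using g_integrable by (intro nn_integral_eq_integral) auto
  finally have "ennreal S * Z = ennreal (outer_energy R) * ennreal (\<integral>\<eta>. g \<eta> \<partial>sph)" .
  then have "ennreal (1 / S) * (ennreal S * Z) = ennreal (1 / S) * ennreal (outer_energy R * (\<integral>\<eta>. g \<eta> \<partial>sph))"
    by (simp add: ennreal_mult' outer_energy_nonneg)
  then have "Z = ennreal (outer_energy R / S * (\<integral>\<eta>. g \<eta> \<partial>sph))"
    using S_pos by (simp add: mult.assoc[symmetric] ennreal_mult'[symmetric])
  moreover have "0 \<le> extend s g \<xi>" for \<xi>
    by (rule extend_nonneg) (rule g_integrable(3))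
  ultimately show ?thesis
    by (simp add: Z_def F_def ennreal_mult)
qed

lemma
  assumes Lp_g: "Lp g" "\<And>\<eta>. 0 \<le> g \<eta>"
  shows integrable_\<phi>_mult_extend_nonneg: "integrable hyp (\<lambda>\<xi>. \<phi> \<xi> powr (q - 1) * extend s g \<xi>)"
    and integral_\<phi>_mult_extend_nonneg: "(\<integral>\<xi>. \<phi> \<xi> powr (q - 1) * extend s g \<xi> \<partial>hyp) = energy (\<lambda>_. 1) / S * (\<integral>\<eta>. g \<eta> \<partial>sph)"
proof -
  note [measurable] = LpD(1)[OF Lp_g(1)]
  have nonneg: "0 \<le> extend s g \<xi>" for \<xi>
    by (rule extend_nonneg) (rule Lp_g(2))
  have nn_integral_eq: "(\<integral>\<^sup>+\<xi>. ennreal (\<phi> \<xi> powr (q - 1) * extend s g \<xi>) \<partial>hyp) = ennreal (energy (\<lambda>_. 1) / S * (\<integral>\<eta>. g \<eta> \<partial>sph))"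
    using nn_integral_outer_extend[OF LpD(1)[OF Lp_g(1)] Lp_integrable[OF Lp_g(1)] Lp_g(2), of 0] by (simp add: outer_energy_0)
  then show "integrable hyp (\<lambda>\<xi>. \<phi> \<xi> powr (q - 1) * extend s g \<xi>)"
    using nonneg by (intro integrableI_nonneg) simp_all
  show "(\<integral>\<xi>. \<phi> \<xi> powr (q - 1) * extend s g \<xi> \<partial>hyp) = energy (\<lambda>_. 1) / S * (\<integral>\<eta>. g \<eta> \<partial>sph)"
    using nn_integral_eq nonneg Lp_g(2) S_pos energy_nonneg by (subst integral_eq_nn_integral) simp_all
qed

lemma
  assumes Lp_w: "Lp w"
  shows integrable_\<phi>_mult_extend: "integrable hyp (\<lambda>\<xi>. \<phi> \<xi> powr (q - 1) * extend s w \<xi>)"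
    and integral_\<phi>_mult_extend: "(\<integral>\<xi>. \<phi> \<xi> powr (q - 1) * extend s w \<xi> \<partial>hyp) = energy (\<lambda>_. 1) / S * (\<integral>\<eta>. w \<eta> \<partial>sph)"
proof -
  note w_borel [measurable] = LpD(1)[OF Lp_w]
  define a b where "a \<eta> = max (w \<eta>) 0" and "b \<eta> = max (- w \<eta>) 0" for \<eta>
  have Lp_a_b: "Lp a" "Lp b"
    unfolding a_def[abs_def] b_def[abs_def] by (rule Lp_bound[OF Lp_w]; simp)+
  have w_eq: "w = (\<lambda>\<eta>. a \<eta> - b \<eta>)"
    by (auto simp: a_def b_def fun_eq_iff)
  have extend_eq: "AE \<xi> in hyp. \<phi> \<xi> powr (q - 1) * extend s a \<xi> - \<phi> \<xi> powr (q - 1) * extend s b \<xi> = \<phi> \<xi> powr (q - 1) * extend s w \<xi>"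
    using AE_hyp by eventually_elim (use Lp_a_b in \<open>simp add: w_eq extend_diff LpD Lp_integrable right_diff_distrib\<close>)
  have parts: "integrable hyp (\<lambda>\<xi>. \<phi> \<xi> powr (q - 1) * extend s a \<xi>)" "integrable hyp (\<lambda>\<xi>. \<phi> \<xi> powr (q - 1) * extend s b \<xi>)"
    "(\<integral>\<xi>. \<phi> \<xi> powr (q - 1) * extend s a \<xi> \<partial>hyp) = energy (\<lambda>_. 1) / S * (\<integral>\<eta>. a \<eta> \<partial>sph)"
    "(\<integral>\<xi>. \<phi> \<xi> powr (q - 1) * extend s b \<xi> \<partial>hyp) = energy (\<lambda>_. 1) / S * (\<integral>\<eta>. b \<eta> \<partial>sph)"
    using integrable_\<phi>_mult_extend_nonneg[OF Lp_a_b(1)] integral_\<phi>_mult_extend_nonneg[OF Lp_a_b(1)]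
      integrable_\<phi>_mult_extend_nonneg[OF Lp_a_b(2)] integral_\<phi>_mult_extend_nonneg[OF Lp_a_b(2)] by (simp_all add: a_def b_def)
  note [measurable] = LpD(1)[OF Lp_a_b(1)] LpD(1)[OF Lp_a_b(2)]
  show "integrable hyp (\<lambda>\<xi>. \<phi> \<xi> powr (q - 1) * extend s w \<xi>)"
    by (rule integrable_cong_AE_imp[OF Bochner_Integration.integrable_diff[OF parts(1,2)] _ extend_eq]) simp
  have "(\<integral>\<xi>. \<phi> \<xi> powr (q - 1) * extend s w \<xi> \<partial>hyp) = (\<integral>\<xi>. \<phi> \<xi> powr (q - 1) * extend s a \<xi> - \<phi> \<xi> powr (q - 1) * extend s b \<xi> \<partial>hyp)"
    by (rule integral_cong_AE[OF _ _ AE_symmetric[OF extend_eq]]) simp_all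
  also have "\<dots> = energy (\<lambda>_. 1) / S * (\<integral>\<eta>. a \<eta> - b \<eta> \<partial>sph)"
    using parts Lp_integrable Lp_a_b by (simp add: right_diff_distrib)
  finally show "(\<integral>\<xi>. \<phi> \<xi> powr (q - 1) * extend s w \<xi> \<partial>hyp) = energy (\<lambda>_. 1) / S * (\<integral>\<eta>. w \<eta> \<partial>sph)"
    by (simp add: w_eq[symmetric])
qed

lemma Lp_add_const:
  assumes Lp_u: "Lp u"
  shows "Lp (\<lambda>\<eta>. c + u \<eta>)"
proof -
  note [measurable] = LpD(1)[OF Lp_u]
  have bound: "\<bar>c + u \<eta>\<bar> powr p \<le> (2 * \<bar>c\<bar>) powr p + 2 powr p * \<bar>u \<eta>\<bar> powr p" for \<eta>
  proof -
    have "\<bar>c + u \<eta>\<bar> powr p \<le> (max (2 * \<bar>c\<bar>) (2 * \<bar>u \<eta>\<bar>)) powr p"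
      using p_gt_1 by (intro powr_mono2) auto
    also have "\<dots> \<le> (2 * \<bar>c\<bar>) powr p + (2 * \<bar>u \<eta>\<bar>) powr p"
      by (simp add: max_def)
    finally show ?thesis
      by (simp add: powr_mult)
  qed
  have "integrable sph (\<lambda>\<eta>. \<bar>c + u \<eta>\<bar> powr p)"
  proof (rule Bochner_Integration.integrable_bound[of _ "\<lambda>\<eta>. (2 * \<bar>c\<bar>) powr p + 2 powr p * \<bar>u \<eta>\<bar> powr p"])
    show "AE \<eta> in sph. norm (\<bar>c + u \<eta>\<bar> powr p) \<le> norm ((2 * \<bar>c\<bar>) powr p + 2 powr p * \<bar>u \<eta>\<bar> powr p)"
      using bound by (intro AE_I2) simp
  qed (use LpD(2)[OF Lp_u] in simp_all)
  then show ?thesis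
    unfolding Lp_def by simp
qed

lemma integrable_\<phi>_powr_mult_extend_powr:
  assumes Lp_w: "Lp w" and r_bounds: "0 \<le> r" "r \<le> q"
  shows "integrable hyp (\<lambda>\<xi>. \<phi> \<xi> powr (q - r) * \<bar>extend s w \<xi>\<bar> powr r)"
proof (rule Bochner_Integration.integrable_bound[of _ "\<lambda>\<xi>. \<phi> \<xi> powr q + \<bar>extend s w \<xi>\<bar> powr q"])
  show "integrable hyp (\<lambda>\<xi>. \<phi> \<xi> powr q + \<bar>extend s w \<xi>\<bar> powr q)"
    using \<phi>_integrable energy_integrable[OF Lp_w] by simp
  show "AE \<xi> in hyp. norm (\<phi> \<xi> powr (q - r) * \<bar>extend s w \<xi>\<bar> powr r) \<le> norm (\<phi> \<xi> powr q + \<bar>extend s w \<xi>\<bar> powr q)"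
    using powr_mult_powr_le[OF \<phi>_nonneg abs_ge_zero r_bounds] by simp
qed (use LpD(1)[OF Lp_w] in simp)

lemma mass_1_add_ge:
  assumes shift: "\<forall>x. \<bar>\<bar>1 + x\<bar> powr p - 1 - \<bar>x\<bar> powr p\<bar> \<le> \<theta> * \<bar>x\<bar> powr p + C * \<bar>x\<bar>" and Lp_w: "Lp w"
  shows "S + (1 - \<theta>) * mass w - C * (\<integral>\<eta>. \<bar>w \<eta>\<bar> \<partial>sph) \<le> mass (\<lambda>\<eta>. 1 + w \<eta>)"
proof -
  have "S + (1 - \<theta>) * mass w - C * (\<integral>\<eta>. \<bar>w \<eta>\<bar> \<partial>sph) = (\<integral>\<eta>. 1 + (1 - \<theta>) * \<bar>w \<eta>\<bar> powr p - C * \<bar>w \<eta>\<bar> \<partial>sph)"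
    using LpD(2)[OF Lp_w] Lp_integrable[OF Lp_w] by (simp add: mass_def measure_sph_S)
  also have "\<dots> \<le> mass (\<lambda>\<eta>. 1 + w \<eta>)"
    unfolding mass_def
  proof (rule integral_mono)
    show "integrable sph (\<lambda>\<eta>. 1 + (1 - \<theta>) * \<bar>w \<eta>\<bar> powr p - C * \<bar>w \<eta>\<bar>)" "integrable sph (\<lambda>\<eta>. \<bar>1 + w \<eta>\<bar> powr p)"
      using LpD(2)[OF Lp_w] LpD(2)[OF Lp_add_const[OF Lp_w]] Lp_integrable[OF Lp_w] by simp_all
    fix \<eta>
    have "- (\<theta> * \<bar>w \<eta>\<bar> powr p + C * \<bar>w \<eta>\<bar>) \<le> \<bar>1 + w \<eta>\<bar> powr p - 1 - \<bar>w \<eta>\<bar> powr p"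
      using shift[rule_format, of "w \<eta>"] unfolding abs_le_iff by linarith
    then show "1 + (1 - \<theta>) * \<bar>w \<eta>\<bar> powr p - C * \<bar>w \<eta>\<bar> \<le> \<bar>1 + w \<eta>\<bar> powr p"
      unfolding left_diff_distrib by linarith
  qed
  finally show ?thesis .
qed

lemma energy_1_add_le:
  assumes C_nonneg: "0 \<le> C" and shift: "\<forall>x. \<bar>\<bar>1 + x\<bar> powr q - 1 - \<bar>x\<bar> powr q\<bar> \<le> \<theta> * \<bar>x\<bar> powr q + C * \<bar>x\<bar>" and Lp_w: "Lp w"
  shows "energy (\<lambda>\<eta>. 1 + w \<eta>) \<le> energy (\<lambda>_. 1) + (1 + \<theta>) * energy w + C * (energy (\<lambda>_. 1) / S * (\<integral>\<eta>. \<bar>w \<eta>\<bar> \<partial>sph))"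
proof -
  let ?B = "\<lambda>\<xi>. \<phi> \<xi> powr q + (1 + \<theta>) * \<bar>extend s w \<xi>\<bar> powr q + C * (\<phi> \<xi> powr (q - 1) * extend s (\<lambda>\<eta>. \<bar>w \<eta>\<bar>) \<xi>)"
  note abs_w = integrable_\<phi>_mult_extend_nonneg[OF Lp_abs[OF Lp_w] abs_ge_zero] integral_\<phi>_mult_extend_nonneg[OF Lp_abs[OF Lp_w] abs_ge_zero]
  have "energy (\<lambda>\<eta>. 1 + w \<eta>) \<le> (\<integral>\<xi>. ?B \<xi> \<partial>hyp)"
    unfolding energy_def
  proof (rule integral_mono_AE[OF energy_integrable[OF Lp_add_const[OF Lp_w]]])
    show "integrable hyp ?B"
      using \<phi>_integrable energy_integrable[OF Lp_w] abs_w(1) by simp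
    show "AE \<xi> in hyp. \<bar>extend s (\<lambda>\<eta>. 1 + w \<eta>) \<xi>\<bar> powr q \<le> ?B \<xi>"
      using AE_hyp
    proof eventually_elim
      fix \<xi> :: 'a
      assume norm_\<xi>: "norm \<xi> < 1"
      have "\<bar>\<phi> \<xi> + extend s w \<xi>\<bar> powr q \<le> \<phi> \<xi> powr q + (1 + \<theta>) * \<bar>extend s w \<xi>\<bar> powr q + C * (\<phi> \<xi> powr (q - 1) * \<bar>extend s w \<xi>\<bar>)"
        by (rule abs_add_powr_le_shift[OF \<phi>_pos[OF norm_\<xi>] shift])
      also have "\<dots> \<le> ?B \<xi>"
        using C_nonneg abs_extend_le by (intro add_left_mono mult_left_mono) auto
      finally show "\<bar>extend s (\<lambda>\<eta>. 1 + w \<eta>) \<xi>\<bar> powr q \<le> ?B \<xi>"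
        by (simp add: extend_1_add[OF norm_\<xi> Lp_w])
    qed
  qed
  also have "\<dots> = energy (\<lambda>_. 1) + (1 + \<theta>) * energy w + C * (energy (\<lambda>_. 1) / S * (\<integral>\<eta>. \<bar>w \<eta>\<bar> \<partial>sph))"
    using \<phi>_integrable energy_integrable[OF Lp_w] abs_w \<phi>_nonneg by (simp add: energy_def[of w] energy_def[of "\<lambda>_. 1"] \<phi>_def)
  finally show ?thesis .
qed

definition outer_form :: "real \<Rightarrow> ('a \<Rightarrow> real) \<Rightarrow> real" where
  "outer_form R w = (\<integral>\<xi>. indicator {R..} (norm \<xi>) * (\<phi> \<xi> powr (q - 2) * \<bar>extend s w \<xi>\<bar> powr 2) \<partial>hyp)"

lemma outer_form_nonneg: "0 \<le> outer_form R w"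
  by (simp add: outer_form_def)

lemma outer_form_0: "outer_form 0 w = (\<integral>\<xi>. \<phi> \<xi> powr (q - 2) * \<bar>extend s w \<xi>\<bar> powr 2 \<partial>hyp)"
  by (simp add: outer_form_def)

lemma integrable_outer_form:
  assumes Lp_w: "Lp w"
  shows "integrable hyp (\<lambda>\<xi>. indicator {R..} (norm \<xi>) * (\<phi> \<xi> powr (q - 2) * \<bar>extend s w \<xi>\<bar> powr 2))"
proof (rule Bochner_Integration.integrable_bound[OF integrable_\<phi>_powr_mult_extend_powr[OF Lp_w, of 2]])
  show "2 \<le> q"
    using q_gt_2 by simp
qed (use LpD(1)[OF Lp_w] in \<open>auto simp: indicator_def\<close>)

lemma nn_integral_outer_form:
  assumes "Lp w"
  shows "(\<integral>\<^sup>+\<xi>. ennreal (indicator {R..} (norm \<xi>) * (\<phi> \<xi> powr (q - 2) * \<bar>extend s w \<xi>\<bar> powr 2)) \<partial>hyp) = ennreal (outer_form R w)"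
  unfolding outer_form_def by (rule nn_integral_eq_integral[OF integrable_outer_form[OF assms]]) simp

lemma integrable_mixed_power:
  assumes Lp_w: "Lp w"
  shows "integrable sph (\<lambda>\<eta>. mixed_power p (w \<eta>))"
proof (rule Bochner_Integration.integrable_bound[of _ "\<lambda>\<eta>. 1 + \<bar>w \<eta>\<bar> powr p"])
  show "AE \<eta> in sph. norm (mixed_power p (w \<eta>)) \<le> norm (1 + \<bar>w \<eta>\<bar> powr p)"
    using mixed_power_le mixed_power_nonneg by (intro AE_I2) simp
qed (use LpD[OF Lp_w] in simp_all)

lemma mass_1_add_ge_mixed_power:
  assumes Lp_w: "Lp w" and mean_0: "(\<integral>\<eta>. w \<eta> \<partial>sph) = 0" and excess_ge: "\<forall>x. c * mixed_power p x \<le> excess p x"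
  shows "S + c * (\<integral>\<eta>. mixed_power p (w \<eta>) \<partial>sph) \<le> mass (\<lambda>\<eta>. 1 + w \<eta>)"
proof -
  have "S + c * (\<integral>\<eta>. mixed_power p (w \<eta>) \<partial>sph) = (\<integral>\<eta>. 1 + p * w \<eta> + c * mixed_power p (w \<eta>) \<partial>sph)"
    using integrable_mixed_power[OF Lp_w] Lp_integrable[OF Lp_w] mean_0 by (simp add: measure_sph_S)
  also have "\<dots> \<le> mass (\<lambda>\<eta>. 1 + w \<eta>)"
    unfolding mass_def
  proof (rule integral_mono)
    show "integrable sph (\<lambda>\<eta>. 1 + p * w \<eta> + c * mixed_power p (w \<eta>))" "integrable sph (\<lambda>\<eta>. \<bar>1 + w \<eta>\<bar> powr p)"
      using integrable_mixed_power[OF Lp_w] Lp_integrable[OF Lp_w] LpD(2)[OF Lp_add_const[OF Lp_w]] by simp_all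
    show "1 + p * w \<eta> + c * mixed_power p (w \<eta>) \<le> \<bar>1 + w \<eta>\<bar> powr p" for \<eta>
      using excess_ge[rule_format, of "w \<eta>"] by (simp add: excess_def)
  qed
  finally show ?thesis .
qed

lemma energy_1_add_le_outer_form:
  assumes Lp_w: "Lp w" and mean_0: "(\<integral>\<eta>. w \<eta> \<partial>sph) = 0" and excess_le: "\<forall>x. excess q x \<le> D * (x\<^sup>2 + \<bar>x\<bar> powr q)"
  shows "energy (\<lambda>\<eta>. 1 + w \<eta>) \<le> energy (\<lambda>_. 1) + D * (outer_form 0 w + energy w)"
proof -
  let ?B = "\<lambda>\<xi>. \<phi> \<xi> powr q + q * (\<phi> \<xi> powr (q - 1) * extend s w \<xi>) + D * (\<phi> \<xi> powr (q - 2) * \<bar>extend s w \<xi>\<bar> powr 2 + \<bar>extend s w \<xi>\<bar> powr q)"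
  have form: "integrable hyp (\<lambda>\<xi>. \<phi> \<xi> powr (q - 2) * \<bar>extend s w \<xi>\<bar> powr 2)"
    using q_gt_2 by (intro integrable_\<phi>_powr_mult_extend_powr Lp_w) auto
  have "energy (\<lambda>\<eta>. 1 + w \<eta>) \<le> (\<integral>\<xi>. ?B \<xi> \<partial>hyp)"
    unfolding energy_def
  proof (rule integral_mono_AE[OF energy_integrable[OF Lp_add_const[OF Lp_w]]])
    show "integrable hyp ?B"
      using \<phi>_integrable energy_integrable[OF Lp_w] integrable_\<phi>_mult_extend[OF Lp_w] form by simp
    show "AE \<xi> in hyp. \<bar>extend s (\<lambda>\<eta>. 1 + w \<eta>) \<xi>\<bar> powr q \<le> ?B \<xi>"
      using AE_hyp
    proof eventually_elim
      fix \<xi> :: 'a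
      assume norm_\<xi>: "norm \<xi> < 1"
      show "\<bar>extend s (\<lambda>\<eta>. 1 + w \<eta>) \<xi>\<bar> powr q \<le> ?B \<xi>"
        unfolding extend_1_add[OF norm_\<xi> Lp_w] by (rule abs_add_powr_le_excess[OF \<phi>_pos[OF norm_\<xi>] excess_le])
    qed
  qed
  also have "\<dots> = energy (\<lambda>_. 1) + D * (outer_form 0 w + energy w)"
    using \<phi>_integrable energy_integrable[OF Lp_w] integrable_\<phi>_mult_extend[OF Lp_w] form integral_\<phi>_mult_extend[OF Lp_w] \<phi>_nonneg mean_0
    by (simp add: energy_def[of w] energy_def[of "\<lambda>_. 1"] outer_form_0 \<phi>_def)
  finally show ?thesis .
qed

definition inner_ratio :: "real \<Rightarrow> real" where
  "inner_ratio R = (1 / (2 * (1 - R)\<^sup>2)) powr s / (((1 - R\<^sup>2) / 8) powr s * S)"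

lemma \<phi>_mult_extend_square_le:
  assumes norm_\<xi>: "norm \<xi> \<le> R" and R_less_1: "R < 1" and Lp_w: "Lp w"
  shows "\<phi> \<xi> powr (q - 2) * \<bar>extend s w \<xi>\<bar> powr 2 \<le> (inner_ratio R * (\<integral>\<eta>. \<bar>w \<eta>\<bar> \<partial>sph))\<^sup>2 * \<phi> \<xi> powr q"
proof -
  define c k where "c = inner_ratio R * (\<integral>\<eta>. \<bar>w \<eta>\<bar> \<partial>sph)" and "k = ((1 - R\<^sup>2) / 8) powr s * S"
  have "0 \<le> R"
    using norm_\<xi> norm_ge_zero order_trans by blast
  then have "R\<^sup>2 < 1"
    using R_less_1 by (simp add: abs_square_less_1)
  then have k_pos: "0 < k"
    using S_pos by (simp add: k_def)
  have c_nonneg: "0 \<le> c"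
    using S_pos by (simp add: c_def inner_ratio_def)
  have "\<bar>extend s w \<xi>\<bar> \<le> c * k"
    using abs_extend_le_L1[OF norm_\<xi> R_less_1 LpD(1)[OF Lp_w] Lp_integrable[OF Lp_w]] k_pos by (simp add: inner_ratio_def c_def k_def[symmetric])
  also have "\<dots> \<le> c * \<phi> \<xi>"
    using \<phi>_ge[OF norm_\<xi> R_less_1] c_nonneg by (intro mult_left_mono) (auto simp: k_def)
  finally have "\<bar>extend s w \<xi>\<bar> powr 2 \<le> (c * \<phi> \<xi>) powr 2"
    by (intro powr_mono2) auto
  then have "\<phi> \<xi> powr (q - 2) * \<bar>extend s w \<xi>\<bar> powr 2 \<le> \<phi> \<xi> powr (q - 2) * (c * \<phi> \<xi>) powr 2"
    by (rule mult_left_mono) simp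
  also have "\<dots> = c powr 2 * \<phi> \<xi> powr (q - 2 + 2)"
    by (simp only: powr_mult powr_add mult.left_commute)
  finally show ?thesis
    using c_nonneg by (simp add: c_def)
qed

lemma outer_form_0_le:
  assumes R_less_1: "R < 1" and Lp_w: "Lp w"
  shows "outer_form 0 w \<le> (inner_ratio R)\<^sup>2 * energy (\<lambda>_. 1) * (\<integral>\<eta>. \<bar>w \<eta>\<bar> \<partial>sph)\<^sup>2 + outer_form R w"
proof -
  let ?c = "inner_ratio R * (\<integral>\<eta>. \<bar>w \<eta>\<bar> \<partial>sph)"
  let ?B = "\<lambda>\<xi>. ?c\<^sup>2 * \<phi> \<xi> powr q + indicator {R..} (norm \<xi>) * (\<phi> \<xi> powr (q - 2) * \<bar>extend s w \<xi>\<bar> powr 2)"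
  have "outer_form 0 w \<le> (\<integral>\<xi>. ?B \<xi> \<partial>hyp)"
    unfolding outer_form_def
  proof (rule integral_mono[OF integrable_outer_form[OF Lp_w]])
    show "integrable hyp ?B"
      using \<phi>_integrable integrable_outer_form[OF Lp_w] by simp
    show "indicator {0..} (norm \<xi>) * (\<phi> \<xi> powr (q - 2) * \<bar>extend s w \<xi>\<bar> powr 2) \<le> ?B \<xi>" for \<xi>
      using \<phi>_mult_extend_square_le[OF _ R_less_1 Lp_w, of \<xi>] by (cases "R \<le> norm \<xi>") simp_all
  qed
  also have "\<dots> = ?c\<^sup>2 * energy (\<lambda>_. 1) + outer_form R w"
    using \<phi>_integrable integrable_outer_form[OF Lp_w] outer_energy_0 by (simp add: outer_form_def outer_energy_def)
  finally show ?thesis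
    by (simp only: power_mult_distrib mult.commute mult.left_commute)
qed

lemma extend_square_le:
  assumes norm_\<xi>: "norm \<xi> < 1" and Lp_w: "Lp w" and square: "integrable sph (\<lambda>\<eta>. (w \<eta>)\<^sup>2)"
  shows "(extend s w \<xi>)\<^sup>2 \<le> \<phi> \<xi> * extend s (\<lambda>\<eta>. (w \<eta>)\<^sup>2) \<xi>"
proof -
  note [measurable] = LpD(1)[OF Lp_w]
  define t where "t = extend s w \<xi> / \<phi> \<xi>"
  have kernel_integrable: "integrable sph (\<lambda>\<eta>. kernel s \<xi> \<eta> * w \<eta>)" "integrable sph (\<lambda>\<eta>. kernel s \<xi> \<eta> * (w \<eta>)\<^sup>2)" "integrable sph (\<lambda>\<eta>. kernel s \<xi> \<eta> * 1)"
    using Lp_integrable[OF Lp_w] square by (intro integrable_kernel_mult[OF norm_\<xi>]; simp)+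
  have "0 \<le> (\<integral>\<eta>. kernel s \<xi> \<eta> * (w \<eta> - t)\<^sup>2 \<partial>sph)"
    by (intro integral_nonneg_AE AE_I2 mult_nonneg_nonneg) (auto simp: kernel_def)
  also have "\<dots> = (\<integral>\<eta>. kernel s \<xi> \<eta> * (w \<eta>)\<^sup>2 - 2 * t * (kernel s \<xi> \<eta> * w \<eta>) + t\<^sup>2 * (kernel s \<xi> \<eta> * 1) \<partial>sph)"
    by (intro Bochner_Integration.integral_cong) (auto simp: power2_diff algebra_simps)
  also have "\<dots> = extend s (\<lambda>\<eta>. (w \<eta>)\<^sup>2) \<xi> - 2 * t * extend s w \<xi> + t\<^sup>2 * \<phi> \<xi>"
    unfolding extend_def \<phi>_def using kernel_integrable by simp
  also have "\<dots> = extend s (\<lambda>\<eta>. (w \<eta>)\<^sup>2) \<xi> - (extend s w \<xi>)\<^sup>2 / \<phi> \<xi>"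
    using \<phi>_pos[OF norm_\<xi>] by (simp add: t_def power2_eq_square field_simps)
  finally show ?thesis
    using \<phi>_pos[OF norm_\<xi>] by (simp add: field_simps)
qed

lemma outer_form_le_square:
  assumes Lp_w: "Lp w" and square: "integrable sph (\<lambda>\<eta>. (w \<eta>)\<^sup>2)"
  shows "outer_form R w \<le> outer_energy R / S * (\<integral>\<eta>. (w \<eta>)\<^sup>2 \<partial>sph)"
proof -
  note [measurable] = LpD(1)[OF Lp_w]
  have "ennreal (outer_form R w) \<le> (\<integral>\<^sup>+\<xi>. ennreal (indicator {R..} (norm \<xi>) * \<phi> \<xi> powr (q - 1) * extend s (\<lambda>\<eta>. (w \<eta>)\<^sup>2) \<xi>) \<partial>hyp)"
    unfolding nn_integral_outer_form[OF Lp_w, symmetric]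
  proof (rule nn_integral_mono_AE, use AE_hyp in eventually_elim)
    fix \<xi> :: 'a
    assume norm_\<xi>: "norm \<xi> < 1"
    have "\<phi> \<xi> powr (q - 2) * \<bar>extend s w \<xi>\<bar> powr 2 \<le> \<phi> \<xi> powr (q - 2) * (\<phi> \<xi> * extend s (\<lambda>\<eta>. (w \<eta>)\<^sup>2) \<xi>)"
      using extend_square_le[OF norm_\<xi> Lp_w square] by (intro mult_left_mono) auto
    also have "\<dots> = \<phi> \<xi> powr (q - 1) * extend s (\<lambda>\<eta>. (w \<eta>)\<^sup>2) \<xi>"
      using \<phi>_powr_mult[OF norm_\<xi>, of "q - 2"] by (simp flip: mult.assoc)
    finally show "ennreal (indicator {R..} (norm \<xi>) * (\<phi> \<xi> powr (q - 2) * \<bar>extend s w \<xi>\<bar> powr 2))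
      \<le> ennreal (indicator {R..} (norm \<xi>) * \<phi> \<xi> powr (q - 1) * extend s (\<lambda>\<eta>. (w \<eta>)\<^sup>2) \<xi>)"
      by (simp add: indicator_def ennreal_leI)
  qed
  also have "\<dots> = ennreal (outer_energy R / S * (\<integral>\<eta>. (w \<eta>)\<^sup>2 \<partial>sph))"
    by (rule nn_integral_outer_extend) (use square in auto)
  finally show ?thesis
    using outer_energy_nonneg S_pos by (subst (asm) ennreal_le_iff) auto
qed

lemma
  assumes p_ge_2: "2 \<le> p" and Lp_w: "Lp w"
  shows square_integrable: "integrable sph (\<lambda>\<eta>. (w \<eta>)\<^sup>2)"
    and mass_plus_square_le: "mass w + (\<integral>\<eta>. (w \<eta>)\<^sup>2 \<partial>sph) \<le> (2 + 2 powr (p - 2)) * (\<integral>\<eta>. mixed_power p (w \<eta>) \<partial>sph)"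
proof -
  note [measurable] = LpD(1)[OF Lp_w]
  have mixed: "integrable sph (\<lambda>\<eta>. (2 + 2 powr (p - 2)) * mixed_power p (w \<eta>))"
    using integrable_mixed_power[OF Lp_w] by simp
  show square: "integrable sph (\<lambda>\<eta>. (w \<eta>)\<^sup>2)"
  proof (rule Bochner_Integration.integrable_bound[OF mixed], measurable, intro AE_I2)
    fix \<eta>
    have "(w \<eta>)\<^sup>2 \<le> (2 + 2 powr (p - 2)) * mixed_power p (w \<eta>)"
      using square_plus_powr_le_mixed_power[OF p_ge_2, of "w \<eta>"] powr_ge_zero[of "\<bar>w \<eta>\<bar>" p] by linarith
    then show "norm ((w \<eta>)\<^sup>2) \<le> norm ((2 + 2 powr (p - 2)) * mixed_power p (w \<eta>))"
      by (simp add: abs_mult mixed_power_nonneg)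
  qed
  have "mass w + (\<integral>\<eta>. (w \<eta>)\<^sup>2 \<partial>sph) = (\<integral>\<eta>. (w \<eta>)\<^sup>2 + \<bar>w \<eta>\<bar> powr p \<partial>sph)"
    using square LpD(2)[OF Lp_w] by (simp add: mass_def)
  also have "\<dots> \<le> (\<integral>\<eta>. (2 + 2 powr (p - 2)) * mixed_power p (w \<eta>) \<partial>sph)"
    using mixed square LpD(2)[OF Lp_w] square_plus_powr_le_mixed_power[OF p_ge_2] by (intro integral_mono) auto
  finally show "mass w + (\<integral>\<eta>. (w \<eta>)\<^sup>2 \<partial>sph) \<le> (2 + 2 powr (p - 2)) * (\<integral>\<eta>. mixed_power p (w \<eta>) \<partial>sph)"
    by simp
qed

lemma mass_le_powr_half:
  assumes p_less_2: "p < 2" and Lp_w: "Lp w" and M_bounds: "(\<integral>\<eta>. mixed_power p (w \<eta>) \<partial>sph) \<le> M" "0 < M" "M \<le> 1"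
  shows "mass w \<le> (S + 2) * M powr (p / 2)"
proof -
  define \<delta> where "\<delta> = sqrt M"
  have \<delta>_pos: "0 < \<delta>" and \<delta>_powr: "\<delta> powr p = M powr (p / 2)"
    using M_bounds by (simp_all add: \<delta>_def powr_half_sqrt[symmetric] powr_powr)
  have "\<delta> powr (p - 2) * M = \<delta> powr (p - 2) * \<delta> powr 2"
    using M_bounds by (simp add: \<delta>_def)
  then have \<delta>_powr_mult: "\<delta> powr (p - 2) * M = M powr (p / 2)"
    unfolding powr_add[symmetric] \<delta>_powr[symmetric] by simp
  have "mass w \<le> (\<integral>\<eta>. \<delta> powr p + (\<delta> powr (p - 2) + 1) * mixed_power p (w \<eta>) \<partial>sph)"
    unfolding mass_def using LpD(2)[OF Lp_w] integrable_mixed_power[OF Lp_w] p_less_2 p_gt_1 \<delta>_pos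
    by (intro integral_mono abs_powr_le_mixed_power) auto
  also have "\<dots> = \<delta> powr p * S + (\<delta> powr (p - 2) + 1) * (\<integral>\<eta>. mixed_power p (w \<eta>) \<partial>sph)"
    using integrable_mixed_power[OF Lp_w] by (simp add: measure_sph_S)
  also have "\<dots> \<le> \<delta> powr p * S + (\<delta> powr (p - 2) + 1) * M"
    using M_bounds by (intro add_left_mono mult_left_mono) (auto intro: add_nonneg_nonneg)
  also have "\<dots> = M powr (p / 2) * (S + 1) + M"
    by (simp add: distrib_right distrib_left \<delta>_powr \<delta>_powr_mult)
  also have "\<dots> \<le> (S + 2) * M powr (p / 2)"
    using M_bounds p_less_2 p_gt_1 powr_mono'[of "p / 2" 1 M] by (simp add: algebra_simps)
  finally show ?thesis .
qed

lemma mass_powr_le_mixed_power: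
  assumes p_less_2: "p < 2" and w_mass_le: "Lp w" "mass w \<le> 1" and M_bounds: "(\<integral>\<eta>. mixed_power p (w \<eta>) \<partial>sph) \<le> M" "0 < M"
  shows "mass w powr (2 / p) \<le> (S + 2) powr (2 / p) * M"
proof (cases "M \<le> 1")
  case True
  have "mass w powr (2 / p) \<le> ((S + 2) * M powr (p / 2)) powr (2 / p)"
    using mass_le_powr_half[OF p_less_2 w_mass_le(1) M_bounds True] p_gt_1 mass_nonneg by (intro powr_mono2) auto
  also have "\<dots> = (S + 2) powr (2 / p) * M"
    using p_gt_1 M_bounds by (simp add: powr_mult powr_powr)
  finally show ?thesis .
next
  case False
  have "mass w powr (2 / p) \<le> 1 * 1"
    using w_mass_le(2) p_gt_1 mass_nonneg by (simp add: powr_le1)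
  also have "\<dots> \<le> (S + 2) powr (2 / p) * M"
    using False S_pos p_gt_1 by (intro mult_mono ge_one_powr_ge_zero) auto
  finally show ?thesis .
qed

lemma distance_le_of_absorbed_form:
  assumes w_small: "Lp w" "(\<integral>\<eta>. \<bar>w \<eta>\<bar> \<partial>sph) \<le> K * sqrt \<tau>" and \<tau>_pos: "0 < \<tau>" and R_less_1: "R < 1" and C0_C1_nonneg: "0 \<le> C0" "0 \<le> C1" and V_nonneg: "0 \<le> V"
    and quadratic: "(\<integral>\<eta>. mixed_power p (w \<eta>) \<partial>sph) \<le> C0 * (\<tau> + outer_form 0 w + mass w powr r)"
    and distance: "\<And>B. (\<integral>\<eta>. mixed_power p (w \<eta>) \<partial>sph) \<le> B \<Longrightarrow> 0 < B \<Longrightarrow> V \<le> C1 * B"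
    and outer: "outer_form R w \<le> \<epsilon> * V" "C1 * (C0 + 1) * \<epsilon> \<le> 1 / 4"
    and superlinear: "mass w powr r \<le> \<omega> * V" "C1 * (C0 + 1) * \<omega> \<le> 1 / 4"
  shows "V \<le> 2 * (C1 * (C0 + 1)) * (1 + (inner_ratio R)\<^sup>2 * energy (\<lambda>_. 1) * K\<^sup>2) * \<tau>"
proof (rule le_of_absorbed_terms[OF _ V_nonneg outer(2) superlinear(2)])
  define A B where "A = (inner_ratio R)\<^sup>2 * energy (\<lambda>_. 1)" and "B = \<tau> + outer_form 0 w + mass w powr r"
  have "0 < B"
    using \<tau>_pos outer_form_nonneg[of 0 w] by (simp add: B_def add_pos_nonneg)
  then have estimate: "V \<le> C1 * ((C0 + 1) * B)"
    using quadratic C0_C1_nonneg by (intro distance) (auto simp: B_def distrib_right add_nonneg_pos)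
  have "(\<integral>\<eta>. \<bar>w \<eta>\<bar> \<partial>sph)\<^sup>2 \<le> K\<^sup>2 * \<tau>"
    using power_mono[OF w_small(2), of 2] \<tau>_pos by (simp add: power_mult_distrib)
  then have "A * (\<integral>\<eta>. \<bar>w \<eta>\<bar> \<partial>sph)\<^sup>2 \<le> A * K\<^sup>2 * \<tau>"
    unfolding A_def using energy_nonneg by (simp add: mult_left_mono mult.assoc)
  then have "B \<le> \<tau> + A * K\<^sup>2 * \<tau> + \<epsilon> * V + \<omega> * V"
    using outer_form_0_le[OF R_less_1 w_small(1)] outer(1) superlinear(1) unfolding A_def B_def by linarith
  then have "C1 * (C0 + 1) * B \<le> C1 * (C0 + 1) * (\<tau> + A * K\<^sup>2 * \<tau> + \<epsilon> * V + \<omega> * V)"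
    using C0_C1_nonneg by (intro mult_left_mono) simp_all
  then show "V \<le> C1 * (C0 + 1) * (\<tau> + (inner_ratio R)\<^sup>2 * energy (\<lambda>_. 1) * K\<^sup>2 * \<tau> + \<epsilon> * V + \<omega> * V)"
    using estimate by (simp add: A_def mult.assoc)
qed

end

context sharp_conformal_extension
begin

lemma energy_1_le: "energy (\<lambda>_. 1 :: real) \<le> \<Gamma> * S powr (q / p)"
  using sharp[OF Lp_const[of 1]] by (simp add: mass_1)

definition perturbation :: "real \<Rightarrow> real \<Rightarrow> ('a \<Rightarrow> real) \<Rightarrow> bool" where
  "perturbation \<tau> l w \<longleftrightarrow> Lp w \<and> (\<integral>\<eta>. w \<eta> \<partial>sph) = 0 \<and> 1 = \<bar>l\<bar> powr p * mass (\<lambda>\<eta>. 1 + w \<eta>) \<and> \<Gamma> - \<tau> \<le> \<bar>l\<bar> powr q * energy (\<lambda>\<eta>. 1 + w \<eta>)"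

lemma energy_gap_le:
  assumes perturbation_w: "perturbation \<tau> l w" and l_nonzero: "l \<noteq> 0" and excess_ge: "0 \<le> c" "\<forall>x. c * mixed_power p x \<le> excess p x"
  shows "\<Gamma> * (S powr (q / p) + q / p * S powr (q / p - 1) * (c * (\<integral>\<eta>. mixed_power p (w \<eta>) \<partial>sph))) \<le> energy (\<lambda>\<eta>. 1 + w \<eta>) + \<tau> * \<bar>l\<bar> powr - q"
proof -
  define e k M where "e = mass (\<lambda>\<eta>. 1 + w \<eta>)" and "k = q / p" and "M = (\<integral>\<eta>. mixed_power p (w \<eta>) \<partial>sph)"
  have k_gt_1: "1 < k"
    using p_less_q p_gt_1 by (simp add: k_def)
  have "0 \<le> c * M"
    using excess_ge(1) by (simp add: M_def mixed_power_nonneg)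
  have "e = \<bar>l\<bar> powr - p"
    using perturbation_w l_nonzero by (simp add: perturbation_def e_def powr_minus field_simps)
  then have e_powr: "e powr k = \<bar>l\<bar> powr - q"
    using p_gt_1 by (simp add: powr_powr k_def)
  have "S powr k + k * S powr (k - 1) * (c * M) \<le> (S + c * M) powr k"
    using powr_ge_tangent[of k S "S + c * M"] k_gt_1 S_pos \<open>0 \<le> c * M\<close> by simp
  also have "\<dots> \<le> e powr k"
    using perturbation_w excess_ge mass_1_add_ge_mixed_power[of w c] S_pos \<open>0 \<le> c * M\<close> k_gt_1 by (intro powr_mono2) (auto simp: e_def M_def perturbation_def)
  finally have "\<Gamma> * (S powr k + k * S powr (k - 1) * (c * M)) \<le> \<Gamma> * \<bar>l\<bar> powr - q"
    unfolding e_powr using \<Gamma>_pos by (intro mult_left_mono) auto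
  moreover have "(\<Gamma> - \<tau>) * \<bar>l\<bar> powr - q \<le> \<bar>l\<bar> powr q * energy (\<lambda>\<eta>. 1 + w \<eta>) * \<bar>l\<bar> powr - q"
    using perturbation_w by (intro mult_right_mono) (auto simp: perturbation_def)
  moreover have "\<bar>l\<bar> powr q * energy (\<lambda>\<eta>. 1 + w \<eta>) * \<bar>l\<bar> powr - q = energy (\<lambda>\<eta>. 1 + w \<eta>)"
    using l_nonzero by (simp add: powr_minus)
  ultimately show ?thesis
    unfolding k_def M_def left_diff_distrib by linarith
qed

lemma quadratic_estimate:
  assumes l0_pos: "0 < l0"
  obtains C where "0 \<le> C" "\<forall>w l \<tau>. perturbation \<tau> l w \<longrightarrow> 0 < \<tau> \<longrightarrow> l0 \<le> \<bar>l\<bar> \<longrightarrow>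
    (\<integral>\<eta>. mixed_power p (w \<eta>) \<partial>sph) \<le> C * (\<tau> + outer_form 0 w + mass w powr (q / p))"
proof -
  obtain c where excess_ge: "0 < c" "\<forall>x. c * mixed_power p x \<le> excess p x"
    by (rule excess_ge_mixed_power[OF p_gt_1])
  obtain D where D_bound: "0 \<le> D" "\<forall>x. excess q x \<le> D * (x\<^sup>2 + \<bar>x\<bar> powr q)"
    by (rule excess_le_square_plus_powr[OF q_gt_2])
  define g where "g = \<Gamma> * (q / p * S powr (q / p - 1) * c)"
  have g_pos: "0 < g"
    using \<Gamma>_pos S_pos excess_ge p_gt_1 q_gt_2 by (simp add: g_def)
  show thesis
  proof (intro that allI impI)
    show "0 \<le> (l0 powr - q + D + D * \<Gamma>) / g"
      using D_bound \<Gamma>_pos g_pos by simp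
    fix w :: "'a \<Rightarrow> real" and l \<tau> :: real
    assume pert: "perturbation \<tau> l w" and \<tau>_pos: "0 < \<tau>" and l_ge: "l0 \<le> \<bar>l\<bar>"
    then have w_mean_0: "Lp w" "(\<integral>\<eta>. w \<eta> \<partial>sph) = 0"
      by (simp_all add: perturbation_def)
    define M B where "M = (\<integral>\<eta>. mixed_power p (w \<eta>) \<partial>sph)" and "B = \<tau> + outer_form 0 w + mass w powr (q / p)"
    have "l \<noteq> 0"
      using l_ge l0_pos by auto
    then have "\<Gamma> * S powr (q / p) + g * M \<le> energy (\<lambda>\<eta>. 1 + w \<eta>) + \<tau> * \<bar>l\<bar> powr - q"
      using energy_gap_le[OF pert _ less_imp_le[OF excess_ge(1)] excess_ge(2)] by (simp add: M_def g_def distrib_left mult.assoc)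
    moreover have "energy (\<lambda>\<eta>. 1 + w \<eta>) \<le> energy (\<lambda>_. 1) + D * (outer_form 0 w + energy w)"
      by (rule energy_1_add_le_outer_form[OF w_mean_0 D_bound(2)])
    moreover have "D * (outer_form 0 w + energy w) \<le> D * (outer_form 0 w + \<Gamma> * mass w powr (q / p))"
      using sharp[OF w_mean_0(1)] D_bound by (intro mult_left_mono) auto
    moreover have "\<tau> * \<bar>l\<bar> powr - q \<le> \<tau> * l0 powr - q"
      using \<tau>_pos l_ge l0_pos q_gt_2 by (intro mult_left_mono powr_mono2') auto
    ultimately have "g * M \<le> l0 powr - q * \<tau> + D * outer_form 0 w + D * \<Gamma> * mass w powr (q / p)"
      using energy_1_le by (simp add: distrib_left mult.assoc mult.commute[of \<tau>])
    also have "\<dots> \<le> l0 powr - q * B + D * B + D * \<Gamma> * B"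
      using D_bound \<Gamma>_pos \<tau>_pos outer_form_nonneg[of 0 w] by (intro add_mono mult_left_mono) (auto simp: B_def)
    finally show "M \<le> (l0 powr - q + D + D * \<Gamma>) / g * B"
      using g_pos by (simp add: field_simps)
  qed
qed

lemma small_part_estimates:
  assumes perturbation_w: "perturbation \<tau> l w" and \<theta>_nonneg: "0 \<le> \<theta>" and C2_nonneg: "0 \<le> C2"
    and shift_p: "\<forall>x. \<bar>\<bar>1 + x\<bar> powr p - 1 - \<bar>x\<bar> powr p\<bar> \<le> \<theta> * \<bar>x\<bar> powr p + C1 * \<bar>x\<bar>"
    and shift_q: "\<forall>x. \<bar>\<bar>1 + x\<bar> powr q - 1 - \<bar>x\<bar> powr q\<bar> \<le> \<theta> * \<bar>x\<bar> powr q + C2 * \<bar>x\<bar>"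
  defines "X \<equiv> \<bar>l\<bar> powr p * S" and "Y \<equiv> \<bar>l\<bar> powr p * mass w" and "W \<equiv> (\<integral>\<eta>. \<bar>w \<eta>\<bar> \<partial>sph)"
  shows "X + (1 - \<theta>) * Y \<le> 1 + \<bar>l\<bar> powr p * (C1 * W)"
    and "\<Gamma> * (1 - (X powr (q / p) + (1 + \<theta>) * Y powr (q / p))) \<le> \<tau> + \<bar>l\<bar> powr q * (C2 * (energy (\<lambda>_. 1) / S * W))"
proof -
  have Lp_w: "Lp w"
    using perturbation_w by (simp add: perturbation_def)
  have "\<bar>l\<bar> powr p * (S + (1 - \<theta>) * mass w - C1 * W) \<le> 1"
    using mult_left_mono[OF mass_1_add_ge[OF shift_p Lp_w], of "\<bar>l\<bar> powr p"] perturbation_w unfolding perturbation_def W_def by simp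
  then show "X + (1 - \<theta>) * Y \<le> 1 + \<bar>l\<bar> powr p * (C1 * W)"
    by (simp add: X_def Y_def algebra_simps)
  have scale: "(\<bar>l\<bar> powr p * x) powr (q / p) = \<bar>l\<bar> powr q * x powr (q / p)" for x
    using p_gt_1 by (simp add: powr_mult powr_powr)
  have "\<Gamma> - \<tau> \<le> \<bar>l\<bar> powr q * (energy (\<lambda>_. 1) + (1 + \<theta>) * energy w + C2 * (energy (\<lambda>_. 1) / S * W))"
    using perturbation_w mult_left_mono[OF energy_1_add_le[OF C2_nonneg shift_q Lp_w], of "\<bar>l\<bar> powr q"] by (simp add: perturbation_def W_def)
  also have "\<dots> \<le> \<bar>l\<bar> powr q * (\<Gamma> * S powr (q / p) + (1 + \<theta>) * (\<Gamma> * mass w powr (q / p)) + C2 * (energy (\<lambda>_. 1) / S * W))"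
    using energy_1_le sharp[OF Lp_w] \<theta>_nonneg by (intro mult_left_mono add_mono order_refl) auto
  also have "\<dots> = \<Gamma> * (X powr (q / p) + (1 + \<theta>) * Y powr (q / p)) + \<bar>l\<bar> powr q * (C2 * (energy (\<lambda>_. 1) / S * W))"
    unfolding X_def Y_def scale by (simp add: algebra_simps)
  finally show "\<Gamma> * (1 - (X powr (q / p) + (1 + \<theta>) * Y powr (q / p))) \<le> \<tau> + \<bar>l\<bar> powr q * (C2 * (energy (\<lambda>_. 1) / S * W))"
    by (simp add: right_diff_distrib)
qed

lemma small_part_estimates_sqrt:
  assumes perturbation_w: "perturbation \<tau> l w" "(\<integral>\<eta>. \<bar>w \<eta>\<bar> \<partial>sph) \<le> K * sqrt \<tau>" and \<tau>_bounds: "0 < \<tau>" "\<tau> \<le> 1"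
    and l_le: "\<bar>l\<bar> \<le> l1" and K_nonneg: "0 \<le> K" and \<theta>_nonneg: "0 \<le> \<theta>" and C1_C2_nonneg: "0 \<le> C1" "0 \<le> C2"
    and shift_p: "\<forall>x. \<bar>\<bar>1 + x\<bar> powr p - 1 - \<bar>x\<bar> powr p\<bar> \<le> \<theta> * \<bar>x\<bar> powr p + C1 * \<bar>x\<bar>"
    and shift_q: "\<forall>x. \<bar>\<bar>1 + x\<bar> powr q - 1 - \<bar>x\<bar> powr q\<bar> \<le> \<theta> * \<bar>x\<bar> powr q + C2 * \<bar>x\<bar>"
  defines "X \<equiv> \<bar>l\<bar> powr p * S" and "Y \<equiv> \<bar>l\<bar> powr p * mass w"
    and "D \<equiv> l1 powr p * (C1 * K) + (1 + l1 powr q * (C2 * (energy (\<lambda>_. 1) / S * K))) / \<Gamma>"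
  shows "X + (1 - \<theta>) * Y \<le> 1 + D * sqrt \<tau>" and "1 - D * sqrt \<tau> \<le> X powr (q / p) + (1 + \<theta>) * Y powr (q / p)"
proof -
  define h D1 D2 where "h = energy (\<lambda>_. 1) / S" and "D1 = l1 powr p * (C1 * K)" and "D2 = (1 + l1 powr q * (C2 * (h * K))) / \<Gamma>"
  have h_nonneg: "0 \<le> h"
    using energy_nonneg S_pos by (simp add: h_def)
  have "D = D1 + D2"
    by (simp add: D_def D1_def D2_def h_def)
  moreover have "0 \<le> D1" "0 \<le> D2"
    using h_nonneg C1_C2_nonneg K_nonneg \<Gamma>_pos by (simp_all add: D1_def D2_def)
  ultimately have D_parts_le: "D1 * sqrt \<tau> \<le> D * sqrt \<tau>" "D2 * sqrt \<tau> \<le> D * sqrt \<tau>"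
    using \<tau>_bounds(1) by (simp_all add: mult_right_mono)
  have \<Gamma>_D2: "\<Gamma> * D2 = 1 + l1 powr q * (C2 * (h * K))"
    using \<Gamma>_pos by (simp add: D2_def)
  have l_powr: "\<bar>l\<bar> powr p \<le> l1 powr p" "\<bar>l\<bar> powr q \<le> l1 powr q"
    using l_le p_gt_1 q_gt_2 by (auto intro: powr_mono2)
  have "\<tau> \<le> sqrt \<tau>"
    using \<tau>_bounds by (simp add: le_sqrt_self)
  note estimates = small_part_estimates[OF perturbation_w(1) \<theta>_nonneg C1_C2_nonneg(2) shift_p shift_q, folded X_def Y_def h_def]
  note estimates(1)
  also have "\<bar>l\<bar> powr p * (C1 * (\<integral>\<eta>. \<bar>w \<eta>\<bar> \<partial>sph)) \<le> l1 powr p * (C1 * (K * sqrt \<tau>))"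
    using l_powr perturbation_w(2) C1_C2_nonneg by (intro mult_mono) auto
  finally show "X + (1 - \<theta>) * Y \<le> 1 + D * sqrt \<tau>"
    using D_parts_le(1) by (simp add: D1_def mult.assoc)
  note estimates(2)
  also have "\<bar>l\<bar> powr q * (C2 * (h * (\<integral>\<eta>. \<bar>w \<eta>\<bar> \<partial>sph))) \<le> l1 powr q * (C2 * (h * (K * sqrt \<tau>)))"
    using l_powr perturbation_w(2) C1_C2_nonneg h_nonneg by (intro mult_mono) auto
  also have "\<tau> + \<dots> \<le> \<Gamma> * (D2 * sqrt \<tau>)"
    unfolding mult.assoc[symmetric, of \<Gamma>] \<Gamma>_D2 using \<open>\<tau> \<le> sqrt \<tau>\<close> by (simp add: algebra_simps)
  finally have "1 - (X powr (q / p) + (1 + \<theta>) * Y powr (q / p)) \<le> D2 * sqrt \<tau>"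
    using \<Gamma>_pos by simp
  then show "1 - D * sqrt \<tau> \<le> X powr (q / p) + (1 + \<theta>) * Y powr (q / p)"
    using D_parts_le(2) by linarith
qed

lemma mass_perturbation_le:
  assumes l0_pos: "0 < l0" and K_nonneg: "0 \<le> K"
  obtains C t where "0 \<le> C" "0 < t"
    "\<forall>w l \<tau>. perturbation \<tau> l w \<longrightarrow> 0 < \<tau> \<longrightarrow> \<tau> \<le> t \<longrightarrow> l0 \<le> \<bar>l\<bar> \<longrightarrow> \<bar>l\<bar> \<le> (S + 1) / S \<longrightarrow> (\<integral>\<eta>. \<bar>w \<eta>\<bar> \<partial>sph) \<le> K * sqrt \<tau> \<longrightarrow> mass w \<le> C * sqrt \<tau>"
proof -
  define k x0 l1 where "k = q / p" and "x0 = min (l0 powr p * S) (1 / 2)" and "l1 = (S + 1) / S"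
  have k_gt_1: "1 < k" and x0_bounds: "0 < x0" "x0 < 1"
    using p_less_q p_gt_1 l0_pos S_pos by (auto simp: k_def x0_def)
  have q_gt_1: "1 < q"
    using q_gt_2 by simp
  obtain \<theta> C d0 where \<theta>_pos: "0 < \<theta>" and C_nonneg: "0 \<le> C" and d0_pos: "0 < d0"
    and split: "\<forall>X Y d. 0 \<le> d \<longrightarrow> d \<le> d0 \<longrightarrow> x0 \<le> X \<longrightarrow> 0 \<le> Y \<longrightarrow> X + (1 - \<theta>) * Y \<le> 1 + d \<longrightarrow>
      1 - d \<le> X powr k + (1 + \<theta>) * Y powr k \<longrightarrow> Y \<le> C * d"
    by (rule no_splitting[OF x0_bounds k_gt_1])
  obtain C1 where C1_bound: "0 \<le> C1" "\<forall>x. \<bar>\<bar>1 + x\<bar> powr p - 1 - \<bar>x\<bar> powr p\<bar> \<le> \<theta> * \<bar>x\<bar> powr p + C1 * \<bar>x\<bar>"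
    by (rule abs_powr_shift[OF p_gt_1 \<theta>_pos])
  obtain C2 where C2_bound: "0 \<le> C2" "\<forall>x. \<bar>\<bar>1 + x\<bar> powr q - 1 - \<bar>x\<bar> powr q\<bar> \<le> \<theta> * \<bar>x\<bar> powr q + C2 * \<bar>x\<bar>"
    by (rule abs_powr_shift[OF q_gt_1 \<theta>_pos])
  define D where "D = l1 powr p * (C1 * K) + (1 + l1 powr q * (C2 * (energy (\<lambda>_. 1) / S * K))) / \<Gamma>"
  have D_nonneg: "0 \<le> D"
    using K_nonneg C1_bound C2_bound energy_nonneg S_pos \<Gamma>_pos by (simp add: D_def)
  show thesis
  proof (intro that allI impI)
    show "0 \<le> C * D / l0 powr p" "0 < min 1 ((d0 / (D + 1))\<^sup>2)"
      using D_nonneg C_nonneg d0_pos by simp_all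
    fix w l \<tau>
    assume pert: "perturbation \<tau> l w" and \<tau>_bounds: "0 < \<tau>" "\<tau> \<le> min 1 ((d0 / (D + 1))\<^sup>2)" and l_bounds: "l0 \<le> \<bar>l\<bar>" "\<bar>l\<bar> \<le> (S + 1) / S"
      and L1_w_le: "(\<integral>\<eta>. \<bar>w \<eta>\<bar> \<partial>sph) \<le> K * sqrt \<tau>"
    define X Y where "X = \<bar>l\<bar> powr p * S" and "Y = \<bar>l\<bar> powr p * mass w"
    have l0_powr: "l0 powr p \<le> \<bar>l\<bar> powr p"
      using l_bounds l0_pos p_gt_1 by (intro powr_mono2) auto
    have D_sqrt_le: "D * sqrt \<tau> \<le> d0"
      using \<tau>_bounds d0_pos by (intro mult_sqrt_le D_nonneg) auto
    have "\<tau> \<le> 1" "\<bar>l\<bar> \<le> l1"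
      using \<tau>_bounds(2) l_bounds(2) by (simp_all add: l1_def)
    note estimates = small_part_estimates_sqrt[OF pert L1_w_le \<tau>_bounds(1) this K_nonneg less_imp_le[OF \<theta>_pos] C1_bound(1) C2_bound(1) C1_bound(2) C2_bound(2), folded X_def Y_def D_def k_def]
    have "x0 \<le> X"
      using mult_right_mono[OF l0_powr, of S] S_pos unfolding x0_def X_def by linarith
    then have "Y \<le> C * (D * sqrt \<tau>)"
      using split D_sqrt_le D_nonneg estimates \<tau>_bounds mass_nonneg[of w] by (simp add: Y_def)
    moreover have "l0 powr p * mass w \<le> Y"
      unfolding Y_def using l0_powr mass_nonneg by (intro mult_right_mono)
    ultimately show "mass w \<le> C * D / l0 powr p * sqrt \<tau>"
      using l0_pos by (simp add: field_simps)
  qed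
qed

lemma perturbation_of_near_optimal:
  assumes near_optimal_u: "near_optimal \<tau> u" and mean_u: "(\<integral>\<eta>. u \<eta> \<partial>sph) = l * S" "l \<noteq> 0"
  shows "perturbation \<tau> l (\<lambda>\<eta>. u \<eta> / l - 1)" "\<bar>l\<bar> \<le> (S + 1) / S" "(\<integral>\<eta>. \<bar>u \<eta> / l - 1\<bar> \<partial>sph) = (\<integral>\<eta>. \<bar>u \<eta> - l\<bar> \<partial>sph) / \<bar>l\<bar>"
proof -
  have near: "Lp u" "mass u = 1" "\<Gamma> - \<tau> \<le> energy u"
    using near_optimal_u by (simp_all add: near_optimal_def)
  have "Lp (\<lambda>\<eta>. u \<eta> / l - 1)"
    using Lp_add_const[OF Lp_cmult[OF near(1), of "1 / l"], of "- 1"] by simp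
  moreover have "u = (\<lambda>\<eta>. l * (1 + (u \<eta> / l - 1)))"
    using mean_u(2) by (simp add: fun_eq_iff)
  then have "mass u = \<bar>l\<bar> powr p * mass (\<lambda>\<eta>. 1 + (u \<eta> / l - 1))" "energy u = \<bar>l\<bar> powr q * energy (\<lambda>\<eta>. 1 + (u \<eta> / l - 1))"
    by (metis mass_cmult, metis energy_cmult)
  ultimately show "perturbation \<tau> l (\<lambda>\<eta>. u \<eta> / l - 1)"
    using near Lp_integrable[OF near(1)] mean_u by (simp add: perturbation_def measure_sph_S)
  have "\<bar>l * S\<bar> \<le> S + 1"
    using integral_abs_bound[of sph u] integral_abs_le_of_mass_1[OF near(1,2)] mean_u(1) by simp
  then show "\<bar>l\<bar> \<le> (S + 1) / S"
    using S_pos by (simp add: abs_mult field_simps)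
  have "\<bar>u \<eta> / l - 1\<bar> = \<bar>u \<eta> - l\<bar> / \<bar>l\<bar>" for \<eta>
    using mean_u(2) by (simp add: diff_divide_distrib flip: abs_divide)
  then show "(\<integral>\<eta>. \<bar>u \<eta> / l - 1\<bar> \<partial>sph) = (\<integral>\<eta>. \<bar>u \<eta> - l\<bar> \<partial>sph) / \<bar>l\<bar>"
    by simp
qed

lemma near_optimal_perturbation_small:
  obtains K t0 l0 where "0 \<le> K" "0 < t0" "0 < l0"
    "\<forall>u \<tau>. near_optimal \<tau> u \<longrightarrow> \<tau> \<le> t0 \<longrightarrow> (\<exists>l. l0 \<le> \<bar>l\<bar> \<and> perturbation \<tau> l (\<lambda>\<eta>. u \<eta> / l - 1) \<and>
      (\<integral>\<eta>. \<bar>u \<eta> / l - 1\<bar> \<partial>sph) \<le> K * sqrt \<tau> \<and> mass (\<lambda>\<eta>. u \<eta> / l - 1) \<le> K * sqrt \<tau>)"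
proof -
  obtain K1 t1 l0 where K1_nonneg: "0 \<le> K1" and t1_pos: "0 < t1" and l0_pos: "0 < l0"
    and close: "\<forall>u \<tau>. near_optimal \<tau> u \<longrightarrow> \<tau> \<le> t1 \<longrightarrow> (\<exists>l. l0 \<le> \<bar>l\<bar> \<and> (\<integral>\<eta>. u \<eta> \<partial>sph) = l * S \<and> (\<integral>\<eta>. \<bar>u \<eta> - l\<bar> \<partial>sph) \<le> K1 * sqrt \<tau>)"
    by (rule near_optimal_L1_close)
  have K1_l0: "0 \<le> K1 / l0"
    using K1_nonneg l0_pos by simp
  obtain C t2 where C_nonneg: "0 \<le> C" and t2_pos: "0 < t2"
    and mass_le: "\<forall>w l \<tau>. perturbation \<tau> l w \<longrightarrow> 0 < \<tau> \<longrightarrow> \<tau> \<le> t2 \<longrightarrow> l0 \<le> \<bar>l\<bar> \<longrightarrow> \<bar>l\<bar> \<le> (S + 1) / S \<longrightarrow> (\<integral>\<eta>. \<bar>w \<eta>\<bar> \<partial>sph) \<le> K1 / l0 * sqrt \<tau> \<longrightarrow> mass w \<le> C * sqrt \<tau>"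
    by (rule mass_perturbation_le[OF l0_pos K1_l0])
  show thesis
  proof (rule that[of "K1 / l0 + C" "min t1 t2" l0])
    show "\<forall>u \<tau>. near_optimal \<tau> u \<longrightarrow> \<tau> \<le> min t1 t2 \<longrightarrow> (\<exists>l. l0 \<le> \<bar>l\<bar> \<and> perturbation \<tau> l (\<lambda>\<eta>. u \<eta> / l - 1) \<and>
      (\<integral>\<eta>. \<bar>u \<eta> / l - 1\<bar> \<partial>sph) \<le> (K1 / l0 + C) * sqrt \<tau> \<and> mass (\<lambda>\<eta>. u \<eta> / l - 1) \<le> (K1 / l0 + C) * sqrt \<tau>)"
    proof (intro allI impI)
      fix u :: "'a \<Rightarrow> real" and \<tau> :: real
      assume near: "near_optimal \<tau> u" and "\<tau> \<le> min t1 t2"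
      then have \<tau>_le: "\<tau> \<le> t1" "\<tau> \<le> t2" "0 < \<tau>"
        by (auto simp: near_optimal_def)
      obtain l where l_ge: "l0 \<le> \<bar>l\<bar>" and mean: "(\<integral>\<eta>. u \<eta> \<partial>sph) = l * S" and L1_le: "(\<integral>\<eta>. \<bar>u \<eta> - l\<bar> \<partial>sph) \<le> K1 * sqrt \<tau>"
        using close near \<tau>_le(1) by blast
      have "l \<noteq> 0"
        using l_ge l0_pos by auto
      note pert = perturbation_of_near_optimal[OF near mean this]
      have L1_w: "(\<integral>\<eta>. \<bar>u \<eta> / l - 1\<bar> \<partial>sph) \<le> K1 / l0 * sqrt \<tau>"
        unfolding pert(3) using frac_le[OF _ L1_le l0_pos l_ge] K1_nonneg \<tau>_le(3) by simp
      have "mass (\<lambda>\<eta>. u \<eta> / l - 1) \<le> C * sqrt \<tau>"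
        using mass_le pert(1,2) \<tau>_le(2,3) l_ge L1_w by blast
      moreover have "0 \<le> K1 / l0 * sqrt \<tau>" "0 \<le> C * sqrt \<tau>"
        using K1_l0 C_nonneg \<tau>_le(3) by (intro mult_nonneg_nonneg; simp)+
      ultimately show "\<exists>l. l0 \<le> \<bar>l\<bar> \<and> perturbation \<tau> l (\<lambda>\<eta>. u \<eta> / l - 1) \<and>
        (\<integral>\<eta>. \<bar>u \<eta> / l - 1\<bar> \<partial>sph) \<le> (K1 / l0 + C) * sqrt \<tau> \<and> mass (\<lambda>\<eta>. u \<eta> / l - 1) \<le> (K1 / l0 + C) * sqrt \<tau>"
        using l_ge pert(1) L1_w unfolding distrib_right by (intro exI[of _ l]) auto
    qed
  qed (use K1_l0 C_nonneg t1_pos t2_pos l0_pos in auto)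
qed

lemma outer_form_le_mass:
  assumes Lp_w: "Lp w"
  shows "outer_form R w \<le> outer_energy R powr ((q - 2) / q) * (\<Gamma> powr (2 / q) * mass w powr (2 / p))"
proof -
  note [measurable] = LpD(1)[OF Lp_w]
  have "(\<integral>\<^sup>+\<xi>. ennreal (indicator {R..} (norm \<xi>) * \<phi> \<xi> powr (q - 2) * \<bar>extend s w \<xi>\<bar> powr 2) \<partial>hyp)
    \<le> ennreal (outer_energy R powr (1 / (q / (q - 2))) * energy w powr (1 / (q / 2)))"
  proof (rule nn_integral_Holder)
    show "1 / (q / (q - 2)) + 1 / (q / 2) = 1"
      using q_gt_2 by (simp add: field_simps)
    have "(indicator {R..} (norm \<xi>) * \<phi> \<xi> powr (q - 2)) powr (q / (q - 2)) = indicator {R..} (norm \<xi>) * \<phi> \<xi> powr q" for \<xi>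
      using q_gt_2 by (simp add: indicator_def powr_powr)
    then show "(\<integral>\<^sup>+\<xi>. ennreal ((indicator {R..} (norm \<xi>) * \<phi> \<xi> powr (q - 2)) powr (q / (q - 2))) \<partial>hyp) \<le> ennreal (outer_energy R)"
      by (simp add: nn_integral_outer_energy)
    have "(\<bar>extend s w \<xi>\<bar> powr 2) powr (q / 2) = \<bar>extend s w \<xi>\<bar> powr q" for \<xi>
      unfolding powr_powr by simp
    then show "(\<integral>\<^sup>+\<xi>. ennreal ((\<bar>extend s w \<xi>\<bar> powr 2) powr (q / 2)) \<partial>hyp) \<le> ennreal (energy w)"
      by (simp add: nn_integral_energy[OF Lp_w])
  qed (use q_gt_2 outer_energy_nonneg energy_nonneg in \<open>auto simp: less_divide_eq\<close>)
  then have "ennreal (outer_form R w) \<le> ennreal (outer_energy R powr ((q - 2) / q) * energy w powr (2 / q))"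
    by (simp add: nn_integral_outer_form[OF Lp_w, symmetric] mult.assoc)
  then have "outer_form R w \<le> outer_energy R powr ((q - 2) / q) * energy w powr (2 / q)"
    by (simp add: ennreal_le_iff)
  also have "energy w powr (2 / q) \<le> (\<Gamma> * mass w powr (q / p)) powr (2 / q)"
    using sharp[OF Lp_w] q_gt_2 energy_nonneg by (intro powr_mono2) auto
  also have "(\<Gamma> * mass w powr (q / p)) powr (2 / q) = \<Gamma> powr (2 / q) * mass w powr (2 / p)"
    using q_gt_2 by (simp add: powr_mult powr_powr)
  finally show ?thesis
    by (simp add: mult_left_mono)
qed

text \<open>The quadratic estimate closes for any distance \<open>V\<close> that controls the mixed power integral and absorbs both
  the outer part of the quadratic form and the superlinear term \<open>mass w powr (q / p)\<close>.\<close>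

lemma stability_of_distance:
  fixes V :: "('a \<Rightarrow> real) \<Rightarrow> real"
  assumes V_nonneg: "\<And>w. 0 \<le> V w"
    and C1_bound: "0 \<le> C1" "\<And>w B. Lp w \<Longrightarrow> mass w \<le> 1 \<Longrightarrow> (\<integral>\<eta>. mixed_power p (w \<eta>) \<partial>sph) \<le> B \<Longrightarrow> 0 < B \<Longrightarrow> V w \<le> C1 * B"
    and form: "\<And>\<epsilon>. 0 < \<epsilon> \<Longrightarrow> \<exists>R. 0 \<le> R \<and> R < 1 \<and> (\<forall>w. Lp w \<longrightarrow> outer_form R w \<le> \<epsilon> * V w)"
    and \<kappa>_superlinear: "0 < \<kappa>" "\<And>w. Lp w \<Longrightarrow> mass w powr (q / p) \<le> mass w powr \<kappa> * V w"
  obtains C t where "0 \<le> C" "0 < t" "\<forall>u \<tau>. near_optimal \<tau> u \<longrightarrow> \<tau> \<le> t \<longrightarrow> (\<exists>l. l \<noteq> 0 \<and> V (\<lambda>\<eta>. u \<eta> / l - 1) \<le> C * \<tau>)"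
proof -
  obtain K t0 l0 where K_nonneg: "0 \<le> K" and t0_pos: "0 < t0" and l0_pos: "0 < l0"
    and remainder: "\<forall>u \<tau>. near_optimal \<tau> u \<longrightarrow> \<tau> \<le> t0 \<longrightarrow> (\<exists>l. l0 \<le> \<bar>l\<bar> \<and> perturbation \<tau> l (\<lambda>\<eta>. u \<eta> / l - 1) \<and>
      (\<integral>\<eta>. \<bar>u \<eta> / l - 1\<bar> \<partial>sph) \<le> K * sqrt \<tau> \<and> mass (\<lambda>\<eta>. u \<eta> / l - 1) \<le> K * sqrt \<tau>)"
    by (rule near_optimal_perturbation_small)
  obtain C0 where C0_nonneg: "0 \<le> C0" and quadratic: "\<forall>w l \<tau>. perturbation \<tau> l w \<longrightarrow> 0 < \<tau> \<longrightarrow> l0 \<le> \<bar>l\<bar> \<longrightarrow>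
      (\<integral>\<eta>. mixed_power p (w \<eta>) \<partial>sph) \<le> C0 * (\<tau> + outer_form 0 w + mass w powr (q / p))"
    by (rule quadratic_estimate[OF l0_pos])
  define C where "C = C1 * (C0 + 1)"
  have C_nonneg: "0 \<le> C"
    using C0_nonneg C1_bound by (simp add: C_def)
  define \<epsilon> where "\<epsilon> = 1 / (4 * (C + 1))"
  have \<epsilon>_bounds: "0 < \<epsilon>" "C * \<epsilon> \<le> 1 / 4"
    using C_nonneg by (auto simp: \<epsilon>_def field_simps)
  obtain R where R_bounds: "0 \<le> R" "R < 1" and outer: "\<forall>w. Lp w \<longrightarrow> outer_form R w \<le> \<epsilon> * V w"
    using form[OF \<epsilon>_bounds(1)] by blast
  obtain t1 where t1_pos: "0 < t1" and small: "\<forall>\<tau> W. 0 \<le> W \<longrightarrow> W \<le> K * sqrt \<tau> \<longrightarrow> 0 < \<tau> \<longrightarrow> \<tau> \<le> t1 \<longrightarrow> W \<le> 1 \<and> C * W powr \<kappa> \<le> 1 / 4"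
    by (rule small_powr_of_le_sqrt[OF K_nonneg C_nonneg \<kappa>_superlinear(1)])
  show thesis
  proof (intro that allI impI)
    show "0 \<le> 2 * C * (1 + (inner_ratio R)\<^sup>2 * energy (\<lambda>_. 1) * K\<^sup>2)" "0 < min t0 t1"
      using C_nonneg energy_nonneg[of "\<lambda>_. 1"] t0_pos t1_pos by simp_all
    fix u :: "'a \<Rightarrow> real" and \<tau>
    assume near: "near_optimal \<tau> u" and "\<tau> \<le> min t0 t1"
    then have \<tau>_le: "\<tau> \<le> t0" "\<tau> \<le> t1" "0 < \<tau>"
      by (auto simp: near_optimal_def)
    obtain l where l_ge: "l0 \<le> \<bar>l\<bar>" and pert: "perturbation \<tau> l (\<lambda>\<eta>. u \<eta> / l - 1)"
      and L1_le: "(\<integral>\<eta>. \<bar>u \<eta> / l - 1\<bar> \<partial>sph) \<le> K * sqrt \<tau>" and mass_le: "mass (\<lambda>\<eta>. u \<eta> / l - 1) \<le> K * sqrt \<tau>"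
      using remainder near \<tau>_le(1) by blast
    define w where "w = (\<lambda>\<eta>. u \<eta> / l - 1)"
    have w_small: "Lp w" "perturbation \<tau> l w" "(\<integral>\<eta>. \<bar>w \<eta>\<bar> \<partial>sph) \<le> K * sqrt \<tau>" "mass w \<le> K * sqrt \<tau>"
      using pert L1_le mass_le by (simp_all add: w_def perturbation_def)
    have mass_small: "mass w \<le> 1" "C * mass w powr \<kappa> \<le> 1 / 4"
      using small mass_nonneg[of w] w_small(4) \<tau>_le(2,3) by blast+
    have "V w \<le> 2 * C * (1 + (inner_ratio R)\<^sup>2 * energy (\<lambda>_. 1) * K\<^sup>2) * \<tau>"
      unfolding C_def
    proof (rule distance_le_of_absorbed_form[where \<epsilon>=\<epsilon> and \<omega>="mass w powr \<kappa>", OF w_small(1,3) \<tau>_le(3) R_bounds(2) C0_nonneg C1_bound(1) V_nonneg])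
      show "(\<integral>\<eta>. mixed_power p (w \<eta>) \<partial>sph) \<le> C0 * (\<tau> + outer_form 0 w + mass w powr (q / p))"
        using quadratic w_small(2) l_ge \<tau>_le(3) by blast
    qed (use outer w_small(1) C1_bound(2)[OF w_small(1) mass_small(1)] \<epsilon>_bounds(2) \<kappa>_superlinear(2)[OF w_small(1)] mass_small(2) in \<open>simp_all add: C_def\<close>)
    then show "\<exists>l. l \<noteq> 0 \<and> V (\<lambda>\<eta>. u \<eta> / l - 1) \<le> 2 * C * (1 + (inner_ratio R)\<^sup>2 * energy (\<lambda>_. 1) * K\<^sup>2) * \<tau>"
      using l_ge l0_pos by (intro exI[of _ l]) (auto simp: w_def)
  qed
qed

theorem stability_ge_2:
  assumes p_ge_2: "2 \<le> p"
  obtains C t where "0 \<le> C" "0 < t" "\<forall>u \<tau>. near_optimal \<tau> u \<longrightarrow> \<tau> \<le> t \<longrightarrow>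
    (\<exists>l. l \<noteq> 0 \<and> mass (\<lambda>\<eta>. u \<eta> / l - 1) + (\<integral>\<eta>. (u \<eta> / l - 1)\<^sup>2 \<partial>sph) \<le> C * \<tau>)"
proof (rule stability_of_distance[where V = "\<lambda>w. mass w + (\<integral>\<eta>. (w \<eta>)\<^sup>2 \<partial>sph)" and \<kappa> = "q / p - 1"])
  show "0 \<le> mass w + (\<integral>\<eta>. (w \<eta>)\<^sup>2 \<partial>sph)" for w :: "'a \<Rightarrow> real"
    using mass_nonneg[of w] by simp
  show "0 \<le> 2 + 2 powr (p - 2)"
    by (simp add: add_nonneg_nonneg)
  show "mass w + (\<integral>\<eta>. (w \<eta>)\<^sup>2 \<partial>sph) \<le> (2 + 2 powr (p - 2)) * B" if "Lp w" "(\<integral>\<eta>. mixed_power p (w \<eta>) \<partial>sph) \<le> B" for w B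
    using mass_plus_square_le[OF p_ge_2 that(1)] mult_left_mono[OF that(2), of "2 + 2 powr (p - 2)"] by (simp add: add_nonneg_nonneg)
  show "0 < q / p - 1"
    using p_less_q p_gt_1 by simp
  show "mass w powr (q / p) \<le> mass w powr (q / p - 1) * (mass w + (\<integral>\<eta>. (w \<eta>)\<^sup>2 \<partial>sph))" for w
    using mass_nonneg[of w] powr_add[of "mass w" "q / p - 1" 1] by (simp add: distrib_left)
  fix \<epsilon> :: real
  assume \<epsilon>_pos: "0 < \<epsilon>"
  obtain R where R_bounds: "0 \<le> R" "R < 1" "outer_energy R < \<epsilon> * S"
    using outer_energy_small[of "\<epsilon> * S"] \<epsilon>_pos S_pos by auto
  have "outer_form R w \<le> \<epsilon> * (mass w + (\<integral>\<eta>. (w \<eta>)\<^sup>2 \<partial>sph))" if "Lp w" for w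
  proof -
    have "outer_form R w \<le> outer_energy R / S * (\<integral>\<eta>. (w \<eta>)\<^sup>2 \<partial>sph)"
      by (rule outer_form_le_square[OF that square_integrable[OF p_ge_2 that]])
    also have "\<dots> \<le> \<epsilon> * (mass w + (\<integral>\<eta>. (w \<eta>)\<^sup>2 \<partial>sph))"
      using R_bounds(3) S_pos \<epsilon>_pos mass_nonneg[of w] by (intro mult_mono) (auto simp: field_simps)
    finally show ?thesis .
  qed
  then show "\<exists>R. 0 \<le> R \<and> R < 1 \<and> (\<forall>w. Lp w \<longrightarrow> outer_form R w \<le> \<epsilon> * (mass w + (\<integral>\<eta>. (w \<eta>)\<^sup>2 \<partial>sph)))"
    using R_bounds by blast
qed (rule that)

theorem stability_less_2:
  assumes p_less_2: "p < 2"
  obtains C t where "0 \<le> C" "0 < t" "\<forall>u \<tau>. near_optimal \<tau> u \<longrightarrow> \<tau> \<le> t \<longrightarrow>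
    (\<exists>l. l \<noteq> 0 \<and> mass (\<lambda>\<eta>. u \<eta> / l - 1) powr (2 / p) \<le> C * \<tau>)"
proof (rule stability_of_distance[where V = "\<lambda>w. mass w powr (2 / p)" and \<kappa> = "(q - 2) / p"])
  show "mass w powr (2 / p) \<le> (S + 2) powr (2 / p) * B"
    if "Lp w" "mass w \<le> 1" "(\<integral>\<eta>. mixed_power p (w \<eta>) \<partial>sph) \<le> B" "0 < B" for w B
    by (rule mass_powr_le_mixed_power[OF p_less_2 that])
  show "0 < (q - 2) / p"
    using q_gt_2 p_gt_1 by simp
  show "mass w powr (q / p) \<le> mass w powr ((q - 2) / p) * mass w powr (2 / p)" for w
    unfolding powr_add[symmetric] by (simp flip: add_divide_distrib)
  fix \<epsilon> :: real
  assume \<epsilon>_pos: "0 < \<epsilon>"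
  define \<epsilon>' where "\<epsilon>' = (\<epsilon> / \<Gamma> powr (2 / q)) powr (q / (q - 2))"
  have \<epsilon>'_powr: "0 < \<epsilon>'" "\<epsilon>' powr ((q - 2) / q) * \<Gamma> powr (2 / q) = \<epsilon>"
    using \<epsilon>_pos \<Gamma>_pos q_gt_2 by (simp_all add: \<epsilon>'_def powr_powr)
  obtain R where R_bounds: "0 \<le> R" "R < 1" "outer_energy R < \<epsilon>'"
    by (rule outer_energy_small[OF \<epsilon>'_powr(1)])
  have "outer_form R w \<le> \<epsilon> * mass w powr (2 / p)" if "Lp w" for w
  proof -
    have "outer_form R w \<le> outer_energy R powr ((q - 2) / q) * (\<Gamma> powr (2 / q) * mass w powr (2 / p))"
      by (rule outer_form_le_mass[OF that])
    also have "\<dots> \<le> \<epsilon>' powr ((q - 2) / q) * (\<Gamma> powr (2 / q) * mass w powr (2 / p))"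
      using R_bounds outer_energy_nonneg q_gt_2 by (intro mult_right_mono powr_mono2) auto
    also have "\<dots> = \<epsilon> * mass w powr (2 / p)"
      unfolding \<epsilon>'_powr(2)[symmetric] by simp
    finally show ?thesis .
  qed
  then show "\<exists>R. 0 \<le> R \<and> R < 1 \<and> (\<forall>w. Lp w \<longrightarrow> outer_form R w \<le> \<epsilon> * mass w powr (2 / p))"
    using R_bounds by blast
qed (use that in simp_all)

end

section \<open>Conformal normalization\<close>

lemma
  fixes g g0 :: "'a::euclidean_space \<Rightarrow> real"
  assumes g0_borel: "g0 \<in> borel_measurable borel" and eq_on_sphere: "\<And>\<eta>. norm \<eta> = 1 \<Longrightarrow> g \<eta> = g0 \<eta>"
  shows integral_sphere_cong: "(\<integral>\<eta>. g \<eta> \<partial>sphere_measure) = (\<integral>\<eta>. g0 \<eta> \<partial>sph)"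
    and integrable_sphere_cong: "integrable sphere_measure g \<longleftrightarrow> integrable sph g0"
  unfolding integral_sph[OF g0_borel] integrable_sph[OF g0_borel]
  by (auto intro!: Bochner_Integration.integral_cong Bochner_Integration.integrable_cong simp: eq_on_sphere)

lemma Lp_norm_cong: "(\<And>x. x \<in> space M \<Longrightarrow> f x = g x) \<Longrightarrow> Lp_norm M r f = Lp_norm M r g"
  unfolding Lp_norm_def by (intro arg_cong[where f="\<lambda>x. x powr _"] Bochner_Integration.integral_cong) auto

context conformal_extension
begin

lemma Lp_norm_sphere:
  assumes "u0 \<in> borel_measurable borel" "\<And>\<eta>. norm \<eta> = 1 \<Longrightarrow> u \<eta> = u0 \<eta>"
  shows "Lp_norm sphere_measure p u = mass u0 powr (1 / p)"
  unfolding Lp_norm_def mass_def using assms by (subst integral_sphere_cong[of "\<lambda>\<eta>. \<bar>u0 \<eta>\<bar> powr p"]) auto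

lemma in_Lp_sphere:
  assumes Lp_u: "Lp u"
  shows "in_Lp sphere_measure p u"
  using LpD[OF Lp_u] borel_measurable_sphere_measureI[OF LpD(1)[OF Lp_u]] integrable_sph[of "\<lambda>\<eta>. \<bar>u \<eta>\<bar> powr p"] unfolding in_Lp_def by simp

lemma in_Lp_sphere_representative:
  assumes in_Lp_u: "in_Lp sphere_measure p u"
  obtains u0 where "Lp u0" "\<forall>\<eta>. norm \<eta> = 1 \<longrightarrow> u \<eta> = u0 \<eta>"
proof
  let ?u = "\<lambda>\<eta>. indicator (sphere 0 1) \<eta> *\<^sub>R u \<eta>"
  show "\<forall>\<eta>. norm \<eta> = 1 \<longrightarrow> u \<eta> = ?u \<eta>"
    by simp
  have "u \<in> borel_measurable (restrict_space borel (sphere 0 1))"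
    using in_Lp_u measurable_cong_sets[OF sets_sphere_measure refl, of borel] by (auto simp: in_Lp_def)
  then have u_borel [measurable]: "?u \<in> borel_measurable borel"
    by (subst (asm) borel_measurable_restrict_space_iff) auto
  have "integrable sphere_measure (\<lambda>\<eta>. \<bar>u \<eta>\<bar> powr p) \<longleftrightarrow> integrable sph (\<lambda>\<eta>. \<bar>?u \<eta>\<bar> powr p)"
  proof (rule integrable_sphere_cong)
    show "(\<lambda>\<eta>. \<bar>?u \<eta>\<bar> powr p) \<in> borel_measurable borel"
      by measurable
  qed simp
  moreover have "integrable sphere_measure (\<lambda>\<eta>. \<bar>u \<eta>\<bar> powr p)"
    using in_Lp_u unfolding in_Lp_def by (rule conjunct2)
  ultimately show "Lp ?u"
    unfolding Lp_def using u_borel by simp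
qed

lemma in_Lp_sphere_normalized:
  assumes in_Lp_u: "in_Lp sphere_measure p u" "Lp_norm sphere_measure p u \<noteq> 0"
  obtains v where "Lp v" "mass v = 1" "\<forall>\<eta>. norm \<eta> = 1 \<longrightarrow> u \<eta> = Lp_norm sphere_measure p u * v \<eta>"
proof -
  obtain u0 where u0_representative: "Lp u0" "\<forall>\<eta>. norm \<eta> = 1 \<longrightarrow> u \<eta> = u0 \<eta>"
    by (rule in_Lp_sphere_representative[OF in_Lp_u(1)])
  define N where "N = Lp_norm sphere_measure p u"
  have N_eq: "N = mass u0 powr (1 / p)"
    unfolding N_def using u0_representative by (intro Lp_norm_sphere LpD(1)) simp_all
  have N_pos: "0 < N"
    using in_Lp_u(2) N_eq by (simp add: N_def)
  have "N powr p = mass u0"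
    using p_gt_1 mass_nonneg by (simp add: N_eq powr_powr)
  then have "mass (\<lambda>\<eta>. 1 / N * u0 \<eta>) = 1"
    unfolding mass_cmult \<open>N powr p = mass u0\<close>[symmetric] using N_pos by (simp add: powr_divide)
  then show thesis
    using N_pos u0_representative by (intro that[of "\<lambda>\<eta>. 1 / N * u0 \<eta>"] Lp_cmult) (simp_all add: N_def[symmetric])
qed

context
  fixes \<alpha> \<beta> :: real
  assumes kernel_order: "real DIM('a) - \<alpha> = 2 * s" and weight_order: "(s - \<beta>) * q = real DIM('a)"
begin

lemma kernel_eq_norm_powr:
  fixes \<xi> \<eta> :: 'a
  assumes norm_\<xi>: "norm \<xi> < 1" and norm_\<eta>: "norm \<eta> = 1"
  shows "kernel s \<xi> \<eta> = weight \<xi> powr s * norm (\<xi> - \<eta>) powr (\<alpha> - real DIM('a))"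
proof -
  have "0 < norm (\<xi> - \<eta>)"
    using norm_\<xi> norm_\<eta> by auto
  then have "((norm (\<xi> - \<eta>))\<^sup>2) powr s = norm (\<xi> - \<eta>) powr (2 * s)"
    unfolding powr_powr[symmetric] by simp
  moreover have "\<alpha> - real DIM('a) = - (2 * s)"
    using kernel_order by simp
  ultimately show ?thesis
    unfolding kernel_def by (simp add: powr_divide powr_minus_divide)
qed

lemma Qop_eq_extend:
  fixes u u0 :: "'a \<Rightarrow> real"
  assumes u0_representative: "u0 \<in> borel_measurable borel" "\<And>\<eta>. norm \<eta> = 1 \<Longrightarrow> u \<eta> = u0 \<eta>" and norm_\<xi>: "norm \<xi> < 1"
  shows "Qop \<alpha> \<beta> u \<xi> = weight \<xi> powr (\<beta> - s) * extend s u0 \<xi>"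
proof -
  have "extend s u0 \<xi> = (\<integral>\<eta>. kernel s \<xi> \<eta> * u \<eta> \<partial>sphere_measure)"
    unfolding extend_def by (rule integral_sphere_cong[symmetric]) (use u0_representative in auto)
  also have "\<dots> = (\<integral>\<eta>. weight \<xi> powr s * (norm (\<xi> - \<eta>) powr (\<alpha> - real DIM('a)) * u \<eta>) \<partial>sphere_measure)"
    by (rule Bochner_Integration.integral_cong) (simp_all add: kernel_eq_norm_powr[OF norm_\<xi>])
  also have "\<dots> = weight \<xi> powr s * (\<integral>\<eta>. norm (\<xi> - \<eta>) powr (\<alpha> - real DIM('a)) * u \<eta> \<partial>sphere_measure)"
    by (rule integral_mult_right_zero)
  finally have extend_eq: "extend s u0 \<xi> = \<dots>" .
  have "weight \<xi> powr \<beta> = weight \<xi> powr (\<beta> - s) * weight \<xi> powr s"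
    unfolding powr_add[symmetric] by simp
  then show ?thesis
    unfolding Qop_def weight_def[symmetric] extend_eq by (simp only: mult.assoc)
qed

lemma Lp_norm_Qop:
  fixes u u0 :: "'a \<Rightarrow> real"
  assumes [measurable]: "u0 \<in> borel_measurable borel" and eq_on_sphere: "\<And>\<eta>. norm \<eta> = 1 \<Longrightarrow> u \<eta> = u0 \<eta>"
  shows "Lp_norm ball_measure q (Qop \<alpha> \<beta> u) = energy u0 powr (1 / q)"
proof -
  have exponent: "(\<beta> - s) * q = - real DIM('a)"
    using weight_order by (simp add: algebra_simps)
  have Qop_powr: "\<bar>Qop \<alpha> \<beta> u \<xi>\<bar> powr q = weight \<xi> powr - real DIM('a) * \<bar>extend s u0 \<xi>\<bar> powr q" if "norm \<xi> < 1" for \<xi>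
    using Qop_eq_extend[OF assms that] by (simp only: abs_mult powr_mult abs_of_nonneg[OF powr_ge_zero] powr_powr exponent)
  have "(\<integral>\<xi>. \<bar>Qop \<alpha> \<beta> u \<xi>\<bar> powr q \<partial>ball_measure) = (\<integral>\<xi>. indicator (ball 0 1) \<xi> *\<^sub>R (\<bar>Qop \<alpha> \<beta> u \<xi>\<bar> powr q) \<partial>lborel)"
    unfolding ball_measure_def by (rule integral_restrict_space) simp
  also have "\<dots> = (\<integral>\<xi>. (weight \<xi> powr - real DIM('a) * indicator (ball 0 1) \<xi>) *\<^sub>R (\<bar>extend s u0 \<xi>\<bar> powr q) \<partial>lborel)"
    by (rule Bochner_Integration.integral_cong) (auto simp: Qop_powr indicator_def)
  also have "\<dots> = (\<integral>\<xi>. \<bar>extend s u0 \<xi>\<bar> powr q \<partial>density lborel (\<lambda>\<xi>. ennreal (weight \<xi> powr - real DIM('a) * indicator (ball 0 1) \<xi>)))"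
    by (rule integral_density[symmetric]) auto
  also have "density lborel (\<lambda>\<xi>::'a. ennreal (weight \<xi> powr - real DIM('a) * indicator (ball 0 1) \<xi>)) = hyp"
    unfolding hyp_def by (intro arg_cong[where f="density lborel"] ext) (simp add: indicator_def)
  finally show ?thesis
    unfolding Lp_norm_def energy_def by simp
qed

lemma Lp_norm_Qop_normalized:
  assumes Lp_v: "Lp v" and N_nonzero: "N \<noteq> 0" and eq_on_sphere: "\<And>\<eta>. norm \<eta> = 1 \<Longrightarrow> u \<eta> = N * v \<eta>"
  shows "Lp_norm ball_measure q (Qop \<alpha> \<beta> u) = \<bar>N\<bar> * energy v powr (1 / q)"
proof -
  have "Lp_norm ball_measure q (Qop \<alpha> \<beta> u) = energy (\<lambda>\<eta>. N * v \<eta>) powr (1 / q)"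
    using LpD(1)[OF Lp_v] eq_on_sphere by (intro Lp_norm_Qop) simp_all
  then show ?thesis
    using N_nonzero q_gt_2 by (simp add: energy_cmult powr_mult powr_powr)
qed

lemma sharp_const_eq:
  assumes p_exp: "p = p_exp TYPE('a) \<alpha>" and q_exp: "q = q_exp TYPE('a) \<alpha> \<beta>"
  shows "sharp_const TYPE('a) \<alpha> \<beta> = Sup {energy v powr (1 / q) | v. Lp v \<and> mass v = 1}" (is "_ = Sup ?E")
proof -
  let ?X = "{Lp_norm (ball_measure :: 'a measure) q (Qop \<alpha> \<beta> u) / Lp_norm (sphere_measure :: 'a measure) p u | u.
    in_Lp (sphere_measure :: 'a measure) p u \<and> Lp_norm (sphere_measure :: 'a measure) p u \<noteq> 0}"
  have "?X = ?E"
  proof (intro subset_antisym subsetI)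
    fix x
    assume "x \<in> ?X"
    then obtain u :: "'a \<Rightarrow> real" where in_Lp_u: "in_Lp sphere_measure p u" "Lp_norm sphere_measure p u \<noteq> 0"
      and x_quotient: "x = Lp_norm ball_measure q (Qop \<alpha> \<beta> u) / Lp_norm sphere_measure p u"
      by auto
    obtain v where v_normalized: "Lp v" "mass v = 1" "\<forall>\<eta>. norm \<eta> = 1 \<longrightarrow> u \<eta> = Lp_norm sphere_measure p u * v \<eta>"
      by (rule in_Lp_sphere_normalized[OF in_Lp_u])
    moreover have "0 \<le> Lp_norm sphere_measure p u"
      by (simp add: Lp_norm_def)
    ultimately have "x = energy v powr (1 / q)"
      unfolding x_quotient using in_Lp_u(2) Lp_norm_Qop_normalized[OF v_normalized(1) in_Lp_u(2)] by simp
    then show "x \<in> ?E"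
      using v_normalized by blast
  next
    fix x
    assume "x \<in> ?E"
    then obtain v where x_energy: "x = energy v powr (1 / q)" "Lp v" "mass v = 1"
      by auto
    then have "Lp_norm sphere_measure p v = 1" "Lp_norm ball_measure q (Qop \<alpha> \<beta> v) = x"
      using Lp_norm_sphere[OF LpD(1) refl] Lp_norm_Qop[OF LpD(1) refl] by simp_all
    then show "x \<in> ?X"
      using in_Lp_sphere[OF x_energy(2)] by (intro CollectI exI[of _ v]) simp
  qed
  then show ?thesis
    unfolding sharp_const_def p_exp q_exp by simp
qed

lemma
  assumes p_exp: "p = p_exp TYPE('a) \<alpha>" and q_exp: "q = q_exp TYPE('a) \<alpha> \<beta>"
  shows energy_le_sharp_const: "Lp v \<Longrightarrow> mass v = 1 \<Longrightarrow> energy v \<le> sharp_const TYPE('a) \<alpha> \<beta> powr q"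
    and sharp_const_pos: "0 < sharp_const TYPE('a) \<alpha> \<beta>"
proof -
  let ?E = "{energy v powr (1 / q) | v. Lp v \<and> mass v = 1}" and ?c = "sharp_const TYPE('a) \<alpha> \<beta>"
  obtain A where A_bound: "0 \<le> A" "\<forall>u. Lp u \<longrightarrow> energy u \<le> A * mass u powr (q / p)"
    by (rule energy_bound)
  have "energy v \<le> A" if "Lp v" "mass v = 1" for v
    using A_bound(2)[rule_format, OF that(1)] that(2) by simp
  then have bounded: "bdd_above ?E"
    using q_gt_2 energy_nonneg by (intro bdd_aboveI[of _ "A powr (1 / q)"]) (auto intro!: powr_mono2)
  have energy_powr_le: "energy v powr (1 / q) \<le> ?c" if "Lp v" "mass v = 1" for v
    unfolding sharp_const_eq[OF assms] using that by (intro cSup_upper bounded) blast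
  show "energy v \<le> ?c powr q" if "Lp v" "mass v = 1" for v
    using powr_mono2[OF _ _ energy_powr_le[OF that], of q] q_gt_2 energy_nonneg by (simp add: powr_powr)
  define a where "a = S powr (- 1 / p)"
  have "a powr p = S powr - 1"
    using p_gt_1 by (simp only: a_def powr_powr) simp
  then have a_powr: "0 < a" "a powr p * S = 1"
    using S_pos by (simp_all add: a_def powr_minus_divide)
  have "Lp (\<lambda>_. a * 1)" "mass (\<lambda>_. a * 1) = 1" "0 < energy (\<lambda>_. a * 1)"
    unfolding mass_cmult energy_cmult using a_powr energy_1_pos by (simp_all add: Lp_const mass_1)
  then show "0 < ?c"
    using energy_powr_le[of "\<lambda>_. a * 1"] powr_gt_zero[of "energy (\<lambda>_. a * 1)" "1 / q"] by linarith
qed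

lemma sharp_conformal_extension_sharp_const:
  assumes p_exp: "p = p_exp TYPE('a) \<alpha>" and q_exp: "q = q_exp TYPE('a) \<alpha> \<beta>"
  shows "sharp_conformal_extension TYPE('a) S m s p q (sharp_const TYPE('a) \<alpha> \<beta> powr q)"
proof unfold_locales
  let ?c = "sharp_const TYPE('a) \<alpha> \<beta>"
  show "0 < ?c powr q"
    using sharp_const_pos[OF assms] by simp
  fix u :: "'a \<Rightarrow> real"
  assume Lp_u: "Lp u"
  show "energy u \<le> ?c powr q * mass u powr (q / p)"
  proof (cases "mass u = 0")
    case True
    obtain A where A_bound: "0 \<le> A" "\<forall>u. Lp u \<longrightarrow> energy u \<le> A * mass u powr (q / p)"
      by (rule energy_bound)
    then show ?thesis
      using Lp_u True by fastforce
  next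
    case False
    define N where "N = mass u powr (1 / p)"
    have N_powr: "0 < N" "N powr p = mass u" "N powr q = mass u powr (q / p)"
      using False mass_nonneg[of u] p_gt_1 by (simp_all add: N_def powr_powr)
    have "mass (\<lambda>\<eta>. 1 / N * u \<eta>) = 1"
      unfolding mass_cmult N_powr(2)[symmetric] using N_powr(1) by (simp add: powr_divide)
    then have "energy (\<lambda>\<eta>. 1 / N * u \<eta>) \<le> ?c powr q"
      by (rule energy_le_sharp_const[OF assms Lp_cmult[OF Lp_u]])
    then show ?thesis
      unfolding energy_cmult N_powr(3)[symmetric] using N_powr(1) by (simp add: powr_divide field_simps)
  qed
qed

end

definition conformal_distance :: "(('a \<Rightarrow> real) \<Rightarrow> real) \<Rightarrow> ('a \<Rightarrow> real) \<Rightarrow> real" where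
  "conformal_distance \<Phi> u = (INF \<Psi>\<in>{\<Psi>. conformal_ball_auto \<Psi>}. INF lam::real. \<Phi> (\<lambda>\<eta>. lam * S powr (1 / p) * pullback p \<Psi> u \<eta> - 1))"

lemma conformal_distance_le:
  assumes "\<And>f. 0 \<le> \<Phi> f" "conformal_ball_auto \<Psi>"
  shows "conformal_distance \<Phi> u \<le> \<Phi> (\<lambda>\<eta>. lam * S powr (1 / p) * pullback p \<Psi> u \<eta> - 1)"
  unfolding conformal_distance_def
  by (rule INF_INF_le[where f="\<lambda>\<Psi> lam. \<Phi> (\<lambda>\<eta>. lam * S powr (1 / p) * pullback p \<Psi> u \<eta> - 1)"]) (use assms in auto)

definition conformal_pullback :: "'a \<Rightarrow> ('a \<Rightarrow> real) \<Rightarrow> 'a \<Rightarrow> real" where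
  "conformal_pullback a u \<eta> = inversion_factor a \<eta> powr (m - s) * u (inversion a \<eta>)"

context
  fixes a :: 'a and u :: "'a \<Rightarrow> real"
  assumes outside: "1 < norm a" and Lp_u: "Lp u"
begin

lemma conformal_pullback_borel [measurable]: "conformal_pullback a u \<in> borel_measurable borel"
  using LpD(1)[OF Lp_u] unfolding conformal_pullback_def[abs_def] by measurable

lemma inversion_factor_powr:
  assumes "norm \<eta> = 1"
  shows "inversion_factor a \<eta> powr m = inversion_factor a \<eta> ^ (DIM('a) - 1)"
  unfolding m_eq using inversion_factor_pos[OF outside] not_inversion_center[OF outside, of \<eta>] assms by (intro powr_realpow) auto

lemma pullback_inversion:
  assumes "norm \<eta> = 1"
  shows "pullback p (inversion a) u \<eta> = conformal_pullback a u \<eta>"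
proof -
  have "sphere_jac (inversion a) \<eta> = inversion_factor a \<eta> powr m"
    by (simp only: sphere_jac_inversion[OF outside assms] inversion_factor_powr[OF assms])
  then show ?thesis
    using s_bounds by (simp add: pullback_def conformal_pullback_def powr_powr p_eq)
qed

lemma conformal_pullback_powr:
  "AE \<eta> in sph. \<bar>conformal_pullback a u \<eta>\<bar> powr p = inversion_factor a \<eta> ^ (DIM('a) - 1) * \<bar>u (inversion a \<eta>)\<bar> powr p"
  using AE_sph
  by eventually_elim (simp add: conformal_pullback_def abs_mult powr_mult powr_powr p_minus_1 inversion_factor_powr)

lemma
  shows Lp_conformal_pullback: "Lp (conformal_pullback a u)"
    and mass_conformal_pullback: "mass (conformal_pullback a u) = mass u"
proof -
  note [measurable] = LpD(1)[OF Lp_u]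
  have "integrable sph (\<lambda>\<eta>. inversion_factor a \<eta> ^ (DIM('a) - 1) * \<bar>u (inversion a \<eta>)\<bar> powr p)"
    using integrable_inversion_sph[OF outside, of "\<lambda>\<eta>. \<bar>u \<eta>\<bar> powr p"] LpD(2)[OF Lp_u] by simp
  then have "integrable sph (\<lambda>\<eta>. \<bar>conformal_pullback a u \<eta>\<bar> powr p)"
    by (subst integrable_cong_AE[OF _ _ conformal_pullback_powr]) measurable
  then show "Lp (conformal_pullback a u)"
    unfolding Lp_def by simp
  have "mass (conformal_pullback a u) = (\<integral>\<eta>. inversion_factor a \<eta> ^ (DIM('a) - 1) * \<bar>u (inversion a \<eta>)\<bar> powr p \<partial>sph)"
    unfolding mass_def by (rule integral_cong_AE[OF _ _ conformal_pullback_powr]) measurable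
  then show "mass (conformal_pullback a u) = mass u"
    using integral_inversion_sph[OF outside, of "\<lambda>\<eta>. \<bar>u \<eta>\<bar> powr p"] by (simp add: mass_def)
qed

lemma extend_conformal_pullback:
  assumes "norm \<xi> < 1"
  shows "extend s (conformal_pullback a u) \<xi> = extend s u (inversion a \<xi>)"
  using extend_inversion[OF outside assms LpD(1)[OF Lp_u], folded m_eq] by (simp add: conformal_pullback_def[abs_def])

lemma energy_conformal_pullback: "energy (conformal_pullback a u) = energy u"
proof -
  note [measurable] = LpD(1)[OF Lp_u]
  have "(\<integral>\<^sup>+\<xi>. ennreal (\<bar>extend s (conformal_pullback a u) \<xi>\<bar> powr q) \<partial>hyp) = (\<integral>\<^sup>+\<xi>. ennreal (\<bar>extend s u (inversion a \<xi>)\<bar> powr q) \<partial>hyp)"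
    by (rule nn_integral_cong_AE, use AE_hyp in eventually_elim) (simp add: extend_conformal_pullback)
  also have "\<dots> = (\<integral>\<^sup>+\<xi>. ennreal (\<bar>extend s u \<xi>\<bar> powr q) \<partial>hyp)"
    by (rule nn_integral_inversion_hyp[OF outside]) measurable
  finally show ?thesis
    unfolding energy_def by (simp add: integral_eq_nn_integral)
qed

lemma abs_conformal_pullback: "\<bar>conformal_pullback a u \<eta>\<bar> = conformal_pullback a (\<lambda>\<eta>. \<bar>u \<eta>\<bar>) \<eta>"
  by (simp add: conformal_pullback_def abs_mult)

end

lemma almost_maximum:
  assumes Lp_u: "Lp u" and \<tau>_pos: "0 < \<tau>"
  obtains \<zeta> where "norm \<zeta> < 1" "\<forall>\<xi>. norm \<xi> < 1 \<longrightarrow> extend s u \<xi> \<le> extend s u \<zeta> + \<tau>"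
proof -
  let ?f = "extend s u"
  have bounded: "bdd_above (?f ` ball 0 1)"
  proof (rule bdd_aboveI2)
    fix \<xi> :: 'a
    assume "\<xi> \<in> ball 0 1"
    then show "?f \<xi> \<le> (S / 2 powr m) powr (s / m) * mass u powr (1 / p)"
      using abs_extend_le_mass[OF Lp_u, of \<xi>] by (simp add: abs_le_iff)
  qed
  have "Sup (?f ` ball 0 1) - \<tau> < Sup (?f ` ball 0 1)"
    using \<tau>_pos by simp
  then obtain \<zeta> where \<zeta>_near_Sup: "norm \<zeta> < 1" "Sup (?f ` ball 0 1) - \<tau> < ?f \<zeta>"
    using less_cSup_iff[OF _ bounded] by (auto simp: image_iff)
  have "?f \<xi> \<le> ?f \<zeta> + \<tau>" if "norm \<xi> < 1" for \<xi>
    using cSUP_upper[OF _ bounded, of \<xi>] that \<zeta>_near_Sup(2) by simp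
  then show thesis
    using \<zeta>_near_Sup(1) by (intro that[of \<zeta>]) auto
qed

end

context sharp_conformal_extension
begin

lemma near_optimal_conformal_pullback:
  fixes a :: 'a
  assumes outside: "1 < norm a" and u_normalized: "Lp u" "mass u = 1" and \<tau>_deficit: "0 < \<tau>" "\<Gamma> - \<tau> \<le> energy u"
    and maximum: "\<forall>\<xi>. norm \<xi> < 1 \<longrightarrow> extend s (\<lambda>\<eta>. \<bar>u \<eta>\<bar>) \<xi> \<le> extend s (\<lambda>\<eta>. \<bar>u \<eta>\<bar>) (inversion a 0) + \<tau>"
  shows "near_optimal \<tau> (conformal_pullback a u)"
  unfolding near_optimal_def
proof (intro conjI allI impI)
  fix \<xi> :: 'a
  assume norm_\<xi>: "norm \<xi> < 1"
  then have "norm (inversion a \<xi>) < 1"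
    using norm_inversion_less_1_iff[OF outside, of \<xi>] not_inversion_center[OF outside, of \<xi>] by simp
  then show "extend s (\<lambda>\<eta>. \<bar>conformal_pullback a u \<eta>\<bar>) \<xi> \<le> extend s (\<lambda>\<eta>. \<bar>conformal_pullback a u \<eta>\<bar>) 0 + \<tau>"
    using maximum norm_\<xi> by (simp add: abs_conformal_pullback[OF outside u_normalized(1)] extend_conformal_pullback[OF outside Lp_abs[OF u_normalized(1)]])
qed (use u_normalized \<tau>_deficit in \<open>simp_all add: Lp_conformal_pullback[OF outside] mass_conformal_pullback[OF outside] energy_conformal_pullback[OF outside]\<close>)

lemma conformal_normalization:
  assumes u_normalized: "Lp u" "mass u = 1" and \<tau>_deficit: "0 < \<tau>" "\<Gamma> - \<tau> \<le> energy u"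
  obtains \<Psi> v where "conformal_ball_auto \<Psi>" "near_optimal \<tau> v"
    "\<forall>\<eta>. norm \<eta> = 1 \<longrightarrow> norm (\<Psi> \<eta>) = 1 \<and> pullback p \<Psi> u \<eta> = v \<eta>"
proof -
  obtain \<zeta> where \<zeta>_in_ball: "norm \<zeta> < 1"
    and maximum: "\<forall>\<xi>. norm \<xi> < 1 \<longrightarrow> extend s (\<lambda>\<eta>. \<bar>u \<eta>\<bar>) \<xi> \<le> extend s (\<lambda>\<eta>. \<bar>u \<eta>\<bar>) \<zeta> + \<tau>"
    by (rule almost_maximum[OF Lp_abs[OF u_normalized(1)] \<tau>_deficit(1)])
  show thesis
  proof (cases "\<zeta> = 0")
    case True
    then have "near_optimal \<tau> u"
      using u_normalized \<tau>_deficit maximum by (simp add: near_optimal_def)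
    then show thesis
      by (rule that[OF conformal_ball_auto_id]) (simp add: pullback_def sphere_jac_id)
  next
    case False
    define a where "a = \<zeta> /\<^sub>R (norm \<zeta>)\<^sup>2"
    have outside: "1 < norm a" and "inversion a 0 = \<zeta>"
      using inversion_center_of_point[OF \<zeta>_in_ball False] by (simp_all add: a_def)
    then have "near_optimal \<tau> (conformal_pullback a u)"
      using u_normalized \<tau>_deficit maximum by (intro near_optimal_conformal_pullback) simp_all
    moreover have "norm (inversion a \<eta>) = 1" if "norm \<eta> = 1" for \<eta>
      using norm_inversion_eq_1_iff[OF outside, of \<eta>] not_inversion_center[OF outside, of \<eta>] that by simp
    ultimately show thesis
      using pullback_inversion[OF outside u_normalized(1)] by (intro that[OF conformal_ball_auto_inversion[OF outside], of "conformal_pullback a u"]) simp_all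
  qed
qed

lemma energy_deficit_le:
  assumes c_sharp: "0 < c" "\<Gamma> = c powr q"
  shows "\<Gamma> - energy v \<le> q / p * (c powr p) powr (q / p - 1) * (c powr p - energy v powr (p / q))"
proof -
  have "(c powr p) powr (q / p) = \<Gamma>" "(energy v powr (p / q)) powr (q / p) = energy v"
    using c_sharp p_gt_1 q_gt_2 energy_nonneg by (simp_all add: powr_powr)
  moreover have "1 \<le> q / p"
    using p_less_q p_gt_1 by simp
  ultimately show ?thesis
    using powr_ge_tangent[of "q / p" "c powr p" "energy v powr (p / q)"] c_sharp(1) by (simp add: right_diff_distrib diff_divide_distrib)
qed

context
  fixes \<Phi> :: "('a \<Rightarrow> real) \<Rightarrow> real" and C t :: real
  assumes near_constant: "\<forall>v \<tau>. near_optimal \<tau> v \<longrightarrow> \<tau> \<le> t \<longrightarrow> (\<exists>l. l \<noteq> 0 \<and> \<Phi> (\<lambda>\<eta>. v \<eta> / l - 1) \<le> C * \<tau>)"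
    and \<Phi>_cong: "\<And>f g. (\<And>\<eta>. norm \<eta> = 1 \<Longrightarrow> f \<eta> = g \<eta>) \<Longrightarrow> \<Phi> f = \<Phi> g" and \<Phi>_nonneg: "\<And>f. 0 \<le> \<Phi> f"
begin

lemma conformal_distance_le_linear:
  assumes v_normalized: "Lp v" "mass v = 1" and N_nonzero: "N \<noteq> 0" and u_eq: "\<forall>\<eta>. norm \<eta> = 1 \<longrightarrow> u \<eta> = N * v \<eta>"
    and \<tau>_bounds: "0 < \<tau>" "\<tau> \<le> t" "\<Gamma> - \<tau> \<le> energy v"
  shows "conformal_distance \<Phi> u \<le> C * \<tau>"
proof -
  obtain \<Psi> w where \<Psi>_conformal: "conformal_ball_auto \<Psi>" and near_optimal_w: "near_optimal \<tau> w"
    and on_sphere: "\<forall>\<eta>. norm \<eta> = 1 \<longrightarrow> norm (\<Psi> \<eta>) = 1 \<and> pullback p \<Psi> v \<eta> = w \<eta>"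
    by (rule conformal_normalization[OF v_normalized \<tau>_bounds(1,3)])
  obtain l where l_close: "l \<noteq> 0" "\<Phi> (\<lambda>\<eta>. w \<eta> / l - 1) \<le> C * \<tau>"
    using near_constant near_optimal_w \<tau>_bounds(2) by blast
  define lam where "lam = 1 / (l * N * S powr (1 / p))"
  have "pullback p \<Psi> u \<eta> = N * w \<eta>" if "norm \<eta> = 1" for \<eta>
    using on_sphere[rule_format, OF that] u_eq by (auto simp: pullback_def)
  then have "lam * S powr (1 / p) * pullback p \<Psi> u \<eta> - 1 = w \<eta> / l - 1" if "norm \<eta> = 1" for \<eta>
    using that N_nonzero S_pos by (simp add: lam_def)
  then have "\<Phi> (\<lambda>\<eta>. lam * S powr (1 / p) * pullback p \<Psi> u \<eta> - 1) = \<Phi> (\<lambda>\<eta>. w \<eta> / l - 1)"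
    by (rule \<Phi>_cong)
  then show ?thesis
    using conformal_distance_le[of \<Phi> \<Psi> u lam] \<Phi>_nonneg \<Psi>_conformal l_close(2) by simp
qed

lemma conformal_distance_le_deficit:
  assumes C_nonneg: "0 \<le> C" and t_pos: "0 < t" and c_sharp: "0 < c" "\<Gamma> = c powr q"
    and v_normalized: "Lp v" "mass v = 1" and N_nonzero: "N \<noteq> 0" and u_eq: "\<forall>\<eta>. norm \<eta> = 1 \<longrightarrow> u \<eta> = N * v \<eta>"
  defines "B \<equiv> \<Phi> (\<lambda>_. - 1)" and "L \<equiv> q / p * (c powr p) powr (q / p - 1)"
  shows "conformal_distance \<Phi> u \<le> (C + B / t) * (L * (c powr p - energy v powr (p / q)))"
proof (rule le_linear_of_small)
  show "conformal_distance \<Phi> u \<le> B"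
    using conformal_distance_le[of \<Phi> "\<lambda>x. x" u 0] \<Phi>_nonneg conformal_ball_auto_id by (simp add: B_def)
  have deficit: "\<Gamma> - energy v \<le> L * (c powr p - energy v powr (p / q))"
    unfolding L_def by (rule energy_deficit_le[OF c_sharp])
  moreover have "energy v \<le> \<Gamma>"
    using sharp[OF v_normalized(1)] v_normalized(2) by simp
  ultimately show "0 \<le> L * (c powr p - energy v powr (p / q))"
    by linarith
  show "conformal_distance \<Phi> u \<le> C * \<tau>" if "0 < \<tau>" "L * (c powr p - energy v powr (p / q)) \<le> \<tau>" "\<tau> \<le> t" for \<tau>
    using deficit that by (intro conformal_distance_le_linear[OF v_normalized N_nonzero u_eq]) simp_all
qed (use C_nonneg t_pos in \<open>simp_all add: B_def \<Phi>_nonneg\<close>)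

lemma stability_from_near_optimal:
  assumes C_nonneg: "0 \<le> C" and t_pos: "0 < t" and c_sharp: "0 < c" "\<Gamma> = c powr q"
    and orders: "real DIM('a) - \<alpha> = 2 * s" "(s - \<beta>) * q = real DIM('a)"
  shows "\<exists>c0>0. \<forall>u :: 'a \<Rightarrow> real. in_Lp sphere_measure p u \<and> Lp_norm sphere_measure p u \<noteq> 0 \<longrightarrow>
    c0 * conformal_distance \<Phi> u \<le> c powr p - Lp_norm ball_measure q (Qop \<alpha> \<beta> u) powr p / Lp_norm sphere_measure p u powr p"
proof -
  define M where "M = (C + \<Phi> (\<lambda>_. - 1) / t) * (q / p * (c powr p) powr (q / p - 1))"
  have M_nonneg: "0 \<le> M"
    using C_nonneg t_pos \<Phi>_nonneg p_gt_1 q_gt_2 by (simp add: M_def)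
  show ?thesis
  proof (intro exI[of _ "1 / (M + 1)"] conjI allI impI)
    fix u :: "'a \<Rightarrow> real"
    assume in_Lp_u: "in_Lp sphere_measure p u \<and> Lp_norm sphere_measure p u \<noteq> 0"
    define N where "N = Lp_norm sphere_measure p u"
    have N_pos: "0 < N"
      using in_Lp_u powr_ge_zero unfolding N_def Lp_norm_def by (simp add: less_le)
    obtain v where v_normalized: "Lp v" "mass v = 1" "\<forall>\<eta>. norm \<eta> = 1 \<longrightarrow> u \<eta> = N * v \<eta>"
      using in_Lp_sphere_normalized in_Lp_u unfolding N_def by metis
    define D where "D = c powr p - energy v powr (p / q)"
    have "Lp_norm ball_measure q (Qop \<alpha> \<beta> u) = N * energy v powr (1 / q)"
      using N_pos v_normalized Lp_norm_Qop_normalized[OF orders v_normalized(1), of N u] by simp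
    then have D_eq: "D = c powr p - Lp_norm ball_measure q (Qop \<alpha> \<beta> u) powr p / N powr p"
      using N_pos by (simp add: D_def powr_mult powr_powr)
    have "energy v powr (p / q) \<le> \<Gamma> powr (p / q)"
      using sharp[OF v_normalized(1)] v_normalized(2) energy_nonneg p_gt_1 q_gt_2 by (intro powr_mono2) auto
    then have D_nonneg: "0 \<le> D"
      using c_sharp q_gt_2 by (simp add: D_def powr_powr)
    have "conformal_distance \<Phi> u \<le> M * D"
      using conformal_distance_le_deficit[OF C_nonneg t_pos c_sharp v_normalized(1,2) _ v_normalized(3)] N_pos by (simp add: M_def D_def mult.assoc)
    then have "conformal_distance \<Phi> u \<le> (M + 1) * D"
      using D_nonneg by (simp add: distrib_right)
    then show "1 / (M + 1) * conformal_distance \<Phi> u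
      \<le> c powr p - Lp_norm ball_measure q (Qop \<alpha> \<beta> u) powr p / Lp_norm sphere_measure p u powr p"
      unfolding D_eq[symmetric] N_def[symmetric] using M_nonneg by (simp add: field_simps)
  qed (use M_nonneg in simp)
qed

end

lemma stability_bound_ge_2:
  assumes p_ge_2: "2 \<le> p" and c_sharp: "0 < c" "\<Gamma> = c powr q"
    and orders: "real DIM('a) - \<alpha> = 2 * s" "(s - \<beta>) * q = real DIM('a)"
  shows "\<exists>c0>0. \<forall>u :: 'a \<Rightarrow> real. in_Lp sphere_measure p u \<and> Lp_norm sphere_measure p u \<noteq> 0 \<longrightarrow>
    c0 * conformal_distance (\<lambda>f. Lp_norm sphere_measure p f powr p + Lp_norm sphere_measure 2 f powr 2) u
    \<le> c powr p - Lp_norm ball_measure q (Qop \<alpha> \<beta> u) powr p / Lp_norm sphere_measure p u powr p"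
proof -
  let ?\<Phi> = "\<lambda>f :: 'a \<Rightarrow> real. Lp_norm sphere_measure p f powr p + Lp_norm sphere_measure 2 f powr 2"
  have \<Phi>_eq: "?\<Phi> f = mass f + (\<integral>\<eta>. (f \<eta>)\<^sup>2 \<partial>sph)" if [measurable]: "f \<in> borel_measurable borel" for f
  proof -
    have "Lp_norm sphere_measure 2 f powr 2 = (\<integral>\<eta>. \<bar>f \<eta>\<bar> powr 2 \<partial>sphere_measure)"
      unfolding Lp_norm_def powr_powr by simp
    also have "\<dots> = (\<integral>\<eta>. (f \<eta>)\<^sup>2 \<partial>sph)"
      by (rule integral_sphere_cong) auto
    finally show ?thesis
      using Lp_norm_sphere[OF that refl] p_gt_1 mass_nonneg by (simp add: powr_powr)
  qed
  obtain C t where C_nonneg_t_pos: "0 \<le> C" "0 < t" and near_constant: "\<forall>u \<tau>. near_optimal \<tau> u \<longrightarrow> \<tau> \<le> t \<longrightarrow>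
      (\<exists>l. l \<noteq> 0 \<and> mass (\<lambda>\<eta>. u \<eta> / l - 1) + (\<integral>\<eta>. (u \<eta> / l - 1)\<^sup>2 \<partial>sph) \<le> C * \<tau>)"
    by (rule stability_ge_2[OF p_ge_2])
  have "(\<lambda>\<eta>. v \<eta> / l - 1) \<in> borel_measurable borel" if "near_optimal \<tau> v" for \<tau> v l
    using that LpD(1)[of v] by (auto simp: near_optimal_def)
  then have "\<forall>v \<tau>. near_optimal \<tau> v \<longrightarrow> \<tau> \<le> t \<longrightarrow> (\<exists>l. l \<noteq> 0 \<and> ?\<Phi> (\<lambda>\<eta>. v \<eta> / l - 1) \<le> C * \<tau>)"
    using near_constant by (simp add: \<Phi>_eq)
  moreover have "?\<Phi> f = ?\<Phi> g" if "\<And>\<eta>. norm \<eta> = 1 \<Longrightarrow> f \<eta> = g \<eta>" for f g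
    using Lp_norm_cong[of sphere_measure f g] that by simp
  ultimately show ?thesis
    by (rule stability_from_near_optimal[OF _ _ _ C_nonneg_t_pos c_sharp orders]) simp_all
qed

lemma stability_bound_less_2:
  assumes p_less_2: "p < 2" and c_sharp: "0 < c" "\<Gamma> = c powr q"
    and orders: "real DIM('a) - \<alpha> = 2 * s" "(s - \<beta>) * q = real DIM('a)"
  shows "\<exists>c0>0. \<forall>u :: 'a \<Rightarrow> real. in_Lp sphere_measure p u \<and> Lp_norm sphere_measure p u \<noteq> 0 \<longrightarrow>
    c0 * conformal_distance (\<lambda>f. Lp_norm sphere_measure p f powr 2) u
    \<le> c powr p - Lp_norm ball_measure q (Qop \<alpha> \<beta> u) powr p / Lp_norm sphere_measure p u powr p"
proof -
  let ?\<Phi> = "\<lambda>f :: 'a \<Rightarrow> real. Lp_norm sphere_measure p f powr 2"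
  have \<Phi>_eq: "?\<Phi> f = mass f powr (2 / p)" if "f \<in> borel_measurable borel" for f
    by (simp add: Lp_norm_sphere[OF that refl] powr_powr)
  obtain C t where C_nonneg_t_pos: "0 \<le> C" "0 < t" and near_constant: "\<forall>u \<tau>. near_optimal \<tau> u \<longrightarrow> \<tau> \<le> t \<longrightarrow>
      (\<exists>l. l \<noteq> 0 \<and> mass (\<lambda>\<eta>. u \<eta> / l - 1) powr (2 / p) \<le> C * \<tau>)"
    by (rule stability_less_2[OF p_less_2])
  have "(\<lambda>\<eta>. v \<eta> / l - 1) \<in> borel_measurable borel" if "near_optimal \<tau> v" for \<tau> v l
    using that LpD(1)[of v] by (auto simp: near_optimal_def)
  then have "\<forall>v \<tau>. near_optimal \<tau> v \<longrightarrow> \<tau> \<le> t \<longrightarrow> (\<exists>l. l \<noteq> 0 \<and> ?\<Phi> (\<lambda>\<eta>. v \<eta> / l - 1) \<le> C * \<tau>)"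
    using near_constant by (simp add: \<Phi>_eq)
  moreover have "?\<Phi> f = ?\<Phi> g" if "\<And>\<eta>. norm \<eta> = 1 \<Longrightarrow> f \<eta> = g \<eta>" for f g
    using Lp_norm_cong[of sphere_measure f g] that by simp
  ultimately show ?thesis
    by (rule stability_from_near_optimal[OF _ _ _ C_nonneg_t_pos c_sharp orders]) simp_all
qed

end

lemma (in conformal_extension) two_le_p_iff:
  assumes "real DIM('a) - \<alpha> = 2 * s"
  shows "2 \<le> p \<longleftrightarrow> \<alpha> \<le> 1"
proof -
  have "2 \<le> p \<longleftrightarrow> m \<le> 2 * s"
    unfolding p_eq using s_bounds by (simp add: field_simps)
  then show ?thesis
    using assms dim_ge_3 by (auto simp: m_eq of_nat_diff)
qed

lemma
  fixes \<alpha> \<beta> :: real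
  defines "n \<equiv> real DIM('a::euclidean_space)"
  assumes dim: "3 \<le> DIM('a)" and \<beta>_nonneg: "0 \<le> \<beta>" and sum: "\<alpha> + \<beta> < n - \<beta>"
    and subcritical: "(n - \<alpha> - 2 * \<beta>) / (2 * n) + (n - \<alpha>) / (2 * (n - 1)) < 1"
  shows conformal_extension_exponents:
      "conformal_extension TYPE('a) (sphere_area TYPE('a)) (real (DIM('a) - 1)) ((n - \<alpha>) / 2) (p_exp TYPE('a) \<alpha>) (q_exp TYPE('a) \<alpha> \<beta>)"
    and weight_order_exponents: "((n - \<alpha>) / 2 - \<beta>) * q_exp TYPE('a) \<alpha> \<beta> = n"
proof -
  define m and s where "m = n - 1" and "s = (n - \<alpha>) / 2"
  have n_eq: "n = m + 1" "2 \<le> m" and m_eq: "real (DIM('a) - 1) = m"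
    using dim by (simp_all add: n_def m_def of_nat_diff)
  have s_gt_\<beta>: "\<beta> < s"
    using sum by (simp add: s_def)
  have "(n - \<alpha> - 2 * \<beta>) / (2 * n) = (s - \<beta>) / n" "(n - \<alpha>) / (2 * (n - 1)) = s / m"
    using n_eq by (simp_all add: s_def field_simps)
  then have reciprocals: "(s - \<beta>) / n + s / m < 1"
    using subcritical by simp
  moreover have "0 < (s - \<beta>) / n"
    using s_gt_\<beta> n_eq by simp
  ultimately have "s / m < 1"
    by linarith
  then have s_less_m: "s < m"
    using n_eq by simp
  have p_eq: "p_exp TYPE('a) \<alpha> = m / (m - s)" and q_eq: "q_exp TYPE('a) \<alpha> \<beta> = n / (s - \<beta>)"
    using s_gt_\<beta> s_less_m by (simp_all add: p_exp_def q_exp_def n_def[symmetric] n_eq s_def field_simps)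
  have "(s - \<beta>) / n < (m - s) / m"
    using reciprocals n_eq by (simp add: diff_divide_distrib)
  then have "m / (m - s) < n / (s - \<beta>)"
    using s_gt_\<beta> s_less_m n_eq by (simp add: field_simps)
  moreover have "m / s < n / s"
    using s_gt_\<beta> \<beta>_nonneg n_eq by (simp add: divide_strict_right_mono)
  moreover have "n / s \<le> n / (s - \<beta>)"
    using s_gt_\<beta> \<beta>_nonneg n_eq by (intro divide_left_mono) auto
  ultimately show "conformal_extension TYPE('a) (sphere_area TYPE('a)) (real (DIM('a) - 1)) ((n - \<alpha>) / 2) (p_exp TYPE('a) \<alpha>) (q_exp TYPE('a) \<alpha> \<beta>)"
    unfolding p_eq q_eq m_eq s_def[symmetric] using dim s_gt_\<beta> \<beta>_nonneg s_less_m by unfold_locales (simp_all add: m_def n_def of_nat_diff)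
  show "((n - \<alpha>) / 2 - \<beta>) * q_exp TYPE('a) \<alpha> \<beta> = n"
    unfolding q_eq s_def[symmetric] using s_gt_\<beta> by simp
qed

theorem theorem1p1:
  fixes \<alpha> \<beta> :: real
  defines "n \<equiv> real DIM('a::euclidean_space)"
    and "p \<equiv> p_exp TYPE('a) \<alpha>"
    and "q \<equiv> q_exp TYPE('a) \<alpha> \<beta>"
    and "c \<equiv> sharp_const TYPE('a) \<alpha> \<beta>"
    and "S \<equiv> sphere_area TYPE('a)"
  assumes "DIM('a) \<ge> 3"
    and "\<beta> \<ge> 0" and "0 < \<alpha> + \<beta>" and "\<alpha> + \<beta> < n - \<beta>"
    and "(n - \<alpha> - 2 * \<beta>) / (2 * n) + (n - \<alpha>) / (2 * (n - 1)) < 1"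
  shows
   "(\<alpha> \<le> 1 \<longrightarrow>
      (\<exists>c0>0. \<forall>u :: 'a \<Rightarrow> real.
         in_Lp sphere_measure p u \<and> Lp_norm sphere_measure p u \<noteq> 0 \<longrightarrow>
         c powr p - Lp_norm ball_measure q (Qop \<alpha> \<beta> u) powr p / Lp_norm sphere_measure p u powr p
         \<ge> c0 * (INF \<Psi>\<in>{\<Psi>. conformal_ball_auto \<Psi>}. INF lam::real.
               Lp_norm sphere_measure p (\<lambda>\<eta>. lam * S powr (1 / p) * pullback p \<Psi> u \<eta> - 1) powr p
             + Lp_norm sphere_measure 2 (\<lambda>\<eta>. lam * S powr (1 / p) * pullback p \<Psi> u \<eta> - 1) powr 2)))
  \<and> (1 < \<alpha> \<and> \<alpha> < n \<longrightarrow>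
      (\<exists>c0>0. \<forall>u :: 'a \<Rightarrow> real.
         in_Lp sphere_measure p u \<and> Lp_norm sphere_measure p u \<noteq> 0 \<longrightarrow>
         c powr p - Lp_norm ball_measure q (Qop \<alpha> \<beta> u) powr p / Lp_norm sphere_measure p u powr p
         \<ge> c0 * (INF \<Psi>\<in>{\<Psi>. conformal_ball_auto \<Psi>}. INF lam::real.
               Lp_norm sphere_measure p (\<lambda>\<eta>. lam * S powr (1 / p) * pullback p \<Psi> u \<eta> - 1) powr 2)))"
proof -
  let ?s = "(n - \<alpha>) / 2"
  interpret conformal_extension "TYPE('a)" S "real (DIM('a) - 1)" ?s p q
    unfolding S_def p_def q_def n_def using assms(6,7,9,10) by (intro conformal_extension_exponents) (simp_all add: n_def)
  have orders: "real DIM('a) - \<alpha> = 2 * ?s" "(?s - \<beta>) * q = real DIM('a)"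
    using weight_order_exponents[where 'a='a, of \<beta> \<alpha>] assms(6,7,9,10) by (simp_all add: n_def q_def)
  note sharp_const = sharp_const_pos[OF orders meta_eq_to_obj_eq[OF p_def] meta_eq_to_obj_eq[OF q_def], folded c_def]
    sharp_conformal_extension_sharp_const[OF orders meta_eq_to_obj_eq[OF p_def] meta_eq_to_obj_eq[OF q_def], folded c_def]
  interpret sharp_conformal_extension "TYPE('a)" S "real (DIM('a) - 1)" ?s p q "c powr q"
    by (rule sharp_const(2))
  have p_cases: "2 \<le> p \<longleftrightarrow> \<alpha> \<le> 1" "p < 2 \<longleftrightarrow> 1 < \<alpha>"
    using two_le_p_iff[OF orders(1)] by auto
  show ?thesis
    using stability_bound_ge_2[OF _ sharp_const(1) refl orders] stability_bound_less_2[OF _ sharp_const(1) refl orders]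
    unfolding conformal_distance_def p_cases by (intro conjI impI) simp_all
qed

end
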